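(* Let $\gamma=2$, $T>0$, $\rho_0\in L^2(H^{-1-},\mu)$, and let $\rho^N_0\in C^\infty_P(H_N)$, $N\in\mathbb{N}$, satisfy $\lim_{N\to\infty}\|\rho^N_0\circ\Pi_N-\rho_0\|_{L^2(\mu)}=0$. Let $\rho^N$ be the solutions of the modified Galerkin approximation $$\partial_t\rho^N_t=\tilde{\mathcal L}_N^*\rho^N_t,\qquad\rho^N|_{t=0}=\rho^N_0,$$ on $[0,T]\times H_N$, regarded as functions on $[0,T]\times H^{-1-}$ through $\rho^N_t(\omega)=\rho^N_t(\Pi_N\omega)$. Then any limit point $\rho$ of $\{\rho^N\}_{N}$ (that is, any weak-$*$ limit in $L^\infty\big([0,T],L^2(H^{-1-},\mu)\big)$ of a subsequence $\rho^{N_i}$) is trivial, i.e., for all $t\in(0,T]$, $\rho_t=\int\rho_0\,d\mu$ $\mu$-a.e.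
   Context: Let $\mathbb{T}^2=\mathbb{R}^2/\mathbb{Z}^2$, $\mathbb{Z}^2_0=\mathbb{Z}^2\setminus\{0\}$, $\mathbb{Z}^2_+=\{k\in\mathbb{Z}^2_0:k_1>0\text{ or }(k_1=0,k_2>0)\}$, $\mathbb{Z}^2_-=-\mathbb{Z}^2_+$, $k^\perp=(k_2,-k_1)$. Put $e_k(x)=\sqrt2\cos(2\pi k\cdot x)$ for $k\in\mathbb{Z}^2_+$, $e_k(x)=\sqrt2\sin(2\pi k\cdot x)$ for $k\in\mathbb{Z}^2_-$. The noise vector fields are $\sigma_k(x)=\frac1{\sqrt2}\frac{k^\perp}{|k|^\gamma}e_k(x)$, $k\in\mathbb{Z}^2_0$, here with $\gamma=2$. $H^{-1-}=\bigcap_{s>0}H^{-1-s}(\mathbb{T}^2)$ (zero-average distributions), and $\mu$ is the law of white noise on $\mathbb{T}^2$: the centered Gaussian measure on $H^{-1-}$ under which $(\langle\omega,e_k\rangle)_{k\in\mathbb{Z}^2_0}$ are i.i.d. standard normal. As usual, elements of $L^\infty([0,T],L^2(H^{-1-},\mu))$ are identified when they agree for almost every $t$. Let $\Lambda_N=\{k\in\mathbb{Z}^2_0:|k_1|\vee|k_2|\le N\}$, $H_N=\mathrm{span}\{e_k:k\in\Lambda_N\}\subset L^2(\mathbb{T}^2,\mathbb{R})$ with the $L^2(\mathbb{T}^2)$ inner product $\langle\cdot,\cdot\rangle_{H_N}$, $\Pi_N\omega=\sum_{k\in\Lambda_N}\langle\omega,e_k\rangle e_k$, and $\nabla_N$ the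 gradient on $H_N$. $C_P^\infty(H_N)$ is the set of smooth functions on $H_N$ with polynomial growth together with all derivatives. The Biot–Savart kernel is $K(x)=2\pi i\sum_{k\in\mathbb{Z}^2_0}\frac{k^\perp}{|k|^2}e^{2\pi ik\cdot x}$ (convergent in $L^p(\mathbb{T}^2)$, $1\le p<2$) and $u(\xi)(x)=\int_{\mathbb{T}^2}K(x-y)\xi(y)\,dy$. For $\xi\in H_N$ set $b_N(\xi)=\Pi_N(u(\xi)\cdot\nabla\xi)$ and $G_N^k(\xi)=\Pi_N(\sigma_k\cdot\nabla\xi)$. With $\Gamma_N=\{k\in\mathbb{Z}^2_0:|k|\le N/3\}$ ($|\cdot|$ Euclidean norm), the modified approximating operator is $$\tilde{\mathcal L}_N\phi=\frac12\sum_{k\in\Gamma_N}\big\langle G_N^k,\nabla_N\langle G_N^k,\nabla_N\phi\rangle_{H_N}\big\rangle_{H_N}-\langle b_N,\nabla_N\phi\rangle_{H_N},$$ and its formal adjoint with respect to the standard Gaussian measure $\mu_N=\mu\circ\Pi_N^{-1}$ on $H_N$ is $$\tilde{\mathcal L}_N^*\phi=\frac12\sum_{k\in\Gamma_N}\big\langle G_N^k,\nabla_N\langle G_N^k,\nabla_N\phi\rangle_{H_N}\big\rangle_{H_N}+\langle b_N,\nabla_N\phi\rangle_{H_N}.$$ The solution $\rho^N$ is the smooth one given by $\rho^N_t(\xi)=\mathbb{E}[\rho^N_0(\omega^N_t)]$, where $\omega^N$ solves the Stratonovich SDE $d\omega^N_t=b_N(\omega^N_t)\,dt+\sum_{k\in\Gamma_N}G_N^k(\omega^N_t)\circ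 dW^k_t$, $\omega^N_0=\xi\in H_N$, with independent standard real Brownian motions $W^k$. The sequence $\{\rho^N\}$ is bounded in $L^\infty([0,T],L^2(H^{-1-},\mu))$. *)

theory Defs
  imports "HOL-Probability.Probability"
begin

section \<open>The torus, its Fourier basis and the noise fields\<close>

text \<open>Functions on the torus are \<open>\<int>\<^sup>2\<close>-periodic functions on the plane; integrals over the torus are
  integrals over the unit cell, which has mass 1.\<close>

type_synonym plane = "real \<times> real"
type_synonym field = "plane \<Rightarrow> real"
type_synonym mode = "int \<times> int"

definition periodic :: "(plane \<Rightarrow> 'a) \<Rightarrow> bool" where
  "periodic f \<longleftrightarrow> (\<forall>x. \<forall>b\<in>Basis. f (x + b) = f x)"

definition torus :: "plane measure" where
  "torus = restrict_space lborel ({0..<1} \<times> {0..<1})"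

definition L2norm :: "'a measure \<Rightarrow> ('a \<Rightarrow> real) \<Rightarrow> real" where
  "L2norm M f = sqrt (\<integral>x. (f x)\<^sup>2 \<partial>M)"

definition L2inner :: "field \<Rightarrow> field \<Rightarrow> real" where
  "L2inner f g = (\<integral>x. f x * g x \<partial>torus)"

definition rvec :: "mode \<Rightarrow> plane" where
  "rvec k = (real_of_int (fst k), real_of_int (snd k))"

definition perp :: "mode \<Rightarrow> plane" where
  "perp k = (real_of_int (snd k), - real_of_int (fst k))"

definition Z20 :: "mode set" where
  "Z20 = UNIV - {(0, 0)}"

definition Z2_plus :: "mode set" where
  "Z2_plus = {k \<in> Z20. fst k > 0 \<or> (fst k = 0 \<and> snd k > 0)}"

text \<open>Only used for \<open>k \<in> Z20\<close>, where the second branch is \<open>k \<in> - Z2_plus\<close>.\<close>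

definition basis_fun :: "mode \<Rightarrow> field" where
  "basis_fun k x =
     (if k \<in> Z2_plus then sqrt 2 * cos (2 * pi * (rvec k \<bullet> x))
      else sqrt 2 * sin (2 * pi * (rvec k \<bullet> x)))"

definition noise_field :: "real \<Rightarrow> mode \<Rightarrow> plane \<Rightarrow> plane" where
  "noise_field \<gamma> k x =
     (1 / sqrt 2 * (1 / norm (rvec k) powr \<gamma>) * basis_fun k x) *\<^sub>R perp k"

definition grad :: "field \<Rightarrow> plane \<Rightarrow> plane" where
  "grad f x = (frechet_derivative f (at x) (1, 0), frechet_derivative f (at x) (0, 1))"


section \<open>Distributions on the torus and white noise\<close>

definition iter_deriv :: "plane list \<Rightarrow> field \<Rightarrow> field" where
  "iter_deriv vs f = foldr (\<lambda>v g x. frechet_derivative g (at x) v) vs f"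

text \<open>Frechet differentiability of all iterated partial derivatives is the same as \<open>C\<^sup>\<infinity>\<close>.\<close>

definition test_funs :: "field set" where
  "test_funs = {f. periodic f \<and>
     (\<forall>vs \<in> lists Basis. \<forall>x. iter_deriv vs f differentiable (at x))}"

type_synonym dist = "field \<Rightarrow> real"

text \<open>Real distributions: linear functionals on \<open>test_funs\<close> which are continuous for the usual
  \<open>C\<^sup>\<infinity>\<close> topology. Extensionality makes equality of distributions coincide with HOL equality.\<close>

definition distributions :: "dist set" where
  "distributions = {\<omega> \<in> extensional test_funs.
     (\<forall>f\<in>test_funs. \<forall>g\<in>test_funs. \<forall>a b. \<omega> (\<lambda>x. a * f x + b * g x) = a * \<omega> f + b * \<omega> g) \<and>
     (\<exists>C m. \<forall>f\<in>test_funs.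
        \<bar>\<omega> f\<bar> \<le> C * (\<Sum>vs \<in> {vs \<in> lists Basis. length vs \<le> m}. SUP x. \<bar>iter_deriv vs f x\<bar>))}"

definition Sobolev0 :: "real \<Rightarrow> dist set" where
  "Sobolev0 r = {\<omega> \<in> distributions. \<omega> (\<lambda>_. 1) = 0 \<and>
     (\<lambda>k. norm (rvec k) powr (2 * r) * (\<omega> (basis_fun k))\<^sup>2) summable_on Z20}"

definition H1minus :: "dist set" where
  "H1minus = (\<Inter>s\<in>{0<..}. Sobolev0 (-1 - s))"

text \<open>The \<open>\<sigma>\<close>-algebra generated by the Fourier coefficients is the Borel \<open>\<sigma>\<close>-algebra of the Polish
  space \<open>H\<^sup>-\<^sup>1\<^sup>-\<close>. The conditions below determine the measure uniquely.\<close>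

definition white_noise :: "dist measure \<Rightarrow> bool" where
  "white_noise \<mu> \<longleftrightarrow>
     prob_space \<mu> \<and> space \<mu> = H1minus \<and>
     sets \<mu> = sigma_sets H1minus
       {{\<omega> \<in> H1minus. \<omega> (basis_fun k) \<in> A} | k A. k \<in> Z20 \<and> A \<in> sets borel} \<and>
     prob_space.indep_vars \<mu> (\<lambda>_. borel) (\<lambda>k \<omega>. \<omega> (basis_fun k)) Z20 \<and>
     (\<forall>k\<in>Z20. distributed \<mu> lborel (\<lambda>\<omega>. \<omega> (basis_fun k)) std_normal_density)"


section \<open>The Galerkin spaces\<close>

definition modes :: "nat \<Rightarrow> mode set" where
  "modes N = {k \<in> Z20. max \<bar>fst k\<bar> \<bar>snd k\<bar> \<le> int N}"

definition noise_modes :: "nat \<Rightarrow> mode set" where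
  "noise_modes N = {k \<in> Z20. norm (rvec k) \<le> real N / 3}"

definition trig_poly :: "nat \<Rightarrow> (mode \<Rightarrow> real) \<Rightarrow> field" where
  "trig_poly N c = (\<lambda>x. \<Sum>k\<in>modes N. c k * basis_fun k x)"

definition HN :: "nat \<Rightarrow> field set" where
  "HN N = range (trig_poly N)"

text \<open>The projection \<open>\<Pi>\<^sub>N\<close>, on distributions and on integrable functions.\<close>

definition proj_dist :: "nat \<Rightarrow> dist \<Rightarrow> field" where
  "proj_dist N \<omega> = trig_poly N (\<lambda>k. \<omega> (basis_fun k))"

definition proj_fun :: "nat \<Rightarrow> field \<Rightarrow> field" where
  "proj_fun N f = trig_poly N (\<lambda>k. L2inner f (basis_fun k))"

definition shift :: "field \<Rightarrow> real \<Rightarrow> mode \<Rightarrow> field" where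
  "shift \<xi> h k = (\<lambda>x. \<xi> x + h * basis_fun k x)"

definition nabla :: "nat \<Rightarrow> (field \<Rightarrow> real) \<Rightarrow> field \<Rightarrow> field" where
  "nabla N \<phi> \<xi> = trig_poly N (\<lambda>k. deriv (\<lambda>h. \<phi> (shift \<xi> h k)) 0)"

definition continuous_HN :: "nat \<Rightarrow> (field \<Rightarrow> real) \<Rightarrow> bool" where
  "continuous_HN N \<phi> \<longleftrightarrow>
     (\<forall>\<xi>\<in>HN N. \<forall>\<epsilon>>0. \<exists>\<delta>>0. \<forall>\<eta>\<in>HN N.
        L2norm torus (\<lambda>x. \<eta> x - \<xi> x) < \<delta> \<longrightarrow> \<bar>\<phi> \<eta> - \<phi> \<xi>\<bar> < \<epsilon>)"

definition poly_growth :: "nat \<Rightarrow> (field \<Rightarrow> real) \<Rightarrow> bool" where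
  "poly_growth N \<phi> \<longleftrightarrow> (\<exists>C p. \<forall>\<xi>\<in>HN N. \<bar>\<phi> \<xi>\<bar> \<le> C * (1 + L2norm torus \<xi>) ^ p)"

text \<open>All iterated partial derivatives up to order \<open>n\<close> exist, are continuous and grow at most
  polynomially; the functions \<open>\<psi>\<close> are the partial derivatives in the directions \<open>e\<^sub>k\<close>.\<close>

primrec CP_order :: "nat \<Rightarrow> nat \<Rightarrow> (field \<Rightarrow> real) \<Rightarrow> bool" where
  "CP_order N 0 \<phi> \<longleftrightarrow> continuous_HN N \<phi> \<and> poly_growth N \<phi>"
| "CP_order N (Suc n) \<phi> \<longleftrightarrow> continuous_HN N \<phi> \<and> poly_growth N \<phi> \<and>
     (\<forall>k\<in>modes N. \<exists>\<psi>.
        (\<forall>\<xi>\<in>HN N. ((\<lambda>h. \<phi> (shift \<xi> h k)) has_real_derivative \<psi> \<xi>) (at 0)) \<and> CP_order N n \<psi>)"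

definition CP_smooth :: "nat \<Rightarrow> (field \<Rightarrow> real) set" where
  "CP_smooth N = {\<phi>. \<forall>n. CP_order N n \<phi>}"

text \<open>Smoothness on \<open>[0,T] \<times> H\<^sub>N\<close>, with one-sided time derivatives at the end points.\<close>

definition continuous_cyl :: "real \<Rightarrow> nat \<Rightarrow> (real \<Rightarrow> field \<Rightarrow> real) \<Rightarrow> bool" where
  "continuous_cyl T N f \<longleftrightarrow>
     (\<forall>t\<in>{0..T}. \<forall>\<xi>\<in>HN N. \<forall>\<epsilon>>0. \<exists>\<delta>>0. \<forall>s\<in>{0..T}. \<forall>\<eta>\<in>HN N.
        \<bar>s - t\<bar> < \<delta> \<and> L2norm torus (\<lambda>x. \<eta> x - \<xi> x) < \<delta> \<longrightarrow> \<bar>f s \<eta> - f t \<xi>\<bar> < \<epsilon>)"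

primrec C_order_cyl :: "real \<Rightarrow> nat \<Rightarrow> nat \<Rightarrow> (real \<Rightarrow> field \<Rightarrow> real) \<Rightarrow> bool" where
  "C_order_cyl T N 0 f \<longleftrightarrow> continuous_cyl T N f"
| "C_order_cyl T N (Suc n) f \<longleftrightarrow> continuous_cyl T N f \<and>
     (\<exists>g. (\<forall>t\<in>{0..T}. \<forall>\<xi>\<in>HN N.
             ((\<lambda>s. f s \<xi>) has_real_derivative g t \<xi>) (at t within {0..T})) \<and>
          C_order_cyl T N n g) \<and>
     (\<forall>k\<in>modes N. \<exists>g. (\<forall>t\<in>{0..T}. \<forall>\<xi>\<in>HN N.
             ((\<lambda>h. f t (shift \<xi> h k)) has_real_derivative g t \<xi>) (at 0)) \<and>
          C_order_cyl T N n g)"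

definition smooth_cyl :: "real \<Rightarrow> nat \<Rightarrow> (real \<Rightarrow> field \<Rightarrow> real) \<Rightarrow> bool" where
  "smooth_cyl T N f \<longleftrightarrow> (\<forall>n. C_order_cyl T N n f)"


section \<open>The Galerkin approximation\<close>

definition biot_savart_partial :: "nat \<Rightarrow> plane \<Rightarrow> complex \<times> complex" where
  "biot_savart_partial N x = (\<Sum>k\<in>modes N.
     let c = 2 * complex_of_real pi * \<i> * exp (2 * complex_of_real pi * \<i> * complex_of_real (rvec k \<bullet> x))
             / complex_of_real ((norm (rvec k))\<^sup>2)
     in (c * complex_of_real (fst (perp k)), c * complex_of_real (snd (perp k))))"

text \<open>The series for the kernel converges in \<open>L\<^sup>p\<close> only, and not unconditionally: its sum is the
  limit over the square boxes, which is real and unique up to null sets.\<close>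

definition biot_savart_kernel :: "(plane \<Rightarrow> plane) \<Rightarrow> bool" where
  "biot_savart_kernel K \<longleftrightarrow> periodic K \<and> K \<in> borel_measurable borel \<and>
     (\<forall>p. 1 \<le> p \<and> p < 2 \<longrightarrow>
        (\<lambda>N. \<integral>\<^sup>+x. ennreal (norm ((complex_of_real (fst (K x)), complex_of_real (snd (K x)))
                              - biot_savart_partial N x) powr p) \<partial>torus) \<longlonglongrightarrow> 0)"

definition velocity :: "(plane \<Rightarrow> plane) \<Rightarrow> field \<Rightarrow> plane \<Rightarrow> plane" where
  "velocity K \<xi> x = (\<integral>y. \<xi> y *\<^sub>R K (x - y) \<partial>torus)"

definition bN :: "(plane \<Rightarrow> plane) \<Rightarrow> nat \<Rightarrow> field \<Rightarrow> field" where
  "bN K N \<xi> = proj_fun N (\<lambda>x. velocity K \<xi> x \<bullet> grad \<xi> x)"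

definition GN :: "real \<Rightarrow> nat \<Rightarrow> mode \<Rightarrow> field \<Rightarrow> field" where
  "GN \<gamma> N k \<xi> = proj_fun N (\<lambda>x. noise_field \<gamma> k x \<bullet> grad \<xi> x)"

definition along :: "nat \<Rightarrow> (field \<Rightarrow> field) \<Rightarrow> (field \<Rightarrow> real) \<Rightarrow> field \<Rightarrow> real" where
  "along N V \<phi> \<xi> = L2inner (V \<xi>) (nabla N \<phi> \<xi>)"

definition LN_adj :: "real \<Rightarrow> (plane \<Rightarrow> plane) \<Rightarrow> nat \<Rightarrow> (field \<Rightarrow> real) \<Rightarrow> field \<Rightarrow> real" where
  "LN_adj \<gamma> K N \<phi> \<xi> =
     1 / 2 * (\<Sum>k\<in>noise_modes N. along N (GN \<gamma> N k) (along N (GN \<gamma> N k) \<phi>) \<xi>)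
     + along N (bN K N) \<phi> \<xi>"

definition galerkin_solution ::
  "real \<Rightarrow> (plane \<Rightarrow> plane) \<Rightarrow> real \<Rightarrow> nat \<Rightarrow> (field \<Rightarrow> real) \<Rightarrow> (real \<Rightarrow> field \<Rightarrow> real) \<Rightarrow> bool" where
  "galerkin_solution \<gamma> K T N \<phi>0 \<phi> \<longleftrightarrow>
     smooth_cyl T N \<phi> \<and>
     (\<forall>\<xi>\<in>HN N. \<phi> 0 \<xi> = \<phi>0 \<xi>) \<and>
     (\<forall>t\<in>{0..T}. \<forall>\<xi>\<in>HN N.
        ((\<lambda>s. \<phi> s \<xi>) has_real_derivative LN_adj \<gamma> K N (\<phi> t) \<xi>) (at t within {0..T}))"


section \<open>The Stratonovich equation\<close>

definition interval_measure :: "real \<Rightarrow> real measure" where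
  "interval_measure t = restrict_space lborel {0..t}"

text \<open>Increments after time \<open>s\<close> are independent of \<open>F s\<close> and, for different modes, of each other,
  jointly: index \<open>None\<close> stands for \<open>F s\<close>.\<close>

definition brownian_family ::
  "'w measure \<Rightarrow> (real \<Rightarrow> 'w measure) \<Rightarrow> (mode \<Rightarrow> real \<Rightarrow> 'w \<Rightarrow> real) \<Rightarrow> bool" where
  "brownian_family M F W \<longleftrightarrow>
     prob_space M \<and> filtration (space M) F \<and> (\<forall>t. subalgebra M (F t)) \<and>
     (\<forall>k\<in>Z20.
        (AE w in M. W k 0 w = 0) \<and>
        (AE w in M. continuous_on {0..} (\<lambda>t. W k t w)) \<and>
        (\<forall>t\<ge>0. W k t \<in> borel_measurable (F t)) \<and>
        (\<forall>s t. 0 \<le> s \<and> s < t \<longrightarrow>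
           distributed M lborel (\<lambda>w. W k t w - W k s w) (normal_density 0 (sqrt (t - s))))) \<and>
     (\<forall>s t. 0 \<le> s \<and> s < t \<longrightarrow>
        prob_space.indep_sets M
          (\<lambda>j. case j of
                 None \<Rightarrow> sets (F s)
               | Some k \<Rightarrow> {(\<lambda>w. W k t w - W k s w) -` A \<inter> space M | A. A \<in> sets borel})
          (insert None (Some ` Z20)))"

text \<open>\<open>I\<close> is the Stratonovich integral of \<open>Y\<close> against \<open>B\<close> over \<open>[0,t]\<close>: the limit in probability of
  the trapezoidal sums along partitions \<open>0 = \<pi> n 0 \<le> \<dots> \<le> \<pi> n (m n) = t\<close> of vanishing mesh.\<close>

definition partitions :: "real \<Rightarrow> (nat \<Rightarrow> nat) \<Rightarrow> (nat \<Rightarrow> nat \<Rightarrow> real) \<Rightarrow> bool" where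
  "partitions t m \<pi> \<longleftrightarrow>
     (\<forall>n. \<pi> n 0 = 0 \<and> \<pi> n (m n) = t \<and> (\<forall>i<m n. \<pi> n i \<le> \<pi> n (Suc i))) \<and>
     (\<forall>\<delta>>0. \<forall>\<^sub>F n in sequentially. \<forall>i<m n. \<pi> n (Suc i) - \<pi> n i < \<delta>)"

definition stratonovich_integral ::
  "'w measure \<Rightarrow> (real \<Rightarrow> 'w \<Rightarrow> real) \<Rightarrow> (real \<Rightarrow> 'w \<Rightarrow> real) \<Rightarrow> real \<Rightarrow> ('w \<Rightarrow> real) \<Rightarrow> bool" where
  "stratonovich_integral M Y B t I \<longleftrightarrow>
     I \<in> borel_measurable M \<and>
     (\<forall>m \<pi>. partitions t m \<pi> \<longrightarrow>
        (\<forall>\<epsilon>>0. (\<lambda>n. measure M {w \<in> space M.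
           \<bar>(\<Sum>i<m n. (Y (\<pi> n i) w + Y (\<pi> n (Suc i)) w) / 2 * (B (\<pi> n (Suc i)) w - B (\<pi> n i) w))
             - I w\<bar> > \<epsilon>}) \<longlonglongrightarrow> 0))"

definition sde_solution ::
  "real \<Rightarrow> (plane \<Rightarrow> plane) \<Rightarrow> real \<Rightarrow> nat \<Rightarrow> 'w measure \<Rightarrow> (real \<Rightarrow> 'w measure) \<Rightarrow>
   (mode \<Rightarrow> real \<Rightarrow> 'w \<Rightarrow> real) \<Rightarrow> field \<Rightarrow> (real \<Rightarrow> 'w \<Rightarrow> field) \<Rightarrow> bool" where
  "sde_solution \<gamma> K T N M F W \<xi> X \<longleftrightarrow>
     (\<forall>t\<in>{0..T}. \<forall>w\<in>space M. X t w \<in> HN N) \<and>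
     (\<forall>j\<in>modes N.
        (\<forall>t\<in>{0..T}. (\<lambda>w. L2inner (X t w) (basis_fun j)) \<in> borel_measurable (F t)) \<and>
        (AE w in M. continuous_on {0..T} (\<lambda>t. L2inner (X t w) (basis_fun j))) \<and>
        (\<forall>t\<in>{0..T}. \<exists>I.
           (\<forall>k\<in>noise_modes N.
              stratonovich_integral M (\<lambda>s w. L2inner (GN \<gamma> N k (X s w)) (basis_fun j)) (W k) t (I k)) \<and>
           (AE w in M. L2inner (X t w) (basis_fun j) =
              L2inner \<xi> (basis_fun j)
              + (\<integral>s. L2inner (bN K N (X s w)) (basis_fun j) \<partial>interval_measure t)
              + (\<Sum>k\<in>noise_modes N. I k w))))"


section \<open>The space \<open>L\<^sup>\<infinity>([0,T], L\<^sup>2(\<mu>))\<close> and its weak-* topology\<close>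

text \<open>Elements are represented by jointly measurable functions; as \<open>L\<^sup>2(\<mu>)\<close> is separable, their classes
  are exactly the strongly measurable \<open>L\<^sup>2(\<mu>)\<close>-valued functions modulo null sets.\<close>

definition Linf_L2 :: "real \<Rightarrow> 'a measure \<Rightarrow> (real \<Rightarrow> 'a \<Rightarrow> real) set" where
  "Linf_L2 T \<mu> = {f.
     (\<lambda>(t, \<omega>). f t \<omega>) \<in> borel_measurable (interval_measure T \<Otimes>\<^sub>M \<mu>) \<and>
     (\<exists>C. AE t in interval_measure T. integrable \<mu> (\<lambda>\<omega>. (f t \<omega>)\<^sup>2) \<and> L2norm \<mu> (f t) \<le> C)}"

definition L1_L2 :: "real \<Rightarrow> 'a measure \<Rightarrow> (real \<Rightarrow> 'a \<Rightarrow> real) set" where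
  "L1_L2 T \<mu> = {g.
     (\<lambda>(t, \<omega>). g t \<omega>) \<in> borel_measurable (interval_measure T \<Otimes>\<^sub>M \<mu>) \<and>
     (AE t in interval_measure T. integrable \<mu> (\<lambda>\<omega>. (g t \<omega>)\<^sup>2)) \<and>
     integrable (interval_measure T) (\<lambda>t. L2norm \<mu> (g t))}"

definition same_class :: "real \<Rightarrow> 'a measure \<Rightarrow> (real \<Rightarrow> 'a \<Rightarrow> real) \<Rightarrow> (real \<Rightarrow> 'a \<Rightarrow> real) \<Rightarrow> bool" where
  "same_class T \<mu> f g \<longleftrightarrow> (AE t in interval_measure T. AE \<omega> in \<mu>. f t \<omega> = g t \<omega>)"

text \<open>Convergence against the predual \<open>L\<^sup>1([0,T], L\<^sup>2(\<mu>))\<close>.\<close>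

definition weak_star_lim ::
  "real \<Rightarrow> 'a measure \<Rightarrow> (nat \<Rightarrow> real \<Rightarrow> 'a \<Rightarrow> real) \<Rightarrow> (real \<Rightarrow> 'a \<Rightarrow> real) \<Rightarrow> bool" where
  "weak_star_lim T \<mu> f f' \<longleftrightarrow>
     (\<forall>i. f i \<in> Linf_L2 T \<mu>) \<and> f' \<in> Linf_L2 T \<mu> \<and>
     (\<forall>g \<in> L1_L2 T \<mu>.
        (\<lambda>i. \<integral>t. (\<integral>\<omega>. f i t \<omega> * g t \<omega> \<partial>\<mu>) \<partial>interval_measure T)
          \<longlonglongrightarrow> (\<integral>t. (\<integral>\<omega>. f' t \<omega> * g t \<omega> \<partial>\<mu>) \<partial>interval_measure T))"

end

theory Submission
  imports Defs
begin

text \<open>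
  Every vector field of the Galerkin system is divergence free, is tangent to the spheres of \<open>H\<^sub>N\<close>, and has a
  \<open>j\<close>-th component which does not depend on the \<open>j\<close>-th coordinate. Gaussian integration by parts against radial
  cutoffs therefore needs no growth bound on the solutions: it gives the energy inequality
  \<open>E (\<rho>\<^sub>t)\<^sup>2 \<le> E (\<rho>\<^sub>0)\<^sup>2\<close> and the duality with the operator \<open>L\<^sub>N\<close> acting on a plane wave
  \<open>\<phi> = cos (\<Sum>j. \<beta>\<^sub>j \<langle>\<omega>, e\<^sub>j\<rangle> + \<theta>)\<close> of finitely many Fourier coefficients.
  For \<open>\<gamma> = 2\<close> the sum \<open>a\<^sub>N\<close> of \<open>|k|\<^sup>-\<^sup>2\<close> over the noise modes diverges logarithmically, and
  \<open>L\<^sub>N \<phi> / a\<^sub>N\<close> converges in \<open>L\<^sup>2(\<mu>)\<close> to \<open>A \<phi>\<close> with an Ornstein--Uhlenbeck operator \<open>A\<close>: what is left over are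
  centred quadratic forms whose variance is only of order \<open>a\<^sub>N\<close>. Dividing the duality formula by \<open>a\<^sub>N\<close> shows that
  the time integrals of a limit point \<open>\<rho>\<close> are orthogonal to all \<open>A \<phi>\<close>. This is a first-order linear equation for
  their Fourier transform, solved only by multiples of the Gaussian one; so they, and then \<open>\<rho>\<close>, are constant.
\<close>

subsection \<open>Integration over the torus\<close>

text \<open>The logarithm makes the limit degenerate. The Ito correction carries the full sum of
  \<open>|k|^-2\<close>, whereas in the centred parts skew-symmetry moves the derivative onto the
  fixed test mode \<open>l\<close>, so that an entry is at most a multiple of
  \<open>|l| / |k|\<close>. As two modes interact with at most four others, the squared
  Hilbert--Schmidt norms cost only one further sum of \<open>|k|^-2\<close>, against a normalisation
  by its square. The radius \<open>N / 3\<close> of the noise modes leaves room for the projection: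
  if \<open>l\<close> is bounded by \<open>N / 2\<close>, then \<open>k + l\<close> and
  \<open>k - l\<close> stay below \<open>N\<close>. Parseval then applies without truncation, and
  the correction is exactly diagonal for each such \<open>N\<close>, not only asymptotically. A
  weak-* limit controls no single time, so the test functions are time indicators multiplied by
  \<open>A \<phi>\<close>. Since \<open>A \<phi>\<close> has mean zero, orthogonality determines a
  time integral only up to an additive constant, which the conserved expectation fixes.\<close>

lemma rvec_add: "rvec (k + l) = rvec k + rvec l"
  and rvec_diff: "rvec (k - l) = rvec k - rvec l"
  and rvec_minus: "rvec (- k) = - rvec k"
  and rvec_zero [simp]: "rvec 0 = 0"
  by (auto simp: rvec_def fst_add fst_diff prod_eq_iff)

lemma rvec_eq_0_iff [simp]: "rvec k = 0 \<longleftrightarrow> k = 0"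
  by (auto simp: rvec_def prod_eq_iff)

lemma inner_rvec: "rvec k \<bullet> x = real_of_int (fst k) * fst x + real_of_int (snd k) * snd x"
  by (simp add: rvec_def inner_prod_def)

lemma periodicD1: "periodic f \<Longrightarrow> f (a + 1, b) = f (a, b)"
  and periodicD2: "periodic f \<Longrightarrow> f (a, b + 1) = f (a, b)"
proof -
  assume f: "periodic f"
  have "(1, 0) \<in> (Basis :: plane set)" "(0, 1) \<in> (Basis :: plane set)"
    by (auto simp: Basis_prod_def)
  then have *: "f (x + (1, 0)) = f x" "f (x + (0, 1)) = f x" for x
    using f unfolding periodic_def by blast+
  show "f (a + 1, b) = f (a, b)" using *(1)[of "(a, b)"] by simp
  show "f (a, b + 1) = f (a, b)" using *(2)[of "(a, b)"] by simp
qed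

lemma periodic_rvec:
  assumes "periodic f"
  shows "f (x + rvec n) = f x"
proof -
  have n1: "f (a + real m, b) = f (a, b)" for a b and m :: nat
  proof (induction m)
    case (Suc m)
    then show ?case using periodicD1[OF assms, of "a + real m" b] by (simp add: add_ac)
  qed auto
  have n2: "f (a, b + real m) = f (a, b)" for a b and m :: nat
  proof (induction m)
    case (Suc m)
    then show ?case using periodicD2[OF assms, of a "b + real m"] by (simp add: add_ac)
  qed auto
  have i1: "f (a + of_int m, b) = f (a, b)" for a b and m :: int
    using n1[of a "nat m" b] n1[of "a + of_int m" "nat (- m)" b] by (cases "m \<ge> 0") auto
  have i2: "f (a, b + of_int m) = f (a, b)" for a b and m :: int
    using n2[of a b "nat m"] n2[of a "b + of_int m" "nat (- m)"] by (cases "m \<ge> 0") auto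
  show ?thesis
    using i1[of "fst x" "fst n" "snd x + of_int (snd n)"] i2[of "fst x" "snd x" "snd n"]
    by (cases x) (simp add: rvec_def)
qed

abbreviation unit_cell :: "plane set" where
  "unit_cell \<equiv> {0..<1} \<times> {0..<1}"

lemma sets_unit_cell [measurable]: "unit_cell \<in> sets borel"
  by (intro borel_Times) auto

lemma space_torus: "space torus = unit_cell"
  by (simp add: torus_def space_restrict_space)

lemma measurable_torus: "f \<in> borel_measurable borel \<Longrightarrow> f \<in> borel_measurable torus"
  unfolding torus_def by (auto intro!: measurable_restrict_space1)

lemma measurable_torus_continuous:
  "continuous_on UNIV f \<Longrightarrow> f \<in> borel_measurable torus"
  by (intro measurable_torus borel_measurable_continuous_onI)

lemma nn_integral_torus:
  "(\<integral>\<^sup>+x. f x \<partial>torus) = (\<integral>\<^sup>+x. f x * indicator unit_cell x \<partial>lborel)"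
  unfolding torus_def by (rule nn_integral_restrict_space) auto

lemma emeasure_torus: "emeasure torus (space torus) = 1"
proof -
  have "emeasure torus (space torus) = (\<integral>\<^sup>+x. indicator unit_cell x \<partial>lborel)"
    using nn_integral_torus[of "\<lambda>_. 1"] by simp
  also have "\<dots> = emeasure lborel unit_cell" by simp
  also have "\<dots> = emeasure (lborel \<Otimes>\<^sub>M lborel) ({0..<1::real} \<times> {0..<1::real})"
    by (simp add: lborel_prod)
  also have "\<dots> = 1"
    by (subst lborel.emeasure_pair_measure_Times) auto
  finally show ?thesis .
qed

interpretation torus: prob_space torus
  by standard (rule emeasure_torus)

lemma nn_integral_lborel_reflect:
  fixes f :: "plane \<Rightarrow> ennreal"
  assumes [measurable]: "f \<in> borel_measurable borel"
  shows "(\<integral>\<^sup>+y. f (x - y) \<partial>lborel) = (\<integral>\<^sup>+y. f y \<partial>lborel)"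
proof -
  have "(\<integral>\<^sup>+y. f y \<partial>lborel) = (\<integral>\<^sup>+y. f y \<partial>density (distr lborel borel (\<lambda>y. x + (-1) *\<^sub>R y))
      (\<lambda>_. ennreal (\<bar>-1 :: real\<bar> ^ DIM(plane))))"
    by (rule arg_cong[OF lborel_affine, of "-1" "\<lambda>M. \<integral>\<^sup>+y. f y \<partial>M" x]) simp
  also have "\<dots> = (\<integral>\<^sup>+y. f (x - y) \<partial>lborel)"
    by (simp add: nn_integral_density nn_integral_distr)
  finally show ?thesis by simp
qed

lemma nn_integral_lborel_shift:
  fixes f :: "plane \<Rightarrow> ennreal"
  assumes [measurable]: "f \<in> borel_measurable borel"
  shows "(\<integral>\<^sup>+y. f (y + a) \<partial>lborel) = (\<integral>\<^sup>+y. f y \<partial>lborel)"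
proof -
  have "(\<integral>\<^sup>+y. f (y + a) \<partial>lborel) = (\<integral>\<^sup>+y. f y \<partial>distr lborel borel ((+) a))"
    by (subst nn_integral_distr) (auto simp: add.commute)
  then show ?thesis by (simp only: lborel_distr_plus)
qed

text \<open>Each point lies in exactly one lattice translate of the cell, given by its integer
  parts. The lattice sum, being 1, can be inserted into an integral to cut it into pieces that are
  moved back into the cell.\<close>

lemma unit_cell_tiling:
  "(\<integral>\<^sup>+n. indicator unit_cell (z - rvec n) \<partial>count_space UNIV) = (1 :: ennreal)"
proof -
  have *: "z - rvec n \<in> unit_cell \<longleftrightarrow> n = (\<lfloor>fst z\<rfloor>, \<lfloor>snd z\<rfloor>)" for n
    by (cases z; cases n) (auto simp: rvec_def floor_eq_iff; linarith)
  have "(\<integral>\<^sup>+n. indicator unit_cell (z - rvec n) \<partial>count_space UNIV) =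
      (\<integral>\<^sup>+n. indicator {(\<lfloor>fst z\<rfloor>, \<lfloor>snd z\<rfloor>)} n \<partial>count_space UNIV)"
    by (intro nn_integral_cong) (simp add: indicator_def *)
  then show ?thesis by simp
qed

text \<open>The reflected cell \<open>x - Q\<close> and \<open>Q\<close> are both fundamental domains of the lattice.\<close>

lemma nn_integral_torus_reflect:
  fixes f :: "plane \<Rightarrow> ennreal"
  assumes [measurable]: "f \<in> borel_measurable borel" and f: "periodic f"
  shows "(\<integral>\<^sup>+y. f (x - y) \<partial>torus) = (\<integral>\<^sup>+y. f y \<partial>torus)"
proof -
  let ?Q = "indicator unit_cell :: plane \<Rightarrow> ennreal"
  have [measurable]: "?Q \<in> borel_measurable borel" by simp
  have "(\<integral>\<^sup>+y. f (x - y) \<partial>torus) = (\<integral>\<^sup>+y. (\<lambda>z. f z * ?Q (x - z)) (x - y) \<partial>lborel)"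
    by (simp add: nn_integral_torus)
  also have "\<dots> = (\<integral>\<^sup>+z. f z * ?Q (x - z) \<partial>lborel)"
    by (rule nn_integral_lborel_reflect[of "\<lambda>z. f z * ?Q (x - z)"]) measurable
  also have "\<dots> = (\<integral>\<^sup>+z. f z * ?Q (x - z) * (\<integral>\<^sup>+n. ?Q (z - rvec n) \<partial>count_space UNIV) \<partial>lborel)"
    by (simp add: unit_cell_tiling)
  also have "\<dots> = (\<integral>\<^sup>+z. (\<integral>\<^sup>+n. f z * ?Q (x - z) * ?Q (z - rvec n) \<partial>count_space UNIV) \<partial>lborel)"
    by (simp add: nn_integral_cmult)
  also have "\<dots> = (\<integral>\<^sup>+n. (\<integral>\<^sup>+z. f z * ?Q (x - z) * ?Q (z - rvec n) \<partial>lborel) \<partial>count_space UNIV)"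
    by (rule nn_integral_count_space_nn_integral) auto
  also have "\<dots> = (\<integral>\<^sup>+n. (\<integral>\<^sup>+z. f z * ?Q (x - z - rvec n) * ?Q z \<partial>lborel) \<partial>count_space UNIV)"
  proof (rule nn_integral_cong)
    fix n
    have "(\<integral>\<^sup>+z. f z * ?Q (x - z) * ?Q (z - rvec n) \<partial>lborel) =
        (\<integral>\<^sup>+z. (\<lambda>z. f z * ?Q (x - z) * ?Q (z - rvec n)) (z + rvec n) \<partial>lborel)"
      by (rule nn_integral_lborel_shift[of "\<lambda>z. f z * ?Q (x - z) * ?Q (z - rvec n)", symmetric]) measurable
    then show "(\<integral>\<^sup>+z. f z * ?Q (x - z) * ?Q (z - rvec n) \<partial>lborel) =
        (\<integral>\<^sup>+z. f z * ?Q (x - z - rvec n) * ?Q z \<partial>lborel)"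
      by (simp add: periodic_rvec[OF f] diff_diff_eq)
  qed
  also have "\<dots> = (\<integral>\<^sup>+z. (\<integral>\<^sup>+n. f z * ?Q z * ?Q (x - z - rvec n) \<partial>count_space UNIV) \<partial>lborel)"
    by (subst nn_integral_count_space_nn_integral) (auto simp: mult_ac)
  also have "\<dots> = (\<integral>\<^sup>+z. f z * ?Q z \<partial>lborel)"
    by (simp add: nn_integral_cmult unit_cell_tiling)
  also have "\<dots> = (\<integral>\<^sup>+y. f y \<partial>torus)"
    by (simp add: nn_integral_torus)
  finally show ?thesis .
qed

lemma integrable_torus_continuous:
  fixes f :: "plane \<Rightarrow> real"
  assumes "continuous_on UNIV f"
  shows "integrable torus f"
proof -
  have "compact (f ` ({0..1} \<times> {0..1}))"
    by (intro compact_continuous_image continuous_on_subset[OF assms] compact_Times) auto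
  then obtain B where B: "\<And>x. x \<in> {0..1} \<times> {0..1} \<Longrightarrow> \<bar>f x\<bar> \<le> B"
    by (metis compact_imp_bounded bounded_iff imageI real_norm_def)
  show ?thesis
  proof (rule torus.integrable_const_bound[where B = B])
    show "AE x in torus. norm (f x) \<le> B"
      by (rule AE_I2) (auto simp: space_torus intro!: B)
  qed (rule measurable_torus_continuous[OF assms])
qed

lemma integral_torus_reflect:
  fixes f :: "plane \<Rightarrow> real"
  assumes [measurable]: "f \<in> borel_measurable borel" and f: "periodic f" and int: "integrable torus f"
  shows "integrable torus (\<lambda>y. f (x - y))" "(\<integral>y. f (x - y) \<partial>torus) = (\<integral>y. f y \<partial>torus)"
proof -
  have refl: "(\<integral>\<^sup>+y. g (f (x - y)) \<partial>torus) = (\<integral>\<^sup>+y. g (f y) \<partial>torus)"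
    if [measurable]: "g \<in> borel_measurable borel" for g :: "real \<Rightarrow> ennreal"
    by (rule nn_integral_torus_reflect) (use f in \<open>auto simp: periodic_def\<close>)
  show i: "integrable torus (\<lambda>y. f (x - y))"
    using int refl[of "\<lambda>r. ennreal (norm r)"]
    by (auto simp: integrable_iff_bounded intro!: measurable_torus)
  show "(\<integral>y. f (x - y) \<partial>torus) = (\<integral>y. f y \<partial>torus)"
    unfolding real_lebesgue_integral_def[OF i] real_lebesgue_integral_def[OF int]
    using refl[of "\<lambda>r. ennreal r"] refl[of "\<lambda>r. ennreal (- r)"] by simp
qed

subsection \<open>Fourier modes\<close>

lemma cos_add_2pi_int: "cos (x + 2 * pi * of_int n) = cos x"
  by (simp only: cos_add cos_int_2pin sin_int_2pin mult_1_right mult_zero_right diff_zero)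

text \<open>The phase treats cosines and sines together: each basis function is
  \<open>sqrt 2\<close> times a wave, and one product rule replaces the case distinction on
  \<open>Z2_plus\<close>.\<close>

definition wave :: "mode \<Rightarrow> real \<Rightarrow> field" where
  "wave n \<theta> x = cos (2 * pi * (rvec n \<bullet> x) - \<theta>)"

lemma continuous_on_wave [continuous_intros]:
  fixes f :: "'a::t2_space \<Rightarrow> plane"
  shows "continuous_on A f \<Longrightarrow> continuous_on A (\<lambda>x. wave n \<theta> (f x))"
  unfolding wave_def by (intro continuous_intros)

lemma abs_wave_le_1: "\<bar>wave n \<theta> x\<bar> \<le> 1"
  by (simp add: wave_def)

lemma wave_minus: "wave (- n) \<theta> = wave n (- \<theta>)"
proof
  fix x
  have "wave (- n) \<theta> x = cos (- (2 * pi * (rvec n \<bullet> x) + \<theta>))"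
    by (simp add: wave_def rvec_minus)
  then show "wave (- n) \<theta> x = wave n (- \<theta>) x"
    unfolding cos_minus by (simp add: wave_def)
qed

lemma periodic_wave: "periodic (wave n \<theta>)"
proof -
  have "wave n \<theta> (x + b) = wave n \<theta> x" if "b \<in> Basis" for x b
  proof -
    from that obtain m :: int where m: "rvec n \<bullet> b = of_int m"
      by (auto simp: Basis_prod_def inner_rvec)
    have "wave n \<theta> (x + b) = cos ((2 * pi * (rvec n \<bullet> x) - \<theta>) + 2 * pi * of_int m)"
      by (simp add: wave_def inner_add_right m algebra_simps)
    then show ?thesis by (simp only: cos_add_2pi_int) (simp add: wave_def)
  qed
  then show ?thesis unfolding periodic_def by blast
qed

lemma wave_mult: "wave a \<alpha> x * wave b \<beta> x = (wave (a - b) (\<alpha> - \<beta>) x + wave (a + b) (\<alpha> + \<beta>) x) / 2"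
proof -
  have "(2 * pi * (rvec (a - b) \<bullet> x) - (\<alpha> - \<beta>)) =
      (2 * pi * (rvec a \<bullet> x) - \<alpha>) - (2 * pi * (rvec b \<bullet> x) - \<beta>)"
    "(2 * pi * (rvec (a + b) \<bullet> x) - (\<alpha> + \<beta>)) =
      (2 * pi * (rvec a \<bullet> x) - \<alpha>) + (2 * pi * (rvec b \<bullet> x) - \<beta>)"
    by (simp_all add: rvec_add rvec_diff inner_diff_left inner_add_left algebra_simps)
  then show ?thesis unfolding wave_def by (simp only: cos_times_cos)
qed

text \<open>The torus mean of \<open>wave n \<theta>\<close>, as \<open>integral_wave\<close> shows:
  only the zero frequency survives.\<close>

definition kappa :: "mode \<Rightarrow> real \<Rightarrow> real" where
  "kappa n \<theta> = (if n = 0 then cos \<theta> else 0)"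

lemma integrable_wave [simp, intro]: "integrable torus (wave n \<theta>)"
  by (intro integrable_torus_continuous continuous_intros)

text \<open>For \<open>n \<noteq> 0\<close> a half-period shift changes the sign of the wave.\<close>

lemma integral_wave: "(\<integral>x. wave n \<theta> x \<partial>torus) = kappa n \<theta>"
proof (cases "n = 0")
  case True
  have "(\<integral>x. cos \<theta> \<partial>torus) = cos \<theta>"
    using torus.prob_space by simp
  then show ?thesis by (simp add: True kappa_def wave_def)
next
  case False
  define v where "v = (1 / (2 * (norm (rvec n))\<^sup>2)) *\<^sub>R rvec n"
  have nv: "rvec n \<bullet> v = 1 / 2"
    using False by (simp add: v_def dot_square_norm)
  have m: "wave n \<theta> \<in> borel_measurable borel"
    by (intro borel_measurable_continuous_onI continuous_intros)
  \<comment> \<open>Translation by \<open>v\<close> is expressed through the two reflections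
    \<open>v - y\<close> and \<open>0 - y\<close>, which leave the integral unchanged.\<close>
  note * = integral_torus_reflect(2)[OF m periodic_wave integrable_wave]
  have "wave n \<theta> (v - y) = - wave n \<theta> (0 - y)" for y
  proof -
    have "wave n \<theta> (v - y) = cos (2 * pi * (rvec n \<bullet> (0 - y)) - \<theta> + pi)"
      by (simp add: wave_def nv inner_diff_right algebra_simps)
    then show ?thesis by (simp add: wave_def)
  qed
  then have "(\<integral>x. wave n \<theta> x \<partial>torus) = - (\<integral>x. wave n \<theta> x \<partial>torus)"
    using *[of v] *[of 0] by simp
  with False show ?thesis by (simp add: kappa_def)
qed

definition phase :: "mode \<Rightarrow> real" where
  "phase k = (if k \<in> Z2_plus then 0 else pi / 2)"

lemma Z20_iff: "k \<in> Z20 \<longleftrightarrow> k \<noteq> 0"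
  by (auto simp: Z20_def zero_prod_def)

lemma basis_fun_wave: "basis_fun k x = sqrt 2 * wave k (phase k) x"
  by (simp add: basis_fun_def wave_def phase_def cos_diff)

text \<open>Exactly one of \<open>k\<close> and \<open>- k\<close> lies in \<open>Z2_plus\<close>,
  so their phases are \<open>0\<close> and \<open>pi / 2\<close> in some order.\<close>

lemma phase_minus: "k \<noteq> 0 \<Longrightarrow> phase (- k) = pi / 2 - phase k"
  by (cases k) (auto simp: phase_def Z2_plus_def Z20_iff zero_prod_def)

lemma continuous_on_basis_fun [continuous_intros]:
  fixes f :: "'a::t2_space \<Rightarrow> plane"
  shows "continuous_on A f \<Longrightarrow> continuous_on A (\<lambda>x. basis_fun k (f x))"
  unfolding basis_fun_wave by (intro continuous_intros)

lemma abs_basis_fun_le: "\<bar>basis_fun k x\<bar> \<le> sqrt 2"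
  using abs_wave_le_1[of k "phase k" x] by (simp add: basis_fun_wave abs_mult)

text \<open>The modes \<open>k\<close> and \<open>- k\<close> are a pair with the same wave length,
  a quarter period apart. Differentiating \<open>basis_fun k\<close> therefore produces
  \<open>basis_fun (- k)\<close>, which is why partner modes appear in all later
  coefficients.\<close>

lemma basis_fun_minus:
  assumes "k \<noteq> 0"
  shows "basis_fun (- k) x = - (sqrt 2 * sin (2 * pi * (rvec k \<bullet> x) - phase k))"
proof -
  have "wave k (phase k - pi / 2) x = cos ((2 * pi * (rvec k \<bullet> x) - phase k) + pi / 2)"
    by (simp add: wave_def algebra_simps)
  also have "\<dots> = - sin (2 * pi * (rvec k \<bullet> x) - phase k)"
    unfolding cos_add cos_pi_half sin_pi_half by simp
  finally show ?thesis
    using assms by (simp add: basis_fun_wave phase_minus wave_minus)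
qed

lemma basis_fun_square_sum:
  "k \<noteq> 0 \<Longrightarrow> (basis_fun k x)\<^sup>2 + (basis_fun (- k) x)\<^sup>2 = 2"
  by (simp add: basis_fun_minus basis_fun_wave[of k] wave_def power_mult_distrib flip: distrib_left)

lemma basis_fun_has_derivative:
  assumes "k \<noteq> 0"
  shows "(basis_fun k has_derivative (\<lambda>h. 2 * pi * basis_fun (- k) x * (rvec k \<bullet> h))) (at x)"
proof -
  have "((\<lambda>x. sqrt 2 * cos (2 * pi * (rvec k \<bullet> x) - phase k)) has_derivative
      (\<lambda>h. 2 * pi * basis_fun (- k) x * (rvec k \<bullet> h))) (at x)"
    unfolding basis_fun_minus[OF assms]
    by (auto intro!: derivative_eq_intros simp: algebra_simps)
  then show ?thesis by (simp add: basis_fun_wave[abs_def] wave_def)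
qed

lemma L2inner_basis_fun:
  assumes "k \<in> Z20" "l \<in> Z20"
  shows "L2inner (basis_fun k) (basis_fun l) = (if k = l then 1 else 0)"
proof -
  have "L2inner (basis_fun k) (basis_fun l) =
      (\<integral>x. wave (k - l) (phase k - phase l) x + wave (k + l) (phase k + phase l) x \<partial>torus)"
    unfolding L2inner_def
  proof (rule Bochner_Integration.integral_cong[OF refl])
    fix x
    have "basis_fun k x * basis_fun l x = 2 * (wave k (phase k) x * wave l (phase l) x)"
      by (simp add: basis_fun_wave)
    then show "basis_fun k x * basis_fun l x =
        wave (k - l) (phase k - phase l) x + wave (k + l) (phase k + phase l) x"
      by (simp add: wave_mult)
  qed
  then have *: "L2inner (basis_fun k) (basis_fun l) =
      kappa (k - l) (phase k - phase l) + kappa (k + l) (phase k + phase l)"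
    by (simp add: integral_wave)
  show ?thesis
  proof (cases "k + l = 0")
    \<comment> \<open>Here the frequency \<open>k + l\<close> vanishes too, but the phases of the
      partners add up to \<open>pi / 2\<close>, whose cosine is 0.\<close>
    case True
    then have l: "l = - k" by (metis minus_unique)
    have "k + k \<noteq> 0" "k \<noteq> - k" using assms by (cases k; auto simp: Z20_iff zero_prod_def)+
    then show ?thesis
      unfolding * using assms by (simp add: kappa_def l phase_minus Z20_iff)
  next
    case False
    then show ?thesis by (auto simp: * kappa_def)
  qed
qed

section \<open>The spaces \<open>HN N\<close> in Fourier coordinates\<close>

lemma finite_modes [simp, intro]: "finite (modes N)"
proof (rule finite_subset)
  show "modes N \<subseteq> {- int N..int N} \<times> {- int N..int N}"
    by (auto simp: modes_def)
qed simp

lemma modes_subset: "modes N \<subseteq> Z20"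
  by (auto simp: modes_def)

lemma modes_Z20: "k \<in> modes N \<Longrightarrow> k \<in> Z20"
  using modes_subset by blast

lemma modes_nonzero: "k \<in> modes N \<Longrightarrow> k \<noteq> 0"
  using modes_subset[of N] by (auto simp: Z20_iff)

lemma modes_mono: "N \<le> N' \<Longrightarrow> modes N \<subseteq> modes N'"
  by (auto simp: modes_def)

lemma modes_uminus: "k \<in> modes N \<Longrightarrow> - k \<in> modes N"
  by (cases k) (auto simp: modes_def Z20_iff zero_prod_def)

lemma continuous_on_trig_poly [continuous_intros]: "continuous_on A (trig_poly N c)"
  unfolding trig_poly_def by (intro continuous_intros)

lemma integrable_torus_mult:
  fixes f g :: field
  assumes "continuous_on UNIV f" "continuous_on UNIV g"
  shows "integrable torus (\<lambda>x. f x * g x)"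
  by (intro integrable_torus_continuous continuous_intros assms)

lemma L2inner_trig_poly_left:
  assumes "continuous_on UNIV g"
  shows "L2inner (trig_poly N c) g = (\<Sum>k\<in>modes N. c k * L2inner (basis_fun k) g)"
proof -
  have "L2inner (trig_poly N c) g = (\<integral>x. (\<Sum>k\<in>modes N. c k * (basis_fun k x * g x)) \<partial>torus)"
    unfolding L2inner_def trig_poly_def by (simp add: sum_distrib_left mult_ac)
  also have "\<dots> = (\<Sum>k\<in>modes N. c k * L2inner (basis_fun k) g)"
    unfolding L2inner_def
    by (subst Bochner_Integration.integral_sum)
      (auto intro!: integrable_torus_mult assms continuous_intros)
  finally show ?thesis .
qed

lemma L2inner_commute: "L2inner f g = L2inner g f"
  by (simp add: L2inner_def mult.commute)

lemma L2inner_trig_poly_basis_fun: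
  assumes "j \<in> Z20"
  shows "L2inner (trig_poly N c) (basis_fun j) = (if j \<in> modes N then c j else 0)"
proof -
  have "L2inner (trig_poly N c) (basis_fun j) = (\<Sum>k\<in>modes N. if k = j then c k else 0)"
    unfolding L2inner_trig_poly_left[OF continuous_on_basis_fun[OF continuous_on_id]]
    using assms modes_subset[of N] by (intro sum.cong refl) (subst L2inner_basis_fun, auto)
  then show ?thesis by (simp add: sum.delta)
qed

lemma trig_poly_cong: "(\<And>k. k \<in> modes N \<Longrightarrow> c k = d k) \<Longrightarrow> trig_poly N c = trig_poly N d"
  by (simp add: trig_poly_def)

lemma trig_poly_mem [simp]: "trig_poly N c \<in> HN N"
  by (simp add: HN_def)

lemma L2inner_trig_poly:
  "L2inner (trig_poly N c) (trig_poly N d) = (\<Sum>k\<in>modes N. c k * d k)"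
  by (subst L2inner_trig_poly_left)
    (auto intro!: continuous_intros sum.cong simp: L2inner_commute[of "basis_fun _"]
      L2inner_trig_poly_basis_fun modes_Z20)

lemma L2norm_trig_poly: "L2norm torus (trig_poly N c) = sqrt (\<Sum>k\<in>modes N. (c k)\<^sup>2)"
  using L2inner_trig_poly[of N c c] by (simp add: L2norm_def L2inner_def power2_eq_square)

lemma trig_poly_diff: "trig_poly N c x - trig_poly N d x = trig_poly N (\<lambda>k. c k - d k) x"
  by (simp add: trig_poly_def sum_subtractf algebra_simps)

lemma shift_trig_poly:
  assumes "k \<in> modes N"
  shows "shift (trig_poly N c) h k = trig_poly N (c(k := c k + h))"
proof
  fix x
  have "trig_poly N (c(k := c k + h)) x =
      (\<Sum>l\<in>modes N. c l * basis_fun l x + (if l = k then h * basis_fun k x else 0))"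
    unfolding trig_poly_def by (intro sum.cong) (auto simp: algebra_simps)
  also have "\<dots> = trig_poly N c x + h * basis_fun k x"
    using assms by (simp add: sum.distrib trig_poly_def)
  finally show "shift (trig_poly N c) h k x = trig_poly N (c(k := c k + h)) x"
    by (simp add: shift_def)
qed

lemma HN_eq_trig_poly:
  assumes "f \<in> HN N"
  shows "f = trig_poly N (\<lambda>k. L2inner f (basis_fun k))"
proof -
  obtain c where f: "f = trig_poly N c" using assms by (auto simp: HN_def)
  show ?thesis
    unfolding f by (intro trig_poly_cong) (simp add: L2inner_trig_poly_basis_fun modes_Z20)
qed

text \<open>Only \<open>f\<close> is a trigonometric polynomial: the components of \<open>g\<close>
  outside \<open>modes N\<close> are orthogonal to it.\<close>

lemma L2inner_parseval:
  assumes "f \<in> HN N" "continuous_on UNIV g"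
  shows "L2inner f g = (\<Sum>j\<in>modes N. L2inner f (basis_fun j) * L2inner g (basis_fun j))"
  by (subst HN_eq_trig_poly[OF assms(1)])
    (simp add: L2inner_trig_poly_left[OF assms(2)] L2inner_commute[of g])

lemma HN_linear:
  assumes "f \<in> HN N" "g \<in> HN N"
  shows "(\<lambda>x. a * f x + b * g x) \<in> HN N"
proof -
  obtain c d where "f = trig_poly N c" "g = trig_poly N d"
    using assms by (auto simp: HN_def)
  then have "(\<lambda>x. a * f x + b * g x) = trig_poly N (\<lambda>k. a * c k + b * d k)"
    by (auto simp: trig_poly_def sum_distrib_left sum.distrib algebra_simps)
  then show ?thesis by simp
qed

lemma basis_fun_mem_HN:
  assumes "n \<in> modes N"
  shows "basis_fun n \<in> HN N"
proof -
  have "trig_poly N (\<lambda>k. if k = n then 1 else 0) x = (\<Sum>k\<in>modes N. if k = n then basis_fun k x else 0)" for x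
    unfolding trig_poly_def by (intro sum.cong) auto
  then have "basis_fun n = trig_poly N (\<lambda>k. if k = n then 1 else 0)"
    using assms by (auto simp: fun_eq_iff)
  then show ?thesis by simp
qed

lemma wave_mem_HN:
  assumes "n \<in> modes N"
  shows "wave n \<theta> \<in> HN N"
proof -
  \<comment> \<open>The phase difference to \<open>basis_fun n\<close>; the addition theorem then
    splits the wave between the partners \<open>n\<close> and \<open>- n\<close>.\<close>
  define \<delta> where "\<delta> = \<theta> - phase n"
  have "wave n \<theta> = (\<lambda>x. (cos \<delta> / sqrt 2) * basis_fun n x + (- sin \<delta> / sqrt 2) * basis_fun (- n) x)"
  proof
    fix x
    have "wave n \<theta> x = cos ((2 * pi * (rvec n \<bullet> x) - phase n) - \<delta>)"
      by (simp add: wave_def \<delta>_def)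
    then show "wave n \<theta> x = (cos \<delta> / sqrt 2) * basis_fun n x + (- sin \<delta> / sqrt 2) * basis_fun (- n) x"
      using modes_nonzero[OF assms] unfolding cos_diff[of _ \<delta>]
      by (simp add: basis_fun_minus basis_fun_wave[of n] wave_def)
  qed
  then show ?thesis
    using HN_linear[OF basis_fun_mem_HN[OF assms] basis_fun_mem_HN[OF modes_uminus[OF assms]],
      of "cos \<delta> / sqrt 2" "- sin \<delta> / sqrt 2"]
    by simp
qed

subsection \<open>The Biot--Savart kernel\<close>

text \<open>One real component of the kernel: \<open>wave k (pi / 2)\<close> is the sine left over
  from the real part of \<open>i\<close> times the exponential. Convolution with a bounded function
  is continuous in \<open>L^1\<close>, so the box sums pass to the limit, and their convolutions
  with \<open>basis_fun l\<close> no longer change once the box contains \<open>l\<close>.\<close>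

lemma convolution_kernel_basis_fun:
  fixes \<kappa> :: field and d :: "mode \<Rightarrow> real"
  defines "\<kappa>N \<equiv> \<lambda>N x. \<Sum>k\<in>modes N. - 2 * pi / (norm (rvec k))\<^sup>2 * d k * wave k (pi / 2) x"
  assumes per: "periodic \<kappa>" and meas: "\<kappa> \<in> borel_measurable borel"
    and odd: "\<And>k. d (- k) = - d k"
    and lim: "(\<lambda>N. \<integral>\<^sup>+x. ennreal \<bar>\<kappa> x - \<kappa>N N x\<bar> \<partial>torus) \<longlonglongrightarrow> 0"
    and l: "l \<in> Z20"
  shows "integrable torus (\<lambda>y. basis_fun l y * \<kappa> (x - y))"
    "(\<integral>y. basis_fun l y * \<kappa> (x - y) \<partial>torus) = 2 * pi / (norm (rvec l))\<^sup>2 * basis_fun (- l) x * d l"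
proof -
  note [measurable] = meas
  have contN: "continuous_on UNIV (\<kappa>N N)" for N
    unfolding \<kappa>N_def by (intro continuous_intros)
  then have [measurable]: "\<kappa>N N \<in> borel_measurable borel" for N
    by (intro borel_measurable_continuous_onI)
  have perN: "periodic (\<kappa>N N)" for N
    using periodic_wave unfolding \<kappa>N_def periodic_def by simp
  have per_diff: "periodic (\<lambda>x. \<kappa> x - \<kappa>N N x)" for N
    using per perN[of N] by (simp add: periodic_def)
  have "\<forall>\<^sub>F N in sequentially. (\<integral>\<^sup>+x. ennreal \<bar>\<kappa> x - \<kappa>N N x\<bar> \<partial>torus) < 1"
    using lim by (rule order_tendstoD) simp
  \<comment> \<open>Integrability of the kernel comes out of the convergence: some partial sum,
    which is continuous, lies at finite \<open>L^1\<close> distance.\<close>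
  then obtain N0 where N0: "(\<integral>\<^sup>+x. ennreal \<bar>\<kappa> x - \<kappa>N N0 x\<bar> \<partial>torus) < 1"
    by (auto simp: eventually_sequentially)
  have "integrable torus (\<lambda>x. \<kappa> x - \<kappa>N N0 x)"
    using N0 by (auto simp: integrable_iff_bounded intro!: measurable_torus intro: less_trans)
  from Bochner_Integration.integrable_add[OF this integrable_torus_continuous[OF contN[of N0]]]
  have int: "integrable torus \<kappa>" by simp
  have int_refl: "integrable torus (\<lambda>y. \<kappa> (x - y))"
    by (rule integral_torus_reflect(1)[OF meas per int])
  show int1: "integrable torus (\<lambda>y. basis_fun l y * \<kappa> (x - y))"
  proof (rule Bochner_Integration.integrable_bound[OF integrable_mult_right[OF integrable_norm[OF int_refl], of "sqrt 2"]])
    show "(\<lambda>y. basis_fun l y * \<kappa> (x - y)) \<in> borel_measurable torus"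
      by (intro measurable_torus borel_measurable_times)
        (auto intro!: borel_measurable_continuous_onI continuous_intros)
    show "AE y in torus. norm (basis_fun l y * \<kappa> (x - y)) \<le> norm (sqrt 2 * norm (\<kappa> (x - y)))"
      by (rule AE_I2) (auto simp: abs_mult abs_basis_fun_le intro!: mult_right_mono)
  qed
  define y0 where "y0 = phase l - 2 * pi * (rvec l \<bullet> x)"
  have main: "(\<integral>y. basis_fun l y * \<kappa>N N (x - y) \<partial>torus) =
      2 * pi / (norm (rvec l))\<^sup>2 * basis_fun (- l) x * d l" if lN: "l \<in> modes N" for N
  proof -
    define \<beta> where "\<beta> k = 2 * pi * (rvec k \<bullet> x) - pi / 2" for k
    define w where "w k = - 2 * pi / (norm (rvec k))\<^sup>2 * d k" for k
    have wave_refl: "wave k (pi / 2) (x - y) = wave k (\<beta> k) y" for k y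
    proof -
      have "wave k (pi / 2) (x - y) = cos (- (2 * pi * (rvec k \<bullet> y) - \<beta> k))"
        by (simp add: wave_def \<beta>_def inner_diff_right algebra_simps)
      then show ?thesis unfolding cos_minus by (simp add: wave_def)
    qed
    have prod: "basis_fun l y * wave k (\<beta> k) y =
        sqrt 2 / 2 * (wave (l - k) (phase l - \<beta> k) y + wave (l + k) (phase l + \<beta> k) y)" for k y
      using wave_mult[of l "phase l" y k "\<beta> k"] by (simp add: basis_fun_wave)
    have "(\<integral>y. basis_fun l y * \<kappa>N N (x - y) \<partial>torus) =
        (\<integral>y. (\<Sum>k\<in>modes N. w k * (basis_fun l y * wave k (\<beta> k) y)) \<partial>torus)"
      unfolding \<kappa>N_def w_def wave_refl by (simp add: sum_distrib_left mult_ac)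
    also have "\<dots> = (\<Sum>k\<in>modes N. w k * (\<integral>y. basis_fun l y * wave k (\<beta> k) y \<partial>torus))"
      by (subst Bochner_Integration.integral_sum)
        (auto intro!: integrable_torus_continuous continuous_intros)
    also have "\<dots> = (\<Sum>k\<in>modes N. w k * (sqrt 2 / 2 * (kappa (l - k) (phase l - \<beta> k) + kappa (l + k) (phase l + \<beta> k))))"
      unfolding prod by (simp add: integral_wave)
    \<comment> \<open>Only \<open>k = l\<close> and \<open>k = - l\<close> resonate with
      \<open>basis_fun l\<close>; because \<open>d\<close> is odd, their contributions are
      equal.\<close>
    also have "\<dots> = (\<Sum>k\<in>modes N. (if k = l then w l * (sqrt 2 / 2 * cos (phase l - \<beta> l)) else 0)
        + (if k = - l then w (- l) * (sqrt 2 / 2 * cos (phase l + \<beta> (- l))) else 0))"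
    proof (intro sum.cong refl)
      fix k assume "k \<in> modes N"
      have "l \<noteq> - l" using l by (cases l) (auto simp: Z20_iff zero_prod_def)
      moreover have "l + k = 0 \<longleftrightarrow> k = - l" by (metis minus_unique add.right_inverse)
      ultimately show "w k * (sqrt 2 / 2 * (kappa (l - k) (phase l - \<beta> k) + kappa (l + k) (phase l + \<beta> k))) =
        (if k = l then w l * (sqrt 2 / 2 * cos (phase l - \<beta> l)) else 0)
        + (if k = - l then w (- l) * (sqrt 2 / 2 * cos (phase l + \<beta> (- l))) else 0)"
        by (auto simp: kappa_def)
    qed
    also have "\<dots> = w l * (sqrt 2 / 2 * cos (phase l - \<beta> l)) + w (- l) * (sqrt 2 / 2 * cos (phase l + \<beta> (- l)))"
      using lN modes_uminus[OF lN] by (simp add: sum.distrib)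
    also have "cos (phase l - \<beta> l) = - sin y0"
    proof -
      have "phase l - \<beta> l = y0 + pi / 2" by (simp add: \<beta>_def y0_def)
      then show ?thesis unfolding cos_add cos_pi_half sin_pi_half by (simp add: cos_add)
    qed
    also have "cos (phase l + \<beta> (- l)) = sin y0"
    proof -
      have "phase l + \<beta> (- l) = y0 - pi / 2" by (simp add: \<beta>_def y0_def rvec_minus)
      then show ?thesis by (simp add: cos_diff)
    qed
    also have "w (- l) = - w l" by (simp add: w_def odd rvec_minus)
    also have "sin y0 = - sin (2 * pi * (rvec l \<bullet> x) - phase l)"
    proof -
      have "y0 = - (2 * pi * (rvec l \<bullet> x) - phase l)" by (simp add: y0_def)
      then show ?thesis by (simp only: sin_minus)
    qed
    finally show ?thesis
      using l by (simp add: basis_fun_minus Z20_iff w_def)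
  qed
  define E where "E N = (\<integral>y. basis_fun l y * \<kappa>N N (x - y) \<partial>torus)" for N
  have "(\<lambda>N. ennreal \<bar>(\<integral>y. basis_fun l y * \<kappa> (x - y) \<partial>torus) - E N\<bar>) \<longlonglongrightarrow> 0"
  proof (rule tendsto_sandwich[OF _ _ tendsto_const])
    have "((\<lambda>N. ennreal (sqrt 2) * (\<integral>\<^sup>+x. ennreal \<bar>\<kappa> x - \<kappa>N N x\<bar> \<partial>torus)) \<longlongrightarrow> ennreal (sqrt 2) * 0) sequentially"
      by (intro ennreal_tendsto_cmult lim) simp
    then show "(\<lambda>N. ennreal (sqrt 2) * (\<integral>\<^sup>+x. ennreal \<bar>\<kappa> x - \<kappa>N N x\<bar> \<partial>torus)) \<longlonglongrightarrow> 0" by simp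
    show "\<forall>\<^sub>F N in sequentially. ennreal \<bar>(\<integral>y. basis_fun l y * \<kappa> (x - y) \<partial>torus) - E N\<bar>
        \<le> ennreal (sqrt 2) * (\<integral>\<^sup>+x. ennreal \<bar>\<kappa> x - \<kappa>N N x\<bar> \<partial>torus)"
    proof (rule always_eventually, rule allI)
      fix N
      have "continuous_on UNIV (\<lambda>y. \<kappa>N N (x - y))"
        by (rule continuous_on_compose2[OF contN]) (auto intro!: continuous_intros)
      then have intN: "integrable torus (\<lambda>y. basis_fun l y * \<kappa>N N (x - y))"
        by (intro integrable_torus_continuous continuous_intros)
      have "ennreal \<bar>(\<integral>y. basis_fun l y * \<kappa> (x - y) \<partial>torus) - E N\<bar> =
          ennreal (norm (\<integral>y. basis_fun l y * \<kappa> (x - y) - basis_fun l y * \<kappa>N N (x - y) \<partial>torus))"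
        unfolding E_def using int1 intN by simp
      also have "\<dots> \<le> (\<integral>\<^sup>+y. ennreal (norm (basis_fun l y * \<kappa> (x - y) - basis_fun l y * \<kappa>N N (x - y))) \<partial>torus)"
        by (intro integral_norm_bound_ennreal Bochner_Integration.integrable_diff int1 intN)
      also have "\<dots> \<le> (\<integral>\<^sup>+y. ennreal (sqrt 2) * ennreal \<bar>\<kappa> (x - y) - \<kappa>N N (x - y)\<bar> \<partial>torus)"
        by (intro nn_integral_mono)
          (auto simp flip: right_diff_distrib ennreal_mult simp: abs_mult abs_basis_fun_le
            intro!: ennreal_leI mult_right_mono)
      also have "\<dots> = ennreal (sqrt 2) * (\<integral>\<^sup>+y. ennreal \<bar>\<kappa> (x - y) - \<kappa>N N (x - y)\<bar> \<partial>torus)"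
        by (rule nn_integral_cmult) (auto intro!: measurable_torus)
      also have "(\<integral>\<^sup>+y. ennreal \<bar>\<kappa> (x - y) - \<kappa>N N (x - y)\<bar> \<partial>torus) = (\<integral>\<^sup>+y. ennreal \<bar>\<kappa> y - \<kappa>N N y\<bar> \<partial>torus)"
        by (rule nn_integral_torus_reflect[of "\<lambda>x. ennreal \<bar>\<kappa> x - \<kappa>N N x\<bar>"])
          (use per_diff[of N] in \<open>auto simp: periodic_def\<close>)
      finally show "ennreal \<bar>(\<integral>y. basis_fun l y * \<kappa> (x - y) \<partial>torus) - E N\<bar>
        \<le> ennreal (sqrt 2) * (\<integral>\<^sup>+x. ennreal \<bar>\<kappa> x - \<kappa>N N x\<bar> \<partial>torus)" .
    qed
  qed auto
  then have "(\<lambda>N. (\<integral>y. basis_fun l y * \<kappa> (x - y) \<partial>torus) - E N) \<longlonglongrightarrow> 0"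
    by (subst tendsto_rabs_zero_iff[symmetric]) (simp add: tendsto_ennreal_iff[symmetric, where F = sequentially])
  from tendsto_diff[OF tendsto_const[of "\<integral>y. basis_fun l y * \<kappa> (x - y) \<partial>torus"] this]
  have "E \<longlonglongrightarrow> (\<integral>y. basis_fun l y * \<kappa> (x - y) \<partial>torus)"
    by simp
  moreover have "E \<longlonglongrightarrow> 2 * pi / (norm (rvec l))\<^sup>2 * basis_fun (- l) x * d l"
  proof (rule tendsto_eventually)
    define N1 where "N1 = nat (max \<bar>fst l\<bar> \<bar>snd l\<bar>)"
    have "l \<in> modes N" if "N \<ge> N1" for N
      using l that by (auto simp: modes_def N1_def)
    then show "\<forall>\<^sub>F N in sequentially. E N = 2 * pi / (norm (rvec l))\<^sup>2 * basis_fun (- l) x * d l"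
      unfolding eventually_sequentially E_def using main by blast
  qed
  ultimately show "(\<integral>y. basis_fun l y * \<kappa> (x - y) \<partial>torus) = 2 * pi / (norm (rvec l))\<^sup>2 * basis_fun (- l) x * d l"
    by (rule LIMSEQ_unique)
qed

lemma integrable_velocity_components:
  assumes K: "biot_savart_kernel K" and l: "l \<in> Z20"
  shows "integrable torus (\<lambda>y. basis_fun l y * fst (K (x - y)))"
    "integrable torus (\<lambda>y. basis_fun l y * snd (K (x - y)))"
    "(\<integral>y. basis_fun l y * fst (K (x - y)) \<partial>torus) = 2 * pi / (norm (rvec l))\<^sup>2 * basis_fun (- l) x * fst (perp l)"
    "(\<integral>y. basis_fun l y * snd (K (x - y)) \<partial>torus) = 2 * pi / (norm (rvec l))\<^sup>2 * basis_fun (- l) x * snd (perp l)"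
proof -
  define \<kappa>N where "\<kappa>N d N x = (\<Sum>k\<in>modes N. - 2 * pi / (norm (rvec k))\<^sup>2 * d k * wave k (pi / 2) x)"
    for d :: "mode \<Rightarrow> real" and N x
  have meas: "K \<in> borel_measurable borel" and per: "periodic K"
    using K by (auto simp: biot_savart_kernel_def)
  have conv: "(\<lambda>N. \<integral>\<^sup>+x. ennreal (norm ((complex_of_real (fst (K x)), complex_of_real (snd (K x)))
      - biot_savart_partial N x)) \<partial>torus) \<longlonglongrightarrow> 0"
    using K unfolding biot_savart_kernel_def by (auto dest: spec[of _ 1])
  have re: "Re (2 * complex_of_real pi * \<i> * exp (2 * complex_of_real pi * \<i> * complex_of_real r)
      / complex_of_real s * complex_of_real d) = - 2 * pi / s * d * sin (2 * pi * r)" for r s d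
  proof -
    have "exp (2 * complex_of_real pi * \<i> * complex_of_real r) = cis (2 * pi * r)"
      by (simp add: cis_conv_exp mult_ac)
    then show ?thesis by (simp add: Re_divide_of_real)
  qed
  have part: "Re (fst (biot_savart_partial N x)) = \<kappa>N (\<lambda>k. fst (perp k)) N x"
    "Re (snd (biot_savart_partial N x)) = \<kappa>N (\<lambda>k. snd (perp k)) N x" for N x
    by (simp_all only: biot_savart_partial_def Let_def fst_sum snd_sum fst_conv snd_conv Re_sum re)
      (simp_all add: \<kappa>N_def wave_def cos_diff)
  have le: "norm (fst z) \<le> norm z" "norm (snd z) \<le> norm z" for z :: "complex \<times> complex"
    by (metis norm_fst_le prod.collapse, metis norm_snd_le prod.collapse)
  let ?D = "\<lambda>N x. (complex_of_real (fst (K x)), complex_of_real (snd (K x))) - biot_savart_partial N x"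
  have bound: "\<bar>fst (K x) - \<kappa>N (\<lambda>k. fst (perp k)) N x\<bar> \<le> norm (?D N x)"
    "\<bar>snd (K x) - \<kappa>N (\<lambda>k. snd (perp k)) N x\<bar> \<le> norm (?D N x)" for N x
    using abs_Re_le_cmod[of "fst (?D N x)"] abs_Re_le_cmod[of "snd (?D N x)"] le[of "?D N x"]
    by (simp_all add: fst_diff snd_diff part)
  have lim1: "(\<lambda>N. \<integral>\<^sup>+x. ennreal \<bar>fst (K x) - \<kappa>N (\<lambda>k. fst (perp k)) N x\<bar> \<partial>torus) \<longlonglongrightarrow> 0"
    by (rule tendsto_sandwich[OF _ _ tendsto_const conv])
      (auto intro!: always_eventually nn_integral_mono ennreal_leI bound)
  have lim2: "(\<lambda>N. \<integral>\<^sup>+x. ennreal \<bar>snd (K x) - \<kappa>N (\<lambda>k. snd (perp k)) N x\<bar> \<partial>torus) \<longlonglongrightarrow> 0"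
    by (rule tendsto_sandwich[OF _ _ tendsto_const conv])
      (auto intro!: always_eventually nn_integral_mono ennreal_leI bound)
  have p: "periodic (\<lambda>x. fst (K x))" "periodic (\<lambda>x. snd (K x))"
    using per by (auto simp: periodic_def)
  have m: "(\<lambda>x. fst (K x)) \<in> borel_measurable borel" "(\<lambda>x. snd (K x)) \<in> borel_measurable borel"
    using meas by (simp_all add: borel_prod[symmetric])
  have odd: "fst (perp (- k)) = - fst (perp k)" "snd (perp (- k)) = - snd (perp k)" for k
    by (simp_all add: perp_def)
  note 1 = convolution_kernel_basis_fun[of "\<lambda>x. fst (K x)" "\<lambda>k. fst (perp k)", OF p(1) m(1) odd(1) lim1[unfolded \<kappa>N_def] l]
  note 2 = convolution_kernel_basis_fun[of "\<lambda>x. snd (K x)" "\<lambda>k. snd (perp k)", OF p(2) m(2) odd(2) lim2[unfolded \<kappa>N_def] l]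
  show "integrable torus (\<lambda>y. basis_fun l y * fst (K (x - y)))"
    "integrable torus (\<lambda>y. basis_fun l y * snd (K (x - y)))"
    "(\<integral>y. basis_fun l y * fst (K (x - y)) \<partial>torus) = 2 * pi / (norm (rvec l))\<^sup>2 * basis_fun (- l) x * fst (perp l)"
    "(\<integral>y. basis_fun l y * snd (K (x - y)) \<partial>torus) = 2 * pi / (norm (rvec l))\<^sup>2 * basis_fun (- l) x * snd (perp l)"
    using 1 2 by blast+
qed

lemma velocity_trig_poly:
  assumes "biot_savart_kernel K"
  shows "velocity K (trig_poly N c) x =
    (\<Sum>k\<in>modes N. (c k * (2 * pi / (norm (rvec k))\<^sup>2) * basis_fun (- k) x) *\<^sub>R perp k)"
proof -
  note i = integrable_velocity_components[OF assms modes_Z20]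
  define e1 e2 :: plane where "e1 = (1, 0)" and "e2 = (0, 1)"
  have "velocity K (trig_poly N c) x = (\<integral>y. (\<Sum>k\<in>modes N. c k *\<^sub>R
      ((basis_fun k y * fst (K (x - y))) *\<^sub>R e1 + (basis_fun k y * snd (K (x - y))) *\<^sub>R e2)) \<partial>torus)"
    unfolding velocity_def trig_poly_def e1_def e2_def
    by (intro Bochner_Integration.integral_cong refl)
      (auto simp: prod_eq_iff fst_sum snd_sum sum_distrib_left sum_distrib_right mult_ac)
  also have "\<dots> = (\<Sum>k\<in>modes N. c k *\<^sub>R
      ((\<integral>y. basis_fun k y * fst (K (x - y)) \<partial>torus) *\<^sub>R e1 + (\<integral>y. basis_fun k y * snd (K (x - y)) \<partial>torus) *\<^sub>R e2))"
    by (subst Bochner_Integration.integral_sum) (auto simp: i simp del: scaleR_scaleR)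
  also have "\<dots> = (\<Sum>k\<in>modes N. (c k * (2 * pi / (norm (rvec k))\<^sup>2) * basis_fun (- k) x) *\<^sub>R perp k)"
    by (intro sum.cong refl) (simp add: i prod_eq_iff e1_def e2_def)
  finally show ?thesis .
qed

lemma grad_trig_poly:
  "grad (trig_poly N c) x = (\<Sum>k\<in>modes N. (c k * (2 * pi * basis_fun (- k) x)) *\<^sub>R rvec k)"
proof -
  have "(trig_poly N c has_derivative (\<lambda>h. \<Sum>k\<in>modes N. c k * (2 * pi * basis_fun (- k) x * (rvec k \<bullet> h)))) (at x)"
    unfolding trig_poly_def
    by (intro has_derivative_sum has_derivative_mult_right basis_fun_has_derivative modes_nonzero)
  from frechet_derivative_at[OF this, symmetric] show ?thesis
    by (simp add: grad_def prod_eq_iff fst_sum snd_sum inner_rvec) (simp add: rvec_def mult_ac)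
qed

subsection \<open>Advection in Fourier coordinates\<close>

definition triple :: "mode \<Rightarrow> mode \<Rightarrow> mode \<Rightarrow> real" where
  "triple a b c = (\<integral>x. basis_fun a x * basis_fun b x * basis_fun c x \<partial>torus)"

lemma triple_eq:
  "triple a b c =
    (kappa (a + b + c) (phase a + phase b + phase c) + kappa (a + b - c) (phase a + phase b - phase c) +
     kappa (a - b + c) (phase a - phase b + phase c) + kappa (a - b - c) (phase a - phase b - phase c)) / sqrt 2"
proof -
  have "basis_fun a x * basis_fun b x * basis_fun c x =
    (wave (a + b + c) (phase a + phase b + phase c) x + wave (a + b - c) (phase a + phase b - phase c) x +
     wave (a - b + c) (phase a - phase b + phase c) x + wave (a - b - c) (phase a - phase b - phase c) x) / sqrt 2" for x
  proof -
    have "basis_fun a x * basis_fun b x * basis_fun c x =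
        2 * sqrt 2 * ((wave a (phase a) x * wave b (phase b) x) * wave c (phase c) x)"
      by (simp add: basis_fun_wave)
    also have "\<dots> = 2 * sqrt 2 * (((wave (a - b) (phase a - phase b) x * wave c (phase c) x) +
        (wave (a + b) (phase a + phase b) x * wave c (phase c) x)) / 2)"
      by (simp only: wave_mult[of a _ _ b]) (simp add: algebra_simps add_divide_distrib)
    also have "\<dots> = sqrt 2 / 2 * (wave (a + b + c) (phase a + phase b + phase c) x +
        wave (a + b - c) (phase a + phase b - phase c) x +
        wave (a - b + c) (phase a - phase b + phase c) x + wave (a - b - c) (phase a - phase b - phase c) x)"
      unfolding wave_mult by (simp add: field_simps)
    also have "sqrt 2 / 2 = 1 / sqrt (2 :: real)"
      by (simp add: field_simps)
    finally show ?thesis by simp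
  qed
  then show ?thesis
    unfolding triple_def by (simp add: integral_wave)
qed

text \<open>Up to the factor \<open>2 * pi\<close>, component \<open>j\<close> of the transport of
  mode \<open>l\<close> by the field \<open>basis_fun k\<close> times \<open>perp k\<close>; the
  gradient of mode \<open>l\<close> brings in its partner \<open>- l\<close>.\<close>

definition adv :: "mode \<Rightarrow> mode \<Rightarrow> mode \<Rightarrow> real" where
  "adv k l j = (perp k \<bullet> rvec l) * triple k (- l) j"

lemma perp_minus: "perp (- k) = - perp k"
  by (simp add: perp_def)

lemma inner_perp_rvec [simp]: "perp k \<bullet> rvec k = 0"
  by (simp add: perp_def rvec_def inner_prod_def)

lemma norm_perp: "norm (perp k) = norm (rvec k)"
  by (simp add: perp_def rvec_def norm_Pair add.commute)

text \<open>What \<open>kappa\<close> becomes under the shift of the phase by \<open>pi / 2\<close>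
  that the partner mode \<open>- l\<close> causes.\<close>

definition kappa_sin :: "mode \<Rightarrow> real \<Rightarrow> real" where
  "kappa_sin n \<theta> = (if n = 0 then sin \<theta> else 0)"

lemma triple_minus:
  assumes "l \<noteq> 0"
  defines "s \<equiv> kappa_sin"
  shows "triple k (- l) j =
    (s (k + l + j) (phase k + phase l + phase j) + s (k + l - j) (phase k + phase l - phase j)
     - s (k - l + j) (phase k - phase l + phase j) - s (k - l - j) (phase k - phase l - phase j)) / sqrt 2"
proof -
  have c: "cos (\<theta> + pi / 2) = - sin \<theta>" "cos (\<theta> - pi / 2) = sin \<theta>" for \<theta> :: real
    by (simp_all add: cos_add cos_diff)
  have e: "phase k + phase (- l) + phase j = (phase k - phase l + phase j) + pi / 2"
    "phase k + phase (- l) - phase j = (phase k - phase l - phase j) + pi / 2"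
    "phase k - phase (- l) + phase j = (phase k + phase l + phase j) - pi / 2"
    "phase k - phase (- l) - phase j = (phase k + phase l - phase j) - pi / 2"
    using assms by (simp_all add: phase_minus)
  show ?thesis
    unfolding triple_eq e kappa_def c s_def kappa_sin_def by simp
qed

text \<open>The transport by the divergence-free field \<open>perp k * basis_fun k\<close> is skew-symmetric in \<open>L\<^sup>2\<close>.\<close>

lemma adv_skew:
  assumes "l \<noteq> 0" "j \<noteq> 0"
  shows "adv k l j = - adv k j l"
proof -
  define s where "s = kappa_sin"
  \<comment> \<open>Divergence-freeness in Fourier variables: a term survives only where a signed
    sum of \<open>k\<close>, \<open>l\<close> and \<open>j\<close> vanishes, and pairing that sum
    with \<open>perp k\<close> relates \<open>perp k \<bullet> rvec l\<close> to
    \<open>perp k \<bullet> rvec j\<close>.\<close>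
  have zero: "s n \<theta> * (perp k \<bullet> rvec n) = 0" for n \<theta> by (simp add: s_def kappa_sin_def)
  have e: "k + j + l = k + l + j" "k + j - l = k - l + j" "k - j + l = k + l - j" "k - j - l = k - l - j"
    "phase k + phase j + phase l = phase k + phase l + phase j"
    "phase k + phase j - phase l = phase k - phase l + phase j"
    "phase k - phase j + phase l = phase k + phase l - phase j"
    "phase k - phase j - phase l = phase k - phase l - phase j"
    by simp_all
  define pl pj where "pl = perp k \<bullet> rvec l" and "pj = perp k \<bullet> rvec j"
  define s1 s2 s3 s4 where "s1 = s (k + l + j) (phase k + phase l + phase j)"
    and "s2 = s (k + l - j) (phase k + phase l - phase j)"
    and "s3 = s (k - l + j) (phase k - phase l + phase j)"
    and "s4 = s (k - l - j) (phase k - phase l - phase j)"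
  have z: "s1 * (pl + pj) = 0" "s2 * (pl - pj) = 0" "s3 * (pj - pl) = 0" "s4 * (- pl - pj) = 0"
    using zero[of "k + l + j"] zero[of "k + l - j"] zero[of "k - l + j"] zero[of "k - l - j"]
    unfolding s1_def s2_def s3_def s4_def pl_def pj_def
    by (simp_all only: rvec_add rvec_diff inner_add_right inner_diff_right inner_perp_rvec) simp_all
  have "adv k l j = pl * ((s1 + s2 - s3 - s4) / sqrt 2)" "adv k j l = pj * ((s1 + s3 - s2 - s4) / sqrt 2)"
    unfolding adv_def triple_minus[OF assms(1), folded s_def] triple_minus[OF assms(2), folded s_def] e
      pl_def pj_def s1_def s2_def s3_def s4_def by simp_all
  then have "adv k l j + adv k j l =
      (s1 * (pl + pj) + s2 * (pl - pj) + s3 * (pj - pl) + s4 * (- pl - pj)) / sqrt 2"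
    by (simp add: algebra_simps add_divide_distrib diff_divide_distrib)
  then show ?thesis unfolding z by simp
qed

lemma adv_same: "j \<noteq> 0 \<Longrightarrow> adv k j j = 0"
  using adv_skew[of j j k] by simp

lemma adv_self [simp]: "adv k k j = 0" "adv (- k) k j = 0"
  by (simp_all add: adv_def perp_minus)

text \<open>The third frequencies for which some signed sum with \<open>k\<close> and
  \<open>l\<close> is zero. There are at most four, so the coefficient matrices below are
  sparse.\<close>

definition interacting :: "mode \<Rightarrow> mode \<Rightarrow> mode set" where
  "interacting k l = {k + l, k - l, l - k, - k - l}"

lemma card_interacting: "finite (interacting k l)" "card (interacting k l) \<le> 4"
  unfolding interacting_def by (auto intro!: order_trans[OF card_insert_le_m1])

lemma interacting_swap: "j \<in> interacting k l \<Longrightarrow> k \<in> interacting j l"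
  by (auto simp: interacting_def)

lemma adv_support:
  assumes "adv k l j \<noteq> 0"
  shows "j \<in> interacting k l"
proof -
  have "k + - l + j = 0 \<or> k + - l - j = 0 \<or> k - - l + j = 0 \<or> k - - l - j = 0"
    using assms unfolding adv_def triple_eq kappa_def by (auto split: if_splits)
  then have "j = l - k \<or> j = k - l \<or> j = - k - l \<or> j = k + l"
    by (cases k; cases l; cases j) (auto simp: zero_prod_def)
  then show ?thesis by (auto simp: interacting_def)
qed

text \<open>Four terms of modulus at most 1 divided by \<open>sqrt 2\<close>, rounded up to an
  integer.\<close>

lemma abs_triple_le: "\<bar>triple a b c\<bar> \<le> 3"
proof -
  have k: "\<bar>kappa n \<theta>\<bar> \<le> 1" for n \<theta> by (simp add: kappa_def)
  have "\<bar>triple a b c\<bar> * sqrt 2 \<le> 4"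
    unfolding triple_eq
    using k[of "a + b + c" "phase a + phase b + phase c"] k[of "a + b - c" "phase a + phase b - phase c"]
      k[of "a - b + c" "phase a - phase b + phase c"] k[of "a - b - c" "phase a - phase b - phase c"]
    by (simp add: abs_divide)
  also have "4 \<le> 3 * sqrt 2"
  proof -
    have "4 / 3 \<le> sqrt (2 :: real)" by (rule real_le_rsqrt) (simp add: power2_eq_square)
    then show ?thesis by simp
  qed
  finally show ?thesis by simp
qed

lemma abs_adv_le: "\<bar>adv k l j\<bar> \<le> 3 * norm (rvec k) * norm (rvec l)"
proof -
  have "\<bar>adv k l j\<bar> = \<bar>perp k \<bullet> rvec l\<bar> * \<bar>triple k (- l) j\<bar>"
    by (simp add: adv_def abs_mult)
  also have "\<dots> \<le> (norm (perp k) * norm (rvec l)) * 3"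
    by (intro mult_mono Cauchy_Schwarz_ineq2 abs_triple_le) auto
  finally show ?thesis by (simp add: norm_perp mult_ac)
qed

text \<open>Entry \<open>(j, l)\<close> of the linear field \<open>GN 2 N k\<close>. The factor
  \<open>sqrt 2 * pi\<close> is the \<open>2 * pi\<close> of the gradient times the
  \<open>1 / sqrt 2\<close> of the noise.\<close>

definition noise_coeff :: "mode \<Rightarrow> mode \<Rightarrow> mode \<Rightarrow> real" where
  "noise_coeff k j l = sqrt 2 * pi / (norm (rvec k))\<^sup>2 * adv k l j"

text \<open>Coefficient of \<open>c a * c b\<close> in component \<open>j\<close> of
  \<open>bN\<close>. Mode \<open>a\<close> creates a velocity proportional to
  \<open>basis_fun (- a)\<close>; the sign comes from \<open>perp (- a) = - perp a\<close>, and the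
  two factors \<open>2 * pi\<close> from the kernel and the gradient.\<close>

definition drift_coeff :: "mode \<Rightarrow> mode \<Rightarrow> mode \<Rightarrow> real" where
  "drift_coeff j a b = - 4 * pi\<^sup>2 / (norm (rvec a))\<^sup>2 * adv (- a) b j"

lemma L2inner_basis_fun_product:
  "L2inner (\<lambda>x. \<Sum>i\<in>I. w i * (basis_fun (f i) x * basis_fun (g i) x)) (basis_fun j) =
     (\<Sum>i\<in>I. w i * triple (f i) (g i) j)"
proof -
  have "L2inner (\<lambda>x. \<Sum>i\<in>I. w i * (basis_fun (f i) x * basis_fun (g i) x)) (basis_fun j) =
      (\<integral>x. (\<Sum>i\<in>I. w i * (basis_fun (f i) x * basis_fun (g i) x * basis_fun j x)) \<partial>torus)"
    unfolding L2inner_def by (simp only: sum_distrib_right mult.assoc)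
  also have "\<dots> = (\<Sum>i\<in>I. w i * triple (f i) (g i) j)"
    unfolding triple_def
    by (subst Bochner_Integration.integral_sum)
      (auto intro!: integrable_torus_continuous continuous_intros)
  finally show ?thesis .
qed

lemma GN_trig_poly:
  assumes "k \<in> Z20"
  shows "GN 2 N k (trig_poly N c) = trig_poly N (\<lambda>j. \<Sum>l\<in>modes N. noise_coeff k j l * c l)"
proof -
  have k: "norm (rvec k) \<noteq> 0" using assms by (simp add: Z20_iff)
  have pw: "norm (rvec k) powr 2 = (norm (rvec k))\<^sup>2"
    by (simp add: powr_numeral)
  have s2: "1 / sqrt 2 = sqrt 2 / (2 :: real)" by (simp add: field_simps)
  have "(\<lambda>x. noise_field 2 k x \<bullet> grad (trig_poly N c) x) =
      (\<lambda>x. \<Sum>l\<in>modes N. (sqrt 2 * pi / (norm (rvec k))\<^sup>2 * (perp k \<bullet> rvec l) * c l) *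
        (basis_fun k x * basis_fun (- l) x))"
    unfolding noise_field_def grad_trig_poly pw s2
    by (auto simp: fun_eq_iff inner_sum_right sum_distrib_left mult_ac intro!: sum.cong)
  then show ?thesis
    unfolding GN_def proj_fun_def
    by (simp only: L2inner_basis_fun_product) (simp add: noise_coeff_def adv_def mult_ac)
qed

lemma bN_trig_poly:
  assumes "biot_savart_kernel K"
  shows "bN K N (trig_poly N c) =
    trig_poly N (\<lambda>j. \<Sum>(a, b)\<in>modes N \<times> modes N. drift_coeff j a b * (c a * c b))"
proof -
  have "(\<lambda>x. velocity K (trig_poly N c) x \<bullet> grad (trig_poly N c) x) =
      (\<lambda>x. \<Sum>i\<in>modes N \<times> modes N. (4 * pi\<^sup>2 / (norm (rvec (fst i)))\<^sup>2 * (perp (fst i) \<bullet> rvec (snd i)) * (c (fst i) * c (snd i))) *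
        (basis_fun (- fst i) x * basis_fun (- snd i) x))"
    unfolding velocity_trig_poly[OF assms] grad_trig_poly
    by (rule ext, subst inner_sum_left, subst inner_sum_right)
      (simp add: sum.cartesian_product power2_eq_square case_prod_beta mult_ac)
  then show ?thesis
    unfolding bN_def proj_fun_def
    by (simp only: L2inner_basis_fun_product)
      (simp add: drift_coeff_def adv_def perp_minus case_prod_beta mult_ac)
qed

lemma one_le_norm_rvec:
  assumes "k \<noteq> 0"
  shows "1 \<le> norm (rvec k)"
proof -
  have "1 \<le> (fst k)\<^sup>2 + (snd k)\<^sup>2"
    using assms by (cases k) (auto simp: zero_prod_def sum_power2_gt_zero_iff int_one_le_iff_zero_less)
  then have "1 \<le> (real_of_int (fst k))\<^sup>2 + (real_of_int (snd k))\<^sup>2"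
    by (metis of_int_1_le_iff of_int_add of_int_power)
  then show ?thesis by (simp add: rvec_def norm_Pair)
qed

lemma noise_modes_bound:
  assumes "k \<in> noise_modes N"
  shows "3 * \<bar>fst k\<bar> \<le> int N" "3 * \<bar>snd k\<bar> \<le> int N"
proof -
  have "\<bar>real_of_int (fst k)\<bar> \<le> norm (rvec k)" "\<bar>real_of_int (snd k)\<bar> \<le> norm (rvec k)"
    using norm_fst_le[of "real_of_int (fst k)" "real_of_int (snd k)"]
      norm_snd_le[of "real_of_int (snd k)" "real_of_int (fst k)"]
    by (simp_all add: rvec_def)
  moreover have "norm (rvec k) \<le> real N / 3"
    using assms by (simp add: noise_modes_def)
  ultimately have "3 * \<bar>real_of_int (fst k)\<bar> \<le> real N" "3 * \<bar>real_of_int (snd k)\<bar> \<le> real N"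
    by linarith+
  then show "3 * \<bar>fst k\<bar> \<le> int N" "3 * \<bar>snd k\<bar> \<le> int N"
    by linarith+
qed

lemma noise_modes_Z20: "k \<in> noise_modes N \<Longrightarrow> k \<in> Z20"
  by (simp add: noise_modes_def)

lemma noise_modes_subset: "noise_modes N \<subseteq> modes N"
proof
  fix k assume k: "k \<in> noise_modes N"
  then show "k \<in> modes N"
    using noise_modes_bound[OF k] by (auto simp: modes_def noise_modes_Z20)
qed

lemma finite_noise_modes [simp, intro]: "finite (noise_modes N)"
  by (rule finite_subset[OF noise_modes_subset]) simp

subsection \<open>The Ito correction\<close>

definition inv_square_sum :: "nat \<Rightarrow> real" where
  "inv_square_sum N = (\<Sum>k\<in>noise_modes N. 1 / (norm (rvec k))\<^sup>2)"

lemma noise_coeff_skew: "l \<noteq> 0 \<Longrightarrow> j \<noteq> 0 \<Longrightarrow> noise_coeff k j l = - noise_coeff k l j"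
  using adv_skew[of l j k] by (simp add: noise_coeff_def)

lemma L2inner_scale_product:
  "L2inner (\<lambda>x. a * (basis_fun k x * basis_fun l x)) (basis_fun j) = a * triple k l j"
  using L2inner_basis_fun_product[where I = "{()}" and w = "\<lambda>_. a" and f = "\<lambda>_. k" and g = "\<lambda>_. l"] by simp

lemma basis_fun_mult:
  "basis_fun a x * basis_fun b x =
    wave (a - b) (phase a - phase b) x + wave (a + b) (phase a + phase b) x"
proof -
  have "basis_fun a x * basis_fun b x = 2 * (wave a (phase a) x * wave b (phase b) x)"
    by (simp add: basis_fun_wave)
  then show ?thesis by (simp add: wave_mult)
qed

text \<open>Parseval for the products \<open>basis_fun k * basis_fun (- l)\<close> and
  \<open>basis_fun k * basis_fun (- m)\<close>. The sum over \<open>modes N\<close> loses nothing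
  because the first product lies in \<open>HN N\<close>: its frequencies are \<open>k + l\<close>
  and \<open>k - l\<close>, bounded by \<open>N / 3 + N / 2\<close>.\<close>

lemma sum_adv_adv:
  assumes k: "k \<in> noise_modes N" and l: "l \<in> modes N0" and N: "2 * N0 \<le> N" and m: "m \<noteq> 0"
  shows "(\<Sum>j\<in>modes N. adv k l j * adv k m j) =
    (perp k \<bullet> rvec l) * (perp k \<bullet> rvec m) *
      (\<integral>x. (basis_fun k x)\<^sup>2 * (basis_fun (- l) x * basis_fun (- m) x) \<partial>torus)"
proof -
  define f where "f x = (perp k \<bullet> rvec l) * (basis_fun k x * basis_fun (- l) x)" for x
  define g where "g x = (perp k \<bullet> rvec m) * (basis_fun k x * basis_fun (- m) x)" for x
  have "f \<in> HN N"
  \<comment> \<open>The zero frequency is missing from \<open>HN N\<close>. It could arise only for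
    \<open>k = l\<close> or \<open>k = - l\<close>, where the scalar factor vanishes.\<close>
  proof (cases "perp k \<bullet> rvec l = 0")
    case True
    then have "f = trig_poly N (\<lambda>_. 0)" by (simp add: f_def trig_poly_def fun_eq_iff)
    then show ?thesis by simp
  next
    case False
    then have nz: "k + l \<noteq> 0" "k - l \<noteq> 0"
      by (auto simp: add_eq_0_iff rvec_minus)
    have lb: "\<bar>fst l\<bar> \<le> int N0" "\<bar>snd l\<bar> \<le> int N0"
      using l by (auto simp: modes_def)
    have mem: "k - - l \<in> modes N" "k + - l \<in> modes N"
      using nz noise_modes_bound[OF k] lb N by (auto simp: modes_def Z20_iff fst_add snd_add fst_diff snd_diff)
    have "f = (\<lambda>x. (perp k \<bullet> rvec l) * wave (k - - l) (phase k - phase (- l)) x +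
        (perp k \<bullet> rvec l) * wave (k + - l) (phase k + phase (- l)) x)"
      unfolding f_def basis_fun_mult distrib_left ..
    with HN_linear[OF wave_mem_HN[OF mem(1)] wave_mem_HN[OF mem(2)]] show ?thesis
      by (simp only:)
  qed
  moreover have "continuous_on UNIV g"
    unfolding g_def by (intro continuous_intros)
  ultimately have "L2inner f g = (\<Sum>j\<in>modes N. L2inner f (basis_fun j) * L2inner g (basis_fun j))"
    by (rule L2inner_parseval)
  also have "\<dots> = (\<Sum>j\<in>modes N. adv k l j * adv k m j)"
    unfolding f_def g_def L2inner_scale_product adv_def ..
  finally have "(\<Sum>j\<in>modes N. adv k l j * adv k m j) = L2inner f g" ..
  also have "\<dots> = (\<integral>x. ((perp k \<bullet> rvec l) * (perp k \<bullet> rvec m)) *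
      ((basis_fun k x)\<^sup>2 * (basis_fun (- l) x * basis_fun (- m) x)) \<partial>torus)"
    unfolding L2inner_def f_def g_def by (simp add: power2_eq_square mult_ac)
  finally show ?thesis by simp
qed

lemma bij_uminus_noise_modes: "bij_betw uminus (noise_modes N) (noise_modes N)"
  by (rule bij_betwI[where g = uminus]) (auto simp: noise_modes_def Z20_iff rvec_minus)

lemma bij_rotate_noise_modes:
  "bij_betw (\<lambda>k. (snd k, - fst k)) (noise_modes N) (noise_modes N)"
  by (rule bij_betwI[where g = "\<lambda>k. (- snd k, fst k)"])
    (auto simp: noise_modes_def Z20_iff zero_prod_def rvec_def norm_Pair add.commute)

text \<open>Averaging over \<open>k \<mapsto> -k\<close> uses \<open>basis_fun_square_sum\<close>; averaging over the quarter turn replaces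
  \<open>(perp k \<bullet> rvec l)\<^sup>2\<close> by half of \<open>|k|\<^sup>2 |l|\<^sup>2\<close>.\<close>

lemma sum_noise_coeff:
  assumes l: "l \<in> modes N0" and N: "2 * N0 \<le> N" and m: "m \<in> modes N"
  shows "(\<Sum>k\<in>noise_modes N. \<Sum>j\<in>modes N. noise_coeff k j l * noise_coeff k j m) =
    (if l = m then pi\<^sup>2 * (norm (rvec l))\<^sup>2 * inv_square_sum N else 0)"
proof -
  have l0: "l \<noteq> 0" "m \<noteq> 0" using l m by (auto dest: modes_nonzero)
  define w where "w k = 2 * pi\<^sup>2 / (norm (rvec k)) ^ 4 * ((perp k \<bullet> rvec l) * (perp k \<bullet> rvec m))" for k
  define J where "J k = (\<integral>x. (basis_fun k x)\<^sup>2 * (basis_fun (- l) x * basis_fun (- m) x) \<partial>torus)" for k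
  have w_minus: "w (- k) = w k" for k by (simp add: w_def perp_minus rvec_minus)
  have int: "integrable torus (\<lambda>x. (basis_fun k x)\<^sup>2 * (basis_fun (- l) x * basis_fun (- m) x))" for k
    by (intro integrable_torus_continuous continuous_intros)
  have J2: "J k + J (- k) = (if l = m then 2 else 0)" if "k \<in> noise_modes N" for k
  proof -
    have "J k + J (- k) = (\<integral>x. 2 * (basis_fun (- l) x * basis_fun (- m) x) \<partial>torus)"
      unfolding J_def using int that
      by (subst Bochner_Integration.integral_add[symmetric])
        (simp_all add: basis_fun_square_sum noise_modes_def Z20_iff flip: distrib_right)
    also have "\<dots> = 2 * L2inner (basis_fun (- l)) (basis_fun (- m))"
      by (simp add: L2inner_def)
    finally show ?thesis using l0 by (simp add: L2inner_basis_fun Z20_iff)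
  qed
  have "(\<Sum>k\<in>noise_modes N. \<Sum>j\<in>modes N. noise_coeff k j l * noise_coeff k j m) = (\<Sum>k\<in>noise_modes N. w k * J k)"
  proof (intro sum.cong refl)
    fix k assume k: "k \<in> noise_modes N"
    have p4: "norm (rvec k) ^ 4 = (norm (rvec k))\<^sup>2 * (norm (rvec k))\<^sup>2" by (simp flip: power_add)
    have "(\<Sum>j\<in>modes N. noise_coeff k j l * noise_coeff k j m) =
        (\<Sum>j\<in>modes N. 2 * pi\<^sup>2 / (norm (rvec k)) ^ 4 * (adv k l j * adv k m j))"
      unfolding noise_coeff_def p4 by (intro sum.cong refl) (simp add: power2_eq_square mult_ac)
    also have "\<dots> = 2 * pi\<^sup>2 / (norm (rvec k)) ^ 4 * (\<Sum>j\<in>modes N. adv k l j * adv k m j)"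
      by (simp only: sum_distrib_left)
    also have "\<dots> = w k * J k"
      unfolding sum_adv_adv[OF k l N l0(2)] by (simp add: w_def J_def)
    finally show "(\<Sum>j\<in>modes N. noise_coeff k j l * noise_coeff k j m) = w k * J k" .
  qed
  also have "\<dots> = (\<Sum>k\<in>noise_modes N. w k * (J k + J (- k))) / 2"
    using sum.reindex_bij_betw[OF bij_uminus_noise_modes, of "\<lambda>k. w k * J k" N]
    by (simp add: w_minus distrib_left sum.distrib)
  also have "\<dots> = (if l = m then (\<Sum>k\<in>noise_modes N. w k) else 0)"
    by (simp add: J2 flip: sum_distrib_right)
  also have "\<dots> = (if l = m then pi\<^sup>2 * (norm (rvec l))\<^sup>2 * inv_square_sum N else 0)"
  proof (cases "l = m")
    case True
    have "(\<Sum>k\<in>noise_modes N. w k) = (\<Sum>k\<in>noise_modes N. w k + w (snd k, - fst k)) / 2"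
      using sum.reindex_bij_betw[OF bij_rotate_noise_modes, of w N] by (simp add: sum.distrib)
    also have "\<dots> = (\<Sum>k\<in>noise_modes N. 2 * pi\<^sup>2 * (norm (rvec l))\<^sup>2 * (1 / (norm (rvec k))\<^sup>2)) / 2"
    proof (intro arg_cong[where f = "\<lambda>s. s / 2"] sum.cong refl)
      fix k assume k: "k \<in> noise_modes N"
      define n where "n = (norm (rvec k))\<^sup>2"
      have n: "n > 0" using k by (auto simp: n_def noise_modes_def Z20_iff)
      have "norm (rvec (snd k, - fst k)) = norm (rvec k)"
        by (simp add: rvec_def norm_Pair add.commute)
      then have nn: "norm (rvec k) ^ 4 = n * n" "norm (rvec (snd k, - fst k)) ^ 4 = n * n"
        by (simp_all add: n_def flip: power_add)
      \<comment> \<open>\<open>perp k\<close> and its quarter turn are orthogonal and of equal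
        length, so this is Pythagoras.\<close>
      have "(perp k \<bullet> rvec l)\<^sup>2 + (perp (snd k, - fst k) \<bullet> rvec l)\<^sup>2 = n * (norm (rvec l))\<^sup>2"
        unfolding n_def by (simp add: perp_def rvec_def norm_Pair power2_eq_square algebra_simps)
      moreover have "w k + w (snd k, - fst k) =
          2 * pi\<^sup>2 / (n * n) * ((perp k \<bullet> rvec l)\<^sup>2 + (perp (snd k, - fst k) \<bullet> rvec l)\<^sup>2)"
        unfolding w_def nn True by (simp add: power2_eq_square distrib_left)
      ultimately have "w k + w (snd k, - fst k) = 2 * pi\<^sup>2 / (n * n) * (n * (norm (rvec l))\<^sup>2)"
        by (simp only:)
      then show "w k + w (snd k, - fst k) = 2 * pi\<^sup>2 * (norm (rvec l))\<^sup>2 * (1 / (norm (rvec k))\<^sup>2)"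
        using n by (simp flip: n_def)
    qed
    also have "\<dots> = pi\<^sup>2 * (norm (rvec l))\<^sup>2 * inv_square_sum N"
      unfolding inv_square_sum_def sum_distrib_left[symmetric] by simp
    finally show ?thesis using True by simp
  qed simp
  finally show ?thesis .
qed

subsection \<open>Logarithmic divergence and Hilbert--Schmidt bounds\<close>

text \<open>The modes \<open>(a, b)\<close> with \<open>b < a\<close> have squared norm at most
  \<open>2 * a^2\<close>. There are \<open>a\<close> of them for each \<open>a\<close>, contributing
  at least \<open>1 / (2 * a)\<close>, so half of the harmonic series is a lower bound.\<close>

lemma inv_square_sum_at_top: "filterlim inv_square_sum at_top sequentially"
proof -
  \<comment> \<open>The 5 is an integer above \<open>3 * sqrt 2\<close>: norms up to
    \<open>sqrt 2 * n\<close> must fit into the radius \<open>N / 3\<close>.\<close>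
  have lower: "harm n / 2 \<le> inv_square_sum N" if nN: "5 * n \<le> N" for n N
  proof -
    define P where "P = (\<lambda>(a :: nat, b :: nat). (int a, int b)) ` (SIGMA a:{1..n}. {..<a})"
    have inj: "inj_on (\<lambda>(a :: nat, b :: nat). (int a, int b)) A" for A
      by (auto simp: inj_on_def)
    have n2: "(norm (rvec (int a, int b)))\<^sup>2 \<le> 2 * (real a)\<^sup>2" if "b < a" for a b
    proof -
      have "(real b)\<^sup>2 \<le> (real a)\<^sup>2" using that by (intro power_mono) auto
      then show ?thesis by (simp add: rvec_def norm_Pair)
    qed
    have "P \<subseteq> noise_modes N"
    proof
      fix k assume "k \<in> P"
      then obtain a b where k: "k = (int a, int b)" "1 \<le> a" "a \<le> n" "b < a"
        by (auto simp: P_def)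
      have "norm (rvec k) \<le> real N / 3"
      proof (rule power2_le_imp_le)
        have "(norm (rvec k))\<^sup>2 \<le> 2 * (real a)\<^sup>2" using n2 k by simp
        also have "\<dots> \<le> (5 * real a / 3)\<^sup>2" by (simp add: power2_eq_square)
        also have "\<dots> \<le> (real N / 3)\<^sup>2" using k nN by (intro power_mono) auto
        finally show "(norm (rvec k))\<^sup>2 \<le> (real N / 3)\<^sup>2" .
      qed simp
      then show "k \<in> noise_modes N"
        using k by (simp add: noise_modes_def Z20_iff zero_prod_def)
    qed
    have "harm n / 2 = (\<Sum>a\<in>{1..n}. \<Sum>b<a. 1 / (2 * (real a)\<^sup>2))"
      unfolding harm_def sum_divide_distrib
      by (intro sum.cong refl) (auto simp: power2_eq_square field_simps)
    also have "\<dots> \<le> (\<Sum>a\<in>{1..n}. \<Sum>b<a. 1 / (norm (rvec (int a, int b)))\<^sup>2)"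
    proof (intro sum_mono)
      fix a b assume ab: "a \<in> {1..n}" "b \<in> {..<a}"
      then have "(int a, int b) \<noteq> 0" by (auto simp: zero_prod_def)
      then have "0 < (norm (rvec (int a, int b)))\<^sup>2" by simp
      with n2[of b a] ab show "1 / (2 * (real a)\<^sup>2) \<le> 1 / (norm (rvec (int a, int b)))\<^sup>2"
        by (intro divide_left_mono) auto
    qed
    also have "\<dots> = (\<Sum>k\<in>P. 1 / (norm (rvec k))\<^sup>2)"
      unfolding P_def by (subst sum.reindex[OF inj]) (simp add: sum.Sigma case_prod_beta)
    also have "\<dots> \<le> inv_square_sum N"
      unfolding inv_square_sum_def by (intro sum_mono2 \<open>P \<subseteq> noise_modes N\<close>) auto
    finally show ?thesis .
  qed
  have "filterlim (\<lambda>N. harm (N div 5) / 2 :: real) at_top sequentially"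
  proof -
    have "filterlim (\<lambda>N::nat. N div 5) at_top sequentially"
      unfolding filterlim_at_top eventually_sequentially
      by (metis div_le_mono nonzero_mult_div_cancel_left zero_neq_numeral)
    from filterlim_compose[OF harm_at_top this]
    have "filterlim (\<lambda>N. harm (N div 5) :: real) at_top sequentially" .
    from filterlim_tendsto_pos_mult_at_top[OF tendsto_const[of "1 / 2"] _ this] show ?thesis
      by simp
  qed
  then show ?thesis
    by (rule filterlim_at_top_mono) (intro always_eventually allI lower, simp)
qed

text \<open>Outside the noise ball a mode contributes at most \<open>9 / N^2\<close>, and the box
  has at most \<open>(3 * N)^2\<close> points: this is the 81. The sum over all modes, which bounds
  the Euler drift, thus has the same logarithmic order as the noise.\<close>

lemma modes_inv_square_sum_le:
  assumes "N > 0"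
  shows "(\<Sum>k\<in>modes N. 1 / (norm (rvec k))\<^sup>2) \<le> inv_square_sum N + 81"
proof -
  have "(\<Sum>k\<in>modes N. 1 / (norm (rvec k))\<^sup>2) =
      inv_square_sum N + (\<Sum>k\<in>modes N - noise_modes N. 1 / (norm (rvec k))\<^sup>2)"
    unfolding inv_square_sum_def using noise_modes_subset[of N]
    by (metis add.commute finite_modes sum.subset_diff)
  also have "(\<Sum>k\<in>modes N - noise_modes N. 1 / (norm (rvec k))\<^sup>2) \<le> (\<Sum>k\<in>modes N - noise_modes N. 9 / (real N)\<^sup>2)"
  proof (intro sum_mono)
    fix k assume k: "k \<in> modes N - noise_modes N"
    then have "real N / 3 \<le> norm (rvec k)" by (auto simp: modes_def noise_modes_def)
    then have "(real N / 3)\<^sup>2 \<le> (norm (rvec k))\<^sup>2" by (intro power_mono) auto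
    then have "1 / (norm (rvec k))\<^sup>2 \<le> 1 / (real N / 3)\<^sup>2"
      using assms by (intro divide_left_mono) (auto intro!: mult_pos_pos)
    then show "1 / (norm (rvec k))\<^sup>2 \<le> 9 / (real N)\<^sup>2" by (simp add: power_divide)
  qed
  also have "\<dots> \<le> (\<Sum>k\<in>{- int N..int N} \<times> {- int N..int N}. 9 / (real N)\<^sup>2)"
    by (intro sum_mono2) (auto simp: modes_def)
  also have "\<dots> = (2 * real N + 1)\<^sup>2 * 9 / (real N)\<^sup>2"
    by (simp add: card_cartesian_product power2_eq_square)
  also have "\<dots> \<le> (3 * real N)\<^sup>2 * 9 / (real N)\<^sup>2"
    using assms by (intro divide_right_mono mult_right_mono power_mono) auto
  also have "\<dots> = 81" using assms by (simp add: power_mult_distrib)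
  finally show ?thesis by simp
qed

lemma sum_square_sparse_le:
  fixes b :: "'a \<Rightarrow> 'b \<Rightarrow> real"
  assumes "finite B"
    and b: "\<And>x y. x \<in> A \<Longrightarrow> \<bar>b x y\<bar> \<le> c x" "\<And>x y. x \<in> A \<Longrightarrow> b x y \<noteq> 0 \<Longrightarrow> y \<in> nb x"
    and nb: "\<And>x. x \<in> A \<Longrightarrow> finite (nb x) \<and> card (nb x) \<le> D"
  shows "(\<Sum>x\<in>A. \<Sum>y\<in>B. (b x y)\<^sup>2) \<le> real D * (\<Sum>x\<in>A. (c x)\<^sup>2)"
  unfolding sum_distrib_left
proof (rule sum_mono)
  fix x assume x: "x \<in> A"
  have "(\<Sum>y\<in>B. (b x y)\<^sup>2) = (\<Sum>y\<in>B \<inter> nb x. (b x y)\<^sup>2)"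
    using assms x by (intro sum.mono_neutral_right) auto
  also have "\<dots> \<le> (\<Sum>y\<in>B \<inter> nb x. (c x)\<^sup>2)"
    by (intro sum_mono) (metis b(1) x power2_abs power_mono abs_ge_zero)
  also have "\<dots> \<le> real D * (c x)\<^sup>2"
    using nb[OF x] card_mono[of "nb x" "B \<inter> nb x"] by (auto intro!: mult_right_mono)
  finally show "(\<Sum>y\<in>B. (b x y)\<^sup>2) \<le> real D * (c x)\<^sup>2" .
qed

text \<open>Squared Hilbert--Schmidt norm of the Gram matrix of a sparse matrix. Expanding the
  square gives four entries, in rows \<open>x\<close>, \<open>x'\<close> and columns
  \<open>m\<close>, \<open>n\<close>. The entries of row \<open>x\<close> are estimated by
  \<open>c x\<close> and those of \<open>x'\<close> by \<open>C\<close>. Given \<open>x\<close>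
  there are at most \<open>D\<close> choices of \<open>m\<close> and of \<open>n\<close>, and given
  \<open>m\<close> at most \<open>D\<close> of \<open>x'\<close>; hence the cube. The fourth
  incidence is dropped.\<close>

lemma sum_square_gram_le:
  fixes a :: "'a \<Rightarrow> 'b \<Rightarrow> real"
  assumes fin: "finite A" "finite B"
    and a: "\<And>x y. x \<in> A \<Longrightarrow> \<bar>a x y\<bar> \<le> c x" "\<And>x y. x \<in> A \<Longrightarrow> a x y \<noteq> 0 \<Longrightarrow> y \<in> nb x"
    and c: "\<And>x. x \<in> A \<Longrightarrow> c x \<le> C"
    and nb: "\<And>x. x \<in> A \<Longrightarrow> finite (nb x) \<and> card (nb x) \<le> D"
    and nb': "\<And>y. card {x \<in> A. y \<in> nb x} \<le> D"
  shows "(\<Sum>m\<in>B. \<Sum>n\<in>B. (\<Sum>x\<in>A. a x m * a x n)\<^sup>2) \<le> C\<^sup>2 * real D ^ 3 * (\<Sum>x\<in>A. (c x)\<^sup>2)"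
proof -
  define i where "i x y = (if y \<in> nb x then 1 else 0 :: real)" for x y
  have ai: "\<bar>a x y\<bar> \<le> c x * i x y" if "x \<in> A" for x y
    using a[OF that, of y] by (cases "y \<in> nb x") (auto simp: i_def)
  have i0: "0 \<le> i x y" "i x y \<le> 1" for x y by (auto simp: i_def)
  have c0: "0 \<le> c x" if "x \<in> A" for x using a(1)[OF that] by (meson abs_ge_zero order_trans)
  have D1: "(\<Sum>y\<in>B. i x y) \<le> real D" if "x \<in> A" for x
  proof -
    have "(\<Sum>y\<in>B. i x y) = real (card (B \<inter> nb x))"
      unfolding i_def using fin by (simp add: sum.If_cases)
    then show ?thesis using nb[OF that] card_mono[of "nb x" "B \<inter> nb x"] by force
  qed
  have D2: "(\<Sum>x\<in>A. i x y) \<le> real D" for y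
  proof -
    have "(\<Sum>x\<in>A. i x y) = real (card {x \<in> A. y \<in> nb x})"
      unfolding i_def using fin by (simp add: sum.If_cases Int_def)
    then show ?thesis using nb'[of y] by simp
  qed
  have "(\<Sum>x\<in>A. a x m * a x n)\<^sup>2 \<le> (\<Sum>x\<in>A. \<Sum>x'\<in>A. (c x)\<^sup>2 * C\<^sup>2 * (i x m * i x n * i x' m))" for m n
  proof -
    have "(\<Sum>x\<in>A. a x m * a x n)\<^sup>2 = (\<Sum>x\<in>A. \<Sum>x'\<in>A. a x m * a x n * (a x' m * a x' n))"
      by (simp add: power2_eq_square sum_product)
    also have "\<dots> \<le> (\<Sum>x\<in>A. \<Sum>x'\<in>A. (c x)\<^sup>2 * C\<^sup>2 * (i x m * i x n * i x' m))"
    proof (intro sum_mono)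
      fix x x' assume x: "x \<in> A" "x' \<in> A"
      have "a x m * a x n * (a x' m * a x' n) \<le> \<bar>a x m\<bar> * \<bar>a x n\<bar> * (\<bar>a x' m\<bar> * \<bar>a x' n\<bar>)"
        by (metis abs_ge_self abs_mult)
      also have "\<dots> \<le> (c x * i x m) * (c x * i x n) * ((C * i x' m) * (C * 1))"
      proof (intro mult_mono)
        show "\<bar>a x m\<bar> \<le> c x * i x m" "\<bar>a x n\<bar> \<le> c x * i x n" using ai x by auto
        show "\<bar>a x' m\<bar> \<le> C * i x' m"
          by (rule order_trans[OF ai[OF x(2)]]) (intro mult_right_mono c x i0)
        show "\<bar>a x' n\<bar> \<le> C * 1"
          using a(1)[OF x(2), of n] c[OF x(2)] by simp
      qed (use c0[OF x(1)] c0[OF x(2)] c[OF x(2)] i0 in \<open>auto intro!: mult_nonneg_nonneg\<close>)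
      also have "\<dots> = (c x)\<^sup>2 * C\<^sup>2 * (i x m * i x n * i x' m)"
        by (simp add: power2_eq_square mult_ac)
      finally show "a x m * a x n * (a x' m * a x' n) \<le> (c x)\<^sup>2 * C\<^sup>2 * (i x m * i x n * i x' m)" .
    qed
    finally show ?thesis .
  qed
  then have "(\<Sum>m\<in>B. \<Sum>n\<in>B. (\<Sum>x\<in>A. a x m * a x n)\<^sup>2) \<le>
      (\<Sum>m\<in>B. \<Sum>n\<in>B. \<Sum>x\<in>A. \<Sum>x'\<in>A. (c x)\<^sup>2 * C\<^sup>2 * (i x m * i x n * i x' m))"
    by (intro sum_mono)
  also have "\<dots> = (\<Sum>x\<in>A. (c x)\<^sup>2 * C\<^sup>2 * (\<Sum>m\<in>B. i x m * ((\<Sum>n\<in>B. i x n) * (\<Sum>x'\<in>A. i x' m))))"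
  proof -
    have "(\<Sum>m\<in>B. \<Sum>n\<in>B. \<Sum>x\<in>A. \<Sum>x'\<in>A. (c x)\<^sup>2 * C\<^sup>2 * (i x m * i x n * i x' m)) =
        (\<Sum>m\<in>B. \<Sum>x\<in>A. \<Sum>n\<in>B. \<Sum>x'\<in>A. (c x)\<^sup>2 * C\<^sup>2 * (i x m * i x n * i x' m))"
      by (intro sum.cong refl) (rule sum.swap)
    also have "\<dots> = (\<Sum>x\<in>A. \<Sum>m\<in>B. \<Sum>n\<in>B. \<Sum>x'\<in>A. (c x)\<^sup>2 * C\<^sup>2 * (i x m * i x n * i x' m))"
      by (rule sum.swap)
    also have "\<dots> = (\<Sum>x\<in>A. (c x)\<^sup>2 * C\<^sup>2 * (\<Sum>m\<in>B. i x m * ((\<Sum>n\<in>B. i x n) * (\<Sum>x'\<in>A. i x' m))))"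
      unfolding sum_product by (simp add: sum_distrib_left mult_ac)
    finally show ?thesis .
  qed
  also have "\<dots> \<le> (\<Sum>x\<in>A. (c x)\<^sup>2 * C\<^sup>2 * (\<Sum>m\<in>B. i x m * (real D * real D)))"
    by (intro sum_mono mult_left_mono mult_mono D1 D2 i0 sum_nonneg mult_nonneg_nonneg) auto
  also have "\<dots> = (\<Sum>x\<in>A. (c x)\<^sup>2 * C\<^sup>2 * ((\<Sum>m\<in>B. i x m) * (real D * real D)))"
    by (simp only: sum_distrib_right)
  also have "\<dots> \<le> (\<Sum>x\<in>A. (c x)\<^sup>2 * C\<^sup>2 * (real D * (real D * real D)))"
    by (intro sum_mono mult_left_mono mult_right_mono D1) auto
  also have "\<dots> = C\<^sup>2 * real D ^ 3 * (\<Sum>x\<in>A. (c x)\<^sup>2)"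
    by (simp add: sum_distrib_left power3_eq_cube mult_ac)
  finally show ?thesis .
qed

definition interacting_set :: "mode \<Rightarrow> mode set \<Rightarrow> mode set" where
  "interacting_set k J = (\<Union>l\<in>J. interacting k l)"

lemma card_interacting_set:
  assumes "finite J"
  shows "finite (interacting_set k J)" "card (interacting_set k J) \<le> 4 * card J"
proof -
  show "finite (interacting_set k J)"
    unfolding interacting_set_def using assms card_interacting by auto
  have "card (interacting_set k J) \<le> (\<Sum>l\<in>J. card (interacting k l))"
    unfolding interacting_set_def by (rule card_UN_le[OF assms])
  also have "\<dots> \<le> (\<Sum>l\<in>J. 4)" by (intro sum_mono card_interacting)
  finally show "card (interacting_set k J) \<le> 4 * card J" by simp
qed

text \<open>By definition \<open>noise_coeff k l m\<close> contains \<open>adv k m l\<close>, whose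
  direct bound grows with the free mode \<open>m\<close>. Skew-symmetry exchanges it for
  \<open>adv k l m\<close> with \<open>l\<close> in the fixed set \<open>J\<close>; dividing by
  \<open>|k|^2\<close> leaves an entry of size \<open>|l| / |k|\<close>, and
  \<open>sum_square_gram_le\<close> turns this into a single sum of \<open>|k|^-2\<close>.\<close>

lemma noise_frobenius_bound:
  assumes J: "finite J" "J \<subseteq> Z20"
  obtains C where "\<And>N. (\<Sum>m\<in>modes N. \<Sum>n\<in>modes N. (\<Sum>k\<in>noise_modes N.
      (\<Sum>l\<in>J. \<beta> l * noise_coeff k l m) * (\<Sum>l\<in>J. \<beta> l * noise_coeff k l n))\<^sup>2) \<le> C * inv_square_sum N"
proof -
  define c0 where "c0 = (\<Sum>l\<in>J. \<bar>\<beta> l\<bar> * (sqrt 2 * pi * 3 * norm (rvec l)))"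
  have c0: "0 \<le> c0" unfolding c0_def by (intro sum_nonneg) auto
  define D where "D = 4 * card J"
  show thesis
  proof (rule that)
    fix N
    \<comment> \<open>Columns outside \<open>modes N\<close> are set to 0: the size and support of
      an entry are known through skew-symmetry, which requires \<open>m\<close> to be nonzero, but
      the Gram estimate asks for them in every column.\<close>
    let ?a = "\<lambda>k m. if m \<in> modes N then \<Sum>l\<in>J. \<beta> l * noise_coeff k l m else 0"
    have sk: "noise_coeff k l m = - (sqrt 2 * pi / (norm (rvec k))\<^sup>2 * adv k l m)"
      if "l \<in> J" "m \<in> modes N" for k l m
      using noise_coeff_skew[of m l k] that J(2) modes_nonzero[of m N]
      by (auto simp: Z20_iff noise_coeff_def adv_skew[of m l k])
    have "(\<Sum>m\<in>modes N. \<Sum>n\<in>modes N. (\<Sum>k\<in>noise_modes N. ?a k m * ?a k n)\<^sup>2)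
        \<le> c0\<^sup>2 * real D ^ 3 * (\<Sum>k\<in>noise_modes N. (c0 / norm (rvec k))\<^sup>2)"
    proof (rule sum_square_gram_le[where nb = "\<lambda>k. interacting_set k J"])
      fix k m assume k: "k \<in> noise_modes N"
      then have k1: "1 \<le> norm (rvec k)" by (auto simp: noise_modes_def Z20_iff intro!: one_le_norm_rvec)
      have t: "\<bar>\<beta> l * noise_coeff k l m\<bar> \<le> \<bar>\<beta> l\<bar> * (sqrt 2 * pi * 3 * norm (rvec l)) / norm (rvec k)"
        if "l \<in> J" "m \<in> modes N" for l
      proof -
        have "\<bar>noise_coeff k l m\<bar> = sqrt 2 * pi / (norm (rvec k))\<^sup>2 * \<bar>adv k l m\<bar>"
          unfolding sk[OF that] by (simp add: abs_mult)
        also have "\<dots> \<le> sqrt 2 * pi / (norm (rvec k))\<^sup>2 * (3 * norm (rvec k) * norm (rvec l))"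
          by (intro mult_left_mono abs_adv_le) auto
        also have "\<dots> = sqrt 2 * pi * 3 * norm (rvec l) / norm (rvec k)"
          using k1 by (simp add: power2_eq_square)
        finally show ?thesis
          unfolding abs_mult times_divide_eq_right[symmetric] by (intro mult_left_mono) auto
      qed
      show "\<bar>?a k m\<bar> \<le> c0 / norm (rvec k)"
      proof (cases "m \<in> modes N")
        case True
        have "\<bar>\<Sum>l\<in>J. \<beta> l * noise_coeff k l m\<bar> \<le> (\<Sum>l\<in>J. \<bar>\<beta> l\<bar> * (sqrt 2 * pi * 3 * norm (rvec l)) / norm (rvec k))"
          by (rule order_trans[OF sum_abs sum_mono[OF t]]) (use True in auto)
        then show ?thesis using True by (simp add: c0_def sum_divide_distrib)
      qed (use c0 in auto)
      show "?a k m \<noteq> 0 \<Longrightarrow> m \<in> interacting_set k J"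
      proof -
        assume a: "?a k m \<noteq> 0"
        then have m: "m \<in> modes N" by (auto split: if_splits)
        obtain l where l: "l \<in> J" "\<beta> l * noise_coeff k l m \<noteq> 0"
          using a m by (auto elim: sum.not_neutral_contains_not_neutral)
        then have "adv k l m \<noteq> 0" using sk[OF l(1) m] by auto
        then show ?thesis using l adv_support[of k l m] by (auto simp: interacting_set_def)
      qed
      show "c0 / norm (rvec k) \<le> c0"
        using c0 k1 by (simp add: divide_le_eq mult_le_cancel_left1)
    next
      show "card {k \<in> noise_modes N. m \<in> interacting_set k J} \<le> D" for m
      proof -
        have "{k \<in> noise_modes N. m \<in> interacting_set k J} \<subseteq> interacting_set m J"
          by (auto simp: interacting_set_def interacting_swap)
        from card_mono[OF card_interacting_set(1)[OF J(1)] this] show ?thesis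
          using card_interacting_set(2)[OF J(1), of m] by (simp add: D_def)
      qed
    qed (use card_interacting_set[OF J(1)] in \<open>auto simp: D_def\<close>)
    also have "\<dots> = c0\<^sup>2 * real D ^ 3 * c0\<^sup>2 * inv_square_sum N"
      by (simp add: inv_square_sum_def sum_distrib_left power_divide)
    finally show "(\<Sum>m\<in>modes N. \<Sum>n\<in>modes N. (\<Sum>k\<in>noise_modes N.
      (\<Sum>l\<in>J. \<beta> l * noise_coeff k l m) * (\<Sum>l\<in>J. \<beta> l * noise_coeff k l n))\<^sup>2) \<le> c0\<^sup>2 * real D ^ 3 * c0\<^sup>2 * inv_square_sum N"
      by simp
  qed
qed

text \<open>The same exchange for the Euler drift: once the derivative falls on the fixed mode
  \<open>j\<close>, the weight \<open>|a|^-2\<close> of the velocity leaves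
  \<open>|j| / |a|\<close>. No Gram matrix occurs here, since the form is already quadratic in the
  coordinates.\<close>

lemma drift_frobenius_bound:
  assumes J: "finite J" "J \<subseteq> Z20"
  obtains C where "C \<ge> 0" "\<And>N. (\<Sum>a\<in>modes N. \<Sum>b\<in>modes N. (\<Sum>j\<in>J. \<beta> j * drift_coeff j a b)\<^sup>2)
      \<le> C * (\<Sum>a\<in>modes N. 1 / (norm (rvec a))\<^sup>2)"
proof -
  define c0 where "c0 = (\<Sum>j\<in>J. \<bar>\<beta> j\<bar> * (4 * pi\<^sup>2 * 3 * norm (rvec j)))"
  show thesis
  proof (rule that)
    show "0 \<le> real (4 * card J) * c0\<^sup>2" by simp
    fix N
    let ?b = "\<lambda>a b. if b \<in> modes N then \<Sum>j\<in>J. \<beta> j * drift_coeff j a b else 0"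
    have sk: "drift_coeff j a b = 4 * pi\<^sup>2 / (norm (rvec a))\<^sup>2 * adv (- a) j b"
      if "j \<in> J" "b \<in> modes N" for j a b
      using that J(2) modes_nonzero[of b N] by (auto simp: Z20_iff drift_coeff_def adv_skew[of b j])
    have c0: "0 \<le> c0" unfolding c0_def by (intro sum_nonneg) auto
    have "(\<Sum>a\<in>modes N. \<Sum>b\<in>modes N. (?b a b)\<^sup>2)
        \<le> real (4 * card J) * (\<Sum>a\<in>modes N. (c0 / norm (rvec a))\<^sup>2)"
    proof (rule sum_square_sparse_le[where nb = "\<lambda>a. interacting_set a J"])
      fix a b assume a: "a \<in> modes N"
      then have a1: "1 \<le> norm (rvec a)" by (intro one_le_norm_rvec) (rule modes_nonzero)
      have t: "\<bar>\<beta> j * drift_coeff j a b\<bar> \<le> \<bar>\<beta> j\<bar> * (4 * pi\<^sup>2 * 3 * norm (rvec j)) / norm (rvec a)"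
        if "j \<in> J" "b \<in> modes N" for j
      proof -
        have "\<bar>drift_coeff j a b\<bar> = 4 * pi\<^sup>2 / (norm (rvec a))\<^sup>2 * \<bar>adv (- a) j b\<bar>"
          unfolding sk[OF that] by (simp add: abs_mult)
        also have "\<dots> \<le> 4 * pi\<^sup>2 / (norm (rvec a))\<^sup>2 * (3 * norm (rvec (- a)) * norm (rvec j))"
          by (intro mult_left_mono abs_adv_le) auto
        also have "\<dots> = 4 * pi\<^sup>2 * 3 * norm (rvec j) / norm (rvec a)"
          using a1 by (simp add: power2_eq_square rvec_minus)
        finally show ?thesis
          unfolding abs_mult times_divide_eq_right[symmetric] by (intro mult_left_mono) auto
      qed
      show "\<bar>?b a b\<bar> \<le> c0 / norm (rvec a)"
      proof (cases "b \<in> modes N")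
        case True
        have "\<bar>\<Sum>j\<in>J. \<beta> j * drift_coeff j a b\<bar> \<le> (\<Sum>j\<in>J. \<bar>\<beta> j\<bar> * (4 * pi\<^sup>2 * 3 * norm (rvec j)) / norm (rvec a))"
          by (rule order_trans[OF sum_abs sum_mono[OF t]]) (use True in auto)
        then show ?thesis using True by (simp add: c0_def sum_divide_distrib)
      qed (use c0 in auto)
      show "?b a b \<noteq> 0 \<Longrightarrow> b \<in> interacting_set a J"
      proof -
        assume nz: "?b a b \<noteq> 0"
        then have b: "b \<in> modes N" by (auto split: if_splits)
        obtain j where j: "j \<in> J" "\<beta> j * drift_coeff j a b \<noteq> 0"
          using nz b by (auto elim: sum.not_neutral_contains_not_neutral)
        then have "adv (- a) j b \<noteq> 0" using sk[OF j(1) b] by auto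
        then have "b \<in> interacting (- a) j" by (rule adv_support)
        then have "b \<in> interacting a j" by (auto simp: interacting_def)
        then show ?thesis using j by (auto simp: interacting_set_def)
      qed
    qed (use card_interacting_set[OF J(1)] in auto)
    also have "\<dots> = real (4 * card J) * c0\<^sup>2 * (\<Sum>a\<in>modes N. 1 / (norm (rvec a))\<^sup>2)"
      by (simp add: sum_distrib_left power_divide)
    finally show "(\<Sum>a\<in>modes N. \<Sum>b\<in>modes N. (\<Sum>j\<in>J. \<beta> j * drift_coeff j a b)\<^sup>2)
      \<le> real (4 * card J) * c0\<^sup>2 * (\<Sum>a\<in>modes N. 1 / (norm (rvec a))\<^sup>2)" by simp
  qed
qed

subsection \<open>Partial derivatives on sequence space\<close>

text \<open>Coordinates are total functions on the index type with the product topology, so that one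
  type serves all \<open>N\<close> and no norm has to be chosen.\<close>

definition has_pd :: "'i \<Rightarrow> (('i \<Rightarrow> real) \<Rightarrow> real) \<Rightarrow> (('i \<Rightarrow> real) \<Rightarrow> real) \<Rightarrow> bool" where
  "has_pd i \<phi> \<phi>' \<longleftrightarrow> (\<forall>c. ((\<lambda>h. \<phi> (c(i := c i + h))) has_real_derivative \<phi>' c) (at 0))"

definition pd :: "'i \<Rightarrow> (('i \<Rightarrow> real) \<Rightarrow> real) \<Rightarrow> ('i \<Rightarrow> real) \<Rightarrow> real" where
  "pd i \<phi> c = deriv (\<lambda>h. \<phi> (c(i := c i + h))) 0"

definition C1 :: "'i set \<Rightarrow> (('i \<Rightarrow> real) \<Rightarrow> real) \<Rightarrow> bool" where
  "C1 I \<phi> \<longleftrightarrow> continuous_on UNIV \<phi> \<and> (\<forall>i\<in>I. has_pd i \<phi> (pd i \<phi>) \<and> continuous_on UNIV (pd i \<phi>))"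

lemma has_pd_imp_pd: "has_pd i \<phi> \<phi>' \<Longrightarrow> pd i \<phi> = \<phi>'"
  by (auto simp: has_pd_def pd_def intro!: ext DERIV_imp_deriv)

lemma C1I:
  assumes "continuous_on UNIV \<phi>" "\<And>i. i \<in> I \<Longrightarrow> has_pd i \<phi> (\<phi>' i)" "\<And>i. i \<in> I \<Longrightarrow> continuous_on UNIV (\<phi>' i)"
  shows "C1 I \<phi>"
  using assms has_pd_imp_pd unfolding C1_def by metis

lemma C1_continuous: "C1 I \<phi> \<Longrightarrow> continuous_on UNIV \<phi>"
  and C1_has_pd: "C1 I \<phi> \<Longrightarrow> i \<in> I \<Longrightarrow> has_pd i \<phi> (pd i \<phi>)"
  and C1_continuous_pd: "C1 I \<phi> \<Longrightarrow> i \<in> I \<Longrightarrow> continuous_on UNIV (pd i \<phi>)"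
  by (auto simp: C1_def)

lemma has_pd_line:
  assumes "has_pd i \<phi> \<phi>'"
  shows "((\<lambda>y. \<phi> (c(i := y))) has_real_derivative \<phi>' (c(i := y))) (at y)"
proof -
  have "((\<lambda>h. \<phi> (c(i := y + h))) has_real_derivative \<phi>' (c(i := y))) (at 0)"
    using assms[unfolded has_pd_def, rule_format, of "c(i := y)"] by simp
  then show ?thesis
    using DERIV_at_within_shift[of "\<lambda>y. \<phi> (c(i := y))" "\<phi>' (c(i := y))" y 0 UNIV] by simp
qed

lemma has_pd_const: "has_pd i (\<lambda>_. a) (\<lambda>_. 0)"
  by (simp add: has_pd_def)

lemma has_pd_coord: "has_pd i (\<lambda>c. c j) (\<lambda>_. if i = j then 1 else 0)"
  by (auto simp: has_pd_def intro!: derivative_eq_intros)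

lemma has_pd_add: "has_pd i f f' \<Longrightarrow> has_pd i g g' \<Longrightarrow> has_pd i (\<lambda>c. f c + g c) (\<lambda>c. f' c + g' c)"
  unfolding has_pd_def by (intro allI DERIV_add) auto

lemma has_pd_mult:
  assumes "has_pd i f f'" "has_pd i g g'"
  shows "has_pd i (\<lambda>c. f c * g c) (\<lambda>c. f' c * g c + f c * g' c)"
proof -
  have "((\<lambda>h. f (c(i := c i + h)) * g (c(i := c i + h))) has_real_derivative
      f' c * g (c(i := c i + 0)) + g' c * f (c(i := c i + 0))) (at 0)" for c
    using assms by (intro DERIV_mult) (auto simp: has_pd_def)
  then show ?thesis by (simp add: has_pd_def mult.commute)
qed

lemma has_pd_sum:
  "(\<And>k. k \<in> A \<Longrightarrow> has_pd i (f k) (f' k)) \<Longrightarrow> has_pd i (\<lambda>c. \<Sum>k\<in>A. f k c) (\<lambda>c. \<Sum>k\<in>A. f' k c)"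
  unfolding has_pd_def by (auto intro!: DERIV_sum)

lemma has_pd_compose:
  assumes "\<And>y. (g has_real_derivative g' y) (at y)" "has_pd i f f'"
  shows "has_pd i (\<lambda>c. g (f c)) (\<lambda>c. g' (f c) * f' c)"
  unfolding has_pd_def
proof
  fix c
  have "((\<lambda>h. f (c(i := c i + h))) has_real_derivative f' c) (at 0)"
    using assms(2) by (simp add: has_pd_def)
  moreover have "(g has_real_derivative g' (f c)) (at (f (c(i := c i + 0))))"
    using assms(1) by simp
  ultimately show "((\<lambda>h. g (f (c(i := c i + h)))) has_real_derivative g' (f c) * f' c) (at 0)"
    using DERIV_chain2 by fastforce
qed

lemma C1_const: "C1 I (\<lambda>_. a)"
  by (rule C1I[OF _ has_pd_const]) auto

lemma C1_coord: "C1 I (\<lambda>c. c j)"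
  by (rule C1I[OF _ has_pd_coord]) auto

lemma C1_mult: "C1 I f \<Longrightarrow> C1 I g \<Longrightarrow> C1 I (\<lambda>c. f c * g c)"
  by (rule C1I[OF _ has_pd_mult]) (auto simp: C1_def intro!: continuous_on_add continuous_on_mult)

lemma C1_sum: "(\<And>k. k \<in> A \<Longrightarrow> C1 I (f k)) \<Longrightarrow> C1 I (\<lambda>c. \<Sum>k\<in>A. f k c)"
  by (rule C1I[OF _ has_pd_sum]) (auto simp: C1_def intro!: continuous_on_sum)

lemma pd_mult: "C1 I f \<Longrightarrow> C1 I g \<Longrightarrow> i \<in> I \<Longrightarrow> pd i (\<lambda>c. f c * g c) c = pd i f c * g c + f c * pd i g c"
  by (rule fun_cong[OF has_pd_imp_pd[OF has_pd_mult[OF C1_has_pd C1_has_pd]]])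

lemma continuous_on_upd:
  fixes f :: "('i \<Rightarrow> real) \<Rightarrow> real"
  assumes "continuous_on UNIV f"
  shows "continuous_on A (\<lambda>y. f (c(i := y)))"
proof (rule continuous_on_compose2[OF assms])
  show "continuous_on A (\<lambda>y. c(i := y))"
    by (rule continuous_on_coordinatewise_then_product, rename_tac k, case_tac "k = i") auto
qed auto

text \<open>The first-order operator given by the vector field with components
  \<open>V j\<close>.\<close>

definition dd :: "'i set \<Rightarrow> ('i \<Rightarrow> ('i \<Rightarrow> real) \<Rightarrow> real) \<Rightarrow> (('i \<Rightarrow> real) \<Rightarrow> real) \<Rightarrow> ('i \<Rightarrow> real) \<Rightarrow> real" where
  "dd I V \<phi> c = (\<Sum>j\<in>I. V j c * pd j \<phi> c)"

lemma dd_mult: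
  "C1 I f \<Longrightarrow> C1 I g \<Longrightarrow> dd I V (\<lambda>c. f c * g c) c = dd I V f c * g c + f c * dd I V g c"
  unfolding dd_def by (simp add: pd_mult sum.distrib sum_distrib_left sum_distrib_right algebra_simps)

lemma dd_const: "dd I V (\<lambda>_. a) c = 0"
  by (simp add: dd_def has_pd_imp_pd[OF has_pd_const])

lemma continuous_on_dd:
  assumes "C1 I f" "\<And>j. j \<in> I \<Longrightarrow> continuous_on UNIV (V j)"
  shows "continuous_on UNIV (dd I V f)"
  using assms unfolding dd_def[abs_def] by (intro continuous_on_sum continuous_on_mult) (auto simp: C1_def)

subsection \<open>Coordinate boxes and radial cutoffs\<close>

text \<open>Coordinates outside \<open>I\<close> are frozen at 0, the default value of
  \<open>vec\<close> below, which makes the box compact in the product topology.\<close>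

definition box_on :: "'i set \<Rightarrow> real \<Rightarrow> ('i \<Rightarrow> real) set" where
  "box_on I r = {c. (\<forall>i\<in>I. \<bar>c i\<bar> \<le> r) \<and> (\<forall>i. i \<notin> I \<longrightarrow> c i = 0)}"

lemma compact_box_on: "compact (box_on I r)"
proof -
  have "box_on I r = PiE UNIV (\<lambda>i. if i \<in> I then {-r..r} else {0})"
    unfolding box_on_def PiE_UNIV_domain by (fastforce simp: abs_le_iff split: if_splits)
  moreover have "compactin (product_topology (\<lambda>i. euclidean) UNIV) (PiE UNIV (\<lambda>i. if i \<in> I then {-r..r} else {0 :: real}))"
    unfolding compactin_PiE by auto
  ultimately show ?thesis
    by (simp add: euclidean_product_topology compactin_euclidean_iff)
qed

lemma bounded_on_box:
  fixes f :: "('i \<Rightarrow> real) \<Rightarrow> real"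
  assumes "continuous_on UNIV f"
  obtains B where "B \<ge> 0" "\<And>c. c \<in> box_on I r \<Longrightarrow> \<bar>f c\<bar> \<le> B"
proof -
  have "compact (f ` box_on I r)"
    by (rule compact_continuous_image[OF continuous_on_subset[OF assms] compact_box_on]) auto
  then obtain B where "\<And>c. c \<in> box_on I r \<Longrightarrow> \<bar>f c\<bar> \<le> B"
    by (metis compact_imp_bounded bounded_iff imageI real_norm_def)
  then show thesis using that[of "max B 0"] by (meson max.cobounded1 max.cobounded2 order_trans)
qed

lemma bounded_on_time_box:
  fixes f :: "real \<Rightarrow> ('i \<Rightarrow> real) \<Rightarrow> real"
  assumes "continuous_on ({0..T} \<times> UNIV) (\<lambda>(t, c). f t c)"
  obtains B where "B \<ge> 0" "\<And>t c. t \<in> {0..T} \<Longrightarrow> c \<in> box_on I r \<Longrightarrow> \<bar>f t c\<bar> \<le> B"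
proof -
  have "compact ((\<lambda>(t, c). f t c) ` ({0..T} \<times> box_on I r))"
    by (rule compact_continuous_image[OF continuous_on_subset[OF assms]])
      (auto intro: compact_Times compact_box_on)
  then obtain B where "\<And>z. z \<in> {0..T} \<times> box_on I r \<Longrightarrow> \<bar>(\<lambda>(t, c). f t c) z\<bar> \<le> B"
    by (metis compact_imp_bounded bounded_iff imageI real_norm_def)
  then have "\<And>t c. t \<in> {0..T} \<Longrightarrow> c \<in> box_on I r \<Longrightarrow> \<bar>f t c\<bar> \<le> B" by auto
  then show thesis using that[of "max B 0"] by (meson max.cobounded1 max.cobounded2 order_trans)
qed

lemma DERIV_max_0_square:
  "((\<lambda>u. (max 0 u)\<^sup>2) has_real_derivative 2 * max 0 u) (at u)" for u :: real
proof -
  consider "u < 0" | "u > 0" | "u = 0" by linarith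
  then show ?thesis
  proof cases
    case 1
    have "((\<lambda>u. 0) has_real_derivative 0) (at u)" by simp
    from has_field_derivative_transform_within_open[OF this, of "{..<0}" "\<lambda>u. (max 0 u)\<^sup>2"] 1 show ?thesis by auto
  next
    case 2
    have "((\<lambda>u. u\<^sup>2) has_real_derivative 2 * u) (at u)" by (auto intro!: derivative_eq_intros)
    from has_field_derivative_transform_within_open[OF this, of "{0<..}" "\<lambda>u. (max 0 u)\<^sup>2"] 2 show ?thesis by auto
  next
    case 3
    have "((\<lambda>h. (max 0 h)\<^sup>2 / h) \<longlongrightarrow> 0) (at (0::real))"
    proof (rule tendsto_0_le[where K = 1])
      show "((\<lambda>h. h) \<longlongrightarrow> 0) (at (0::real))" by (rule tendsto_ident_at)
      show "\<forall>\<^sub>F h in at (0::real). norm ((max 0 h)\<^sup>2 / h) \<le> norm h * 1"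
        by (intro always_eventually allI) (auto simp: max_def power2_eq_square)
    qed
    then show ?thesis using 3 by (simp add: DERIV_def)
  qed
qed

text \<open>The square makes the positive part continuously differentiable, and integration by parts
  spends exactly one derivative on it. The support is the ball of radius \<open>sqrt R\<close> in
  the coordinates of \<open>I\<close>.\<close>

definition cutoff :: "'i set \<Rightarrow> real \<Rightarrow> ('i \<Rightarrow> real) \<Rightarrow> real" where
  "cutoff I R c = (max 0 (1 - (\<Sum>i\<in>I. (c i)\<^sup>2) / R))\<^sup>2"

lemma cutoff_bounds:
  assumes "R > 0"
  shows "0 \<le> cutoff I R c" "cutoff I R c \<le> 1"
proof -
  have "(\<Sum>i\<in>I. (c i)\<^sup>2) / R \<ge> 0" using assms by (intro divide_nonneg_pos sum_nonneg) auto
  then have "max 0 (1 - (\<Sum>i\<in>I. (c i)\<^sup>2) / R) \<le> 1" by auto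
  then show "0 \<le> cutoff I R c" "cutoff I R c \<le> 1"
    unfolding cutoff_def by (auto simp: power_le_one_iff abs_square_le_1)
qed

lemma cutoff_has_pd:
  assumes "finite I" "i \<in> I"
  shows "has_pd i (cutoff I R) (\<lambda>c. 2 * max 0 (1 - (\<Sum>i\<in>I. (c i)\<^sup>2) / R) * (- 2 * c i / R))"
proof -
  have "has_pd i (\<lambda>c. \<Sum>j\<in>I. c j * c j) (\<lambda>c. \<Sum>j\<in>I. (if i = j then 1 else 0) * c j + c j * (if i = j then 1 else 0))"
    by (intro has_pd_sum has_pd_mult has_pd_coord)
  moreover have "(\<Sum>j\<in>I. (if i = j then 1 else 0) * c j + c j * (if i = j then 1 else 0)) = 2 * c i" for c :: "'a \<Rightarrow> real"
    using assms by (simp add: sum.distrib if_distrib if_distribR cong: if_cong)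
  ultimately have "has_pd i (\<lambda>c. \<Sum>j\<in>I. (c j)\<^sup>2) (\<lambda>c. 2 * c i)"
    by (simp add: power2_eq_square)
  from has_pd_add[OF has_pd_const[of i 1] has_pd_mult[OF has_pd_const[of i "- 1 / R"] this]]
  have "has_pd i (\<lambda>c. 1 - (\<Sum>i\<in>I. (c i)\<^sup>2) / R) (\<lambda>c. - 2 * c i / R)"
    by simp
  from has_pd_compose[OF DERIV_max_0_square this] show ?thesis
    by (simp add: cutoff_def[abs_def])
qed

lemma C1_cutoff:
  assumes "finite I"
  shows "C1 I (cutoff I R)"
proof (rule C1I[OF _ cutoff_has_pd[OF assms]])
  show "continuous_on UNIV (cutoff I R)"
    unfolding cutoff_def[abs_def] by (cases "R = 0") (auto intro!: continuous_intros)
  show "continuous_on UNIV (\<lambda>c. 2 * max 0 (1 - (\<Sum>i\<in>I. (c i)\<^sup>2) / R) * (- 2 * c i / R))" for i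
    by (cases "R = 0") (auto intro!: continuous_intros)
qed

lemma cutoff_support:
  assumes "finite I" "R > 0" "cutoff I R c \<noteq> 0" "i \<in> I"
  shows "\<bar>c i\<bar> \<le> sqrt R"
proof -
  have "(\<Sum>i\<in>I. (c i)\<^sup>2) / R < 1"
    by (rule ccontr) (use assms(3) in \<open>simp add: cutoff_def\<close>)
  then have "(\<Sum>i\<in>I. (c i)\<^sup>2) < R" using assms(2) by simp
  moreover have "(c i)\<^sup>2 \<le> (\<Sum>i\<in>I. (c i)\<^sup>2)"
    using assms by (intro member_le_sum) auto
  ultimately show ?thesis
    using real_sqrt_le_mono[of "(c i)\<^sup>2" R] by simp
qed

lemma cutoff_mult_bounded:
  fixes f :: "('i \<Rightarrow> real) \<Rightarrow> real"
  assumes "finite I" "R > 0" "continuous_on UNIV f"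
  obtains B where "B \<ge> 0" "\<And>c. (\<And>i. i \<notin> I \<Longrightarrow> c i = 0) \<Longrightarrow> \<bar>f c * cutoff I R c\<bar> \<le> B"
proof -
  obtain B where B: "B \<ge> 0" "\<And>c. c \<in> box_on I (sqrt R) \<Longrightarrow> \<bar>f c\<bar> \<le> B"
    using bounded_on_box[OF assms(3)] by metis
  show thesis
  proof (rule that[OF B(1)])
    fix c :: "'i \<Rightarrow> real" assume c: "\<And>i. i \<notin> I \<Longrightarrow> c i = 0"
    show "\<bar>f c * cutoff I R c\<bar> \<le> B"
    proof (cases "cutoff I R c = 0")
      case False
      then have "c \<in> box_on I (sqrt R)"
        using cutoff_support[OF assms(1,2)] c by (auto simp: box_on_def)
      then have "\<bar>f c\<bar> * \<bar>cutoff I R c\<bar> \<le> B * 1"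
        using B cutoff_bounds[OF assms(2), of I c] by (intro mult_mono) auto
      then show ?thesis by (simp add: abs_mult)
    qed (use B in auto)
  qed
qed

lemma cutoff_tendsto_1:
  assumes "finite I"
  shows "(\<lambda>n. cutoff I (real (Suc n)) c) \<longlonglongrightarrow> 1"
proof -
  have "(\<lambda>n. (\<Sum>i\<in>I. (c i)\<^sup>2) * inverse (real (Suc n))) \<longlonglongrightarrow> (\<Sum>i\<in>I. (c i)\<^sup>2) * 0"
    by (intro tendsto_intros LIMSEQ_inverse_real_of_nat)
  then have "(\<lambda>n. (\<Sum>i\<in>I. (c i)\<^sup>2) / real (Suc n)) \<longlonglongrightarrow> 0"
    by (simp add: divide_inverse)
  then have "(\<lambda>n. (max 0 (1 - (\<Sum>i\<in>I. (c i)\<^sup>2) / real (Suc n)))\<^sup>2) \<longlonglongrightarrow> (max 0 (1 - 0))\<^sup>2"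
    by (intro tendsto_intros)
  then show ?thesis unfolding cutoff_def by simp
qed

subsection \<open>Families of independent standard normal variables\<close>

text \<open>The density satisfies \<open>g' y = - y * g y\<close>, so the difference of the two
  integrands is the derivative of \<open>h * g\<close>, which has bounded support.\<close>

lemma std_normal_ibp:
  fixes h h' :: "real \<Rightarrow> real"
  assumes h: "\<And>y. (h has_real_derivative h' y) (at y)" and h': "continuous_on UNIV h'"
    and supp: "\<And>y. r < \<bar>y\<bar> \<Longrightarrow> h y = 0"
  shows "(\<integral>y. h' y \<partial>std_normal_distribution) = (\<integral>y. y * h y \<partial>std_normal_distribution)"
proof -
  define g where "g = std_normal_density"
  \<comment> \<open>One unit beyond the support: every point with
    \<open>a \<le> \<bar>y\<bar>\<close> has a neighbourhood on which \<open>h\<close> vanishes, so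
    \<open>h'\<close> vanishes there as well. The absolute value covers negative
    \<open>r\<close>.\<close>
  define a where "a = \<bar>r\<bar> + 1"
  have g: "(g has_real_derivative - y * g y) (at y)" for y
    unfolding g_def normal_density_def
    by (auto intro!: derivative_eq_intros simp: field_simps power2_eq_square)
  have cont_h: "continuous_on UNIV h"
    using h by (meson DERIV_continuous continuous_at_imp_continuous_on)
  have cont_g: "continuous_on UNIV g"
    using g by (meson DERIV_continuous continuous_at_imp_continuous_on)
  have h'0: "h' y = 0" if "a \<le> \<bar>y\<bar>" for y
  proof -
    have "((\<lambda>_. 0) has_real_derivative 0) (at y)" by simp
    then have "(h has_real_derivative 0) (at y)"
    proof (rule has_field_derivative_transform_within_open[where S = "{y. r < \<bar>y\<bar>}"])
      show "open {y :: real. r < \<bar>y\<bar>}" by (intro open_Collect_less continuous_intros)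
    qed (use that supp in \<open>auto simp: a_def\<close>)
    with h show ?thesis using DERIV_unique by blast
  qed
  let ?f = "\<lambda>y. h' y * g y - y * h y * g y"
  have meas: "(\<lambda>y. h' y * g y) \<in> borel_measurable borel" "(\<lambda>y. y * h y * g y) \<in> borel_measurable borel"
    by (intro borel_measurable_continuous_onI continuous_intros h' cont_g cont_h)+
  have int: "integrable lborel (\<lambda>y. h' y * g y)" "integrable lborel (\<lambda>y. y * h y * g y)"
  proof -
    have *: "integrable lborel u" if c: "continuous_on UNIV u" and z: "\<And>y. a \<le> \<bar>y\<bar> \<Longrightarrow> u y = 0" for u :: "real \<Rightarrow> real"
    proof -
      have "integrable lborel (\<lambda>x. indicator {-a..a} x *\<^sub>R u x)"
        using borel_integrable_compact[of "{-a..a}" u] continuous_on_subset[OF c] by auto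
      moreover have "(\<lambda>x. indicator {-a..a} x *\<^sub>R u x) = u"
      proof
        fix x show "indicator {-a..a} x *\<^sub>R u x = u x"
          using z[of x] by (cases "a \<le> \<bar>x\<bar>") (auto simp: indicator_def)
      qed
      ultimately show ?thesis by simp
    qed
    show "integrable lborel (\<lambda>y. h' y * g y)"
      by (rule *) (auto intro!: continuous_intros h' cont_g simp: h'0)
    show "integrable lborel (\<lambda>y. y * h y * g y)"
      by (rule *) (auto intro!: continuous_intros cont_h cont_g simp: supp a_def)
  qed
  have "(\<integral>y. ?f y * indicator {-a..a} y \<partial>lborel) = h a * g a - h (-a) * g (-a)"
  proof (rule integral_FTC_Icc_real)
    show "- a \<le> a" by (simp add: a_def)
    show "((\<lambda>y. h y * g y) has_real_derivative ?f y) (at y)" for y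
      using DERIV_mult[OF h[of y] g[of y]] by (simp add: mult_ac)
    have "continuous_on UNIV ?f"
      by (intro continuous_intros h' cont_g cont_h)
    then show "isCont ?f y" for y
      by (simp add: continuous_on_eq_continuous_at)
  qed
  also have "\<dots> = 0" by (simp add: supp a_def)
  also have "(\<lambda>y. ?f y * indicator {-a..a} y) = ?f"
  proof
    fix y show "?f y * indicator {-a..a} y = ?f y"
      by (cases "a \<le> \<bar>y\<bar>") (auto simp: indicator_def h'0 supp a_def)
  qed
  finally have "(\<integral>y. h' y * g y \<partial>lborel) = (\<integral>y. y * h y * g y \<partial>lborel)"
    using int by simp
  moreover have "continuous_on UNIV (\<lambda>y. y * h y)"
    by (intro continuous_intros cont_h)
  ultimately show ?thesis
    using h' by (simp add: integral_density g_def mult.commute borel_measurable_continuous_onI)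
qed

locale gaussian_family = prob_space M for M :: "'w measure" +
  fixes X :: "'i::countable \<Rightarrow> 'w \<Rightarrow> real" and S :: "'i set"
  assumes indep: "indep_vars (\<lambda>_. borel) X S"
    and normal: "\<And>i. i \<in> S \<Longrightarrow> distributed M lborel (X i) std_normal_density"
begin

definition vec :: "'i set \<Rightarrow> 'w \<Rightarrow> 'i \<Rightarrow> real" where
  "vec I w i = (if i \<in> I then X i w else 0)"

lemma X_measurable: "i \<in> S \<Longrightarrow> X i \<in> borel_measurable M"
  using indep by (auto simp: indep_vars_def)

lemma distr_X: "i \<in> S \<Longrightarrow> distr M borel (X i) = std_normal_distribution"
  using distributed_distr_eq_density[OF normal] by (simp cong: distr_cong)

lemma vec_measurable: "I \<subseteq> S \<Longrightarrow> vec I \<in> borel_measurable M"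
  by (rule measurable_coordinatewise_then_product, rename_tac i, case_tac "i \<in> I")
    (auto simp: vec_def[abs_def] intro: X_measurable)

lemma measurable_vec_continuous:
  fixes f :: "('i \<Rightarrow> real) \<Rightarrow> real"
  assumes "continuous_on UNIV f" "I \<subseteq> S"
  shows "(\<lambda>w. f (vec I w)) \<in> borel_measurable M"
  using measurable_compose[OF vec_measurable[OF assms(2)] borel_measurable_continuous_onI[OF assms(1)]] .

lemma integrable_cutoff:
  assumes "finite I" "I \<subseteq> S" "R > 0" "continuous_on UNIV f"
  shows "integrable M (\<lambda>w. f (vec I w) * cutoff I R (vec I w))"
proof -
  obtain B where B: "\<And>c. (\<And>i. i \<notin> I \<Longrightarrow> c i = 0) \<Longrightarrow> \<bar>f c * cutoff I R c\<bar> \<le> B"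
    using cutoff_mult_bounded[OF assms(1,3,4)] by metis
  show ?thesis
  proof (rule integrable_const_bound[where B = B])
    show "(\<lambda>w. f (vec I w) * cutoff I R (vec I w)) \<in> borel_measurable M"
      using assms C1_continuous[OF C1_cutoff[OF assms(1)]]
      by (intro borel_measurable_times measurable_vec_continuous)
  qed (auto intro!: AE_I2 B simp: vec_def)
qed

lemma integral_vec:
  fixes f :: "('i \<Rightarrow> real) \<Rightarrow> real"
  assumes I: "finite I" "I \<subseteq> S" "I \<noteq> {}" and f: "f \<in> borel_measurable borel"
  defines "Z \<equiv> \<lambda>c i. if i \<in> I then c i else (0 :: real)"
  shows "(\<lambda>c. f (Z c)) \<in> borel_measurable (PiM I (\<lambda>_. std_normal_distribution))"
    "(\<integral>w. f (vec I w) \<partial>M) = (\<integral>c. f (Z c) \<partial>PiM I (\<lambda>_. std_normal_distribution))"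
proof -
  have [measurable]: "X i \<in> borel_measurable M" if "i \<in> I" for i
    using X_measurable I that by auto
  have "Z \<in> borel_measurable (PiM I (\<lambda>_. borel))"
    unfolding Z_def by (rule measurable_coordinatewise_then_product, rename_tac i, case_tac "i \<in> I") auto
  from measurable_compose[OF this f]
  have m: "(\<lambda>c. f (Z c)) \<in> borel_measurable (PiM I (\<lambda>_. borel))" .
  have sets: "sets (PiM I (\<lambda>_. std_normal_distribution)) = sets (PiM I (\<lambda>_. borel :: real measure))"
    by (rule sets_PiM_cong) auto
  show "(\<lambda>c. f (Z c)) \<in> borel_measurable (PiM I (\<lambda>_. std_normal_distribution))"
    using m by (simp add: measurable_cong_sets[OF sets refl])
  have "PiM I (\<lambda>_. std_normal_distribution) = PiM I (\<lambda>i. distr M borel (X i))"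
    using I by (intro PiM_cong) (auto simp: distr_X)
  also have "\<dots> = distr M (PiM I (\<lambda>_. borel)) (\<lambda>w. \<lambda>i\<in>I. X i w)"
    using indep_vars_subset[OF indep I(2)] I
    by (subst indep_vars_iff_distr_eq_PiM'[THEN iffD1]) auto
  finally have "(\<integral>c. f (Z c) \<partial>PiM I (\<lambda>_. std_normal_distribution)) = (\<integral>w. f (Z (\<lambda>i\<in>I. X i w)) \<partial>M)"
    using m by (simp add: integral_distr)
  moreover have "Z (\<lambda>i\<in>I. X i w) = vec I w" for w
    by (auto simp: Z_def vec_def fun_eq_iff)
  ultimately show "(\<integral>w. f (vec I w) \<partial>M) = (\<integral>c. f (Z c) \<partial>PiM I (\<lambda>_. std_normal_distribution))"
    by simp
qed

text \<open>The joint law is a product measure. Integrating the coordinate \<open>j\<close> first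
  reduces the claim to \<open>std_normal_ibp\<close> on each line parallel to the \<open>j\<close>
  axis; the support condition makes the integrands bounded.\<close>

lemma gaussian_ibp:
  assumes I: "finite I" "I \<subseteq> S" "j \<in> I"
    and \<phi>: "continuous_on UNIV \<phi>" "has_pd j \<phi> \<phi>'" "continuous_on UNIV \<phi>'"
    and supp: "\<And>c i. i \<in> I \<Longrightarrow> \<phi> c \<noteq> 0 \<Longrightarrow> \<bar>c i\<bar> \<le> r"
  shows "(\<integral>w. \<phi>' (vec I w) \<partial>M) = (\<integral>w. vec I w j * \<phi> (vec I w) \<partial>M)"
proof -
  define Z where "Z c i = (if i \<in> I then c i else 0)" for c :: "'i \<Rightarrow> real" and i
  define P where "P J = PiM J (\<lambda>_ :: 'i. std_normal_distribution)" for J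
  define J where "J = I - {j}"
  interpret N: prob_space std_normal_distribution
    using real_dist_normal_dist by (simp add: real_distribution_def)
  interpret product_prob_space "\<lambda>_ :: 'i. std_normal_distribution" ..
  interpret PI: prob_space "P I" unfolding P_def by (rule prob_space_PiM) (rule N.prob_space_axioms)
  have supp': "\<phi>' c = 0" if "i \<in> I" "r < \<bar>c i\<bar>" for c i
  proof -
    \<comment> \<open>If \<open>i\<close> differs from \<open>j\<close>, the whole line lies outside
      the support; otherwise only the part beyond \<open>r\<close> does.\<close>
    let ?U = "if i = j then {y. r < \<bar>y\<bar>} else (UNIV :: real set)"
    have "((\<lambda>_. 0) has_real_derivative 0) (at (c j))" by simp
    then have "((\<lambda>y. \<phi> (c(j := y))) has_real_derivative 0) (at (c j))"
    proof (rule has_field_derivative_transform_within_open[where S = ?U])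
      show "open ?U" by (auto intro!: open_Collect_less continuous_intros)
      show "c j \<in> ?U" using that by auto
      show "0 = \<phi> (c(j := y))" if "y \<in> ?U" for y
        using supp[OF \<open>i \<in> I\<close>, of "c(j := y)"] that \<open>r < \<bar>c i\<bar>\<close> by (auto split: if_splits)
    qed
    moreover have "((\<lambda>y. \<phi> (c(j := y))) has_real_derivative \<phi>' c) (at (c j))"
      using has_pd_line[OF \<phi>(2), of c "c j"] by simp
    ultimately show ?thesis using DERIV_unique by blast
  qed
  have int: "integrable (P I) (\<lambda>c. f (Z c))"
    if f: "continuous_on UNIV f" "\<And>c i. i \<in> I \<Longrightarrow> r < \<bar>c i\<bar> \<Longrightarrow> f c = 0" for f :: "('i \<Rightarrow> real) \<Rightarrow> real"
  proof -
    obtain B where B: "B \<ge> 0" "\<And>c. c \<in> box_on I r \<Longrightarrow> \<bar>f c\<bar> \<le> B"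
      using bounded_on_box[OF f(1)] by metis
    have "\<bar>f (Z c)\<bar> \<le> B" for c
    proof (cases "Z c \<in> box_on I r")
      case False
      then obtain i where "i \<in> I" "r < \<bar>Z c i\<bar>" by (auto simp: box_on_def Z_def)
      then show ?thesis using f(2) B by auto
    qed (rule B)
    moreover have "(\<lambda>c. f (Z c)) \<in> borel_measurable (P I)"
      unfolding P_def Z_def using I f by (intro integral_vec(1) borel_measurable_continuous_onI) auto
    ultimately show ?thesis by (intro PI.integrable_const_bound[where B = B]) auto
  qed
  have supp0: "\<phi> c = 0" if "i \<in> I" "r < \<bar>c i\<bar>" for c i
    using supp[OF that(1), of c] that(2) by auto
  have cj: "continuous_on UNIV (\<lambda>c. c j * \<phi> c)"
    by (intro continuous_intros \<phi>) auto
  have fubini: "(\<integral>w. f (vec I w) \<partial>M) = (\<integral>x. (\<integral>y. f ((Z x)(j := y)) \<partial>std_normal_distribution) \<partial>P J)"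
    if f: "continuous_on UNIV f" "\<And>c i. i \<in> I \<Longrightarrow> r < \<bar>c i\<bar> \<Longrightarrow> f c = 0" for f :: "('i \<Rightarrow> real) \<Rightarrow> real"
  proof -
    have "(\<integral>w. f (vec I w) \<partial>M) = (\<integral>c. f (Z c) \<partial>P I)"
      unfolding P_def Z_def using I f by (intro integral_vec(2) borel_measurable_continuous_onI) auto
    also have "\<dots> = (\<integral>x. (\<integral>y. f (Z (x(j := y))) \<partial>std_normal_distribution) \<partial>P J)"
    proof -
      have "I = insert j J" "finite J" "j \<notin> J" using I by (auto simp: J_def)
      then show ?thesis
        using product_integral_insert[of J j "\<lambda>c. f (Z c)"] int[OF f] by (simp add: P_def)
    qed
    also have "(\<lambda>x y. f (Z (x(j := y)))) = (\<lambda>x y. f ((Z x)(j := y)))"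
      using I by (intro ext arg_cong[of _ _ f]) (auto simp: Z_def)
    finally show ?thesis .
  qed
  have "(\<integral>w. \<phi>' (vec I w) \<partial>M) = (\<integral>x. (\<integral>y. \<phi>' ((Z x)(j := y)) \<partial>std_normal_distribution) \<partial>P J)"
    by (rule fubini[OF \<phi>(3) supp'])
  also have "\<dots> = (\<integral>x. (\<integral>y. y * \<phi> ((Z x)(j := y)) \<partial>std_normal_distribution) \<partial>P J)"
  proof (rule Bochner_Integration.integral_cong[OF refl], rule std_normal_ibp[where r = r])
    fix x y
    show "((\<lambda>y. \<phi> ((Z x)(j := y))) has_real_derivative \<phi>' ((Z x)(j := y))) (at y)"
      by (rule has_pd_line[OF \<phi>(2)])
    show "continuous_on UNIV (\<lambda>y. \<phi>' ((Z x)(j := y)))"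
      by (rule continuous_on_upd[OF \<phi>(3)])
    show "r < \<bar>y\<bar> \<Longrightarrow> \<phi> ((Z x)(j := y)) = 0"
      using supp0[OF I(3), of "(Z x)(j := y)"] by simp
  qed
  also have "\<dots> = (\<integral>w. vec I w j * \<phi> (vec I w) \<partial>M)"
    using fubini[OF cj] supp0 by simp
  finally show ?thesis .
qed

text \<open>A vector field is tangent to the spheres when \<open>\<Sum>j. c j * V j c = 0\<close>, so it does not see the cutoff.\<close>

lemma expectation_dd_cutoff:
  assumes I: "finite I" "I \<subseteq> S" and R: "R > 0" and \<phi>: "C1 I \<phi>"
    and V: "\<And>j. j \<in> I \<Longrightarrow> continuous_on UNIV (V j)" "\<And>j c y. j \<in> I \<Longrightarrow> V j (c(j := y)) = V j c"
    and tangent: "\<And>c. (\<Sum>j\<in>I. c j * V j c) = 0"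
  shows "(\<integral>w. dd I V \<phi> (vec I w) * cutoff I R (vec I w) \<partial>M) = 0"
proof -
  note cut = C1_cutoff[OF I(1), of R]
  note prod = C1_mult[OF \<phi> cut]
  have dd_cut: "dd I V (cutoff I R) c = 0" for c
  proof -
    have "dd I V (cutoff I R) c = (\<Sum>j\<in>I. (2 * max 0 (1 - (\<Sum>i\<in>I. (c i)\<^sup>2) / R) * (- 2 / R)) * (c j * V j c))"
      unfolding dd_def using has_pd_imp_pd[OF cutoff_has_pd[OF I(1)]] by (intro sum.cong) auto
    also have "\<dots> = 0" unfolding sum_distrib_left[symmetric] tangent by simp
    finally show ?thesis .
  qed
  \<comment> \<open>As \<open>V j\<close> does not depend on the coordinate \<open>j\<close>, no
    divergence term arises.\<close>
  have V_pd: "has_pd j (\<lambda>c. V j c * (\<phi> c * cutoff I R c)) (\<lambda>c. V j c * pd j (\<lambda>c. \<phi> c * cutoff I R c) c)"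
    if "j \<in> I" for j
  proof -
    have "has_pd j (V j) (\<lambda>_. 0)"
      unfolding has_pd_def using V(2)[OF that] by simp
    from has_pd_mult[OF this C1_has_pd[OF prod that]] show ?thesis by simp
  qed
  have contV: "continuous_on UNIV (\<lambda>c. V j c * (\<phi> c * cutoff I R c))"
    "continuous_on UNIV (\<lambda>c. V j c * pd j (\<lambda>c. \<phi> c * cutoff I R c) c)" if "j \<in> I" for j
    using V(1)[OF that] C1_continuous[OF prod] C1_continuous_pd[OF prod that]
    by (auto intro!: continuous_on_mult)
  have ibp: "(\<integral>w. V j (vec I w) * pd j (\<lambda>c. \<phi> c * cutoff I R c) (vec I w) \<partial>M) =
      (\<integral>w. vec I w j * (V j (vec I w) * (\<phi> (vec I w) * cutoff I R (vec I w))) \<partial>M)" if "j \<in> I" for j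
    by (rule gaussian_ibp[where r = "sqrt R", OF I that contV(1)[OF that] V_pd[OF that] contV(2)[OF that]])
      (use cutoff_support[OF I(1) R] in auto)
  have int1: "integrable M (\<lambda>w. V j (vec I w) * pd j (\<lambda>c. \<phi> c * cutoff I R c) (vec I w))" if j: "j \<in> I" for j
  proof -
    \<comment> \<open>The extra unit is slack: outside the larger box a shift of one coordinate by
      less than 1 stays outside the support, so the difference quotients defining \<open>pd\<close>
      are 0.\<close>
    obtain B where B: "\<And>c. c \<in> box_on I (sqrt R + 1) \<Longrightarrow> \<bar>V j c * pd j (\<lambda>c. \<phi> c * cutoff I R c) c\<bar> \<le> B" "0 \<le> B"
      using bounded_on_box[OF contV(2)[OF j]] by metis
    have "\<bar>V j (vec I w) * pd j (\<lambda>c. \<phi> c * cutoff I R c) (vec I w)\<bar> \<le> B" for w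
    proof (cases "vec I w \<in> box_on I (sqrt R + 1)")
      case False
      then obtain i where i: "i \<in> I" "sqrt R + 1 < \<bar>vec I w i\<bar>" by (auto simp: box_on_def vec_def)
      have "((\<lambda>_. 0) has_real_derivative 0) (at 0)" by simp
      then have "((\<lambda>h. (\<lambda>c. \<phi> c * cutoff I R c) ((vec I w)(j := vec I w j + h))) has_real_derivative 0) (at 0)"
      proof (rule has_field_derivative_transform_within_open[where S = "{-1<..<1}"])
        fix h :: real assume h: "h \<in> {-1<..<1}"
        have "\<not> \<bar>((vec I w)(j := vec I w j + h)) i\<bar> \<le> sqrt R" using i h by auto
        then have "cutoff I R ((vec I w)(j := vec I w j + h)) = 0"
          using cutoff_support[OF I(1) R _ i(1)] by blast
        then show "0 = (\<lambda>c. \<phi> c * cutoff I R c) ((vec I w)(j := vec I w j + h))" by simp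
      qed auto
      then have "pd j (\<lambda>c. \<phi> c * cutoff I R c) (vec I w) = 0"
        unfolding pd_def by (rule DERIV_imp_deriv)
      then show ?thesis using B by simp
    qed (use B in auto)
    moreover have "(\<lambda>w. V j (vec I w) * pd j (\<lambda>c. \<phi> c * cutoff I R c) (vec I w)) \<in> borel_measurable M"
      by (rule measurable_vec_continuous[OF contV(2)[OF j] I(2)])
    ultimately show ?thesis by (intro integrable_const_bound[where B = B]) auto
  qed
  have int2: "integrable M (\<lambda>w. vec I w j * (V j (vec I w) * (\<phi> (vec I w) * cutoff I R (vec I w))))" if "j \<in> I" for j
  proof -
    have "continuous_on UNIV (\<lambda>c :: 'i \<Rightarrow> real. c j * (V j c * \<phi> c))"
      using V(1)[OF that] C1_continuous[OF \<phi>] by (auto intro!: continuous_on_mult)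
    from integrable_cutoff[OF I R this] show ?thesis by (simp add: mult_ac)
  qed
  have "(\<integral>w. dd I V \<phi> (vec I w) * cutoff I R (vec I w) \<partial>M) = (\<integral>w. dd I V (\<lambda>c. \<phi> c * cutoff I R c) (vec I w) \<partial>M)"
    by (simp add: dd_mult[OF \<phi> cut] dd_cut)
  also have "\<dots> = (\<Sum>j\<in>I. \<integral>w. V j (vec I w) * pd j (\<lambda>c. \<phi> c * cutoff I R c) (vec I w) \<partial>M)"
    unfolding dd_def using int1 by (rule Bochner_Integration.integral_sum)
  also have "\<dots> = (\<Sum>j\<in>I. \<integral>w. vec I w j * (V j (vec I w) * (\<phi> (vec I w) * cutoff I R (vec I w))) \<partial>M)"
    by (intro sum.cong refl ibp)
  also have "\<dots> = (\<integral>w. (\<Sum>j\<in>I. vec I w j * (V j (vec I w) * (\<phi> (vec I w) * cutoff I R (vec I w)))) \<partial>M)"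
    using int2 by (rule Bochner_Integration.integral_sum[symmetric])
  also have "\<dots> = (\<integral>w. (\<Sum>j\<in>I. vec I w j * V j (vec I w)) * (\<phi> (vec I w) * cutoff I R (vec I w)) \<partial>M)"
    by (simp only: sum_distrib_right mult.assoc)
  also have "\<dots> = 0" by (simp add: tangent)
  finally show ?thesis .
qed

end

text \<open>Replaces a sum of coordinates by a product, whose integrability follows from
  independence.\<close>

lemma one_plus_sum_le_prod:
  fixes f :: "'a \<Rightarrow> real"
  assumes "finite I" "\<And>i. i \<in> I \<Longrightarrow> 0 \<le> f i"
  shows "1 + (\<Sum>i\<in>I. f i) \<le> (\<Prod>i\<in>I. 1 + f i)"
  using assms
proof (induction I)
  case (insert i I)
  have "1 \<le> (\<Prod>i\<in>I. 1 + f i)" using insert by (intro prod_ge_1) auto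
  then have "f i * 1 \<le> f i * (\<Prod>i\<in>I. 1 + f i)" using insert by (intro mult_left_mono) auto
  then show ?case using insert by (simp add: algebra_simps)
qed simp

lemma std_normal_distribution_moments:
  "(\<integral>x. x \<partial>std_normal_distribution) = 0" "(\<integral>x. x\<^sup>2 \<partial>std_normal_distribution) = 1"
  "(\<integral>x. x ^ 3 \<partial>std_normal_distribution) = 0" "(\<integral>x. x ^ 4 \<partial>std_normal_distribution) = 3"
  using integral_std_normal_distribution_moment_odd[of 1] integral_std_normal_distribution_moment_odd[of 3]
    std_normal_distribution_even_moments(1)[of 1] std_normal_distribution_even_moments(1)[of 2]
  by (simp_all add: fact_numeral)

text \<open>Stated on a convex set so that one-sided derivatives at the ends of \<open>[0,T]\<close>
  are included; there the mean value inequality bounds the difference quotients by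
  \<open>g\<close>.\<close>

lemma has_derivative_integral_dominated:
  fixes f f' :: "real \<Rightarrow> 'a \<Rightarrow> real"
  assumes U: "convex U" "t \<in> U"
    and int: "\<And>s. s \<in> U \<Longrightarrow> integrable M (f s)" and meas: "f' t \<in> borel_measurable M"
    and deriv: "\<And>s w. s \<in> U \<Longrightarrow> w \<in> space M \<Longrightarrow> ((\<lambda>s. f s w) has_real_derivative f' s w) (at s within U)"
    and dom: "\<And>s w. s \<in> U \<Longrightarrow> w \<in> space M \<Longrightarrow> \<bar>f' s w\<bar> \<le> g w" "integrable M g"
  shows "((\<lambda>s. \<integral>w. f s w \<partial>M) has_real_derivative (\<integral>w. f' t w \<partial>M)) (at t within U)"
  unfolding has_field_derivative_iff tendsto_at_iff_sequentially
proof safe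
  fix x assume x: "\<forall>n. x n \<in> U - {t}" "x \<longlonglongrightarrow> t"
  have "(\<lambda>n. \<integral>w. (f (x n) w - f t w) / (x n - t) \<partial>M) \<longlonglongrightarrow> (\<integral>w. f' t w \<partial>M)"
  proof (rule integral_dominated_convergence[where w = g])
    show "(\<lambda>w. (f (x n) w - f t w) / (x n - t)) \<in> borel_measurable M" for n
      using int[of "x n"] int[OF U(2)] x(1) by (intro borel_measurable_divide borel_measurable_diff) auto
    show "AE w in M. (\<lambda>n. (f (x n) w - f t w) / (x n - t)) \<longlonglongrightarrow> f' t w"
      using deriv[OF U(2)] x unfolding has_field_derivative_iff tendsto_at_iff_sequentially
      by (intro AE_I2) (auto simp: comp_def)
    show "AE w in M. norm ((f (x n) w - f t w) / (x n - t)) \<le> g w" for n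
    proof (rule AE_I2)
      fix w assume w: "w \<in> space M"
      have xn: "x n \<in> U" "x n \<noteq> t" using x(1) by auto
      have "norm (f (x n) w - f t w) \<le> g w * norm (x n - t)"
        by (rule field_differentiable_bound[of U "\<lambda>t. f t w" "\<lambda>t. f' t w"]) (use deriv dom(1) xn U w in auto)
      then show "norm ((f (x n) w - f t w) / (x n - t)) \<le> g w"
        using xn(2) by (simp add: divide_le_eq)
    qed
  qed (fact meas dom(2))+
  moreover have "(\<integral>w. (f (x n) w - f t w) / (x n - t) \<partial>M) = ((\<integral>w. f (x n) w \<partial>M) - (\<integral>w. f t w \<partial>M)) / (x n - t)" for n
    using int[of "x n"] int[OF U(2)] x(1) by (subst integral_divide_zero, subst Bochner_Integration.integral_diff) auto
  ultimately show "((\<lambda>y. ((\<integral>w. f y w \<partial>M) - (\<integral>w. f t w \<partial>M)) / (y - t)) \<circ> x) \<longlonglongrightarrow> (\<integral>w. f' t w \<partial>M)"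
    by (simp only: comp_def)
qed

context gaussian_family
begin

subsection \<open>Moments\<close>

lemma integral_X:
  fixes f :: "real \<Rightarrow> real"
  assumes "i \<in> S" "f \<in> borel_measurable borel"
  shows "integrable M (\<lambda>w. f (X i w)) \<longleftrightarrow> integrable std_normal_distribution f"
    "(\<integral>w. f (X i w) \<partial>M) = (\<integral>x. f x \<partial>std_normal_distribution)"
  using integral_distr[OF X_measurable[OF assms(1)] assms(2)]
    integrable_distr_eq[OF X_measurable[OF assms(1)] assms(2)]
  by (simp_all add: distr_X[OF assms(1)])

lemma indep_vars_fun:
  fixes f :: "'i \<Rightarrow> real \<Rightarrow> real"
  assumes "I \<subseteq> S" "\<And>i. i \<in> I \<Longrightarrow> f i \<in> borel_measurable borel"
  shows "indep_vars (\<lambda>_. borel) (\<lambda>i w. f i (X i w)) I"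
  by (rule indep_vars_compose2[OF indep_vars_subset[OF indep assms(1)]]) (use assms in auto)

lemma monomial_expectation:
  assumes I: "finite I" "I \<subseteq> S"
  shows "integrable M (\<lambda>w. \<Prod>i\<in>I. X i w ^ e i)"
    "(\<integral>w. (\<Prod>i\<in>I. X i w ^ e i) \<partial>M) = (\<Prod>i\<in>I. \<integral>x. x ^ e i \<partial>std_normal_distribution)"
proof -
  have int: "integrable M (\<lambda>w. X i w ^ e i)" if "i \<in> I" for i
    using integral_X(1)[of i "\<lambda>x. x ^ e i"] that I integrable_std_normal_distribution_moment by auto
  have ind: "indep_vars (\<lambda>_. borel) (\<lambda>i w. X i w ^ e i) I"
    by (rule indep_vars_fun[OF I(2)]) auto
  show "integrable M (\<lambda>w. \<Prod>i\<in>I. X i w ^ e i)"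
    by (rule indep_vars_integrable[OF I(1) ind int])
  show "(\<integral>w. (\<Prod>i\<in>I. X i w ^ e i) \<partial>M) = (\<Prod>i\<in>I. \<integral>x. x ^ e i \<partial>std_normal_distribution)"
  proof -
    have "(\<integral>w. (\<Prod>i\<in>I. X i w ^ e i) \<partial>M) = (\<Prod>i\<in>I. \<integral>w. X i w ^ e i \<partial>M)"
      by (rule indep_vars_lebesgue_integral[OF I(1) ind int])
    also have "\<dots> = (\<Prod>i\<in>I. \<integral>x. x ^ e i \<partial>std_normal_distribution)"
      using I by (intro prod.cong refl integral_X(2)) auto
    finally show ?thesis .
  qed
qed

text \<open>Isserlis' formula. The exponent \<open>e\<close> counts multiplicities, independence
  factorises the monomial, and the moments 0, 1, 0, 3 settle every pattern of coincidences.\<close>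

lemma wick4:
  assumes "{m, n, p, q} \<subseteq> S"
  shows "integrable M (\<lambda>w. X m w * X n w * (X p w * X q w))"
    "(\<integral>w. X m w * X n w * (X p w * X q w) \<partial>M) =
      of_bool (m = n \<and> p = q) + of_bool (m = p \<and> n = q) + of_bool (m = q \<and> n = p)"
proof -
  define e :: "'i \<Rightarrow> nat" where "e i = of_bool (i = m) + of_bool (i = n) + of_bool (i = p) + of_bool (i = q)" for i
  let ?A = "{m, n, p, q}"
  have d: "(\<Prod>i\<in>?A. X i w ^ of_bool (i = k)) = X k w" if "k \<in> ?A" for k w
  proof -
    have "(\<Prod>i\<in>?A. X i w ^ of_bool (i = k)) = (\<Prod>i\<in>?A. if i = k then X k w else 1)"
      by (intro prod.cong) auto
    then show ?thesis using that by (simp only: prod.delta finite.intros if_True)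
  qed
  have eq: "(\<Prod>i\<in>?A. X i w ^ e i) = X m w * X n w * (X p w * X q w)" for w
    unfolding e_def power_add prod.distrib using d[of m w] d[of n w] d[of p w] d[of q w] by simp
  note * = monomial_expectation[of ?A e, OF _ assms, unfolded eq]
  show "integrable M (\<lambda>w. X m w * X n w * (X p w * X q w))"
    using *(1) by simp
  have "(\<Prod>i\<in>?A. \<integral>x. x ^ e i \<partial>std_normal_distribution) =
      of_bool (m = n \<and> p = q) + of_bool (m = p \<and> n = q) + of_bool (m = q \<and> n = p)"
    unfolding e_def
    by (cases "m = n"; cases "m = p"; cases "m = q"; cases "n = p"; cases "n = q"; cases "p = q";
        simp add: std_normal_distribution_moments std_normal_distribution_moments(2)[unfolded power2_eq_square]
          std_normal_distribution_moments(4)[unfolded power4_eq_xxxx mult.assoc] prod.insert_if)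
  then show "(\<integral>w. X m w * X n w * (X p w * X q w) \<partial>M) =
      of_bool (m = n \<and> p = q) + of_bool (m = p \<and> n = q) + of_bool (m = q \<and> n = p)"
    using *(2) by simp
qed

lemma wick2:
  assumes "m \<in> S" "n \<in> S"
  shows "integrable M (\<lambda>w. X m w * X n w)" "(\<integral>w. X m w * X n w \<partial>M) = of_bool (m = n)"
proof -
  show "integrable M (\<lambda>w. X m w * X n w)" "(\<integral>w. X m w * X n w \<partial>M) = of_bool (m = n)"
  proof (atomize (full), cases "m = n")
    case True
    then show "integrable M (\<lambda>w. X m w * X n w) \<and> (\<integral>w. X m w * X n w \<partial>M) = of_bool (m = n)"
      using monomial_expectation[of "{m}" "\<lambda>_. 2"] assms std_normal_distribution_moments(2)
      by (simp add: power2_eq_square)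
  next
    case False
    then show "integrable M (\<lambda>w. X m w * X n w) \<and> (\<integral>w. X m w * X n w \<partial>M) = of_bool (m = n)"
      using monomial_expectation[of "{m, n}" "\<lambda>_. 1"] assms
      by (simp add: std_normal_distribution_moments)
  qed
qed

text \<open>The centred products \<open>z i\<close> and \<open>z j\<close> are uncorrelated unless
  \<open>j\<close> is \<open>i\<close> or its transpose. The transposed term is absorbed by
  \<open>2 * x * y \<le> x^2 + y^2\<close>, which gives the factor 2 for any matrix
  \<open>s\<close>, symmetric or not.\<close>

lemma quadratic_form_variance:
  fixes s :: "'i \<Rightarrow> 'i \<Rightarrow> real"
  assumes I: "finite I" "I \<subseteq> S"
  defines "Q \<equiv> \<lambda>w. \<Sum>m\<in>I. \<Sum>n\<in>I. s m n * (X m w * X n w - of_bool (m = n))"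
  shows "integrable M (\<lambda>w. (Q w)\<^sup>2)" "(\<integral>w. (Q w)\<^sup>2 \<partial>M) \<le> 2 * (\<Sum>m\<in>I. \<Sum>n\<in>I. (s m n)\<^sup>2)"
proof -
  define z where "z i w = X (fst i) w * X (snd i) w - of_bool (fst i = snd i)" for i w
  define t where "t i = s (fst i) (snd i)" for i
  let ?I = "I \<times> I"
  have zz: "z i w * z j w = X (fst i) w * X (snd i) w * (X (fst j) w * X (snd j) w)
      - of_bool (fst i = snd i) * (X (fst j) w * X (snd j) w)
      - of_bool (fst j = snd j) * (X (fst i) w * X (snd i) w)
      + of_bool (fst i = snd i) * of_bool (fst j = snd j)" for i j w
    by (simp add: z_def algebra_simps)
  have int_zz: "integrable M (\<lambda>w. z i w * z j w)" and
    E_zz: "(\<integral>w. z i w * z j w \<partial>M) = of_bool (j = i) + of_bool (j = (snd i, fst i))"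
    if ij: "i \<in> ?I" "j \<in> ?I" for i j
  proof -
    have S: "fst i \<in> S" "snd i \<in> S" "fst j \<in> S" "snd j \<in> S" using ij I by auto
    then have S4: "{fst i, snd i, fst j, snd j} \<subseteq> S" by auto
    note ints = wick4(1)[OF S4] wick2(1)[OF S(1,2)] wick2(1)[OF S(3,4)]
    show "integrable M (\<lambda>w. z i w * z j w)"
      unfolding zz using ints by (intro Bochner_Integration.integrable_add Bochner_Integration.integrable_diff) auto
    show "(\<integral>w. z i w * z j w \<partial>M) = of_bool (j = i) + of_bool (j = (snd i, fst i))"
    proof -
      have "(\<integral>w. z i w * z j w \<partial>M) = (\<integral>w. X (fst i) w * X (snd i) w * (X (fst j) w * X (snd j) w) \<partial>M)
          - of_bool (fst i = snd i) * (\<integral>w. X (fst j) w * X (snd j) w \<partial>M)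
          - of_bool (fst j = snd j) * (\<integral>w. X (fst i) w * X (snd i) w \<partial>M)
          + of_bool (fst i = snd i) * of_bool (fst j = snd j)"
        unfolding zz using ints by (simp add: prob_space del: of_bool_eq_iff)
      also have "\<dots> = of_bool (j = i) + of_bool (j = (snd i, fst i))"
        unfolding wick4(2)[OF S4] wick2(2)[OF S(1,2)] wick2(2)[OF S(3,4)] prod_eq_iff fst_conv snd_conv of_bool_conj
          eq_commute[of "fst j" "fst i"] eq_commute[of "snd j" "snd i"] eq_commute[of "fst j" "snd i"] eq_commute[of "snd j" "fst i"]
        by (simp only: mult.commute)
      finally show ?thesis .
    qed
  qed
  have Q: "Q w = (\<Sum>i\<in>?I. t i * z i w)" for w
    by (simp add: Q_def sum.cartesian_product case_prod_beta t_def z_def)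
  have Q2: "(Q w)\<^sup>2 = (\<Sum>i\<in>?I. \<Sum>j\<in>?I. t i * t j * (z i w * z j w))" for w
    by (simp add: Q power2_eq_square sum_product mult_ac)
  show "integrable M (\<lambda>w. (Q w)\<^sup>2)"
    unfolding Q2 by (intro Bochner_Integration.integrable_sum integrable_mult_right int_zz)
  have "(\<integral>w. (Q w)\<^sup>2 \<partial>M) = (\<Sum>i\<in>?I. \<Sum>j\<in>?I. t i * t j * (\<integral>w. z i w * z j w \<partial>M))"
    unfolding Q2 using int_zz by (simp add: Bochner_Integration.integral_sum)
  also have "\<dots> = (\<Sum>i\<in>?I. \<Sum>j\<in>?I. (if j = i then t i * t j else 0) + (if j = (snd i, fst i) then t i * t j else 0))"
    by (intro sum.cong refl) (auto simp: E_zz of_bool_def)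
  also have "\<dots> = (\<Sum>i\<in>?I. t i * t i + t i * t (snd i, fst i))"
  proof (rule sum.cong[OF refl])
    fix i assume "i \<in> ?I"
    then show "(\<Sum>j\<in>?I. (if j = i then t i * t j else 0) + (if j = (snd i, fst i) then t i * t j else 0)) =
        t i * t i + t i * t (snd i, fst i)"
      using I by (auto simp: sum.distrib)
  qed
  also have "\<dots> \<le> (\<Sum>i\<in>?I. (3 / 2) * (t i)\<^sup>2 + (1 / 2) * (t (snd i, fst i))\<^sup>2)"
  proof (rule sum_mono)
    fix i
    have "0 \<le> (t i - t (snd i, fst i))\<^sup>2" by simp
    then show "t i * t i + t i * t (snd i, fst i) \<le> (3 / 2) * (t i)\<^sup>2 + (1 / 2) * (t (snd i, fst i))\<^sup>2"
      by (simp add: power2_eq_square algebra_simps)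
  qed
  also have "\<dots> = (3 / 2) * (\<Sum>i\<in>?I. (t i)\<^sup>2) + (1 / 2) * (\<Sum>i\<in>?I. (t (snd i, fst i))\<^sup>2)"
    by (simp add: sum.distrib sum_distrib_left)
  also have "(\<Sum>i\<in>?I. (t (snd i, fst i))\<^sup>2) = (\<Sum>i\<in>?I. (t i)\<^sup>2)"
    by (rule sum.reindex_bij_witness[where i = "\<lambda>i. (snd i, fst i)" and j = "\<lambda>i. (snd i, fst i)"]) auto
  finally show "(\<integral>w. (Q w)\<^sup>2 \<partial>M) \<le> 2 * (\<Sum>m\<in>I. \<Sum>n\<in>I. (s m n)\<^sup>2)"
    by (simp add: sum.cartesian_product case_prod_beta t_def)
qed

lemma integrable_square_poly_growth:
  assumes I: "finite I" "I \<subseteq> S" and f: "f \<in> borel_measurable M"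
    and bound: "\<And>w. \<bar>f w\<bar> \<le> C * (1 + sqrt (\<Sum>i\<in>I. (X i w)\<^sup>2)) ^ p"
  shows "integrable M (\<lambda>w. (f w)\<^sup>2)"
proof -
  let ?g = "\<lambda>x :: real. (1 + \<bar>x\<bar>) ^ (2 * p)"
  interpret N: prob_space std_normal_distribution
    using real_dist_normal_dist by (simp add: real_distribution_def)
  have "integrable std_normal_distribution ?g"
  proof (rule Bochner_Integration.integrable_bound)
    show "integrable std_normal_distribution (\<lambda>x. 2 ^ (2 * p) * (1 + x ^ (2 * p)))"
      using integrable_std_normal_distribution_moment by (intro integrable_mult_right Bochner_Integration.integrable_add) auto
    show "AE x in std_normal_distribution. norm (?g x) \<le> norm (2 ^ (2 * p) * (1 + x ^ (2 * p)))"
    proof (rule AE_I2)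
      fix x :: real
      have "(1 + \<bar>x\<bar>) ^ (2 * p) \<le> (2 * max 1 \<bar>x\<bar>) ^ (2 * p)" by (intro power_mono) auto
      also have "\<dots> = 2 ^ (2 * p) * (max 1 \<bar>x\<bar>) ^ (2 * p)" by (rule power_mult_distrib)
      also have "(max 1 \<bar>x\<bar>) ^ (2 * p) \<le> 1 + \<bar>x\<bar> ^ (2 * p)" by (auto simp: max_def)
      finally have "(1 + \<bar>x\<bar>) ^ (2 * p) \<le> 2 ^ (2 * p) * (1 + \<bar>x\<bar> ^ (2 * p))" by simp
      then show "norm (?g x) \<le> norm (2 ^ (2 * p) * (1 + x ^ (2 * p)))"
        by (simp add: power_even_abs abs_mult)
    qed
  qed simp
  then have "integrable M (\<lambda>w. ?g (X i w))" if "i \<in> I" for i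
    using integral_X(1)[of i ?g] that I by auto
  then have "integrable M (\<lambda>w. \<Prod>i\<in>I. ?g (X i w))"
    by (intro indep_vars_integrable[OF I(1)] indep_vars_fun[OF I(2)]) auto
  then have "integrable M (\<lambda>w. C\<^sup>2 * (\<Prod>i\<in>I. ?g (X i w)))" by simp
  then show ?thesis
  proof (rule Bochner_Integration.integrable_bound)
    show "(\<lambda>w. (f w)\<^sup>2) \<in> borel_measurable M" using f by simp
    show "AE w in M. norm ((f w)\<^sup>2) \<le> norm (C\<^sup>2 * (\<Prod>i\<in>I. ?g (X i w)))"
    proof (rule AE_I2)
      fix w
      have "sqrt (\<Sum>i\<in>I. (X i w)\<^sup>2) \<le> (\<Sum>i\<in>I. \<bar>X i w\<bar>)"
        using L2_set_le_sum_abs[of "\<lambda>i. X i w" I] by (simp add: L2_set_def)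
      then have "1 + sqrt (\<Sum>i\<in>I. (X i w)\<^sup>2) \<le> (\<Prod>i\<in>I. 1 + \<bar>X i w\<bar>)"
        using one_plus_sum_le_prod[OF I(1), of "\<lambda>i. \<bar>X i w\<bar>"] by simp
      moreover have "0 \<le> sqrt (\<Sum>i\<in>I. (X i w)\<^sup>2)" by (simp add: sum_nonneg)
      ultimately have le: "(1 + sqrt (\<Sum>i\<in>I. (X i w)\<^sup>2)) ^ (2 * p) \<le> (\<Prod>i\<in>I. 1 + \<bar>X i w\<bar>) ^ (2 * p)"
        by (intro power_mono) auto
      have "(f w)\<^sup>2 = \<bar>f w\<bar>\<^sup>2" by simp
      also have "\<dots> \<le> (C * (1 + sqrt (\<Sum>i\<in>I. (X i w)\<^sup>2)) ^ p)\<^sup>2"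
        by (rule power_mono[OF bound]) simp
      also have "\<dots> = C\<^sup>2 * (1 + sqrt (\<Sum>i\<in>I. (X i w)\<^sup>2)) ^ (2 * p)"
        by (simp add: power_mult_distrib mult.commute flip: power_mult)
      also have "\<dots> \<le> C\<^sup>2 * (\<Prod>i\<in>I. 1 + \<bar>X i w\<bar>) ^ (2 * p)"
        by (intro mult_left_mono le) simp
      also have "\<dots> = C\<^sup>2 * (\<Prod>i\<in>I. ?g (X i w))"
        by (simp only: prod_power_distrib)
      finally show "norm ((f w)\<^sup>2) \<le> norm (C\<^sup>2 * (\<Prod>i\<in>I. ?g (X i w)))" by simp
    qed
  qed
qed

subsection \<open>Differentiation in time\<close>

lemma continuous_on_section:
  fixes u :: "real \<Rightarrow> ('i \<Rightarrow> real) \<Rightarrow> real"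
  assumes "continuous_on ({0..T} \<times> UNIV) (\<lambda>(t, c). u t c)"
  shows "t \<in> {0..T} \<Longrightarrow> continuous_on UNIV (u t)" "continuous_on {0..T} (\<lambda>t. u t c)"
proof -
  show "t \<in> {0..T} \<Longrightarrow> continuous_on UNIV (u t)"
    using continuous_on_compose2[OF assms] continuous_on_Pair[OF continuous_on_const continuous_on_id]
    by force
  show "continuous_on {0..T} (\<lambda>t. u t c)"
    using continuous_on_compose2[OF assms] continuous_on_Pair[OF continuous_on_id continuous_on_const]
    by force
qed

lemma time_cutoff_bound:
  fixes u :: "real \<Rightarrow> ('i \<Rightarrow> real) \<Rightarrow> real"
  assumes I: "finite I" and R: "R > 0" and u: "continuous_on ({0..T} \<times> UNIV) (\<lambda>(t, c). u t c)"
  obtains B where "\<And>t w. t \<in> {0..T} \<Longrightarrow> \<bar>u t (vec I w) * cutoff I R (vec I w)\<bar> \<le> B"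
proof -
  obtain B where B: "B \<ge> 0" "\<And>t c. t \<in> {0..T} \<Longrightarrow> c \<in> box_on I (sqrt R) \<Longrightarrow> \<bar>u t c\<bar> \<le> B"
    using bounded_on_time_box[OF u] by metis
  show thesis
  proof (rule that)
    fix t w assume t: "t \<in> {0..T}"
    show "\<bar>u t (vec I w) * cutoff I R (vec I w)\<bar> \<le> B"
    proof (cases "cutoff I R (vec I w) = 0")
      case False
      then have "vec I w \<in> box_on I (sqrt R)"
        unfolding box_on_def using cutoff_support[OF I R, of "vec I w"] by (auto, simp add: vec_def)
      then have "\<bar>u t (vec I w)\<bar> * \<bar>cutoff I R (vec I w)\<bar> \<le> B * 1"
        using B t cutoff_bounds[OF R, of I "vec I w"] by (intro mult_mono) auto
      then show ?thesis by (simp add: abs_mult)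
    qed (use B in simp)
  qed
qed

lemma continuous_on_expectation_cutoff:
  fixes u :: "real \<Rightarrow> ('i \<Rightarrow> real) \<Rightarrow> real"
  assumes I: "finite I" "I \<subseteq> S" and R: "R > 0" and u: "continuous_on ({0..T} \<times> UNIV) (\<lambda>(t, c). u t c)"
  shows "continuous_on {0..T} (\<lambda>t. \<integral>w. u t (vec I w) * cutoff I R (vec I w) \<partial>M)"
  unfolding continuous_on_sequentially
proof safe
  fix x a assume xa: "\<forall>n. x n \<in> {0..T}" "a \<in> {0..T}" "x \<longlonglongrightarrow> a"
  obtain B where B: "\<And>t w. t \<in> {0..T} \<Longrightarrow> \<bar>u t (vec I w) * cutoff I R (vec I w)\<bar> \<le> B"
    using time_cutoff_bound[OF I(1) R u] by metis
  have "(\<lambda>n. \<integral>w. u (x n) (vec I w) * cutoff I R (vec I w) \<partial>M) \<longlonglongrightarrow> (\<integral>w. u a (vec I w) * cutoff I R (vec I w) \<partial>M)"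
  proof (rule integral_dominated_convergence[where w = "\<lambda>_. B"])
    show "(\<lambda>w. u a (vec I w) * cutoff I R (vec I w)) \<in> borel_measurable M"
      using integrable_cutoff[OF I R continuous_on_section(1)[OF u xa(2)]] by simp
    show "(\<lambda>w. u (x n) (vec I w) * cutoff I R (vec I w)) \<in> borel_measurable M" for n
      using integrable_cutoff[OF I R continuous_on_section(1)[OF u]] xa(1) by blast
    show "AE w in M. (\<lambda>n. u (x n) (vec I w) * cutoff I R (vec I w)) \<longlonglongrightarrow> u a (vec I w) * cutoff I R (vec I w)"
      using continuous_on_section(2)[OF u] xa unfolding continuous_on_sequentially
      by (intro AE_I2 tendsto_mult tendsto_const) (auto simp: comp_def)
    show "AE w in M. norm (u (x n) (vec I w) * cutoff I R (vec I w)) \<le> B" for n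
      using B xa(1) by (intro AE_I2) auto
  qed auto
  then show "((\<lambda>t. \<integral>w. u t (vec I w) * cutoff I R (vec I w) \<partial>M) \<circ> x) \<longlonglongrightarrow> (\<integral>w. u a (vec I w) * cutoff I R (vec I w) \<partial>M)"
    by (simp add: comp_def)
qed

lemma has_derivative_expectation_cutoff:
  fixes u u' :: "real \<Rightarrow> ('i \<Rightarrow> real) \<Rightarrow> real"
  assumes I: "finite I" "I \<subseteq> S" and R: "R > 0"
    and u: "continuous_on ({0..T} \<times> UNIV) (\<lambda>(t, c). u t c)"
    and u': "continuous_on ({0..T} \<times> UNIV) (\<lambda>(t, c). u' t c)"
    and deriv: "\<And>t w. t \<in> {0..T} \<Longrightarrow> ((\<lambda>t. u t (vec I w)) has_real_derivative u' t (vec I w)) (at t within {0..T})"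
    and t: "t \<in> {0..T}"
  shows "((\<lambda>t. \<integral>w. u t (vec I w) * cutoff I R (vec I w) \<partial>M) has_real_derivative
    (\<integral>w. u' t (vec I w) * cutoff I R (vec I w) \<partial>M)) (at t within {0..T})"
proof -
  obtain B where B: "\<And>t w. t \<in> {0..T} \<Longrightarrow> \<bar>u' t (vec I w) * cutoff I R (vec I w)\<bar> \<le> B"
    using time_cutoff_bound[OF I(1) R u'] by metis
  show ?thesis
  proof (rule has_derivative_integral_dominated[where g = "\<lambda>_. B", OF _ t])
    show "integrable M (\<lambda>w. u s (vec I w) * cutoff I R (vec I w))" if "s \<in> {0..T}" for s
      by (rule integrable_cutoff[OF I R continuous_on_section(1)[OF u that]])
    show "(\<lambda>w. u' t (vec I w) * cutoff I R (vec I w)) \<in> borel_measurable M"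
      using integrable_cutoff[OF I R continuous_on_section(1)[OF u' t]] by simp
    show "((\<lambda>s. u s (vec I w) * cutoff I R (vec I w)) has_real_derivative u' s (vec I w) * cutoff I R (vec I w)) (at s within {0..T})"
      if "s \<in> {0..T}" for s w
      using deriv[OF that] by (auto intro!: derivative_eq_intros)
  qed (use B in auto)
qed

end

subsection \<open>The Galerkin operator in coordinates\<close>

definition noise_drift :: "nat \<Rightarrow> mode \<Rightarrow> mode \<Rightarrow> (mode \<Rightarrow> real) \<Rightarrow> real" where
  "noise_drift N k j c = (\<Sum>l\<in>modes N. noise_coeff k j l * c l)"

definition euler_drift :: "nat \<Rightarrow> mode \<Rightarrow> (mode \<Rightarrow> real) \<Rightarrow> real" where
  "euler_drift N j c = (\<Sum>(a, b)\<in>modes N \<times> modes N. drift_coeff j a b * (c a * c b))"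

lemma C1_noise_drift: "C1 I (noise_drift N k j)"
  unfolding noise_drift_def[abs_def] by (intro C1_sum C1_mult C1_const C1_coord)

lemma C1_euler_drift: "C1 I (euler_drift N j)"
  unfolding euler_drift_def[abs_def] case_prod_beta by (intro C1_sum C1_mult C1_const C1_coord)

lemma sum_skew_eq_0:
  fixes s :: "'a \<Rightarrow> 'a \<Rightarrow> real"
  assumes "\<And>i j. i \<in> I \<Longrightarrow> j \<in> I \<Longrightarrow> s i j = - s j i"
  shows "(\<Sum>i\<in>I. \<Sum>j\<in>I. s i j * (x i * x j)) = 0"
proof -
  have "(\<Sum>i\<in>I. \<Sum>j\<in>I. s i j * (x i * x j)) = (\<Sum>j\<in>I. \<Sum>i\<in>I. s i j * (x i * x j))"
    by (rule sum.swap)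
  also have "\<dots> = (\<Sum>j\<in>I. \<Sum>i\<in>I. - (s j i * (x j * x i)))"
    by (intro sum.cong refl, subst assms) auto
  also have "\<dots> = - (\<Sum>j\<in>I. \<Sum>i\<in>I. s j i * (x j * x i))"
    by (simp add: sum_negf)
  finally show ?thesis by simp
qed

lemma noise_drift_tangent: "(\<Sum>j\<in>modes N. c j * noise_drift N k j c) = 0"
proof -
  have "(\<Sum>j\<in>modes N. c j * noise_drift N k j c) = (\<Sum>j\<in>modes N. \<Sum>l\<in>modes N. noise_coeff k j l * (c j * c l))"
    by (simp add: noise_drift_def sum_distrib_left mult_ac)
  also have "\<dots> = 0"
    by (rule sum_skew_eq_0) (auto intro: noise_coeff_skew dest: modes_nonzero)
  finally show ?thesis .
qed

lemma drift_coeff_skew: "j \<noteq> 0 \<Longrightarrow> b \<noteq> 0 \<Longrightarrow> drift_coeff j a b = - drift_coeff b a j"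
  using adv_skew[of b j "- a"] by (simp add: drift_coeff_def)

text \<open>Conservation of enstrophy: for each advecting mode \<open>a\<close> the matrix of
  \<open>drift_coeff\<close> in \<open>(j, b)\<close> is skew.\<close>

lemma euler_drift_tangent: "(\<Sum>j\<in>modes N. c j * euler_drift N j c) = 0"
proof -
  have "(\<Sum>j\<in>modes N. c j * euler_drift N j c) =
      (\<Sum>j\<in>modes N. \<Sum>a\<in>modes N. \<Sum>b\<in>modes N. c a * (drift_coeff j a b * (c j * c b)))"
    unfolding euler_drift_def sum_distrib_left sum.cartesian_product[symmetric]
    by (intro sum.cong refl) (simp add: mult_ac)
  also have "\<dots> = (\<Sum>a\<in>modes N. c a * (\<Sum>j\<in>modes N. \<Sum>b\<in>modes N. drift_coeff j a b * (c j * c b)))"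
    unfolding sum_distrib_left by (rule sum.swap)
  also have "\<dots> = (\<Sum>a\<in>modes N. c a * 0)"
  proof (intro sum.cong refl arg_cong[where f = "(*) _"])
    fix a
    show "(\<Sum>j\<in>modes N. \<Sum>b\<in>modes N. drift_coeff j a b * (c j * c b)) = 0"
      by (rule sum_skew_eq_0) (auto intro: drift_coeff_skew dest: modes_nonzero)
  qed
  finally show ?thesis by simp
qed

lemma noise_drift_upd:
  assumes "j \<in> modes N"
  shows "noise_drift N k j (c(j := y)) = noise_drift N k j c"
proof -
  have "noise_coeff k j j = 0"
    using modes_nonzero[OF assms] by (simp add: noise_coeff_def adv_same)
  then show ?thesis unfolding noise_drift_def by (intro sum.cong) auto
qed

text \<open>Terms with \<open>b = j\<close> vanish by skew-symmetry. Terms with \<open>a = j\<close>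
  vanish because, after exchanging \<open>j\<close> and \<open>b\<close>, they contain the transport
  of mode \<open>j\<close> by its own velocity.\<close>

lemma euler_drift_upd:
  assumes "j \<in> modes N"
  shows "euler_drift N j (c(j := y)) = euler_drift N j c"
proof -
  have "drift_coeff j a j = 0" for a
    using modes_nonzero[OF assms] by (simp add: drift_coeff_def adv_same)
  moreover have "drift_coeff j j b = 0" if "b \<in> modes N" for b
    using drift_coeff_skew[of j b j] modes_nonzero[OF assms] modes_nonzero[OF that]
    by (simp add: drift_coeff_def)
  ultimately show ?thesis unfolding euler_drift_def by (intro sum.cong refl) (auto simp: split_beta)
qed

text \<open>The sign \<open>s = 1\<close> gives the operator in the equation for the solutions,
  \<open>s = - 1\<close> its Gaussian adjoint, which acts on test functions.\<close>

definition galerkin_op :: "real \<Rightarrow> nat \<Rightarrow> ((mode \<Rightarrow> real) \<Rightarrow> real) \<Rightarrow> (mode \<Rightarrow> real) \<Rightarrow> real" where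
  "galerkin_op s N \<phi> c =
    1 / 2 * (\<Sum>k\<in>noise_modes N. dd (modes N) (noise_drift N k) (dd (modes N) (noise_drift N k) \<phi>) c)
    + s * dd (modes N) (euler_drift N) \<phi> c"

lemma along_trig_poly:
  assumes "\<And>c. V (trig_poly N c) = trig_poly N (\<lambda>j. v j c)"
  shows "along N V \<phi> (trig_poly N c) = dd (modes N) v (\<lambda>c. \<phi> (trig_poly N c)) c"
proof -
  have "nabla N \<phi> (trig_poly N c) = trig_poly N (\<lambda>k. pd k (\<lambda>c. \<phi> (trig_poly N c)) c)"
    unfolding nabla_def pd_def by (intro trig_poly_cong) (simp add: shift_trig_poly)
  then show ?thesis
    by (simp add: along_def assms L2inner_trig_poly dd_def)
qed

lemma LN_adj_trig_poly:
  assumes "biot_savart_kernel K"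
  shows "LN_adj 2 K N \<phi> (trig_poly N c) = galerkin_op 1 N (\<lambda>c. \<phi> (trig_poly N c)) c"
proof -
  have 1: "along N (GN 2 N k) \<phi> (trig_poly N c) = dd (modes N) (noise_drift N k) (\<lambda>c. \<phi> (trig_poly N c)) c"
    if "k \<in> noise_modes N" for k \<phi> c
    by (rule along_trig_poly) (simp add: GN_trig_poly[OF noise_modes_Z20[OF that]] noise_drift_def)
  have 2: "along N (bN K N) \<phi> (trig_poly N c) = dd (modes N) (euler_drift N) (\<lambda>c. \<phi> (trig_poly N c)) c"
    by (rule along_trig_poly) (simp add: bN_trig_poly[OF assms] euler_drift_def)
  show ?thesis
    unfolding LN_adj_def galerkin_op_def 2 by (simp add: 1)
qed

definition C2 :: "'i set \<Rightarrow> (('i \<Rightarrow> real) \<Rightarrow> real) \<Rightarrow> bool" where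
  "C2 I \<phi> \<longleftrightarrow> C1 I \<phi> \<and> (\<forall>i\<in>I. C1 I (pd i \<phi>))"

lemma C1_dd:
  assumes "C2 I \<phi>" "\<And>j. j \<in> I \<Longrightarrow> C1 I (V j)"
  shows "C1 I (dd I V \<phi>)"
  using assms unfolding dd_def[abs_def] C2_def by (intro C1_sum C1_mult) auto

lemma continuous_on_galerkin_op:
  assumes "C2 (modes N) \<phi>"
  shows "continuous_on UNIV (galerkin_op s N \<phi>)"
proof -
  have "continuous_on UNIV (dd (modes N) (euler_drift N) \<phi>)"
    using assms by (intro continuous_on_dd C1_continuous[OF C1_euler_drift]) (auto simp: C2_def)
  moreover have "continuous_on UNIV (dd (modes N) (noise_drift N k) (dd (modes N) (noise_drift N k) \<phi>))" for k
    using assms by (intro continuous_on_dd C1_dd C1_continuous[OF C1_noise_drift] C1_noise_drift)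
  ultimately show ?thesis
    unfolding galerkin_op_def[abs_def] by (intro continuous_intros)
qed

text \<open>Classical regularity together with the equation; integrability at positive times is a
  consequence, derived in \<open>energy\<close>.\<close>

definition coordinate_solution :: "real \<Rightarrow> nat \<Rightarrow> (real \<Rightarrow> (mode \<Rightarrow> real) \<Rightarrow> real) \<Rightarrow> bool" where
  "coordinate_solution T N u \<longleftrightarrow>
    continuous_on ({0..T} \<times> UNIV) (\<lambda>(t, c). u t c) \<and>
    continuous_on ({0..T} \<times> UNIV) (\<lambda>(t, c). galerkin_op 1 N (u t) c) \<and>
    (\<forall>t\<in>{0..T}. C2 (modes N) (u t)) \<and>
    (\<forall>t\<in>{0..T}. \<forall>c. ((\<lambda>t. u t c) has_real_derivative galerkin_op 1 N (u t) c) (at t within {0..T}))"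

section \<open>Integration by parts for the Galerkin operator under the cutoff\<close>

locale mode_gaussian = gaussian_family M X Z20
  for M :: "'w measure" and X :: "mode \<Rightarrow> 'w \<Rightarrow> real"
begin

text \<open>Expectation weighted by the cutoff, for which every continuous function of the
  coordinates is integrable.\<close>

definition EC :: "nat \<Rightarrow> real \<Rightarrow> ((mode \<Rightarrow> real) \<Rightarrow> real) \<Rightarrow> real" where
  "EC N R f = (\<integral>w. f (vec (modes N) w) * cutoff (modes N) R (vec (modes N) w) \<partial>M)"

lemma EC_add:
  assumes "R > 0" "continuous_on UNIV f" "continuous_on UNIV g"
  shows "EC N R (\<lambda>c. f c + g c) = EC N R f + EC N R g"
  unfolding EC_def distrib_right using assms
  by (intro Bochner_Integration.integral_add integrable_cutoff) (auto simp: modes_subset)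

lemma EC_cmult: "EC N R (\<lambda>c. a * f c) = a * EC N R f"
  unfolding EC_def mult.assoc by simp

lemma EC_sum:
  assumes "R > 0" "finite A" "\<And>k. k \<in> A \<Longrightarrow> continuous_on UNIV (f k)"
  shows "EC N R (\<lambda>c. \<Sum>k\<in>A. f k c) = (\<Sum>k\<in>A. EC N R (f k))"
  unfolding EC_def sum_distrib_right using assms
  by (intro Bochner_Integration.integral_sum integrable_cutoff) (auto simp: modes_subset)

lemma EC_noise:
  assumes "R > 0" "C1 (modes N) \<phi>"
  shows "EC N R (dd (modes N) (noise_drift N k) \<phi>) = 0"
  unfolding EC_def using assms
  by (intro expectation_dd_cutoff modes_subset)
    (auto intro: C1_continuous[OF C1_noise_drift] simp: noise_drift_upd noise_drift_tangent)

lemma EC_drift: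
  assumes "R > 0" "C1 (modes N) \<phi>"
  shows "EC N R (dd (modes N) (euler_drift N) \<phi>) = 0"
  unfolding EC_def using assms
  by (intro expectation_dd_cutoff modes_subset)
    (auto intro: C1_continuous[OF C1_euler_drift] simp: euler_drift_upd euler_drift_tangent)

text \<open>The weighted mean of \<open>D\<close> applied to \<open>w * D u\<close> is 0, because
  the tangential field \<open>D\<close> does not see the cutoff; the product rule does the
  rest.\<close>

lemma EC_noise_noise:
  fixes N k
  defines "D \<equiv> dd (modes N) (noise_drift N k)"
  assumes R: "R > 0" and u: "C2 (modes N) u" and w: "C2 (modes N) w"
  shows "EC N R (\<lambda>c. w c * D (D u) c) = - EC N R (\<lambda>c. D w c * D u c)"
proof -
  have Du: "C1 (modes N) (D u)" and w1: "C1 (modes N) w" and u1: "C1 (modes N) u"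
    using u w unfolding D_def by (auto intro!: C1_dd C1_noise_drift simp: C2_def)
  have contD: "continuous_on UNIV (D f)" if "C1 (modes N) f" for f
    unfolding D_def by (intro continuous_on_dd that C1_continuous[OF C1_noise_drift])
  have "0 = EC N R (D (\<lambda>c. w c * D u c))"
    unfolding D_def using EC_noise[OF R C1_mult[OF w1 Du]] unfolding D_def by simp
  also have "\<dots> = EC N R (\<lambda>c. D w c * D u c + w c * D (D u) c)"
    unfolding D_def by (subst dd_mult[OF w1 Du[unfolded D_def], abs_def]) simp
  also have "\<dots> = EC N R (\<lambda>c. D w c * D u c) + EC N R (\<lambda>c. w c * D (D u) c)"
    by (intro EC_add R continuous_on_mult contD C1_continuous[OF w1] w1 u1 Du)
  finally show ?thesis by simp
qed

lemma EC_drift_skew: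
  fixes N
  defines "D \<equiv> dd (modes N) (euler_drift N)"
  assumes R: "R > 0" and u: "C1 (modes N) u" and w: "C1 (modes N) w"
  shows "EC N R (\<lambda>c. w c * D u c) = - EC N R (\<lambda>c. u c * D w c)"
proof -
  have contD: "continuous_on UNIV (D f)" if "C1 (modes N) f" for f
    unfolding D_def by (intro continuous_on_dd that C1_continuous[OF C1_euler_drift])
  have "0 = EC N R (D (\<lambda>c. w c * u c))"
    unfolding D_def using EC_drift[OF R C1_mult[OF w u]] by simp
  also have "\<dots> = EC N R (\<lambda>c. u c * D w c + w c * D u c)"
    unfolding D_def by (subst dd_mult[OF w u, abs_def]) (simp add: mult.commute)
  also have "\<dots> = EC N R (\<lambda>c. u c * D w c) + EC N R (\<lambda>c. w c * D u c)"
    by (intro EC_add R continuous_on_mult contD C1_continuous[OF w] C1_continuous[OF u] w u)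
  finally show ?thesis by simp
qed

lemma EC_galerkin_op:
  assumes R: "R > 0" and u: "C2 (modes N) u" and w: "C2 (modes N) w"
  shows "EC N R (\<lambda>c. w c * galerkin_op s N u c) =
    - 1 / 2 * (\<Sum>k\<in>noise_modes N. EC N R (\<lambda>c. dd (modes N) (noise_drift N k) w c * dd (modes N) (noise_drift N k) u c))
    + s * EC N R (\<lambda>c. w c * dd (modes N) (euler_drift N) u c)"
proof -
  let ?D = "\<lambda>k. dd (modes N) (noise_drift N k)"
  let ?b = "dd (modes N) (euler_drift N)"
  have w0: "continuous_on UNIV w" and u1: "C1 (modes N) u"
    using u w by (auto simp: C2_def intro: C1_continuous)
  have c1: "continuous_on UNIV (\<lambda>c. w c * ?D k (?D k u) c)" for k
    by (intro continuous_on_mult w0 continuous_on_dd C1_dd u C1_noise_drift C1_continuous[OF C1_noise_drift[of UNIV]])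
  have c2: "continuous_on UNIV (\<lambda>c. w c * ?b u c)"
    by (intro continuous_on_mult w0 continuous_on_dd u1 C1_continuous[OF C1_euler_drift])
  have "EC N R (\<lambda>c. w c * galerkin_op s N u c) =
      EC N R (\<lambda>c. 1 / 2 * (\<Sum>k\<in>noise_modes N. w c * ?D k (?D k u) c) + s * (w c * ?b u c))"
    unfolding galerkin_op_def by (simp add: distrib_left sum_distrib_left mult_ac)
  also have "\<dots> = EC N R (\<lambda>c. 1 / 2 * (\<Sum>k\<in>noise_modes N. w c * ?D k (?D k u) c)) + EC N R (\<lambda>c. s * (w c * ?b u c))"
    by (intro EC_add R continuous_on_mult continuous_on_const continuous_on_sum c1 c2)
  also have "\<dots> = 1 / 2 * (\<Sum>k\<in>noise_modes N. EC N R (\<lambda>c. w c * ?D k (?D k u) c)) + s * EC N R (\<lambda>c. w c * ?b u c)"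
    unfolding EC_cmult EC_sum[OF R finite_noise_modes c1] ..
  also have "(\<Sum>k\<in>noise_modes N. EC N R (\<lambda>c. w c * ?D k (?D k u) c)) = - (\<Sum>k\<in>noise_modes N. EC N R (\<lambda>c. ?D k w c * ?D k u c))"
    by (simp add: EC_noise_noise[OF R u w] sum_negf)
  finally show ?thesis by simp
qed

text \<open>The noise part is symmetric and the drift is skew, so that passing to the adjoint only
  reverses the sign of the drift.\<close>

lemma EC_galerkin_op_dual:
  assumes R: "R > 0" and u: "C2 (modes N) u" and w: "C2 (modes N) w"
  shows "EC N R (\<lambda>c. w c * galerkin_op 1 N u c) = EC N R (\<lambda>c. u c * galerkin_op (- 1) N w c)"
  using EC_drift_skew[OF R, of N u w] u w
  unfolding EC_galerkin_op[OF R u w] EC_galerkin_op[OF R w u]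
  by (simp add: mult.commute C2_def)

text \<open>With \<open>w = u\<close> skew-symmetry cancels the drift, and the noise leaves minus a
  sum of squares.\<close>

lemma EC_galerkin_op_dissipative:
  assumes R: "R > 0" and u: "C2 (modes N) u"
  shows "EC N R (\<lambda>c. u c * galerkin_op 1 N u c) \<le> 0"
proof -
  have "EC N R (\<lambda>c. u c * dd (modes N) (euler_drift N) u c) = 0"
    using EC_drift_skew[OF R, of N u u] u by (simp add: C2_def)
  moreover have "0 \<le> EC N R (\<lambda>c. f c * f c)" for f
    unfolding EC_def
    by (intro Bochner_Integration.integral_nonneg mult_nonneg_nonneg[of "_ * _"] cutoff_bounds(1)[OF R]) simp
  ultimately show ?thesis
    unfolding EC_galerkin_op[OF R u u] by (simp add: sum_nonneg)
qed

subsection \<open>Energy and duality for solutions\<close>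

context
  fixes T :: real and N :: nat and u :: "real \<Rightarrow> (mode \<Rightarrow> real) \<Rightarrow> real"
  assumes T: "T > 0" and sol: "coordinate_solution T N u"
begin

lemma u_cont: "continuous_on ({0..T} \<times> UNIV) (\<lambda>(t, c). u t c)"
  and u'_cont: "continuous_on ({0..T} \<times> UNIV) (\<lambda>(t, c). galerkin_op 1 N (u t) c)"
  and u_C2: "t \<in> {0..T} \<Longrightarrow> C2 (modes N) (u t)"
  and u_deriv: "t \<in> {0..T} \<Longrightarrow>
      ((\<lambda>t. u t c) has_real_derivative galerkin_op 1 N (u t) c) (at t within {0..T})"
  using sol by (auto simp: coordinate_solution_def)

lemma energy_cutoff:
  assumes R: "R > 0" and t: "t \<in> {0..T}"
  shows "EC N R (\<lambda>c. (u t c)\<^sup>2) \<le> EC N R (\<lambda>c. (u 0 c)\<^sup>2)"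
proof (cases "t = 0")
  case False
  then have t0: "0 < t" using t by simp
  have sq_cont: "continuous_on ({0..T} \<times> UNIV) (\<lambda>(t, c). (u t c)\<^sup>2)"
    using continuous_on_power[OF u_cont, of 2] by (simp add: case_prod_beta')
  have sq'_cont: "continuous_on ({0..T} \<times> UNIV) (\<lambda>(t, c). 2 * (u t c * galerkin_op 1 N (u t) c))"
    using continuous_on_mult_left[OF continuous_on_mult[OF u_cont u'_cont], of 2] by (simp add: case_prod_beta')
  have d: "((\<lambda>t. EC N R (\<lambda>c. (u t c)\<^sup>2)) has_real_derivative EC N R (\<lambda>c. 2 * (u s c * galerkin_op 1 N (u s) c))) (at s within {0..T})"
    if "s \<in> {0..T}" for s
    unfolding EC_def
  proof (rule has_derivative_expectation_cutoff[OF finite_modes modes_subset R sq_cont sq'_cont _ that])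
    fix t w assume "t \<in> {0..T}"
    from u_deriv[OF this, of "vec (modes N) w"]
    show "((\<lambda>t. (u t (vec (modes N) w))\<^sup>2) has_real_derivative
        2 * (u t (vec (modes N) w) * galerkin_op 1 N (u t) (vec (modes N) w))) (at t within {0..T})"
      by (auto intro!: derivative_eq_intros)
  qed
  show ?thesis
  proof (rule DERIV_nonpos_imp_decreasing_open[OF less_imp_le[OF t0]])
    show "continuous_on {0..t} (\<lambda>t. EC N R (\<lambda>c. (u t c)\<^sup>2))"
      using DERIV_continuous[OF d] t
      by (intro continuous_on_subset[where s = "{0..T}" and t = "{0..t}"])
        (auto simp: continuous_on_eq_continuous_within)
    fix s assume s: "0 < s" "s < t"
    then have "at s within {0..T} = at s" using t by (intro at_within_interior) auto
    moreover have "EC N R (\<lambda>c. 2 * (u s c * galerkin_op 1 N (u s) c)) \<le> 0"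
      unfolding EC_cmult using EC_galerkin_op_dissipative[OF R u_C2, of s] s t by simp
    ultimately show "\<exists>y. ((\<lambda>t. EC N R (\<lambda>c. (u t c)\<^sup>2)) has_real_derivative y) (at s) \<and> y \<le> 0"
      using d[of s] s t by auto
  qed
qed simp

text \<open>Fatou's lemma as the cutoff radius tends to infinity; the finite right-hand side gives
  the integrability at time \<open>t\<close>.\<close>

lemma energy:
  assumes t: "t \<in> {0..T}" and int0: "integrable M (\<lambda>w. (u 0 (vec (modes N) w))\<^sup>2)"
  shows "integrable M (\<lambda>w. (u t (vec (modes N) w))\<^sup>2)"
    "(\<integral>w. (u t (vec (modes N) w))\<^sup>2 \<partial>M) \<le> (\<integral>w. (u 0 (vec (modes N) w))\<^sup>2 \<partial>M)"
proof -
  let ?v = "\<lambda>w. vec (modes N) w"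
  let ?c = "\<lambda>n w. cutoff (modes N) (real (Suc n)) (?v w)"
  have cont: "continuous_on UNIV (u s)" if "s \<in> {0..T}" for s
    using u_C2[OF that] by (auto simp: C2_def intro: C1_continuous)
  have int: "integrable M (\<lambda>w. (u s (?v w))\<^sup>2 * ?c n w)" if "s \<in> {0..T}" for s n
    using integrable_cutoff[OF finite_modes modes_subset, of "real (Suc n)" "\<lambda>c. (u s c)\<^sup>2"] cont[OF that]
    by (auto intro: continuous_on_power)
  have cb: "0 \<le> ?c n w" "?c n w \<le> 1" for n w
    by (rule cutoff_bounds; simp)+
  have le: "(\<integral>\<^sup>+w. ennreal ((u t (?v w))\<^sup>2 * ?c n w) \<partial>M) \<le> ennreal (\<integral>w. (u 0 (?v w))\<^sup>2 \<partial>M)" for n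
  proof -
    have "(\<integral>\<^sup>+w. ennreal ((u t (?v w))\<^sup>2 * ?c n w) \<partial>M) = ennreal (\<integral>w. (u t (?v w))\<^sup>2 * ?c n w \<partial>M)"
      using int[OF t] cb by (intro nn_integral_eq_integral) auto
    also have "(\<integral>w. (u t (?v w))\<^sup>2 * ?c n w \<partial>M) \<le> (\<integral>w. (u 0 (?v w))\<^sup>2 * ?c n w \<partial>M)"
      using energy_cutoff[OF _ t, of "real (Suc n)"] by (simp add: EC_def)
    also have "\<dots> \<le> (\<integral>w. (u 0 (?v w))\<^sup>2 \<partial>M)"
      using int[of 0] T int0 cb by (intro integral_mono) (auto intro!: mult_left_le)
    finally show ?thesis by (simp add: ennreal_leI)
  qed
  have "(\<integral>\<^sup>+w. ennreal ((u t (?v w))\<^sup>2) \<partial>M) = (\<integral>\<^sup>+w. liminf (\<lambda>n. ennreal ((u t (?v w))\<^sup>2 * ?c n w)) \<partial>M)"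
  proof (rule nn_integral_cong)
    fix w
    have "(\<lambda>n. (u t (?v w))\<^sup>2 * ?c n w) \<longlonglongrightarrow> (u t (?v w))\<^sup>2 * 1"
      by (intro tendsto_intros cutoff_tendsto_1) simp
    then have "(\<lambda>n. ennreal ((u t (?v w))\<^sup>2 * ?c n w)) \<longlonglongrightarrow> ennreal ((u t (?v w))\<^sup>2)"
      by (intro tendsto_ennrealI) simp
    from lim_imp_Liminf[OF _ this]
    show "ennreal ((u t (?v w))\<^sup>2) = liminf (\<lambda>n. ennreal ((u t (?v w))\<^sup>2 * ?c n w))" by simp
  qed
  also have "\<dots> \<le> liminf (\<lambda>n. \<integral>\<^sup>+w. ennreal ((u t (?v w))\<^sup>2 * ?c n w) \<partial>M)"
    using int[OF t] by (intro nn_integral_liminf) auto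
  also have "\<dots> \<le> liminf (\<lambda>n. ennreal (\<integral>w. (u 0 (?v w))\<^sup>2 \<partial>M))"
    by (intro Liminf_mono always_eventually allI le)
  also have "\<dots> = ennreal (\<integral>w. (u 0 (?v w))\<^sup>2 \<partial>M)"
    by (rule Liminf_const) simp
  finally have fin: "(\<integral>\<^sup>+w. ennreal ((u t (?v w))\<^sup>2) \<partial>M) \<le> ennreal (\<integral>w. (u 0 (?v w))\<^sup>2 \<partial>M)" .
  have m: "(\<lambda>w. (u t (?v w))\<^sup>2) \<in> borel_measurable M"
    by (intro borel_measurable_power measurable_vec_continuous cont t modes_subset)
  show i: "integrable M (\<lambda>w. (u t (?v w))\<^sup>2)"
    using fin m by (intro integrableI_nonneg) (auto simp: order_le_less_trans)
  show "(\<integral>w. (u t (?v w))\<^sup>2 \<partial>M) \<le> (\<integral>w. (u 0 (?v w))\<^sup>2 \<partial>M)"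
    using fin unfolding nn_integral_eq_integral[OF i AE_I2[OF zero_le_power2]]
    by (simp add: ennreal_le_iff)
qed

text \<open>The fundamental theorem of calculus in time, with the operator moved onto
  \<open>w\<close>. The cutoff stays at this point: the size of \<open>galerkin_op (- 1) N w\<close>
  is controlled only later, for plane waves.\<close>

lemma duality_cutoff:
  assumes R: "R > 0" and t: "t \<in> {0..T}" and w: "C2 (modes N) w"
  shows "integrable lborel (\<lambda>s. indicator {0..t} s *\<^sub>R EC N R (\<lambda>c. u s c * galerkin_op (- 1) N w c))"
    "(\<integral>s. indicator {0..t} s *\<^sub>R EC N R (\<lambda>c. u s c * galerkin_op (- 1) N w c) \<partial>lborel) =
      EC N R (\<lambda>c. u t c * w c) - EC N R (\<lambda>c. u 0 c * w c)"
proof -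
  have w0: "continuous_on A (\<lambda>z. w (snd z))" for A :: "(real \<times> (mode \<Rightarrow> real)) set"
    by (rule continuous_on_compose2[OF C1_continuous[of "modes N" w] continuous_on_snd[OF continuous_on_id]])
      (use w in \<open>auto simp: C2_def\<close>)
  have c0: "continuous_on ({0..T} \<times> UNIV) (\<lambda>(t, c). u t c * w c)"
    using continuous_on_mult[OF u_cont w0] by (simp add: case_prod_beta')
  have c1: "continuous_on ({0..T} \<times> UNIV) (\<lambda>(t, c). w c * galerkin_op 1 N (u t) c)"
    using continuous_on_mult[OF w0 u'_cont] by (simp add: case_prod_beta')
  have eq: "EC N R (\<lambda>c. w c * galerkin_op 1 N (u s) c) = EC N R (\<lambda>c. u s c * galerkin_op (- 1) N w c)"
    if "s \<in> {0..T}" for s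
    by (rule EC_galerkin_op_dual[OF R u_C2[OF that] w])
  have "continuous_on {0..T} (\<lambda>s. EC N R (\<lambda>c. w c * galerkin_op 1 N (u s) c))"
    unfolding EC_def by (rule continuous_on_expectation_cutoff[OF finite_modes modes_subset R c1])
  then have cont: "continuous_on {0..t} (\<lambda>s. EC N R (\<lambda>c. u s c * galerkin_op (- 1) N w c))"
    by (rule continuous_on_subset[OF continuous_on_eq[OF _ eq]]) (use t in auto)
  have d: "((\<lambda>t. EC N R (\<lambda>c. u t c * w c)) has_vector_derivative EC N R (\<lambda>c. u s c * galerkin_op (- 1) N w c)) (at s within {0..t})"
    if s: "0 \<le> s" "s \<le> t" for s
  proof -
    have sT: "s \<in> {0..T}" using s t by auto
    have "((\<lambda>t. EC N R (\<lambda>c. u t c * w c)) has_real_derivative EC N R (\<lambda>c. w c * galerkin_op 1 N (u s) c)) (at s within {0..T})"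
      unfolding EC_def
    proof (rule has_derivative_expectation_cutoff[OF finite_modes modes_subset R c0 c1 _ sT])
      fix t w' assume "t \<in> {0..T}"
      from u_deriv[OF this, of "vec (modes N) w'"]
      show "((\<lambda>t. u t (vec (modes N) w') * w (vec (modes N) w')) has_real_derivative
          w (vec (modes N) w') * galerkin_op 1 N (u t) (vec (modes N) w')) (at t within {0..T})"
        by (auto intro!: derivative_eq_intros)
    qed
    then show ?thesis
      unfolding eq[OF sT] has_real_derivative_iff_has_vector_derivative
      by (rule has_vector_derivative_within_subset) (use t in auto)
  qed
  have "0 \<le> t" using t by simp
  from has_bochner_integral_FTC_Icc[OF this d cont]
  show "integrable lborel (\<lambda>s. indicator {0..t} s *\<^sub>R EC N R (\<lambda>c. u s c * galerkin_op (- 1) N w c))"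
    "(\<integral>s. indicator {0..t} s *\<^sub>R EC N R (\<lambda>c. u s c * galerkin_op (- 1) N w c) \<partial>lborel) =
      EC N R (\<lambda>c. u t c * w c) - EC N R (\<lambda>c. u 0 c * w c)"
    by (auto simp: has_bochner_integral_iff)
qed

end

end

subsection \<open>Plane-wave test functions\<close>

definition lin :: "'i set \<Rightarrow> ('i \<Rightarrow> real) \<Rightarrow> ('i \<Rightarrow> real) \<Rightarrow> real" where
  "lin J \<beta> c = (\<Sum>j\<in>J. \<beta> j * c j)"

lemma has_pd_lin:
  assumes "finite J"
  shows "has_pd i (lin J \<beta>) (\<lambda>c. if i \<in> J then \<beta> i else 0)"
proof -
  have "has_pd i (lin J \<beta>) (\<lambda>c. \<Sum>j\<in>J. 0 * c j + \<beta> j * (if i = j then 1 else 0))"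
    unfolding lin_def[abs_def] by (intro has_pd_sum has_pd_mult has_pd_const has_pd_coord)
  moreover have "(\<Sum>j\<in>J. 0 * c j + \<beta> j * (if i = j then 1 else 0)) = (if i \<in> J then \<beta> i else 0)" for c :: "'a \<Rightarrow> real"
    using assms by (simp add: if_distrib cong: if_cong)
  ultimately show ?thesis by simp
qed

lemma C1_lin: "C1 I (lin J \<beta>)"
  unfolding lin_def[abs_def] by (intro C1_sum C1_mult C1_const C1_coord)

lemma ridge_function:
  assumes J: "finite J" and g: "\<And>y. (g has_real_derivative g' y) (at y)" and g': "continuous_on UNIV g'"
  shows "C1 I (\<lambda>c. g (lin J \<beta> c))"
    "pd i (\<lambda>c. g (lin J \<beta> c)) = (\<lambda>c. g' (lin J \<beta> c) * (if i \<in> J then \<beta> i else 0))"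
proof -
  have h: "has_pd i (\<lambda>c. g (lin J \<beta> c)) (\<lambda>c. g' (lin J \<beta> c) * (if i \<in> J then \<beta> i else 0))" for i
    by (rule has_pd_compose[OF g has_pd_lin[OF J]])
  have l: "continuous_on UNIV (lin J \<beta>)" by (rule C1_continuous[OF C1_lin[of UNIV]])
  have "continuous_on UNIV g" using g by (meson DERIV_continuous continuous_at_imp_continuous_on)
  then have "continuous_on UNIV (\<lambda>c. g (lin J \<beta> c))" by (rule continuous_on_compose2[OF _ l]) auto
  moreover have "continuous_on UNIV (\<lambda>c. g' (lin J \<beta> c) * (if i \<in> J then \<beta> i else 0))" for i
    by (intro continuous_on_mult continuous_on_const continuous_on_compose2[OF g' l]) auto
  ultimately show "C1 I (\<lambda>c. g (lin J \<beta> c))" by (intro C1I[OF _ h]) auto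
  show "pd i (\<lambda>c. g (lin J \<beta> c)) = (\<lambda>c. g' (lin J \<beta> c) * (if i \<in> J then \<beta> i else 0))"
    by (rule has_pd_imp_pd[OF h])
qed

lemma dd_ridge_function:
  assumes "finite I" "J \<subseteq> I" "\<And>y. (g has_real_derivative g' y) (at y)" "continuous_on UNIV g'"
  shows "dd I V (\<lambda>c. g (lin J \<beta> c)) c = g' (lin J \<beta> c) * (\<Sum>j\<in>J. \<beta> j * V j c)"
proof -
  have J: "finite J" using assms finite_subset by blast
  have "dd I V (\<lambda>c. g (lin J \<beta> c)) c = (\<Sum>i\<in>I. if i \<in> J then g' (lin J \<beta> c) * (\<beta> i * V i c) else 0)"
    unfolding dd_def ridge_function(2)[OF J assms(3,4)] by (intro sum.cong) auto
  also have "\<dots> = (\<Sum>i\<in>J. g' (lin J \<beta> c) * (\<beta> i * V i c))"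
    using assms by (simp add: sum.If_cases Int_absorb1)
  finally show ?thesis by (simp only: sum_distrib_left)
qed

definition plane_wave :: "'i set \<Rightarrow> ('i \<Rightarrow> real) \<Rightarrow> real \<Rightarrow> ('i \<Rightarrow> real) \<Rightarrow> real" where
  "plane_wave J \<beta> \<theta> c = cos (lin J \<beta> c + \<theta>)"

lemma cos_shift_deriv: "((\<lambda>y. cos (y + \<theta>)) has_real_derivative - sin (y + \<theta>)) (at y)"
  and sin_shift_deriv: "((\<lambda>y. - sin (y + \<theta>)) has_real_derivative - cos (y + \<theta>)) (at y)"
  by (auto intro!: derivative_eq_intros)

lemma cos_shift_cont: "continuous_on UNIV (\<lambda>y. - cos (y + \<theta> :: real))"
  and sin_shift_cont: "continuous_on UNIV (\<lambda>y. - sin (y + \<theta> :: real))"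
  by (auto intro!: continuous_intros)

lemma C2_plane_wave:
  assumes "finite J"
  shows "C2 I (plane_wave J \<beta> \<theta>)"
  unfolding C2_def plane_wave_def[abs_def] ridge_function(2)[OF assms cos_shift_deriv sin_shift_cont]
  using assms
  by (intro conjI ballI C1_mult C1_const ridge_function(1)[OF assms cos_shift_deriv sin_shift_cont]
      ridge_function(1)[OF assms sin_shift_deriv cos_shift_cont])

text \<open>The value on \<open>plane_wave J \<beta> \<theta>\<close> of \<open>pi^2 / 2\<close>
  times the sum over \<open>j\<close> of \<open>|j|^2 * (d_j^2 - c_j * d_j)\<close>, where
  \<open>d_j\<close> is the partial derivative. This generates an Ornstein--Uhlenbeck process that
  leaves the standard Gaussian law invariant.\<close>

definition ou_op :: "mode set \<Rightarrow> (mode \<Rightarrow> real) \<Rightarrow> real \<Rightarrow> (mode \<Rightarrow> real) \<Rightarrow> real" where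
  "ou_op J \<beta> \<theta> c = pi\<^sup>2 / 2 *
    (sin (lin J \<beta> c + \<theta>) * (\<Sum>j\<in>J. \<beta> j * (norm (rvec j))\<^sup>2 * c j)
     - cos (lin J \<beta> c + \<theta>) * (\<Sum>j\<in>J. (\<beta> j)\<^sup>2 * (norm (rvec j))\<^sup>2))"

lemma sum_noise_coeff_row:
  assumes l: "l \<in> modes N0" and N: "2 * N0 \<le> N" and m: "m \<in> modes N"
  shows "(\<Sum>k\<in>noise_modes N. \<Sum>j\<in>modes N. noise_coeff k l j * noise_coeff k m j) =
    (if l = m then pi\<^sup>2 * (norm (rvec l))\<^sup>2 * inv_square_sum N else 0)"
proof -
  have "noise_coeff k l j * noise_coeff k m j = noise_coeff k j l * noise_coeff k j m" if "j \<in> modes N" for k j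
    by (simp add: noise_coeff_skew[of j _ k] modes_nonzero[OF l] modes_nonzero[OF m] modes_nonzero[OF that])
  then show ?thesis using sum_noise_coeff[OF assms] by simp
qed

text \<open>Skew-symmetry is applied once here, leaving a minus sign, and twice in
  \<open>sum_noise_coeff_row\<close>. The minus sign makes the Ito correction a damping of mode
  \<open>l\<close>.\<close>

lemma sum_noise_coeff_mixed:
  assumes l: "l \<in> modes N0" and N: "2 * N0 \<le> N" and m: "m \<in> modes N"
  shows "(\<Sum>k\<in>noise_modes N. \<Sum>j\<in>modes N. noise_coeff k l j * noise_coeff k j m) =
    (if l = m then - pi\<^sup>2 * (norm (rvec l))\<^sup>2 * inv_square_sum N else 0)"
proof -
  have "noise_coeff k l j * noise_coeff k j m = - (noise_coeff k j l * noise_coeff k j m)" if "j \<in> modes N" for k j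
    by (simp add: noise_coeff_skew[of j l k] modes_nonzero[OF l] modes_nonzero[OF that])
  then show ?thesis using sum_noise_coeff[OF assms] by (simp add: sum_negf)
qed

definition test_noise :: "mode set \<Rightarrow> (mode \<Rightarrow> real) \<Rightarrow> mode \<Rightarrow> mode \<Rightarrow> real" where
  "test_noise J \<beta> k m = (\<Sum>j\<in>J. \<beta> j * noise_coeff k j m)"

lemma sum_test_noise_drift:
  "(\<Sum>j\<in>J. \<beta> j * noise_drift N k j c) = lin (modes N) (test_noise J \<beta> k) c"
  unfolding noise_drift_def lin_def test_noise_def sum_distrib_left sum_distrib_right
  by (subst sum.swap) (simp add: mult_ac)

lemma noise_noise_plane_wave:
  assumes J: "J \<subseteq> modes N"
  shows "dd (modes N) (noise_drift N k) (dd (modes N) (noise_drift N k) (plane_wave J \<beta> \<theta>)) c =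
    - cos (lin J \<beta> c + \<theta>) * (lin (modes N) (test_noise J \<beta> k) c)\<^sup>2
    - sin (lin J \<beta> c + \<theta>) * (\<Sum>i\<in>modes N. test_noise J \<beta> k i * noise_drift N k i c)"
proof -
  have fJ: "finite J" using J finite_subset by blast
  have 1: "dd (modes N) (noise_drift N k) (plane_wave J \<beta> \<theta>) =
      (\<lambda>c. (- sin (lin J \<beta> c + \<theta>)) * lin (modes N) (test_noise J \<beta> k) c)"
    unfolding plane_wave_def[abs_def] sum_test_noise_drift[symmetric]
    by (rule ext, rule dd_ridge_function[OF finite_modes J cos_shift_deriv sin_shift_cont])
  have 2: "dd (modes N) (noise_drift N k) (lin (modes N) (test_noise J \<beta> k)) c =
      (\<Sum>i\<in>modes N. test_noise J \<beta> k i * noise_drift N k i c)"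
    using dd_ridge_function[OF finite_modes order_refl, where g = "\<lambda>y. y" and g' = "\<lambda>_. 1"] by simp
  have 3: "dd (modes N) (noise_drift N k) (\<lambda>c. - sin (lin J \<beta> c + \<theta>)) c =
      - cos (lin J \<beta> c + \<theta>) * lin (modes N) (test_noise J \<beta> k) c"
    unfolding sum_test_noise_drift[symmetric]
    by (rule dd_ridge_function[OF finite_modes J sin_shift_deriv cos_shift_cont])
  show ?thesis
    unfolding 1 dd_mult[OF ridge_function(1)[OF fJ sin_shift_deriv cos_shift_cont] C1_lin] 2 3
    by (simp add: power2_eq_square)
qed

text \<open>The terms with first derivatives of the squared noise operator reproduce the linear part
  of \<open>ou_op\<close> without error, by \<open>sum_noise_coeff_mixed\<close>. In the
  second-order term the Gaussian mean of the quadratic form is added and subtracted, so the bracket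
  is centred. What remains besides is the Euler drift.\<close>

lemma galerkin_op_plane_wave:
  assumes J: "J \<subseteq> modes N0" and N: "2 * N0 \<le> N"
  shows "galerkin_op (- 1) N (plane_wave J \<beta> \<theta>) c =
    inv_square_sum N * ou_op J \<beta> \<theta> c
    - cos (lin J \<beta> c + \<theta>) / 2 * ((\<Sum>k\<in>noise_modes N. (lin (modes N) (test_noise J \<beta> k) c)\<^sup>2)
        - inv_square_sum N * (pi\<^sup>2 * (\<Sum>j\<in>J. (\<beta> j)\<^sup>2 * (norm (rvec j))\<^sup>2)))
    + sin (lin J \<beta> c + \<theta>) * (\<Sum>j\<in>J. \<beta> j * euler_drift N j c)"
proof -
  have JN: "J \<subseteq> modes N" using J modes_mono[of N0 N] N by auto
  have fJ: "finite J" using J finite_subset by blast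
  have e: "dd (modes N) (euler_drift N) (plane_wave J \<beta> \<theta>) c = - sin (lin J \<beta> c + \<theta>) * (\<Sum>j\<in>J. \<beta> j * euler_drift N j c)"
    unfolding plane_wave_def[abs_def] by (rule dd_ridge_function[OF finite_modes JN cos_shift_deriv sin_shift_cont])
  have "(\<Sum>k\<in>noise_modes N. \<Sum>i\<in>modes N. test_noise J \<beta> k i * noise_drift N k i c) =
      (\<Sum>k\<in>noise_modes N. \<Sum>i\<in>modes N. \<Sum>(j, m)\<in>J \<times> modes N. \<beta> j * c m * (noise_coeff k j i * noise_coeff k i m))"
    unfolding test_noise_def noise_drift_def sum_product sum.cartesian_product by (simp add: mult_ac)
  also have "\<dots> = (\<Sum>k\<in>noise_modes N. \<Sum>(j, m)\<in>J \<times> modes N. \<Sum>i\<in>modes N. \<beta> j * c m * (noise_coeff k j i * noise_coeff k i m))"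
    unfolding case_prod_beta by (intro sum.cong refl sum.swap)
  also have "\<dots> = (\<Sum>(j, m)\<in>J \<times> modes N. \<Sum>k\<in>noise_modes N. \<Sum>i\<in>modes N. \<beta> j * c m * (noise_coeff k j i * noise_coeff k i m))"
    unfolding case_prod_beta by (rule sum.swap)
  also have "\<dots> = (\<Sum>(j, m)\<in>J \<times> modes N. \<beta> j * c m * (if j = m then - pi\<^sup>2 * (norm (rvec j))\<^sup>2 * inv_square_sum N else 0))"
  proof (rule sum.cong[OF refl])
    fix x assume "x \<in> J \<times> modes N"
    then have "fst x \<in> modes N0" "snd x \<in> modes N" using J by auto
    from sum_noise_coeff_mixed[OF this(1) N this(2)]
    show "(case x of (j, m) \<Rightarrow> \<Sum>k\<in>noise_modes N. \<Sum>i\<in>modes N. \<beta> j * c m * (noise_coeff k j i * noise_coeff k i m)) =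
        (case x of (j, m) \<Rightarrow> \<beta> j * c m * (if j = m then - pi\<^sup>2 * (norm (rvec j))\<^sup>2 * inv_square_sum N else 0))"
      by (simp only: case_prod_beta sum_distrib_left[symmetric])
  qed
  also have "\<dots> = (\<Sum>j\<in>J. \<Sum>m\<in>modes N. if m = j then - pi\<^sup>2 * inv_square_sum N * (\<beta> j * (norm (rvec j))\<^sup>2 * c j) else 0)"
    unfolding sum.cartesian_product by (intro sum.cong refl) auto
  also have "\<dots> = (\<Sum>j\<in>J. - pi\<^sup>2 * inv_square_sum N * (\<beta> j * (norm (rvec j))\<^sup>2 * c j))"
    using JN by (intro sum.cong refl) (auto simp: sum.delta)
  also have "\<dots> = - pi\<^sup>2 * inv_square_sum N * (\<Sum>j\<in>J. \<beta> j * (norm (rvec j))\<^sup>2 * c j)"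
    by (simp only: sum_distrib_left)
  finally have n: "(\<Sum>k\<in>noise_modes N. \<Sum>i\<in>modes N. test_noise J \<beta> k i * noise_drift N k i c) =
      - pi\<^sup>2 * inv_square_sum N * (\<Sum>j\<in>J. \<beta> j * (norm (rvec j))\<^sup>2 * c j)" .
  have "(\<Sum>k\<in>noise_modes N. dd (modes N) (noise_drift N k) (dd (modes N) (noise_drift N k) (plane_wave J \<beta> \<theta>)) c) =
      - cos (lin J \<beta> c + \<theta>) * (\<Sum>k\<in>noise_modes N. (lin (modes N) (test_noise J \<beta> k) c)\<^sup>2)
      - sin (lin J \<beta> c + \<theta>) * (- pi\<^sup>2 * inv_square_sum N * (\<Sum>j\<in>J. \<beta> j * (norm (rvec j))\<^sup>2 * c j))"
    unfolding noise_noise_plane_wave[OF JN] sum_subtractf sum_distrib_left[symmetric] n ..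
  then show ?thesis
    unfolding galerkin_op_def e by (simp add: ou_op_def algebra_simps)
qed

text \<open>The trace is the Gaussian mean of the quadratic form in
  \<open>galerkin_op_plane_wave\<close>; it equals the constant subtracted there.\<close>

lemma trace_test_noise:
  assumes J: "J \<subseteq> modes N0" and N: "2 * N0 \<le> N"
  shows "(\<Sum>k\<in>noise_modes N. \<Sum>m\<in>modes N. (test_noise J \<beta> k m)\<^sup>2) =
    inv_square_sum N * (pi\<^sup>2 * (\<Sum>j\<in>J. (\<beta> j)\<^sup>2 * (norm (rvec j))\<^sup>2))"
proof -
  have JN: "J \<subseteq> modes N" using J modes_mono[of N0 N] N by auto
  have fJ: "finite J" using J finite_subset by blast
  have "(\<Sum>k\<in>noise_modes N. \<Sum>m\<in>modes N. (test_noise J \<beta> k m)\<^sup>2) =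
      (\<Sum>k\<in>noise_modes N. \<Sum>m\<in>modes N. \<Sum>(i, j)\<in>J \<times> J. \<beta> i * \<beta> j * (noise_coeff k i m * noise_coeff k j m))"
    unfolding test_noise_def power2_eq_square sum_product sum.cartesian_product by (simp add: mult_ac)
  also have "\<dots> = (\<Sum>k\<in>noise_modes N. \<Sum>(i, j)\<in>J \<times> J. \<Sum>m\<in>modes N. \<beta> i * \<beta> j * (noise_coeff k i m * noise_coeff k j m))"
    unfolding case_prod_beta by (intro sum.cong refl sum.swap)
  also have "\<dots> = (\<Sum>(i, j)\<in>J \<times> J. \<Sum>k\<in>noise_modes N. \<Sum>m\<in>modes N. \<beta> i * \<beta> j * (noise_coeff k i m * noise_coeff k j m))"
    unfolding case_prod_beta by (rule sum.swap)
  also have "\<dots> = (\<Sum>(i, j)\<in>J \<times> J. \<beta> i * \<beta> j * (if i = j then pi\<^sup>2 * (norm (rvec i))\<^sup>2 * inv_square_sum N else 0))"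
  proof (rule sum.cong[OF refl])
    fix x assume "x \<in> J \<times> J"
    then have "fst x \<in> modes N0" "snd x \<in> modes N" using J JN by auto
    from sum_noise_coeff_row[OF this(1) N this(2)]
    show "(case x of (i, j) \<Rightarrow> \<Sum>k\<in>noise_modes N. \<Sum>m\<in>modes N. \<beta> i * \<beta> j * (noise_coeff k i m * noise_coeff k j m)) =
        (case x of (i, j) \<Rightarrow> \<beta> i * \<beta> j * (if i = j then pi\<^sup>2 * (norm (rvec i))\<^sup>2 * inv_square_sum N else 0))"
      by (simp only: case_prod_beta sum_distrib_left[symmetric])
  qed
  also have "\<dots> = (\<Sum>i\<in>J. \<Sum>j\<in>J. if j = i then inv_square_sum N * (pi\<^sup>2 * ((\<beta> i)\<^sup>2 * (norm (rvec i))\<^sup>2)) else 0)"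
    unfolding sum.cartesian_product by (intro sum.cong refl) (auto simp: power2_eq_square)
  also have "\<dots> = (\<Sum>i\<in>J. inv_square_sum N * (pi\<^sup>2 * ((\<beta> i)\<^sup>2 * (norm (rvec i))\<^sup>2)))"
    using fJ by simp
  finally show ?thesis by (simp only: sum_distrib_left)
qed

text \<open>Order \<open>a\<close> against order \<open>a^2\<close>; the 81 is that of
  \<open>modes_inv_square_sum_le\<close>.\<close>

lemma filterlim_error_0:
  assumes "filterlim a at_top sequentially"
  shows "(\<lambda>N::nat. (C * a N + D * (a N + 81)) / (a N)\<^sup>2 :: real) \<longlonglongrightarrow> 0"
proof -
  have i: "(\<lambda>N. inverse (a N)) \<longlonglongrightarrow> 0"
    by (rule tendsto_inverse_0_at_top[OF assms])
  have "(\<lambda>N. (C + D) * inverse (a N) + 81 * D * (inverse (a N))\<^sup>2) \<longlonglongrightarrow> (C + D) * 0 + 81 * D * 0\<^sup>2"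
    by (intro tendsto_intros i)
  then have "(\<lambda>N. (C + D) * inverse (a N) + 81 * D * (inverse (a N))\<^sup>2) \<longlonglongrightarrow> 0"
    by simp
  moreover have "\<forall>\<^sub>F N in sequentially. (C + D) * inverse (a N) + 81 * D * (inverse (a N))\<^sup>2 = (C * a N + D * (a N + 81)) / (a N)\<^sup>2"
    using filterlim_at_top_dense[THEN iffD1, OF assms, rule_format, of 0]
    by eventually_elim (simp add: field_simps power2_eq_square)
  ultimately show ?thesis by (simp cong: tendsto_cong)
qed

section \<open>Convergence of the normalised operator on plane waves\<close>

context mode_gaussian
begin

lemma X_vec: "j \<in> modes N \<Longrightarrow> vec (modes N) w j = X j w"
  by (simp add: vec_def)

lemma lin_vec: "J \<subseteq> I \<Longrightarrow> lin J \<beta> (vec I w) = lin J \<beta> (\<lambda>k. X k w)"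
  unfolding lin_def by (intro sum.cong) (auto simp: vec_def)

lemma ou_op_vec:
  assumes J: "J \<subseteq> I"
  shows "ou_op J \<beta> \<theta> (vec I w) = ou_op J \<beta> \<theta> (\<lambda>k. X k w)"
proof -
  have "(\<Sum>j\<in>J. \<beta> j * (norm (rvec j))\<^sup>2 * vec I w j) = (\<Sum>j\<in>J. \<beta> j * (norm (rvec j))\<^sup>2 * X j w)"
    using J by (intro sum.cong) (auto simp: vec_def)
  then show ?thesis unfolding ou_op_def lin_vec[OF J] by simp
qed

lemma ou_op_measurable:
  assumes "J \<subseteq> Z20"
  shows "(\<lambda>w. ou_op J \<beta> \<theta> (\<lambda>k. X k w)) \<in> borel_measurable M"
proof -
  have "continuous_on UNIV (ou_op J \<beta> \<theta>)"
    unfolding ou_op_def[abs_def] lin_def by (intro continuous_intros) auto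
  from measurable_vec_continuous[OF this assms] show ?thesis by (simp add: ou_op_vec)
qed

lemma integrable_ou_op_square:
  assumes J: "finite J" "J \<subseteq> Z20"
  shows "integrable M (\<lambda>w. (ou_op J \<beta> \<theta> (\<lambda>k. X k w))\<^sup>2)"
proof -
  define b where "b j = \<beta> j * (norm (rvec j))\<^sup>2" for j
  define v where "v = (\<Sum>j\<in>J. (\<beta> j)\<^sup>2 * (norm (rvec j))\<^sup>2)"
  have i: "integrable M (\<lambda>w. (lin J b (\<lambda>k. X k w))\<^sup>2)"
    unfolding lin_def power2_eq_square sum_product using J
    by (intro Bochner_Integration.integrable_sum)
      (auto intro!: integrable_mult_right wick2(1) simp: mult.assoc mult.left_commute[of "X _ _"])
  have "integrable M (\<lambda>w. pi ^ 4 / 4 * (2 * (lin J b (\<lambda>k. X k w))\<^sup>2 + 2 * v\<^sup>2))"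
    using i by simp
  then show ?thesis
  proof (rule Bochner_Integration.integrable_bound)
    show "(\<lambda>w. (ou_op J \<beta> \<theta> (\<lambda>k. X k w))\<^sup>2) \<in> borel_measurable M"
      using ou_op_measurable[OF J(2)] by simp
    show "AE w in M. norm ((ou_op J \<beta> \<theta> (\<lambda>k. X k w))\<^sup>2) \<le> norm (pi ^ 4 / 4 * (2 * (lin J b (\<lambda>k. X k w))\<^sup>2 + 2 * v\<^sup>2))"
    proof (rule AE_I2)
      fix w
      define y where "y = lin J \<beta> (\<lambda>k. X k w) + \<theta>"
      define l where "l = lin J b (\<lambda>k. X k w)"
      have "(sin y * l - cos y * v)\<^sup>2 \<le> 2 * (sin y * l)\<^sup>2 + 2 * (cos y * v)\<^sup>2"
        using sum_squares_ge_zero[of "sin y * l + cos y * v" 0] by (simp add: power2_eq_square algebra_simps)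
      also have "\<dots> \<le> 2 * l\<^sup>2 + 2 * v\<^sup>2"
        by (intro add_mono mult_left_mono)
          (auto simp: power_mult_distrib abs_square_le_1 intro!: mult_left_le_one_le)
      finally have "(pi\<^sup>2 / 2)\<^sup>2 * (sin y * l - cos y * v)\<^sup>2 \<le> (pi\<^sup>2 / 2)\<^sup>2 * (2 * l\<^sup>2 + 2 * v\<^sup>2)"
        by (rule mult_left_mono) simp
      moreover have "(pi\<^sup>2 / 2)\<^sup>2 = pi ^ 4 / (4 :: real)" by (simp add: power_divide flip: power_mult)
      moreover have "ou_op J \<beta> \<theta> (\<lambda>k. X k w) = pi\<^sup>2 / 2 * (sin y * l - cos y * v)"
        by (simp add: ou_op_def y_def l_def lin_def b_def v_def)
      ultimately have "(ou_op J \<beta> \<theta> (\<lambda>k. X k w))\<^sup>2 \<le> pi ^ 4 / 4 * (2 * l\<^sup>2 + 2 * v\<^sup>2)"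
        by (simp only: power_mult_distrib)
      then show "norm ((ou_op J \<beta> \<theta> (\<lambda>k. X k w))\<^sup>2) \<le> norm (pi ^ 4 / 4 * (2 * (lin J b (\<lambda>k. X k w))\<^sup>2 + 2 * v\<^sup>2))"
        unfolding l_def[symmetric] by simp
    qed
  qed
qed

text \<open>Both error terms are centred quadratic forms with squared Hilbert--Schmidt norms of order \<open>log N\<close>, while the
  normalisation is \<open>(log N)\<^sup>2\<close>.\<close>

lemma galerkin_op_plane_wave_limit:
  assumes J: "finite J" "J \<subseteq> Z20"
  obtains N1 \<epsilon> where "\<epsilon> \<longlonglongrightarrow> 0" "\<And>N. N1 \<le> N \<Longrightarrow> inv_square_sum N > 0" "\<And>N. N1 \<le> N \<Longrightarrow> J \<subseteq> modes N"
    "\<And>N. N1 \<le> N \<Longrightarrow> integrable M (\<lambda>w. (galerkin_op (- 1) N (plane_wave J \<beta> \<theta>) (vec (modes N) w) / inv_square_sum N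
        - ou_op J \<beta> \<theta> (\<lambda>k. X k w))\<^sup>2)"
    "\<And>N. N1 \<le> N \<Longrightarrow> (\<integral>w. (galerkin_op (- 1) N (plane_wave J \<beta> \<theta>) (vec (modes N) w) / inv_square_sum N
        - ou_op J \<beta> \<theta> (\<lambda>k. X k w))\<^sup>2 \<partial>M) \<le> \<epsilon> N"
proof -
  obtain C where C: "\<And>N. (\<Sum>m\<in>modes N. \<Sum>n\<in>modes N. (\<Sum>k\<in>noise_modes N. test_noise J \<beta> k m * test_noise J \<beta> k n)\<^sup>2)
      \<le> C * inv_square_sum N"
    using noise_frobenius_bound[OF J, of \<beta>] unfolding test_noise_def by blast
  obtain D where D: "D \<ge> 0" "\<And>N. (\<Sum>a\<in>modes N. \<Sum>b\<in>modes N. (\<Sum>j\<in>J. \<beta> j * drift_coeff j a b)\<^sup>2)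
      \<le> D * (\<Sum>a\<in>modes N. 1 / (norm (rvec a))\<^sup>2)"
    using drift_frobenius_bound[OF J, of \<beta>] by blast
  obtain N0 where N0: "J \<subseteq> modes N0"
  proof
    define N0 where "N0 = nat (\<Sum>j\<in>J. \<bar>fst j\<bar> + \<bar>snd j\<bar>)"
    show "J \<subseteq> modes N0"
    proof
      fix j assume j: "j \<in> J"
      then have "\<bar>fst j\<bar> + \<bar>snd j\<bar> \<le> (\<Sum>j\<in>J. \<bar>fst j\<bar> + \<bar>snd j\<bar>)"
        using J by (intro member_le_sum[where f = "\<lambda>j. \<bar>fst j\<bar> + \<bar>snd j\<bar>"]) auto
      then show "j \<in> modes N0" using j J by (auto simp: modes_def N0_def)
    qed
  qed
  have "\<forall>\<^sub>F N in sequentially. inv_square_sum N > 0"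
    using filterlim_at_top_dense[THEN iffD1, OF inv_square_sum_at_top] by blast
  then obtain N2 where N2: "\<And>N. N2 \<le> N \<Longrightarrow> inv_square_sum N > 0"
    by (auto simp: eventually_sequentially)
  \<comment> \<open>Beyond \<open>N2\<close> the normalisation is positive, \<open>2 * N0\<close>
    makes the identities on \<open>J\<close> exact, and \<open>Suc\<close> keeps \<open>N\<close>
    positive for \<open>modes_inv_square_sum_le\<close>.\<close>
  define N1 where "N1 = Suc (max N2 (2 * N0))"
  \<comment> \<open>The coefficients of \<open>C\<close> and \<open>D\<close> are the weights
    \<open>1 / 2\<close> and 2 in the bound \<open>f2\<close>, each multiplied by the 2 of
    \<open>quadratic_form_variance\<close>.\<close>
  define \<epsilon> where "\<epsilon> N = (C * inv_square_sum N + 4 * D * (inv_square_sum N + 81)) / (inv_square_sum N)\<^sup>2" for N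
  define S where "S N m n = (\<Sum>k\<in>noise_modes N. test_noise J \<beta> k m * test_noise J \<beta> k n)" for N m n
  define U where "U a b = (\<Sum>j\<in>J. \<beta> j * drift_coeff j a b)" for a b
  define Q where "Q N s w = (\<Sum>m\<in>modes N. \<Sum>n\<in>modes N. s m n * (X m w * X n w - of_bool (m = n)))"
    for N and s :: "mode \<Rightarrow> mode \<Rightarrow> real" and w
  have int: "integrable M (\<lambda>w. (galerkin_op (- 1) N (plane_wave J \<beta> \<theta>) (vec (modes N) w) / inv_square_sum N
        - ou_op J \<beta> \<theta> (\<lambda>k. X k w))\<^sup>2)" (is ?int) and
    bound: "(\<integral>w. (galerkin_op (- 1) N (plane_wave J \<beta> \<theta>) (vec (modes N) w) / inv_square_sum N
        - ou_op J \<beta> \<theta> (\<lambda>k. X k w))\<^sup>2 \<partial>M) \<le> \<epsilon> N" (is ?bound)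
    if N: "N1 \<le> N" for N
  proof -
    define a where "a = inv_square_sum N"
    have a: "a > 0" and NN: "2 * N0 \<le> N" "0 < N" using N N2 by (auto simp: a_def N1_def)
    have JN: "J \<subseteq> modes N" using N0 modes_mono[of N0 N] NN by auto
    let ?f = "\<lambda>w. galerkin_op (- 1) N (plane_wave J \<beta> \<theta>) (vec (modes N) w) / a - ou_op J \<beta> \<theta> (\<lambda>k. X k w)"
    have Q1: "(\<Sum>k\<in>noise_modes N. (lin (modes N) (test_noise J \<beta> k) (vec (modes N) w))\<^sup>2)
        - a * (pi\<^sup>2 * (\<Sum>j\<in>J. (\<beta> j)\<^sup>2 * (norm (rvec j))\<^sup>2)) = Q N (S N) w" for w
    proof -
      have "(\<Sum>k\<in>noise_modes N. (lin (modes N) (test_noise J \<beta> k) (vec (modes N) w))\<^sup>2) =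
          (\<Sum>k\<in>noise_modes N. \<Sum>(m, n)\<in>modes N \<times> modes N. test_noise J \<beta> k m * test_noise J \<beta> k n * (X m w * X n w))"
        unfolding lin_def power2_eq_square sum_product sum.cartesian_product
        by (intro sum.cong refl) (auto simp: X_vec mult_ac)
      also have "\<dots> = (\<Sum>(m, n)\<in>modes N \<times> modes N. S N m n * (X m w * X n w))"
        unfolding S_def sum_distrib_right case_prod_beta by (rule sum.swap)
      finally have 1: "(\<Sum>k\<in>noise_modes N. (lin (modes N) (test_noise J \<beta> k) (vec (modes N) w))\<^sup>2) =
          (\<Sum>m\<in>modes N. \<Sum>n\<in>modes N. S N m n * (X m w * X n w))"
        by (simp add: sum.cartesian_product)
      have "a * (pi\<^sup>2 * (\<Sum>j\<in>J. (\<beta> j)\<^sup>2 * (norm (rvec j))\<^sup>2)) =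
          (\<Sum>k\<in>noise_modes N. \<Sum>m\<in>modes N. (test_noise J \<beta> k m)\<^sup>2)"
        unfolding a_def by (rule trace_test_noise[OF N0 NN(1), symmetric])
      also have "\<dots> = (\<Sum>m\<in>modes N. S N m m)"
        unfolding S_def power2_eq_square by (rule sum.swap)
      also have "\<dots> = (\<Sum>m\<in>modes N. \<Sum>n\<in>modes N. S N m n * of_bool (m = n))"
        by (intro sum.cong refl) (simp add: of_bool_def if_distrib cong: if_cong)
      finally show ?thesis
        unfolding 1 Q_def by (simp add: sum_subtractf right_diff_distrib)
    qed
    have Q2: "(\<Sum>j\<in>J. \<beta> j * euler_drift N j (vec (modes N) w)) = Q N U w" for w
    proof -
      have "(\<Sum>j\<in>J. \<beta> j * euler_drift N j (vec (modes N) w)) =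
          (\<Sum>j\<in>J. \<Sum>(m, n)\<in>modes N \<times> modes N. \<beta> j * drift_coeff j m n * (X m w * X n w))"
        unfolding euler_drift_def sum_distrib_left by (intro sum.cong refl) (auto simp: X_vec mult_ac)
      also have "\<dots> = (\<Sum>(m, n)\<in>modes N \<times> modes N. U m n * (X m w * X n w))"
        unfolding U_def sum_distrib_right case_prod_beta by (rule sum.swap)
      also have "\<dots> = (\<Sum>m\<in>modes N. \<Sum>n\<in>modes N. U m n * (X m w * X n w))"
        by (simp add: sum.cartesian_product)
      \<comment> \<open>The Euler form is already centred: its diagonal is 0, since a mode does not
        transport itself.\<close>
      also have "\<dots> = Q N U w"
        unfolding Q_def by (intro sum.cong refl) (auto simp: of_bool_def U_def drift_coeff_def)
      finally show ?thesis .
    qed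
    have f: "?f w = (- cos (lin J \<beta> (vec (modes N) w) + \<theta>) / 2 * Q N (S N) w
        + sin (lin J \<beta> (vec (modes N) w) + \<theta>) * Q N U w) / a" for w
      unfolding galerkin_op_plane_wave[OF N0 NN(1)] a_def[symmetric] Q1 Q2 ou_op_vec[OF JN]
      using a by (simp add: field_simps)
    have f2: "(?f w)\<^sup>2 \<le> ((Q N (S N) w)\<^sup>2 / 2 + 2 * (Q N U w)\<^sup>2) / a\<^sup>2" for w
    proof -
      define y where "y = lin J \<beta> (vec (modes N) w) + \<theta>"
      define p q where "p = Q N (S N) w" and "q = Q N U w"
      have "(- cos y / 2 * p + sin y * q)\<^sup>2 \<le> 2 * (cos y / 2 * p)\<^sup>2 + 2 * (sin y * q)\<^sup>2"
        using sum_squares_ge_zero[of "cos y / 2 * p + sin y * q" 0] by (simp add: power2_eq_square algebra_simps)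
      also have "\<dots> = (cos y)\<^sup>2 * (p\<^sup>2 / 2) + (sin y)\<^sup>2 * (2 * q\<^sup>2)"
        by (simp add: power_mult_distrib power_divide)
      also have "\<dots> \<le> 1 * (p\<^sup>2 / 2) + 1 * (2 * q\<^sup>2)"
        by (intro add_mono mult_right_mono) (auto simp: abs_square_le_1)
      finally show ?thesis
        unfolding f power_divide y_def p_def q_def by (intro divide_right_mono) auto
    qed
    note q1 = quadratic_form_variance[OF finite_modes modes_subset, of "S N" N, folded Q_def]
    note q2 = quadratic_form_variance[OF finite_modes modes_subset, of U N, folded Q_def]
    have ib: "integrable M (\<lambda>w. ((Q N (S N) w)\<^sup>2 / 2 + 2 * (Q N U w)\<^sup>2) / a\<^sup>2)"
      using q1(1) q2(1) by simp
    have m: "?f \<in> borel_measurable M"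
      using J by (intro borel_measurable_diff borel_measurable_divide borel_measurable_const ou_op_measurable
        measurable_vec_continuous continuous_on_galerkin_op C2_plane_wave modes_subset)
    show i: ?int
      unfolding a_def[symmetric]
      by (rule Bochner_Integration.integrable_bound[OF ib]) (use m f2 in \<open>auto intro!: AE_I2\<close>)
    have "(\<integral>w. (?f w)\<^sup>2 \<partial>M) \<le> (\<integral>w. ((Q N (S N) w)\<^sup>2 / 2 + 2 * (Q N U w)\<^sup>2) / a\<^sup>2 \<partial>M)"
      by (rule integral_mono[OF i[folded a_def] ib f2])
    also have "\<dots> = ((\<integral>w. (Q N (S N) w)\<^sup>2 \<partial>M) / 2 + 2 * (\<integral>w. (Q N U w)\<^sup>2 \<partial>M)) / a\<^sup>2"
      using q1(1) q2(1) by simp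
    also have "\<dots> \<le> (C * a + 4 * (D * (a + 81))) / a\<^sup>2"
    proof (intro divide_right_mono add_mono)
      show "(\<integral>w. (Q N (S N) w)\<^sup>2 \<partial>M) / 2 \<le> C * a"
        using q1(2) C[of N, folded S_def] unfolding a_def by linarith
      have "D * (\<Sum>k\<in>modes N. 1 / (norm (rvec k))\<^sup>2) \<le> D * (a + 81)"
        unfolding a_def by (intro mult_left_mono modes_inv_square_sum_le NN D)
      then show "2 * (\<integral>w. (Q N U w)\<^sup>2 \<partial>M) \<le> 4 * (D * (a + 81))"
        using q2(2) D(2)[of N, folded U_def] by linarith
    qed simp
    finally show ?bound unfolding \<epsilon>_def a_def by (simp add: mult.assoc)
  qed
  show thesis
  proof (rule that)
    show "\<epsilon> \<longlonglongrightarrow> 0"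
      unfolding \<epsilon>_def[abs_def] by (rule filterlim_error_0[OF inv_square_sum_at_top])
    show "inv_square_sum N > 0" if "N1 \<le> N" for N using N2 that by (simp add: N1_def)
    show "J \<subseteq> modes N" if "N1 \<le> N" for N using order_trans[OF N0 modes_mono[of N0 N]] that by (simp add: N1_def)
  qed (fact int bound)+
qed

end

subsection \<open>Fourier uniqueness\<close>

lemma cauchy_schwarz_integral:
  fixes f g :: "'a \<Rightarrow> real"
  assumes meas: "f \<in> borel_measurable M" "g \<in> borel_measurable M"
    and int: "integrable M (\<lambda>x. (f x)\<^sup>2)" "integrable M (\<lambda>x. (g x)\<^sup>2)"
  shows "integrable M (\<lambda>x. f x * g x)"
    "\<bar>\<integral>x. f x * g x \<partial>M\<bar> \<le> sqrt (\<integral>x. (f x)\<^sup>2 \<partial>M) * sqrt (\<integral>x. (g x)\<^sup>2 \<partial>M)"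
proof -
  show i: "integrable M (\<lambda>x. f x * g x)"
  proof (rule Bochner_Integration.integrable_bound)
    show "integrable M (\<lambda>x. (f x)\<^sup>2 + (g x)\<^sup>2)" using int by simp
    show "(\<lambda>x. f x * g x) \<in> borel_measurable M" using meas by simp
    show "AE x in M. norm (f x * g x) \<le> norm ((f x)\<^sup>2 + (g x)\<^sup>2)"
    proof (rule AE_I2)
      fix x
      have "0 \<le> (\<bar>f x\<bar> - \<bar>g x\<bar>)\<^sup>2" by simp
      then have "2 * (\<bar>f x\<bar> * \<bar>g x\<bar>) \<le> (f x)\<^sup>2 + (g x)\<^sup>2" by (simp add: power2_diff)
      moreover have "0 \<le> \<bar>f x\<bar> * \<bar>g x\<bar>" by simp
      ultimately have "\<bar>f x\<bar> * \<bar>g x\<bar> \<le> (f x)\<^sup>2 + (g x)\<^sup>2" by linarith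
      then show "norm (f x * g x) \<le> norm ((f x)\<^sup>2 + (g x)\<^sup>2)" by (simp add: abs_mult)
    qed
  qed
  define A B C where "A = (\<integral>x. (f x)\<^sup>2 \<partial>M)" and "B = (\<integral>x. f x * g x \<partial>M)" and "C = (\<integral>x. (g x)\<^sup>2 \<partial>M)"
  have q: "0 \<le> A + 2 * t * B + t\<^sup>2 * C" for t
  proof -
    have "0 \<le> (\<integral>x. (f x + t * g x)\<^sup>2 \<partial>M)" by simp
    also have "\<dots> = (\<integral>x. (f x)\<^sup>2 + 2 * t * (f x * g x) + t\<^sup>2 * (g x)\<^sup>2 \<partial>M)"
      by (simp add: power2_sum power_mult_distrib mult_ac add_ac)
    also have "\<dots> = A + 2 * t * B + t\<^sup>2 * C"
      using i int by (simp add: A_def B_def C_def)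
    finally show ?thesis .
  qed
  have C: "0 \<le> C" and A: "0 \<le> A" by (simp_all add: A_def C_def)
  have "B\<^sup>2 \<le> A * C"
  proof (cases "C = 0")
    case True
    have "B = 0"
    proof (rule ccontr)
      assume "B \<noteq> 0"
      \<comment> \<open>This \<open>t\<close> gives the affine function the value
        \<open>- 1\<close>.\<close>
      then show False using q[of "- (A + 1) / (2 * B)"] True by (simp add: field_simps)
    qed
    then show ?thesis using True by simp
  next
    case False
    then show ?thesis using q[of "- B / C"] C by (simp add: field_simps power2_eq_square)
  qed
  then have "\<bar>B\<bar> \<le> sqrt (A * C)"
    using real_sqrt_le_mono[of "B\<^sup>2" "A * C"] by simp
  then show "\<bar>\<integral>x. f x * g x \<partial>M\<bar> \<le> sqrt (\<integral>x. (f x)\<^sup>2 \<partial>M) * sqrt (\<integral>x. (g x)\<^sup>2 \<partial>M)"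
    by (simp add: A_def B_def C_def real_sqrt_mult)
qed

text \<open>The two normalised laws of \<open>Y\<close> with densities the positive and the negative part of \<open>g\<close> have the same
  characteristic function.\<close>

lemma integral_indicator_eq_0_of_char:
  fixes g Y :: "'a \<Rightarrow> real"
  assumes g: "integrable M g" and Y: "Y \<in> borel_measurable M"
    and cos0: "\<And>t. (\<integral>w. g w * cos (t * Y w) \<partial>M) = 0" and sin0: "\<And>t. (\<integral>w. g w * sin (t * Y w) \<partial>M) = 0"
    and A: "A \<in> sets borel"
  shows "(\<integral>w. g w * indicator A (Y w) \<partial>M) = 0"
proof -
  note [measurable] = Y A borel_measurable_integrable[OF g]
  define p n where "p w = max 0 (g w)" and "n w = max 0 (- g w)" for w
  have g_eq: "g w = p w - n w" for w by (simp add: p_def n_def max_def)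
  have [measurable]: "p \<in> borel_measurable M" "n \<in> borel_measurable M"
    unfolding p_def[abs_def] n_def[abs_def] by auto
  have pn: "0 \<le> p w" "0 \<le> n w" for w by (auto simp: p_def n_def)
  have ip: "integrable M p" and in': "integrable M n"
    using g unfolding p_def[abs_def] n_def[abs_def] by auto
  define m where "m = (\<integral>w. p w \<partial>M)"
  \<comment> \<open>At \<open>t = 0\<close> the cosine condition says that both parts of
    \<open>g\<close> have the same mass.\<close>
  have m_n: "m = (\<integral>w. n w \<partial>M)"
    using cos0[of 0] ip in' by (simp add: m_def g_eq)
  show ?thesis
  proof (cases "m = 0")
    case True
    then have "AE w in M. p w = 0" "AE w in M. n w = 0"
      using ip in' pn m_n integral_nonneg_eq_0_iff_AE[of M p] integral_nonneg_eq_0_iff_AE[of M n]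
      by (auto simp: m_def)
    then have "AE w in M. g w * indicator A (Y w) = 0"
      by eventually_elim (simp add: g_eq)
    then show ?thesis by (intro integral_eq_zero_AE)
  next
    case False
    then have m: "m > 0" using pn by (simp add: m_def less_le)
    define D where "D q = density M (\<lambda>w. ennreal (q w / m))" for q
    have D: "real_distribution (distr (D q) borel Y)"
      "char (distr (D q) borel Y) t = (\<integral>w. q w *\<^sub>R cis (t * Y w) \<partial>M) / m"
      "measure (distr (D q) borel Y) A = (\<integral>w. q w * indicator A (Y w) \<partial>M) / m"
      if [measurable]: "q \<in> borel_measurable M" and q: "\<And>w. 0 \<le> q w" "integrable M q" "(\<integral>w. q w \<partial>M) = m" for q t
    proof -
      have "emeasure (D q) (space (D q)) = (\<integral>\<^sup>+w. ennreal (q w / m) \<partial>M)"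
        by (simp add: D_def emeasure_density cong: nn_integral_cong)
      also have "\<dots> = ennreal (\<integral>w. q w / m \<partial>M)"
        using q m by (intro nn_integral_eq_integral) auto
      also have "\<dots> = 1" using q m by simp
      finally interpret Dq: prob_space "D q" by (rule prob_spaceI)
      have [measurable]: "Y \<in> borel_measurable (D q)" by (simp add: D_def)
      interpret R: prob_space "distr (D q) borel Y" by (rule Dq.prob_space_distr) simp
      show "real_distribution (distr (D q) borel Y)"
        by unfold_locales (auto simp: real_distribution_axioms_def)
      have "char (distr (D q) borel Y) t = (\<integral>w. cis (t * Y w) \<partial>D q)"
        unfolding char_def cis_conv_exp by (subst integral_distr) (auto simp: mult.commute)
      also have "\<dots> = (\<integral>w. (q w / m) *\<^sub>R cis (t * Y w) \<partial>M)"
        unfolding D_def using q m by (subst integral_density) (auto simp: cis_conv_exp)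
      also have "\<dots> = (\<integral>w. q w *\<^sub>R cis (t * Y w) / of_real m \<partial>M)"
        by (intro Bochner_Integration.integral_cong refl) (simp add: scaleR_conv_of_real)
      finally show "char (distr (D q) borel Y) t = (\<integral>w. q w *\<^sub>R cis (t * Y w) \<partial>M) / m" by simp
      have "measure (distr (D q) borel Y) A = (\<integral>x. indicator A x \<partial>distr (D q) borel Y)" by simp
      also have "\<dots> = (\<integral>w. indicator A (Y w) \<partial>D q)"
        by (subst integral_distr) auto
      also have "\<dots> = (\<integral>w. (q w / m) *\<^sub>R indicator A (Y w) \<partial>M)"
        unfolding D_def using q m by (subst integral_density) auto
      finally show "measure (distr (D q) borel Y) A = (\<integral>w. q w * indicator A (Y w) \<partial>M) / m" by simp
    qed
    have ci: "integrable M (\<lambda>w. q w *\<^sub>R cis (t * Y w))" if "integrable M q" for q :: "'a \<Rightarrow> real" and t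
      using that by (rule Bochner_Integration.integrable_bound)
        (use that in \<open>auto simp: cis_conv_exp\<close>)
    have "char (distr (D p) borel Y) = char (distr (D n) borel Y)"
    proof
      fix t
      have gc: "integrable M (\<lambda>w. g w * cos (t * Y w))" "integrable M (\<lambda>w. g w * sin (t * Y w))"
        by (rule Bochner_Integration.integrable_bound[OF g]; auto simp: abs_mult intro!: mult_left_le)+
      have "(\<integral>w. p w *\<^sub>R cis (t * Y w) \<partial>M) - (\<integral>w. n w *\<^sub>R cis (t * Y w) \<partial>M) = (\<integral>w. g w *\<^sub>R cis (t * Y w) \<partial>M)"
        using ci[OF ip] ci[OF in'] by (simp add: g_eq scaleR_left_diff_distrib)
      also have "\<dots> = (\<integral>w. of_real (g w * cos (t * Y w)) + \<i> * of_real (g w * sin (t * Y w)) \<partial>M)"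
        by (intro Bochner_Integration.integral_cong refl) (simp add: complex_eq_iff)
      also have "\<dots> = of_real (\<integral>w. g w * cos (t * Y w) \<partial>M) + \<i> * of_real (\<integral>w. g w * sin (t * Y w) \<partial>M)"
        by (subst Bochner_Integration.integral_add[OF integrable_of_real[OF gc(1)]
              integrable_mult_right[OF integrable_of_real[OF gc(2)]]])
          (simp only: integral_mult_right_zero integral_complex_of_real)
      finally have "(\<integral>w. p w *\<^sub>R cis (t * Y w) \<partial>M) = (\<integral>w. n w *\<^sub>R cis (t * Y w) \<partial>M)"
        by (simp add: cos0 sin0)
      then show "char (distr (D p) borel Y) t = char (distr (D n) borel Y) t"
        using D(2)[of p] D(2)[of n] pn ip in' m_n by (simp add: m_def)
    qed
    then have "distr (D p) borel Y = distr (D n) borel Y"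
      using D(1)[of p] D(1)[of n] pn ip in' m_n by (intro Levy_uniqueness) (auto simp: m_def)
    then have eq: "(\<integral>w. p w * indicator A (Y w) \<partial>M) = (\<integral>w. n w * indicator A (Y w) \<partial>M)"
      using D(3)[of p] D(3)[of n] pn ip in' m_n m by (simp add: m_def)
    have "integrable M (\<lambda>w. q w * indicator A (Y w))" if "integrable M q" for q :: "'a \<Rightarrow> real"
      using that by (rule Bochner_Integration.integrable_bound) (use that in \<open>auto simp: indicator_def\<close>)
    then show ?thesis
      using eq ip in' by (simp add: g_eq left_diff_distrib)
  qed
qed

text \<open>Indicators are introduced one coordinate at a time while an arbitrary plane wave is
  carried along. Multiplying that wave by a cosine or sine of \<open>t * X l\<close> only changes
  its frequency at \<open>l\<close> and its phase, so the induction hypothesis provides the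
  characteristic functions needed by \<open>integral_indicator_eq_0_of_char\<close>.\<close>

lemma integral_cylinder_eq_0:
  fixes h :: "'a \<Rightarrow> real" and X :: "'i \<Rightarrow> 'a \<Rightarrow> real"
  assumes h: "integrable M h" and X: "\<And>k. k \<in> S \<Longrightarrow> X k \<in> borel_measurable M"
    and zero: "\<And>J \<beta> \<theta>. finite J \<Longrightarrow> J \<subseteq> S \<Longrightarrow> (\<integral>w. h w * plane_wave J \<beta> \<theta> (\<lambda>k. X k w) \<partial>M) = 0"
    and I: "finite I" "I \<subseteq> S" and A: "\<And>i. i \<in> I \<Longrightarrow> A i \<in> sets borel"
  shows "(\<integral>w. h w * (\<Prod>i\<in>I. indicator (A i) (X i w)) \<partial>M) = 0"
proof -
  have meas: "(\<lambda>w. plane_wave J \<beta> \<theta> (\<lambda>k. X k w)) \<in> borel_measurable M" if "J \<subseteq> S" for J \<beta> \<theta>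
  proof -
    have "(\<lambda>w. lin J \<beta> (\<lambda>k. X k w)) \<in> borel_measurable M"
      unfolding lin_def using that by (intro borel_measurable_sum borel_measurable_times X) auto
    then show ?thesis unfolding plane_wave_def by simp
  qed
  have ind: "integrable M (\<lambda>w. h w * (\<Prod>i\<in>I. indicator (A i) (X i w)) * plane_wave J \<beta> \<theta> (\<lambda>k. X k w))"
    if "finite I" "I \<subseteq> S" "\<And>i. i \<in> I \<Longrightarrow> A i \<in> sets borel" "J \<subseteq> S" for I J \<beta> \<theta>
  proof (rule Bochner_Integration.integrable_bound[OF h])
    show "(\<lambda>w. h w * (\<Prod>i\<in>I. indicator (A i) (X i w)) * plane_wave J \<beta> \<theta> (\<lambda>k. X k w)) \<in> borel_measurable M"
      using that h by (intro borel_measurable_times borel_measurable_prod meas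
          measurable_compose[OF X borel_measurable_indicator]) auto
    have "0 \<le> (\<Prod>i\<in>I. indicator (A i) (X i w) :: real)" "(\<Prod>i\<in>I. indicator (A i) (X i w) :: real) \<le> 1" for w
      by (auto intro!: prod_nonneg prod_le_1 simp: indicator_def)
    then have "\<bar>(\<Prod>i\<in>I. indicator (A i) (X i w)) * plane_wave J \<beta> \<theta> (\<lambda>k. X k w)\<bar> \<le> 1" for w
      unfolding abs_mult plane_wave_def by (intro mult_le_one) auto
    then show "AE w in M. norm (h w * (\<Prod>i\<in>I. indicator (A i) (X i w)) * plane_wave J \<beta> \<theta> (\<lambda>k. X k w)) \<le> norm (h w)"
      by (intro AE_I2) (simp add: mult.assoc abs_mult mult_left_le)
  qed
  have "\<forall>J \<beta> \<theta>. finite J \<longrightarrow> J \<subseteq> S \<longrightarrow> (\<integral>w. h w * (\<Prod>i\<in>I. indicator (A i) (X i w)) * plane_wave J \<beta> \<theta> (\<lambda>k. X k w) \<partial>M) = 0"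
    using I A
  proof (induction I)
    case empty
    then show ?case using zero by simp
  next
    case (insert l I)
    show ?case
    proof (intro allI impI)
      fix J \<beta> \<theta> assume J: "finite J" "J \<subseteq> S"
      define P where "P w = h w * (\<Prod>i\<in>I. indicator (A i) (X i w))" for w
      define J' where "J' = insert l J"
      \<comment> \<open>If \<open>l\<close> is outside \<open>J\<close>, the value of
        \<open>\<beta>\<close> there is arbitrary and counts as 0 before \<open>t\<close> is
        added.\<close>
      define \<beta>' :: "real \<Rightarrow> 'i \<Rightarrow> real" where "\<beta>' t = \<beta>(l := (if l \<in> J then \<beta> l else 0) + t)" for t
      have J': "finite J'" "J' \<subseteq> S" using J insert by (auto simp: J'_def)
      have IH: "(\<integral>w. P w * plane_wave J \<beta> \<theta> (\<lambda>k. X k w) \<partial>M) = 0" if "finite J" "J \<subseteq> S" for J \<beta> \<theta>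
        using insert that unfolding P_def by simp
      have intP: "integrable M (\<lambda>w. P w * plane_wave J \<beta> \<theta> (\<lambda>k. X k w))" if "J \<subseteq> S" for J \<beta> \<theta>
        using ind[of I J] insert that unfolding P_def by simp
      have lin': "lin J' (\<beta>' t) c = lin J \<beta> c + t * c l" for t c
      proof -
        have "lin J' (\<beta>' t) c = lin (J - {l}) \<beta> c + ((if l \<in> J then \<beta> l else 0) + t) * c l"
        proof -
          have "J' = insert l (J - {l})" by (auto simp: J'_def)
          then have "lin J' (\<beta>' t) c = \<beta>' t l * c l + (\<Sum>j\<in>J - {l}. \<beta>' t j * c j)"
            unfolding lin_def by (simp only:, subst sum.insert) (use J in auto)
          also have "(\<Sum>j\<in>J - {l}. \<beta>' t j * c j) = (\<Sum>j\<in>J - {l}. \<beta> j * c j)"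
            by (intro sum.cong) (auto simp: \<beta>'_def)
          finally show ?thesis by (simp add: lin_def \<beta>'_def)
        qed
        also have "\<dots> = lin J \<beta> c + t * c l"
          unfolding lin_def using J by (cases "l \<in> J") (auto simp: sum.remove algebra_simps)
        finally show ?thesis .
      qed
      have "(\<integral>w. (P w * plane_wave J \<beta> \<theta> (\<lambda>k. X k w)) * indicator (A l) (X l w) \<partial>M) = 0"
      proof (rule integral_indicator_eq_0_of_char)
        show "integrable M (\<lambda>w. P w * plane_wave J \<beta> \<theta> (\<lambda>k. X k w))" by (rule intP[OF J(2)])
        show "X l \<in> borel_measurable M" "A l \<in> sets borel" using X insert by auto
        fix t
        have c: "P w * plane_wave J \<beta> \<theta> (\<lambda>k. X k w) * cos (t * X l w) =
            1 / 2 * (P w * plane_wave J' (\<beta>' (- t)) \<theta> (\<lambda>k. X k w)) + 1 / 2 * (P w * plane_wave J' (\<beta>' t) \<theta> (\<lambda>k. X k w))" for w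
        proof -
          have eq: "cos (lin J \<beta> (\<lambda>k. X k w) + \<theta>) * cos (t * X l w) =
              (cos (lin J \<beta> (\<lambda>k. X k w) + - t * X l w + \<theta>) + cos (lin J \<beta> (\<lambda>k. X k w) + t * X l w + \<theta>)) / 2"
            unfolding cos_times_cos by (simp add: algebra_simps)
          show ?thesis
            unfolding plane_wave_def lin' mult.assoc eq by (simp add: distrib_left add_divide_distrib)
        qed
        show "(\<integral>w. P w * plane_wave J \<beta> \<theta> (\<lambda>k. X k w) * cos (t * X l w) \<partial>M) = 0"
          unfolding c using intP[OF J'(2)] by (simp add: IH[OF J'])
        have s: "P w * plane_wave J \<beta> \<theta> (\<lambda>k. X k w) * sin (t * X l w) =
            1 / 2 * (P w * plane_wave J' (\<beta>' t) (\<theta> - pi / 2) (\<lambda>k. X k w)) - 1 / 2 * (P w * plane_wave J' (\<beta>' (- t)) (\<theta> - pi / 2) (\<lambda>k. X k w))" for w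
        proof -
          have sh: "cos (y + (\<theta> - pi / 2)) = sin (y + \<theta>)" for y
            by (metis add_diff_eq cos_diff cos_pi_half sin_pi_half mult_zero_right mult_1_right add_0)
          have eq: "cos (lin J \<beta> (\<lambda>k. X k w) + \<theta>) * sin (t * X l w) =
              (sin (lin J \<beta> (\<lambda>k. X k w) + t * X l w + \<theta>) - sin (lin J \<beta> (\<lambda>k. X k w) + - t * X l w + \<theta>)) / 2"
            unfolding cos_times_sin by (simp add: algebra_simps)
          show ?thesis
            unfolding plane_wave_def lin' sh mult.assoc eq by (simp add: right_diff_distrib diff_divide_distrib)
        qed
        show "(\<integral>w. P w * plane_wave J \<beta> \<theta> (\<lambda>k. X k w) * sin (t * X l w) \<partial>M) = 0"
          unfolding s using intP[OF J'(2)] by (simp add: IH[OF J'])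
      qed
      then show "(\<integral>w. h w * (\<Prod>i\<in>insert l I. indicator (A i) (X i w)) * plane_wave J \<beta> \<theta> (\<lambda>k. X k w) \<partial>M) = 0"
        using insert by (simp add: P_def mult_ac)
    qed
  qed
  from this[rule_format, of "{}" "\<lambda>_. 0" 0] show ?thesis
    by (simp add: plane_wave_def lin_def)
qed

text \<open>Dynkin's argument carries the vanishing integrals from \<open>G\<close> to all
  measurable sets; the set where \<open>h\<close>, respectively \<open>- h\<close>, is positive then
  shows that it is null. The generators used later are cylinder sets, half-lines in time and
  measurable rectangles.\<close>

lemma AE_eq_0_of_generator:
  fixes h :: "'a \<Rightarrow> real"
  assumes h: "integrable M h" and sets: "sets M = sigma_sets (space M) G" and G: "Int_stable G" "G \<subseteq> Pow (space M)"
    and tot: "(\<integral>w. h w \<partial>M) = 0" and zero: "\<And>E. E \<in> G \<Longrightarrow> (\<integral>w. h w * indicator E w \<partial>M) = 0"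
  shows "AE w in M. h w = 0"
proof -
  have int: "integrable M (\<lambda>w. h w * indicator E w)" if "E \<in> sets M" for E
    using integrable_mult_indicator[OF that h] by (simp add: mult.commute)
  have all: "(\<integral>w. h w * indicator E w \<partial>M) = 0" if "E \<in> sets M" for E
    using G that[unfolded sets]
  proof (induction rule: sigma_sets_induct_disjoint)
    case (basic E)
    then show ?case by (rule zero)
  next
    case (compl E)
    then have E: "E \<in> sets M" by (simp add: sets)
    have "(\<integral>w. h w * indicator (space M - E) w \<partial>M) = (\<integral>w. h w - h w * indicator E w \<partial>M)"
      by (intro Bochner_Integration.integral_cong) (auto simp: indicator_def)
    then show ?case using compl h int[OF E] tot by simp
  next
    case (union F)
    then have F: "F i \<in> sets M" for i using sets by auto
    have UN: "(\<Sum>i<n. h w * indicator (F i) w) = h w * indicator (\<Union>i<n. F i) w" for n w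
      using union(1) by (subst indicator_UN_disjoint)
        (auto simp: disjoint_family_on_def sum_distrib_left)
    have "(\<lambda>n. \<integral>w. (\<Sum>i<n. h w * indicator (F i) w) \<partial>M) \<longlonglongrightarrow> (\<integral>w. h w * indicator (\<Union>i. F i) w \<partial>M)"
      unfolding UN
    proof (rule integral_dominated_convergence[where w = "\<lambda>w. \<bar>h w\<bar>"])
      show "AE w in M. (\<lambda>n. h w * indicator (\<Union>i<n. F i) w) \<longlonglongrightarrow> h w * indicator (\<Union>i. F i) w"
        by (intro AE_I2 tendsto_mult tendsto_const LIMSEQ_indicator_UN)
    qed (use h F in \<open>auto simp: indicator_def\<close>)
    moreover have "(\<integral>w. (\<Sum>i<n. h w * indicator (F i) w) \<partial>M) = 0" for n
      using union int[OF F] by (subst Bochner_Integration.integral_sum) auto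
    ultimately show ?case by (simp add: LIMSEQ_const_iff)
  qed (use tot in simp)
  have pos: "AE w in M. g w \<le> 0" if g: "integrable M g" "\<And>E. E \<in> sets M \<Longrightarrow> (\<integral>w. g w * indicator E w \<partial>M) = 0"
    for g :: "'a \<Rightarrow> real"
  proof -
    let ?E = "{w \<in> space M. 0 < g w}"
    have E: "?E \<in> sets M" using g(1) by auto
    have "integrable M (\<lambda>w. g w * indicator ?E w)"
      using integrable_mult_indicator[OF E g(1)] by (simp add: mult.commute)
    then have "AE w in M. g w * indicator ?E w = 0"
      using g(2)[OF E] by (subst (asm) integral_nonneg_eq_0_iff_AE) (auto simp: indicator_def)
    then show ?thesis by (rule AE_mp) (auto intro!: AE_I2 simp: indicator_def split: if_splits)
  qed
  have "AE w in M. h w \<le> 0" by (rule pos[OF h all])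
  moreover have "AE w in M. - h w \<le> 0" by (rule pos) (use h all in auto)
  ultimately show ?thesis by eventually_elim simp
qed

lemma AE_eq_0_of_plane_waves:
  fixes h :: "'a \<Rightarrow> real" and X :: "'i \<Rightarrow> 'a \<Rightarrow> real"
  assumes h: "integrable M h"
    and sets: "sets M = sigma_sets (space M) {{w \<in> space M. X k w \<in> A} | k A. k \<in> S \<and> A \<in> sets borel}"
    and zero: "\<And>J \<beta> \<theta>. finite J \<Longrightarrow> J \<subseteq> S \<Longrightarrow> (\<integral>w. h w * plane_wave J \<beta> \<theta> (\<lambda>k. X k w) \<partial>M) = 0"
  shows "AE w in M. h w = 0"
proof -
  let ?G0 = "{{w \<in> space M. X k w \<in> A} | k A. k \<in> S \<and> A \<in> sets borel}"
  \<comment> \<open>The cylinder sets close the generators under finite intersections.\<close>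
  define G where "G = {{w \<in> space M. \<forall>i\<in>I. X i w \<in> A i} | I A. finite I \<and> I \<subseteq> S \<and> (\<forall>i. A i \<in> sets borel)}"
  have X: "X k \<in> borel_measurable M" if "k \<in> S" for k
  proof (rule measurableI)
    fix A :: "real set" assume "A \<in> sets borel"
    then have "{w \<in> space M. X k w \<in> A} \<in> sets M" unfolding sets using that by (intro sigma_sets.Basic) blast
    then show "X k -` A \<inter> space M \<in> sets M" by (simp add: vimage_def Int_def conj_commute)
  qed auto
  have G_sets: "G \<subseteq> sets M"
  proof
    fix E assume "E \<in> G"
    then obtain I A where E: "E = {w \<in> space M. \<forall>i\<in>I. X i w \<in> A i}" "finite I" "I \<subseteq> S" "\<And>i. A i \<in> sets borel"
      by (auto simp: G_def)
    show "E \<in> sets M"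
      unfolding E(1) by (intro sets.sets_Collect_finite_All' sets.sets_Collect_finite_All measurable_sets_Collect[OF X]) (use E in auto)
  qed
  have G0_G: "?G0 \<subseteq> G"
  proof
    fix E assume "E \<in> ?G0"
    then obtain k A where "E = {w \<in> space M. X k w \<in> A}" "k \<in> S" "A \<in> sets borel" by auto
    then show "E \<in> G" unfolding G_def by (auto intro!: exI[of _ "{k}"] exI[of _ "\<lambda>_. A"])
  qed
  have "sets M = sigma_sets (space M) G"
  proof
    show "sets M \<subseteq> sigma_sets (space M) G" unfolding sets by (rule sigma_sets_mono') (rule G0_G)
    show "sigma_sets (space M) G \<subseteq> sets M" by (rule sets.sigma_sets_subset[OF G_sets])
  qed
  moreover have "Int_stable G"
  proof (rule Int_stableI)
    fix E F assume "E \<in> G" "F \<in> G"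
    then obtain I A J B where
      E: "E = {w \<in> space M. \<forall>i\<in>I. X i w \<in> A i}" "finite I" "I \<subseteq> S" "\<And>i. A i \<in> sets borel" and
      F: "F = {w \<in> space M. \<forall>i\<in>J. X i w \<in> B i}" "finite J" "J \<subseteq> S" "\<And>i. B i \<in> sets borel"
      by (auto simp: G_def)
    define C where "C i = (if i \<in> I then A i else UNIV) \<inter> (if i \<in> J then B i else UNIV)" for i
    have "E \<inter> F = {w \<in> space M. \<forall>i\<in>I \<union> J. X i w \<in> C i}"
      unfolding E(1) F(1) C_def by auto
    moreover have "C i \<in> sets borel" for i unfolding C_def using E(4) F(4) by auto
    ultimately show "E \<inter> F \<in> G"
      unfolding G_def using E(2,3) F(2,3) by (auto intro!: exI[of _ "I \<union> J"] exI[of _ C])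
  qed
  moreover have "(\<integral>w. h w * indicator E w \<partial>M) = 0" if EG: "E \<in> G" for E
  proof -
    obtain I A where E: "E = {w \<in> space M. \<forall>i\<in>I. X i w \<in> A i}" "finite I" "I \<subseteq> S" "\<And>i. A i \<in> sets borel"
      using EG unfolding G_def mem_Collect_eq by blast
    have "(\<integral>w. h w * indicator E w \<partial>M) = (\<integral>w. h w * (\<Prod>i\<in>I. indicator (A i) (X i w)) \<partial>M)"
    proof (intro Bochner_Integration.integral_cong refl arg_cong[where f = "(*) _"])
      fix w assume "w \<in> space M"
      then show "indicator E w = (\<Prod>i\<in>I. indicator (A i) (X i w) :: real)"
        using E(2) unfolding E(1) by (auto simp: indicator_def prod_zero_iff intro!: prod.neutral[symmetric])
    qed
    also have "\<dots> = 0"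
      by (rule integral_cylinder_eq_0[OF h X zero E(2,3) E(4)])
    finally show ?thesis .
  qed
  moreover have "(\<integral>w. h w \<partial>M) = 0"
    using zero[of "{}" "\<lambda>_. 0" 0] by (simp add: plane_wave_def lin_def)
  moreover have "G \<subseteq> Pow (space M)" by (auto simp: G_def)
  ultimately show ?thesis by (intro AE_eq_0_of_generator[OF h])
qed

subsection \<open>The limit operator\<close>

lemma C2_const: "C2 I (\<lambda>_. a)"
  unfolding C2_def has_pd_imp_pd[OF has_pd_const] by (simp add: C1_const)

lemma galerkin_op_const: "galerkin_op s N (\<lambda>_. a) c = 0"
proof -
  have "dd I V (\<lambda>_. a) = (\<lambda>_. 0)" for I :: "mode set" and V by (rule ext) (rule dd_const)
  then show ?thesis by (simp add: galerkin_op_def dd_const)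
qed

lemma space_interval_measure: "space (interval_measure T) = {0..T}"
  by (simp add: interval_measure_def space_restrict_space)

lemma finite_interval_measure: "finite_measure (interval_measure T)"
proof
  have "emeasure (interval_measure T) {0..T} = emeasure lborel {0..T}"
    unfolding interval_measure_def by (rule emeasure_restrict_space) auto
  then show "emeasure (interval_measure T) (space (interval_measure T)) \<noteq> \<infinity>"
    by (simp add: space_interval_measure emeasure_lborel_Icc_eq)
qed

lemma measure_interval_measure: "0 \<le> T \<Longrightarrow> measure (interval_measure T) (space (interval_measure T)) = T"
  unfolding space_interval_measure unfolding interval_measure_def by (subst measure_restrict_space) auto

lemma integral_interval_measure:
  fixes f :: "real \<Rightarrow> real"
  assumes "t \<in> {0..T}"
  shows "integrable (interval_measure T) (\<lambda>s. indicator {0..t} s * f s) \<longleftrightarrow> integrable lborel (\<lambda>s. indicator {0..t} s *\<^sub>R f s)"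
    "(\<integral>s. indicator {0..t} s * f s \<partial>interval_measure T) = (\<integral>s. indicator {0..t} s *\<^sub>R f s \<partial>lborel)"
proof -
  have "(\<lambda>s. indicator {0..T} s *\<^sub>R (indicator {0..t} s * f s)) = (\<lambda>s. indicator {0..t} s *\<^sub>R f s)"
    using assms by (auto simp: fun_eq_iff indicator_def)
  then show "integrable (interval_measure T) (\<lambda>s. indicator {0..t} s * f s) \<longleftrightarrow> integrable lborel (\<lambda>s. indicator {0..t} s *\<^sub>R f s)"
    "(\<integral>s. indicator {0..t} s * f s \<partial>interval_measure T) = (\<integral>s. indicator {0..t} s *\<^sub>R f s \<partial>lborel)"
    unfolding interval_measure_def by (simp_all add: integrable_restrict_space integral_restrict_space)
qed

context mode_gaussian
begin

text \<open>Invariance of the Gaussian law is inherited from the Galerkin operators: duality with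
  the constant 1 makes \<open>galerkin_op (- 1) N\<close> of a plane wave centred, and mean zero
  survives division by \<open>inv_square_sum N\<close> and the limit in \<open>L^2\<close>.\<close>

lemma expectation_ou_op:
  assumes J: "finite J" "J \<subseteq> Z20"
  shows "(\<integral>w. ou_op J \<beta> \<theta> (\<lambda>k. X k w) \<partial>M) = 0"
proof -
  let ?G = "\<lambda>w. ou_op J \<beta> \<theta> (\<lambda>k. X k w)"
  let ?L = "\<lambda>N w. galerkin_op (- 1) N (plane_wave J \<beta> \<theta>) (vec (modes N) w)"
  obtain N1 \<epsilon> where \<epsilon>: "\<epsilon> \<longlonglongrightarrow> 0" and a: "\<And>N. N1 \<le> N \<Longrightarrow> inv_square_sum N > 0"
    and "\<And>N. N1 \<le> N \<Longrightarrow> J \<subseteq> modes N"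
    and int: "\<And>N. N1 \<le> N \<Longrightarrow> integrable M (\<lambda>w. (?L N w / inv_square_sum N - ?G w)\<^sup>2)"
    and le: "\<And>N. N1 \<le> N \<Longrightarrow> (\<integral>w. (?L N w / inv_square_sum N - ?G w)\<^sup>2 \<partial>M) \<le> \<epsilon> N"
    by (rule galerkin_op_plane_wave_limit[OF J, where \<beta> = \<beta> and \<theta> = \<theta>]) (rule that; assumption)
  have mL: "?L N \<in> borel_measurable M" for N
    by (intro measurable_vec_continuous continuous_on_galerkin_op C2_plane_wave J modes_subset)
  have mG: "?G \<in> borel_measurable M" by (rule ou_op_measurable[OF J(2)])
  have iG: "integrable M ?G"
    by (rule square_integrable_imp_integrable[OF mG integrable_ou_op_square[OF J]])
  have bound: "\<bar>\<integral>w. ?G w \<partial>M\<bar> \<le> sqrt (\<epsilon> N)" if N: "N1 \<le> N" for N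
  proof -
    let ?a = "inv_square_sum N"
    let ?d = "\<lambda>w. ?L N w / ?a - ?G w"
    have md: "?d \<in> borel_measurable M" using mL mG by simp
    have id: "integrable M ?d" by (rule square_integrable_imp_integrable[OF md int[OF N]])
    from Bochner_Integration.integrable_add[OF id iG] have "integrable M (\<lambda>w. ?L N w / ?a)" by simp
    from integrable_mult_right[OF this, of ?a] have iL: "integrable M (?L N)" using a[OF N] by simp
    have "(\<lambda>n. \<integral>w. ?L N w * cutoff (modes N) (real (Suc n)) (vec (modes N) w) \<partial>M) \<longlonglongrightarrow> (\<integral>w. ?L N w \<partial>M)"
    proof (rule integral_dominated_convergence[where w = "\<lambda>w. \<bar>?L N w\<bar>"])
      show "(\<lambda>w. ?L N w * cutoff (modes N) (real (Suc n)) (vec (modes N) w)) \<in> borel_measurable M" for n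
        by (intro borel_measurable_times mL measurable_vec_continuous C1_continuous[OF C1_cutoff] finite_modes modes_subset)
      show "AE w in M. (\<lambda>n. ?L N w * cutoff (modes N) (real (Suc n)) (vec (modes N) w)) \<longlonglongrightarrow> ?L N w"
        using tendsto_mult[OF tendsto_const cutoff_tendsto_1[OF finite_modes]] by (intro AE_I2) force
      show "AE w in M. norm (?L N w * cutoff (modes N) (real (Suc n)) (vec (modes N) w)) \<le> \<bar>?L N w\<bar>" for n
        by (intro AE_I2) (simp add: abs_mult cutoff_bounds mult_left_le)
    qed (use mL iL in auto)
    moreover have "(\<integral>w. ?L N w * cutoff (modes N) (real (Suc n)) (vec (modes N) w) \<partial>M) = 0" for n
    proof -
      have "EC N (real (Suc n)) (\<lambda>c. 1 * galerkin_op (- 1) N (plane_wave J \<beta> \<theta>) c) =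
          EC N (real (Suc n)) (\<lambda>c. plane_wave J \<beta> \<theta> c * galerkin_op 1 N (\<lambda>_. 1) c)"
        by (rule EC_galerkin_op_dual[symmetric]) (auto intro!: C2_const C2_plane_wave J)
      then show ?thesis by (simp add: galerkin_op_const EC_def)
    qed
    ultimately have L0: "(\<integral>w. ?L N w \<partial>M) = 0" by (simp add: LIMSEQ_const_iff)
    have "(\<integral>w. ?G w \<partial>M) = - (\<integral>w. 1 * ?d w \<partial>M)"
      using iL iG by (simp add: L0)
    then have "\<bar>\<integral>w. ?G w \<partial>M\<bar> = \<bar>\<integral>w. 1 * ?d w \<partial>M\<bar>" by (simp only: abs_minus_cancel)
    also have "\<dots> \<le> sqrt (\<integral>w. 1\<^sup>2 \<partial>M) * sqrt (\<integral>w. (?d w)\<^sup>2 \<partial>M)"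
      by (rule cauchy_schwarz_integral(2)) (use md int[OF N] in auto)
    also have "\<dots> \<le> sqrt (\<epsilon> N)" using le[OF N] by (simp add: prob_space)
    finally show ?thesis .
  qed
  have "(\<lambda>N. sqrt (\<epsilon> N)) \<longlonglongrightarrow> sqrt 0" by (intro tendsto_intros \<epsilon>)
  then have "\<bar>\<integral>w. ?G w \<partial>M\<bar> \<le> 0"
    by (intro LIMSEQ_le_const[of _ "0"]) (use bound in auto)
  then show ?thesis by simp
qed

text \<open>Along \<open>\<tau> \<mapsto> (\<beta>\<^sub>j exp (|j|\<^sup>2 \<tau>))\<^sub>j\<close> the hypothesis becomes a linear differential equation for
  \<open>E [h cos (\<dots>)]\<close>; letting \<open>\<tau> \<rightarrow> -\<infinity>\<close> identifies its solution.\<close>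

lemma expectation_plane_wave:
  assumes h: "h \<in> borel_measurable M" "integrable M (\<lambda>w. (h w)\<^sup>2)" and J: "finite J" "J \<subseteq> Z20"
    and zero: "\<And>\<beta>. (\<integral>w. h w * ou_op J \<beta> \<theta> (\<lambda>k. X k w) \<partial>M) = 0"
  shows "(\<integral>w. h w * plane_wave J \<beta> \<theta> (\<lambda>k. X k w) \<partial>M) = (\<integral>w. h w \<partial>M) * cos \<theta> * exp (- (\<Sum>j\<in>J. (\<beta> j)\<^sup>2) / 2)"
proof -
  define \<nu> where "\<nu> j = (norm (rvec j))\<^sup>2" for j
  define b where "b \<tau> j = \<beta> j * exp (\<nu> j * \<tau>)" for \<tau> j
  have \<nu>: "\<nu> j > 0" if "j \<in> J" for j using J that by (auto simp: \<nu>_def Z20_iff)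
  have ih: "integrable M h" by (rule square_integrable_imp_integrable[OF h])
  have XJ: "X j \<in> borel_measurable M" if "j \<in> J" for j using J that by (intro X_measurable) auto
  have ihX: "integrable M (\<lambda>w. h w * X j w)" if "j \<in> J" for j
    using J that wick2(1)[of j j] XJ[OF that] h
    by (intro cauchy_schwarz_integral(1)) (auto simp: power2_eq_square)
  define y where "y \<tau> w = lin J (b \<tau>) (\<lambda>k. X k w) + \<theta>" for \<tau> w
  define z where "z \<tau> w = (\<Sum>j\<in>J. b \<tau> j * \<nu> j * X j w)" for \<tau> w
  define V where "V \<tau> = (\<Sum>j\<in>J. (b \<tau> j)\<^sup>2 * \<nu> j)" for \<tau>
  define f where "f \<tau> w = h w * cos (y \<tau> w)" for \<tau> w
  define f' where "f' \<tau> w = - (h w * (sin (y \<tau> w) * z \<tau> w))" for \<tau> w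
  define \<Phi> where "\<Phi> \<tau> = (\<integral>w. f \<tau> w \<partial>M)" for \<tau>
  have ym: "y \<tau> \<in> borel_measurable M" "z \<tau> \<in> borel_measurable M" for \<tau>
    unfolding y_def[abs_def] z_def[abs_def] lin_def
    by (intro borel_measurable_sum borel_measurable_times borel_measurable_add borel_measurable_const XJ; simp)+
  have fm: "f \<tau> \<in> borel_measurable M" "f' \<tau> \<in> borel_measurable M" for \<tau>
    unfolding f_def[abs_def] f'_def[abs_def] using h ym by simp_all
  have fi: "integrable M (f \<tau>)" for \<tau>
    by (rule Bochner_Integration.integrable_bound[OF ih fm(1)]) (simp add: f_def abs_mult mult_left_le)
  \<comment> \<open>For \<open>\<tau> \<le> 0\<close> all exponentials are at most 1, so this
    function dominates independently of \<open>\<tau>\<close>; the curve is therefore followed on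
    the negative half-line only.\<close>
  define g where "g w = (\<Sum>j\<in>J. \<bar>\<beta> j\<bar> * \<nu> j * \<bar>h w * X j w\<bar>)" for w
  have gi: "integrable M g"
    unfolding g_def by (intro Bochner_Integration.integrable_sum integrable_mult_right integrable_abs ihX)
  have dom: "\<bar>f' \<tau> w\<bar> \<le> g w" if "\<tau> \<le> 0" for \<tau> w
  proof -
    have "\<bar>f' \<tau> w\<bar> = \<bar>sin (y \<tau> w)\<bar> * \<bar>h w * z \<tau> w\<bar>" by (simp add: f'_def abs_mult mult_ac)
    also have "\<dots> \<le> 1 * \<bar>h w * z \<tau> w\<bar>" by (intro mult_right_mono) auto
    also have "\<dots> = \<bar>\<Sum>j\<in>J. b \<tau> j * \<nu> j * (h w * X j w)\<bar>"
      by (simp add: z_def sum_distrib_left mult_ac)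
    also have "\<dots> \<le> (\<Sum>j\<in>J. \<bar>b \<tau> j * \<nu> j * (h w * X j w)\<bar>)" by (rule sum_abs)
    also have "\<dots> \<le> g w"
      unfolding g_def
    proof (rule sum_mono)
      fix j assume j: "j \<in> J"
      have "\<bar>b \<tau> j\<bar> \<le> \<bar>\<beta> j\<bar> * 1"
        unfolding b_def abs_mult using \<nu>[OF j] that by (intro mult_left_mono) (auto simp: mult_nonneg_nonpos)
      then show "\<bar>b \<tau> j * \<nu> j * (h w * X j w)\<bar> \<le> \<bar>\<beta> j\<bar> * \<nu> j * \<bar>h w * X j w\<bar>"
        unfolding abs_mult[of "_ * _" "h w * X j w"] abs_mult[of "b \<tau> j"] using \<nu>[OF j]
        by (intro mult_right_mono) auto
    qed
    finally show ?thesis .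
  qed
  have yd: "((\<lambda>\<tau>. y \<tau> w) has_real_derivative z \<tau> w) (at \<tau> within U)" for w \<tau> U
    unfolding y_def z_def lin_def b_def
    by (auto intro!: derivative_eq_intros sum.cong simp: mult_ac)
  have fd: "((\<lambda>\<tau>. f \<tau> w) has_real_derivative f' \<tau> w) (at \<tau> within U)" for w \<tau> U
    unfolding f_def f'_def by (auto intro!: derivative_eq_intros yd)
  have \<Phi>d: "(\<Phi> has_real_derivative (\<integral>w. f' \<tau> w \<partial>M)) (at \<tau> within {..0})" if "\<tau> \<in> {..0}" for \<tau>
    unfolding \<Phi>_def[abs_def]
    by (rule has_derivative_integral_dominated[where g = g]) (use that fi fm fd dom gi in auto)
  have f'_eq: "(\<integral>w. f' \<tau> w \<partial>M) = - V \<tau> * \<Phi> \<tau>" if "\<tau> \<le> 0" for \<tau>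
  proof -
    have f'i: "integrable M (f' \<tau>)"
      by (rule Bochner_Integration.integrable_bound[OF gi fm(2)]) (use dom[OF that] in \<open>auto intro!: AE_I2 order_trans[OF _ abs_ge_self]\<close>)
    have "h w * ou_op J (b \<tau>) \<theta> (\<lambda>k. X k w) = pi\<^sup>2 / 2 * (- f' \<tau> w - V \<tau> * f \<tau> w)" for w
      by (simp add: ou_op_def f'_def f_def y_def z_def V_def \<nu>_def algebra_simps)
    with zero[of "b \<tau>"] have "(\<integral>w. - f' \<tau> w - V \<tau> * f \<tau> w \<partial>M) = 0" by simp
    then show ?thesis using f'i fi[of \<tau>] by (simp add: \<Phi>_def)
  qed
  \<comment> \<open>The exponent of the integrating factor: its derivative is \<open>V\<close>,
    while that of \<open>\<Phi>\<close> is \<open>- V\<close> times \<open>\<Phi>\<close>. It tends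
    to 0 as \<open>\<tau>\<close> tends to \<open>-\<infinity>\<close>.\<close>
  define E where "E \<tau> = (\<Sum>j\<in>J. (b \<tau> j)\<^sup>2) / 2" for \<tau>
  have Ed: "(E has_real_derivative V \<tau>) (at \<tau> within U)" for \<tau> U
    unfolding E_def[abs_def] V_def b_def
    by (auto intro!: derivative_eq_intros sum.cong simp: power2_eq_square sum_divide_distrib)
  have "((\<lambda>\<tau>. \<Phi> \<tau> * exp (E \<tau>)) has_real_derivative 0) (at \<tau> within {..0})" if "\<tau> \<in> {..0}" for \<tau>
    using that by (auto intro!: derivative_eq_intros \<Phi>d Ed simp: f'_eq)
  then have "\<exists>c. \<forall>\<tau>\<in>{..0}. \<Phi> \<tau> * exp (E \<tau>) = c"
    by (intro has_field_derivative_zero_constant) auto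
  then have const: "\<Phi> (- real n) * exp (E (- real n)) = \<Phi> 0 * exp (E 0)" for n
    by (metis atMost_iff neg_le_0_iff_le of_nat_0_le_iff order_refl)
  have bl: "(\<lambda>n. b (- real n) j) \<longlonglongrightarrow> 0" if "j \<in> J" for j
  proof -
    have "(\<lambda>n. exp (- \<nu> j) ^ n) \<longlonglongrightarrow> 0" using \<nu>[OF that] by (intro LIMSEQ_power_zero) auto
    from tendsto_mult[OF tendsto_const[of "\<beta> j"] this] show ?thesis
      by (simp add: b_def mult.commute flip: exp_of_nat_mult)
  qed
  have "(\<lambda>n. \<Phi> (- real n)) \<longlonglongrightarrow> (\<integral>w. h w * cos \<theta> \<partial>M)"
    unfolding \<Phi>_def
  proof (rule integral_dominated_convergence[where w = "\<lambda>w. \<bar>h w\<bar>"])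
    show "AE w in M. (\<lambda>n. f (- real n) w) \<longlonglongrightarrow> h w * cos \<theta>"
    proof (rule AE_I2)
      fix w
      have "(\<lambda>n. y (- real n) w) \<longlonglongrightarrow> (\<Sum>j\<in>J. 0 * X j w) + \<theta>"
        unfolding y_def lin_def by (intro tendsto_intros bl)
      then show "(\<lambda>n. f (- real n) w) \<longlonglongrightarrow> h w * cos \<theta>"
        unfolding f_def by (intro tendsto_intros) simp
    qed
    show "AE w in M. norm (f (- real n) w) \<le> \<bar>h w\<bar>" for n
      by (intro AE_I2) (simp add: f_def abs_mult mult_left_le)
  qed (use h ih fm in auto)
  moreover have "(\<lambda>n. E (- real n)) \<longlonglongrightarrow> (\<Sum>j\<in>J. 0\<^sup>2) / 2"
    unfolding E_def by (intro tendsto_intros bl) auto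
  ultimately have "(\<lambda>n. \<Phi> (- real n) * exp (E (- real n))) \<longlonglongrightarrow> (\<integral>w. h w * cos \<theta> \<partial>M) * exp 0"
    by (intro tendsto_intros) simp_all
  then have "\<Phi> 0 * exp (E 0) = (\<integral>w. h w \<partial>M) * cos \<theta>"
    unfolding const by (simp add: LIMSEQ_const_iff)
  then have "\<Phi> 0 = (\<integral>w. h w \<partial>M) * cos \<theta> * exp (- E 0)"
    by (simp add: exp_minus field_simps)
  moreover have "b 0 = \<beta>" by (simp add: b_def fun_eq_iff)
  ultimately show ?thesis
    by (simp add: \<Phi>_def f_def y_def E_def plane_wave_def)
qed

text \<open>Subtracting the mean preserves the orthogonality, because \<open>ou_op\<close> is
  centred. For mean zero, \<open>expectation_plane_wave\<close> makes all Fourier coefficients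
  vanish.\<close>

lemma constant_of_ou_op_orthogonal:
  assumes h: "h \<in> borel_measurable M" "integrable M (\<lambda>w. (h w)\<^sup>2)"
    and sets: "sets M = sigma_sets (space M) {{w \<in> space M. X k w \<in> A} | k A. k \<in> Z20 \<and> A \<in> sets borel}"
    and zero: "\<And>J \<beta> \<theta>. finite J \<Longrightarrow> J \<subseteq> Z20 \<Longrightarrow> (\<integral>w. h w * ou_op J \<beta> \<theta> (\<lambda>k. X k w) \<partial>M) = 0"
  shows "AE w in M. h w = (\<integral>w. h w \<partial>M)"
proof -
  define m where "m = (\<integral>w. h w \<partial>M)"
  have ih: "integrable M h" by (rule square_integrable_imp_integrable[OF h])
  have h0: "(\<lambda>w. h w - m) \<in> borel_measurable M" "integrable M (\<lambda>w. (h w - m)\<^sup>2)"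
    using h ih by (auto simp: power2_diff)
  have "AE w in M. h w - m = 0"
  proof (rule AE_eq_0_of_plane_waves[where S = Z20, OF _ sets])
    show "integrable M (\<lambda>w. h w - m)" using ih by simp
    fix J \<beta> \<theta> assume J: "finite J" "J \<subseteq> Z20"
    have "(\<integral>w. (h w - m) * ou_op J \<beta> \<theta> (\<lambda>k. X k w) \<partial>M) = 0" for \<beta>
    proof -
      have i: "integrable M (\<lambda>w. h w * ou_op J \<beta> \<theta> (\<lambda>k. X k w))" "integrable M (\<lambda>w. ou_op J \<beta> \<theta> (\<lambda>k. X k w))"
        by (rule cauchy_schwarz_integral(1)[OF h(1) ou_op_measurable[OF J(2)] h(2) integrable_ou_op_square[OF J]],
            rule square_integrable_imp_integrable[OF ou_op_measurable[OF J(2)] integrable_ou_op_square[OF J]])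
      then show ?thesis
        by (simp add: left_diff_distrib zero[OF J] expectation_ou_op[OF J])
    qed
    from expectation_plane_wave[OF h0 J this]
    show "(\<integral>w. (h w - m) * plane_wave J \<beta> \<theta> (\<lambda>k. X k w) \<partial>M) = 0"
      using ih by (simp add: m_def prob_space)
  qed
  then show ?thesis by (simp add: m_def)
qed

subsection \<open>Testing the equation against plane waves\<close>

text \<open>After division by \<open>inv_square_sum N\<close> the boundary terms of the duality formula vanish as \<open>N\<close> grows.\<close>

lemma time_integral_ou_op_bound:
  assumes T: "T > 0" and sol: "coordinate_solution T N u"
    and int0: "integrable M (\<lambda>w. (u 0 (vec (modes N) w))\<^sup>2)"
    and B: "(\<integral>w. (u 0 (vec (modes N) w))\<^sup>2 \<partial>M) \<le> B"
    and J: "finite J" "J \<subseteq> Z20" and a: "inv_square_sum N > 0"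
    and intL: "integrable M (\<lambda>w. (galerkin_op (- 1) N (plane_wave J \<beta> \<theta>) (vec (modes N) w) / inv_square_sum N
        - ou_op J \<beta> \<theta> (\<lambda>k. X k w))\<^sup>2)"
    and \<delta>: "(\<integral>w. (galerkin_op (- 1) N (plane_wave J \<beta> \<theta>) (vec (modes N) w) / inv_square_sum N
        - ou_op J \<beta> \<theta> (\<lambda>k. X k w))\<^sup>2 \<partial>M) \<le> \<delta>"
    and meas: "(\<lambda>(t, w). u t (vec (modes N) w)) \<in> borel_measurable (interval_measure T \<Otimes>\<^sub>M M)"
    and t: "t \<in> {0..T}"
  shows "\<bar>\<integral>s. indicator {0..t} s * (\<integral>w. u s (vec (modes N) w) * ou_op J \<beta> \<theta> (\<lambda>k. X k w) \<partial>M) \<partial>interval_measure T\<bar>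
    \<le> 2 * sqrt B / inv_square_sum N + T * (sqrt B * sqrt \<delta>)"
proof -
  let ?v = "\<lambda>w. vec (modes N) w"
  let ?W = "plane_wave J \<beta> \<theta>"
  define G where "G w = ou_op J \<beta> \<theta> (\<lambda>k. X k w)" for w
  define A where "A = inv_square_sum N"
  define L where "L w = galerkin_op (- 1) N ?W (?v w) / A" for w
  define \<eta> where "\<eta> n w = cutoff (modes N) (real (Suc n)) (?v w)" for n w
  define I where "I = interval_measure T"
  interpret I: finite_measure I unfolding I_def by (rule finite_interval_measure)
  have cont: "continuous_on UNIV (u s)" if "s \<in> {0..T}" for s
    using u_C2[OF T sol that] by (auto simp: C2_def intro: C1_continuous)
  have um: "(\<lambda>w. u s (?v w)) \<in> borel_measurable M" if "s \<in> {0..T}" for s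
    by (intro measurable_vec_continuous cont that modes_subset)
  have ui: "integrable M (\<lambda>w. (u s (?v w))\<^sup>2)" and uB: "sqrt (\<integral>w. (u s (?v w))\<^sup>2 \<partial>M) \<le> sqrt B" if "s \<in> {0..T}" for s
    using energy[OF T sol that int0] B by auto
  have sB: "0 \<le> sqrt B"
  proof -
    have "0 \<le> sqrt (\<integral>w. (u 0 (?v w))\<^sup>2 \<partial>M)" by simp
    also have "\<dots> \<le> sqrt B" using T by (intro uB) simp
    finally show ?thesis .
  qed
  have mG: "G \<in> borel_measurable M" and iG: "integrable M (\<lambda>w. (G w)\<^sup>2)"
    unfolding G_def by (rule ou_op_measurable[OF J(2)], rule integrable_ou_op_square[OF J])
  have mL: "L \<in> borel_measurable M"
    unfolding L_def[abs_def] using J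
    by (intro borel_measurable_divide borel_measurable_const measurable_vec_continuous continuous_on_galerkin_op
        C2_plane_wave modes_subset)
  have iLG: "integrable M (\<lambda>w. (L w - G w)\<^sup>2)" and \<delta>': "(\<integral>w. (L w - G w)\<^sup>2 \<partial>M) \<le> \<delta>"
    using intL \<delta> by (simp_all add: L_def G_def A_def)
  have m\<eta>: "\<eta> n \<in> borel_measurable M" for n
    unfolding \<eta>_def by (intro measurable_vec_continuous C1_continuous[OF C1_cutoff] finite_modes modes_subset)
  have \<eta>: "0 \<le> \<eta> n w" "\<eta> n w \<le> 1" for n w unfolding \<eta>_def by (rule cutoff_bounds; simp)+
  define dm where "dm w = 4 * (G w)\<^sup>2 + 4 * (L w - G w)\<^sup>2" for w
  have idm: "integrable M dm" unfolding dm_def[abs_def] using iG iLG by simp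
  have dom: "(G w - \<eta> n w * L w)\<^sup>2 \<le> dm w" for n w
  proof -
    \<comment> \<open>The error consists of the part of \<open>G\<close> removed by the cutoff and
      the truncated operator error; both are dominated uniformly in \<open>n\<close>.\<close>
    have "(G w - \<eta> n w * L w)\<^sup>2 = ((1 - \<eta> n w) * G w - \<eta> n w * (L w - G w))\<^sup>2" by (simp add: algebra_simps)
    also have "\<dots> \<le> 2 * ((1 - \<eta> n w) * G w)\<^sup>2 + 2 * (\<eta> n w * (L w - G w))\<^sup>2"
      using sum_squares_ge_zero[of "(1 - \<eta> n w) * G w + \<eta> n w * (L w - G w)" 0] by (simp add: power2_eq_square algebra_simps)
    also have "\<dots> \<le> 2 * (G w)\<^sup>2 + 2 * (L w - G w)\<^sup>2"
      using \<eta>[of n w] by (intro add_mono mult_left_mono) (auto simp: power_mult_distrib power_le_one intro!: mult_left_le_one_le)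
    also have "\<dots> \<le> dm w" by (simp add: dm_def)
    finally show ?thesis .
  qed
  have mD: "(\<lambda>w. G w - \<eta> n w * L w) \<in> borel_measurable M" for n using mG mL m\<eta> by simp
  have iD: "integrable M (\<lambda>w. (G w - \<eta> n w * L w)\<^sup>2)" for n
    by (rule Bochner_Integration.integrable_bound[OF idm])
      (use mD dom in \<open>auto intro!: AE_I2 order_trans[OF _ abs_ge_self]\<close>)
  define D where "D n = (\<integral>w. (G w - \<eta> n w * L w)\<^sup>2 \<partial>M)" for n
  have D_lim: "D \<longlonglongrightarrow> (\<integral>w. (G w - 1 * L w)\<^sup>2 \<partial>M)"
    unfolding D_def
  proof (rule integral_dominated_convergence[where w = dm])
    show "AE w in M. (\<lambda>n. (G w - \<eta> n w * L w)\<^sup>2) \<longlonglongrightarrow> (G w - 1 * L w)\<^sup>2"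
      unfolding \<eta>_def by (intro AE_I2 tendsto_intros cutoff_tendsto_1) simp
  qed (use mG mL mD idm dom in auto)
  define p where "p s = (\<integral>w. u s (?v w) * G w \<partial>M)" for s
  have p_meas: "p \<in> borel_measurable I"
  proof -
    have "(\<lambda>(s, w). u s (?v w) * G w) \<in> borel_measurable (I \<Otimes>\<^sub>M M)"
      using borel_measurable_times[OF meas[folded I_def] measurable_compose[OF measurable_snd mG]]
      by (simp add: case_prod_beta')
    then show ?thesis unfolding p_def[abs_def] by (rule borel_measurable_lebesgue_integral)
  qed
  have p_bound: "\<bar>p s\<bar> \<le> sqrt B * sqrt (\<integral>w. (G w)\<^sup>2 \<partial>M)" if s: "s \<in> {0..T}" for s
  proof -
    have "\<bar>p s\<bar> \<le> sqrt (\<integral>w. (u s (?v w))\<^sup>2 \<partial>M) * sqrt (\<integral>w. (G w)\<^sup>2 \<partial>M)"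
      unfolding p_def by (rule cauchy_schwarz_integral(2)[OF um[OF s] mG ui[OF s] iG])
    also have "\<dots> \<le> sqrt B * sqrt (\<integral>w. (G w)\<^sup>2 \<partial>M)" by (intro mult_right_mono uB s) simp
    finally show ?thesis .
  qed
  have ind: "(indicator {0..t} :: real \<Rightarrow> real) \<in> borel_measurable I"
    unfolding I_def interval_measure_def by (intro measurable_restrict_space1) auto
  have ip: "integrable I (\<lambda>s. indicator {0..t} s * p s)"
  proof (rule I.integrable_const_bound)
    show "AE s in I. norm (indicator {0..t} s * p s) \<le> sqrt B * sqrt (\<integral>w. (G w)\<^sup>2 \<partial>M)"
      using p_bound p_bound[of 0] T
      by (intro AE_I2) (auto simp: I_def space_interval_measure indicator_def intro: order_trans[OF abs_ge_zero])
  qed (use ind p_meas in simp)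
  \<comment> \<open>At fixed \<open>N\<close>, \<open>q\<close> uses the truncated Galerkin operator
    in place of \<open>G\<close>: duality turns its time integral into boundary terms, bounded by
    the energy and divided by \<open>A\<close>. The energy also controls \<open>p - q\<close>. The
    cutoff is removed afterwards, by letting \<open>n\<close> grow.\<close>
  have main: "\<bar>\<integral>s. indicator {0..t} s * p s \<partial>I\<bar> \<le> 2 * sqrt B / A + T * (sqrt B * sqrt (D n))" for n
  proof -
    define R where "R = real (Suc n)"
    have R: "R > 0" by (simp add: R_def)
    define q where "q s = (\<integral>w. u s (?v w) * (\<eta> n w * L w) \<partial>M)" for s
    have q_EC: "q s = EC N R (\<lambda>c. u s c * galerkin_op (- 1) N ?W c) / A" for s
    proof -
      have "q s = (\<integral>w. u s (?v w) * galerkin_op (- 1) N ?W (?v w) * cutoff (modes N) R (?v w) / A \<partial>M)"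
        unfolding q_def \<eta>_def L_def R_def
        by (intro Bochner_Integration.integral_cong refl) (simp add: mult_ac)
      then show ?thesis unfolding EC_def by simp
    qed
    note dual = duality_cutoff[OF T sol R t C2_plane_wave[OF J(1)]]
    have iq: "integrable I (\<lambda>s. indicator {0..t} s * q s)"
      unfolding I_def q_EC using integral_interval_measure(1)[OF t] dual(1)[where \<beta>1 = \<beta> and \<theta>1 = \<theta>]
      by (simp add: divide_inverse flip: mult.assoc)
    have EC_bound: "\<bar>EC N R (\<lambda>c. u s c * ?W c)\<bar> \<le> sqrt B" if s: "s \<in> {0..T}" for s
    proof -
      define k where "k w = ?W (?v w) * \<eta> n w" for w
      have k1: "\<bar>k w\<bar> \<le> 1" for w
        unfolding k_def abs_mult plane_wave_def using \<eta>[of n w] by (intro mult_le_one) auto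
      have mk: "k \<in> borel_measurable M"
        unfolding k_def[abs_def] using C2_plane_wave[OF J(1)]
        by (intro borel_measurable_times m\<eta> measurable_vec_continuous modes_subset) (auto simp: C2_def intro: C1_continuous)
      have k2: "(k w)\<^sup>2 \<le> 1" for w using k1[of w] by (simp add: abs_square_le_1)
      have ik: "integrable M (\<lambda>w. (k w)\<^sup>2)"
        by (rule integrable_const_bound[where B = 1]) (use k2 mk in auto)
      have "\<bar>EC N R (\<lambda>c. u s c * ?W c)\<bar> = \<bar>\<integral>w. u s (?v w) * k w \<partial>M\<bar>"
        unfolding EC_def k_def \<eta>_def R_def by (simp add: mult.assoc)
      also have "\<dots> \<le> sqrt (\<integral>w. (u s (?v w))\<^sup>2 \<partial>M) * sqrt (\<integral>w. (k w)\<^sup>2 \<partial>M)"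
        by (rule cauchy_schwarz_integral(2)[OF um[OF s] mk ui[OF s] ik])
      also have "\<dots> \<le> sqrt B * 1"
      proof (intro mult_mono uB s)
        have "(\<integral>w. (k w)\<^sup>2 \<partial>M) \<le> (\<integral>w. 1 \<partial>M)" by (rule integral_mono[OF ik _ k2]) simp
        then show "sqrt (\<integral>w. (k w)\<^sup>2 \<partial>M) \<le> 1" by (simp add: prob_space)
      qed (use sB in auto)
      finally show ?thesis by simp
    qed
    have "(\<integral>s. indicator {0..t} s * q s \<partial>I) = (\<integral>s. (indicator {0..t} s * EC N R (\<lambda>c. u s c * galerkin_op (- 1) N ?W c)) / A \<partial>I)"
      unfolding q_EC by simp
    also have "\<dots> = (EC N R (\<lambda>c. u t c * ?W c) - EC N R (\<lambda>c. u 0 c * ?W c)) / A"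
      unfolding I_def integral_divide_zero integral_interval_measure(2)[OF t] dual(2) ..
    finally have "\<bar>\<integral>s. indicator {0..t} s * q s \<partial>I\<bar> = \<bar>EC N R (\<lambda>c. u t c * ?W c) - EC N R (\<lambda>c. u 0 c * ?W c)\<bar> / A"
      using a by (simp add: A_def)
    also have "\<dots> \<le> 2 * sqrt B / A"
      using EC_bound[OF t] EC_bound[of 0] T a by (intro divide_right_mono) (auto simp: A_def)
    finally have first: "\<bar>\<integral>s. indicator {0..t} s * q s \<partial>I\<bar> \<le> 2 * sqrt B / A" .
    have pq: "\<bar>p s - q s\<bar> \<le> sqrt B * sqrt (D n)" if s: "s \<in> {0..T}" for s
    proof -
      have i1: "integrable M (\<lambda>w. u s (?v w) * G w)" and i2: "integrable M (\<lambda>w. u s (?v w) * (G w - \<eta> n w * L w))"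
        by (rule cauchy_schwarz_integral(1)[OF um[OF s] mG ui[OF s] iG],
            rule cauchy_schwarz_integral(1)[OF um[OF s] mD ui[OF s] iD])
      from Bochner_Integration.integrable_diff[OF i1 i2]
      have i3: "integrable M (\<lambda>w. u s (?v w) * (\<eta> n w * L w))" by (simp add: right_diff_distrib)
      have "p s - q s = (\<integral>w. u s (?v w) * (G w - \<eta> n w * L w) \<partial>M)"
        unfolding p_def q_def using i1 i3 by (simp add: right_diff_distrib)
      also have "\<bar>\<dots>\<bar> \<le> sqrt (\<integral>w. (u s (?v w))\<^sup>2 \<partial>M) * sqrt (D n)"
        unfolding D_def by (rule cauchy_schwarz_integral(2)[OF um[OF s] mD ui[OF s] iD])
      also have "\<dots> \<le> sqrt B * sqrt (D n)" by (intro mult_right_mono uB s) (simp add: D_def)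
      finally show ?thesis .
    qed
    have "\<bar>\<integral>s. indicator {0..t} s * p s - indicator {0..t} s * q s \<partial>I\<bar> \<le> (\<integral>s. sqrt B * sqrt (D n) \<partial>I)"
    proof (rule order_trans[OF integral_abs_bound])
      show "(\<integral>s. \<bar>indicator {0..t} s * p s - indicator {0..t} s * q s\<bar> \<partial>I) \<le> (\<integral>s. sqrt B * sqrt (D n) \<partial>I)"
      proof (rule integral_mono)
        fix s assume "s \<in> space I"
        then show "\<bar>indicator {0..t} s * p s - indicator {0..t} s * q s\<bar> \<le> sqrt B * sqrt (D n)"
          using pq[of s] by (auto simp: I_def space_interval_measure indicator_def intro: order_trans[OF abs_ge_zero])
      qed (use ip iq in auto)
    qed
    also have "\<dots> = T * (sqrt B * sqrt (D n))"
      using measure_interval_measure[of T] T by (simp add: I_def)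
    finally have second: "\<bar>(\<integral>s. indicator {0..t} s * p s \<partial>I) - (\<integral>s. indicator {0..t} s * q s \<partial>I)\<bar> \<le> T * (sqrt B * sqrt (D n))"
      using ip iq by simp
    show ?thesis using first second by linarith
  qed
  have "(\<lambda>n. 2 * sqrt B / A + T * (sqrt B * sqrt (D n))) \<longlonglongrightarrow> 2 * sqrt B / A + T * (sqrt B * sqrt (\<integral>w. (G w - 1 * L w)\<^sup>2 \<partial>M))"
    by (intro tendsto_intros D_lim)
  then have "\<bar>\<integral>s. indicator {0..t} s * p s \<partial>I\<bar> \<le> 2 * sqrt B / A + T * (sqrt B * sqrt (\<integral>w. (G w - 1 * L w)\<^sup>2 \<partial>M))"
    by (rule LIMSEQ_le_const) (use main in auto)
  also have "\<dots> \<le> 2 * sqrt B / A + T * (sqrt B * sqrt \<delta>)"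
  proof -
    have "sqrt (\<integral>w. (G w - 1 * L w)\<^sup>2 \<partial>M) \<le> sqrt \<delta>"
      using \<delta>' by (simp add: power2_commute[of "G _"])
    then show ?thesis using T sB by (intro add_left_mono mult_left_mono) auto
  qed
  finally show ?thesis by (simp add: p_def G_def A_def I_def)
qed

end

subsection \<open>Solutions in coordinates\<close>

text \<open>By Parseval the \<open>L^2\<close> distance on \<open>HN N\<close> is a finite
  expression in coordinate differences, hence continuous for the product topology.\<close>

lemma continuous_on_cyl_coordinates:
  assumes "continuous_cyl T N f"
  shows "continuous_on ({0..T} \<times> UNIV) (\<lambda>(t, c). f t (trig_poly N c))"
  unfolding continuous_on_def
proof (safe, rule tendstoI)
  fix t :: real and c :: "mode \<Rightarrow> real" and e :: real
  assume t: "t \<in> {0..T}" and e: "0 < e"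
  from assms[unfolded continuous_cyl_def, rule_format, OF t trig_poly_mem e]
  obtain d where d: "d > 0" "\<forall>s\<in>{0..T}. \<forall>\<eta>\<in>HN N.
      \<bar>s - t\<bar> < d \<and> L2norm torus (\<lambda>x. \<eta> x - trig_poly N c x) < d \<longrightarrow> \<bar>f s \<eta> - f t (trig_poly N c)\<bar> < e"
    by blast
  let ?F = "at (t, c) within {0..T} \<times> UNIV"
  define g where "g z = sqrt (\<Sum>k\<in>modes N. (snd z k - c k)\<^sup>2)" for z :: "real \<times> (mode \<Rightarrow> real)"
  have "continuous_on UNIV g"
    unfolding g_def[abs_def]
    by (intro continuous_intros continuous_on_product_then_coordinatewise)
  then have "isCont g (t, c)" by (simp add: continuous_on_eq_continuous_at)
  then have "(g \<longlongrightarrow> g (t, c)) ?F"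
    by (meson continuous_at_imp_continuous_at_within continuous_within)
  then have g: "\<forall>\<^sub>F z in ?F. g z < d" by (rule order_tendstoD) (simp add: g_def d)
  have "((\<lambda>z. \<bar>fst z - t\<bar>) \<longlongrightarrow> \<bar>fst (t, c) - t\<bar>) ?F" by (intro tendsto_intros)
  then have s: "\<forall>\<^sub>F z in ?F. \<bar>fst z - t\<bar> < d" by (rule order_tendstoD) (simp add: d)
  have m: "\<forall>\<^sub>F z in ?F. z \<in> {0..T} \<times> UNIV"
    by (simp add: eventually_at_filter)
  show "\<forall>\<^sub>F z in ?F. dist (case z of (t, c) \<Rightarrow> f t (trig_poly N c)) (f t (trig_poly N c)) < e"
    using g s m
  proof eventually_elim
    case (elim z)
    then show ?case
      using d(2)[rule_format, of "fst z" "trig_poly N (snd z)"]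
      by (auto simp: dist_real_def trig_poly_diff L2norm_trig_poly g_def)
  qed
qed

lemma has_pd_coordinates:
  assumes "\<And>\<xi>. \<xi> \<in> HN N \<Longrightarrow> ((\<lambda>h. f (shift \<xi> h k)) has_real_derivative g \<xi>) (at 0)" "k \<in> modes N"
  shows "has_pd k (\<lambda>c. f (trig_poly N c)) (\<lambda>c. g (trig_poly N c))"
  unfolding has_pd_def
proof
  fix c
  show "((\<lambda>h. f (trig_poly N (c(k := c k + h)))) has_real_derivative g (trig_poly N c)) (at 0)"
    using assms(1)[of "trig_poly N c"] by (simp add: shift_trig_poly[OF assms(2)])
qed

lemma continuous_section_coordinates:
  assumes "continuous_cyl T N f" "t \<in> {0..T}"
  shows "continuous_on UNIV (\<lambda>c. f t (trig_poly N c))"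
  using continuous_on_compose2[OF continuous_on_cyl_coordinates[OF assms(1)]]
    continuous_on_Pair[OF continuous_on_const continuous_on_id] assms(2)
  by force

lemma C_order_cyl_continuous: "C_order_cyl T N n f \<Longrightarrow> continuous_cyl T N f"
  by (cases n) auto

lemma C1_coordinates:
  assumes f: "C_order_cyl T N (Suc n) f" and t: "t \<in> {0..T}"
  shows "C1 (modes N) (\<lambda>c. f t (trig_poly N c))"
proof -
  have "\<forall>k\<in>modes N. \<exists>g. (\<forall>t\<in>{0..T}. \<forall>\<xi>\<in>HN N. ((\<lambda>h. f t (shift \<xi> h k)) has_real_derivative g t \<xi>) (at 0)) \<and>
      C_order_cyl T N n g"
    using f by simp
  then obtain g where g: "\<And>k t \<xi>. k \<in> modes N \<Longrightarrow> t \<in> {0..T} \<Longrightarrow> \<xi> \<in> HN N \<Longrightarrow>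
      ((\<lambda>h. f t (shift \<xi> h k)) has_real_derivative g k t \<xi>) (at 0)"
    "\<And>k. k \<in> modes N \<Longrightarrow> C_order_cyl T N n (g k)"
    by metis
  show ?thesis
  proof (rule C1I)
    show "continuous_on UNIV (\<lambda>c. f t (trig_poly N c))"
      by (rule continuous_section_coordinates[OF C_order_cyl_continuous[OF f] t])
    fix k assume k: "k \<in> modes N"
    show "has_pd k (\<lambda>c. f t (trig_poly N c)) (\<lambda>c. g k t (trig_poly N c))"
      by (rule has_pd_coordinates[OF g(1)[OF k t] k])
    show "continuous_on UNIV (\<lambda>c. g k t (trig_poly N c))"
      by (rule continuous_section_coordinates[OF C_order_cyl_continuous[OF g(2)[OF k]] t])
  qed
qed

lemma C2_coordinates:
  assumes f: "C_order_cyl T N (Suc (Suc n)) f" and t: "t \<in> {0..T}"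
  shows "C2 (modes N) (\<lambda>c. f t (trig_poly N c))"
  unfolding C2_def
proof (intro conjI ballI)
  show "C1 (modes N) (\<lambda>c. f t (trig_poly N c))" by (rule C1_coordinates[OF f t])
  fix k assume k: "k \<in> modes N"
  then obtain g where g: "\<And>t \<xi>. t \<in> {0..T} \<Longrightarrow> \<xi> \<in> HN N \<Longrightarrow>
      ((\<lambda>h. f t (shift \<xi> h k)) has_real_derivative g t \<xi>) (at 0)" "C_order_cyl T N (Suc n) g"
    using f C_order_cyl.simps(2)[of T N "Suc n" f] by blast
  have "pd k (\<lambda>c. f t (trig_poly N c)) = (\<lambda>c. g t (trig_poly N c))"
    by (rule has_pd_imp_pd[OF has_pd_coordinates[OF g(1)[OF t] k]])
  then show "C1 (modes N) (pd k (\<lambda>c. f t (trig_poly N c)))"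
    using C1_coordinates[OF g(2) t] by simp
qed

text \<open>Joint continuity of the right-hand side is read off from the continuous time derivative
  supplied by smoothness. Both are derivatives of the same function within \<open>{0..T}\<close>,
  which has no isolated point because \<open>T > 0\<close>, so they agree also at the end
  points.\<close>

lemma galerkin_coordinate_solution:
  assumes K: "biot_savart_kernel K" and T: "T > 0" and sol: "galerkin_solution 2 K T N \<phi>0 \<phi>"
  shows "coordinate_solution T N (\<lambda>t c. \<phi> t (trig_poly N c))"
proof -
  have C: "C_order_cyl T N n \<phi>" for n
    using sol by (simp add: galerkin_solution_def smooth_cyl_def)
  have deriv: "((\<lambda>s. \<phi> s (trig_poly N c)) has_real_derivative galerkin_op 1 N (\<lambda>c. \<phi> t (trig_poly N c)) c) (at t within {0..T})"
    if "t \<in> {0..T}" for t c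
    using sol that by (simp add: galerkin_solution_def LN_adj_trig_poly[OF K, symmetric])
  have "\<exists>g. (\<forall>t\<in>{0..T}. \<forall>\<xi>\<in>HN N. ((\<lambda>s. \<phi> s \<xi>) has_real_derivative g t \<xi>) (at t within {0..T})) \<and> continuous_cyl T N g"
    using C[of "Suc 0"] by simp
  then obtain g where g: "\<forall>t\<in>{0..T}. \<forall>\<xi>\<in>HN N. ((\<lambda>s. \<phi> s \<xi>) has_real_derivative g t \<xi>) (at t within {0..T})"
    "continuous_cyl T N g"
    by blast
  have eq: "galerkin_op 1 N (\<lambda>c. \<phi> t (trig_poly N c)) c = g t (trig_poly N c)" if t: "t \<in> {0..T}" for t c
  proof (rule tendsto_unique)
    show "((\<lambda>s. (\<phi> s (trig_poly N c) - \<phi> t (trig_poly N c)) / (s - t)) \<longlongrightarrow> galerkin_op 1 N (\<lambda>c. \<phi> t (trig_poly N c)) c) (at t within {0..T})"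
      using deriv[OF t] by (simp add: has_field_derivative_iff)
    show "((\<lambda>s. (\<phi> s (trig_poly N c) - \<phi> t (trig_poly N c)) / (s - t)) \<longlongrightarrow> g t (trig_poly N c)) (at t within {0..T})"
      using g(1)[rule_format, OF t trig_poly_mem] by (simp add: has_field_derivative_iff)
    show "at t within {0..T} \<noteq> bot"
      using T t by (simp add: trivial_limit_within islimpt_Icc)
  qed
  show ?thesis
    unfolding coordinate_solution_def
  proof (intro conjI ballI allI)
    show "continuous_on ({0..T} \<times> UNIV) (\<lambda>(t, c). \<phi> t (trig_poly N c))"
      by (rule continuous_on_cyl_coordinates[OF C_order_cyl_continuous[OF C]])
    show "continuous_on ({0..T} \<times> UNIV) (\<lambda>(t, c). galerkin_op 1 N (\<lambda>c. \<phi> t (trig_poly N c)) c)"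
      by (rule continuous_on_eq[OF continuous_on_cyl_coordinates[OF g(2)]]) (auto simp: eq)
    show "C2 (modes N) (\<lambda>c. \<phi> t (trig_poly N c))" if "t \<in> {0..T}" for t
      by (rule C2_coordinates[OF C that])
  qed (rule deriv)
qed

lemma white_noise_mode_gaussian:
  assumes "white_noise \<mu>"
  shows "mode_gaussian \<mu> (\<lambda>k \<omega>. \<omega> (basis_fun k))"
proof -
  interpret prob_space \<mu> using assms by (simp add: white_noise_def)
  show ?thesis
    by unfold_locales (use assms in \<open>auto simp: white_noise_def\<close>)
qed

context mode_gaussian
begin

text \<open>Duality against the constant 1, which the operator annihilates; the square integrability
  from \<open>energy\<close> allows the cutoff to be removed.\<close>

lemma expectation_conserved:
  assumes T: "T > 0" and sol: "coordinate_solution T N u"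
    and int0: "integrable M (\<lambda>w. (u 0 (vec (modes N) w))\<^sup>2)" and t: "t \<in> {0..T}"
  shows "(\<integral>w. u t (vec (modes N) w) \<partial>M) = (\<integral>w. u 0 (vec (modes N) w) \<partial>M)"
proof -
  let ?c = "\<lambda>n w. cutoff (modes N) (real (Suc n)) (vec (modes N) w)"
  have lim: "(\<lambda>n. EC N (real (Suc n)) (\<lambda>c. u s c * 1)) \<longlonglongrightarrow> (\<integral>w. u s (vec (modes N) w) \<partial>M)" if s: "s \<in> {0..T}" for s
  proof -
    have cont: "continuous_on UNIV (u s)"
      using u_C2[OF T sol s] by (auto simp: C2_def intro: C1_continuous)
    have m: "(\<lambda>w. u s (vec (modes N) w)) \<in> borel_measurable M"
      by (rule measurable_vec_continuous[OF cont modes_subset])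
    have i: "integrable M (\<lambda>w. u s (vec (modes N) w))"
      by (rule square_integrable_imp_integrable[OF m energy(1)[OF T sol s int0]])
    show ?thesis
      unfolding EC_def
    proof (rule integral_dominated_convergence[where w = "\<lambda>w. \<bar>u s (vec (modes N) w)\<bar>"])
      show "(\<lambda>w. u s (vec (modes N) w) * 1 * ?c n w) \<in> borel_measurable M" for n
        by (intro borel_measurable_times m borel_measurable_const measurable_vec_continuous
            C1_continuous[OF C1_cutoff] finite_modes modes_subset)
      show "AE w in M. (\<lambda>n. u s (vec (modes N) w) * 1 * ?c n w) \<longlonglongrightarrow> u s (vec (modes N) w)"
        using tendsto_mult[OF tendsto_const cutoff_tendsto_1[OF finite_modes]] by (intro AE_I2) force
      show "AE w in M. norm (u s (vec (modes N) w) * 1 * ?c n w) \<le> \<bar>u s (vec (modes N) w)\<bar>" for n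
        by (intro AE_I2) (simp add: abs_mult cutoff_bounds mult_left_le)
    qed (use m i in auto)
  qed
  have "EC N (real (Suc n)) (\<lambda>c. u t c * 1) = EC N (real (Suc n)) (\<lambda>c. u 0 c * 1)" for n
    using duality_cutoff(2)[OF T sol _ t C2_const, of "real (Suc n)" 1]
    by (simp add: galerkin_op_const EC_def)
  then show ?thesis
    using LIMSEQ_unique[OF lim[OF t]] lim[of 0] T by simp
qed

end

subsection \<open>Identification of weak-* limits\<close>

text \<open>After extension by 0, the integral over a half-line is a value of the primitive of
  \<open>k\<close>, and half-lines generate the Borel sets.\<close>

lemma AE_eq_0_of_primitive:
  fixes k :: "real \<Rightarrow> real"
  assumes k: "integrable (interval_measure T) k"
    and zero: "\<And>t. t \<in> {0..T} \<Longrightarrow> (\<integral>s. indicator {0..t} s * k s \<partial>interval_measure T) = 0"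
  shows "AE s in interval_measure T. k s = 0"
proof -
  define h where "h s = indicator {0..T} s * k s" for s
  have h: "integrable lborel h"
    using k unfolding interval_measure_def h_def by (simp add: integrable_restrict_space)
  have prim: "(\<integral>s. h s * indicator {..a} s \<partial>lborel) = 0" for a
  proof (cases "0 \<le> min a T")
    case True
    have "(\<integral>s. h s * indicator {..a} s \<partial>lborel) = (\<integral>s. indicator {0..min a T} s *\<^sub>R k s \<partial>lborel)"
      by (intro Bochner_Integration.integral_cong) (auto simp: h_def indicator_def)
    also have "\<dots> = (\<integral>s. indicator {0..min a T} s * k s \<partial>interval_measure T)"
      using True by (intro integral_interval_measure(2)[symmetric]) auto
    also have "\<dots> = 0" using True by (intro zero) auto
    finally show ?thesis .
  next
    case False
    then have "h s * indicator {..a} s = 0" for s by (auto simp: h_def indicator_def)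
    then show ?thesis by (simp only: Bochner_Integration.integral_zero)
  qed
  have "AE s in lborel. h s = 0"
  proof (rule AE_eq_0_of_generator[OF h, where G = "range atMost"])
    show "sets lborel = sigma_sets (space lborel) (range (atMost :: real \<Rightarrow> _))"
      unfolding sets_lborel space_lborel by (subst borel_eq_atMost) simp
    show "Int_stable (range (atMost :: real \<Rightarrow> _))"
      by (rule Int_stableI) auto
    have "(\<integral>s. h s \<partial>lborel) = (\<integral>s. h s * indicator {..T} s \<partial>lborel)"
      by (intro Bochner_Integration.integral_cong) (auto simp: h_def indicator_def)
    then show "(\<integral>s. h s \<partial>lborel) = 0" using prim[of T] by simp
  qed (use prim in auto)
  then have "AE s in lborel. s \<in> {0..T} \<longrightarrow> k s = 0"
    by eventually_elim (auto simp: h_def indicator_def)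
  then show ?thesis
    unfolding interval_measure_def by (subst AE_restrict_space_iff) auto
qed

lemma indicator_L1_L2:
  assumes "prob_space \<mu>" and G: "G \<in> borel_measurable \<mu>" "integrable \<mu> (\<lambda>\<omega>. (G \<omega>)\<^sup>2)"
  shows "(\<lambda>s \<omega>. indicator {0..t} s * G \<omega>) \<in> L1_L2 T \<mu>"
proof -
  interpret prob_space \<mu> by fact
  interpret I: finite_measure "interval_measure T" by (rule finite_interval_measure)
  have ind: "(indicator {0..t} :: real \<Rightarrow> real) \<in> borel_measurable (interval_measure T)"
    unfolding interval_measure_def by (intro measurable_restrict_space1) auto
  have norm: "L2norm \<mu> (\<lambda>\<omega>. indicator {0..t} s * G \<omega>) = indicator {0..t} s * L2norm \<mu> G" for s
    by (cases "s \<in> {0..t}") (simp_all add: L2norm_def)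
  have "(\<lambda>(s, \<omega>). indicator {0..t} s * G \<omega>) \<in> borel_measurable (interval_measure T \<Otimes>\<^sub>M \<mu>)"
    using borel_measurable_times[OF measurable_compose[OF measurable_fst ind] measurable_compose[OF measurable_snd G(1)]]
    by (simp add: case_prod_beta')
  moreover have "integrable \<mu> (\<lambda>\<omega>. (indicator {0..t} s * G \<omega>)\<^sup>2)" for s
    using G(2) by (simp add: power_mult_distrib)
  moreover have "integrable (interval_measure T) (\<lambda>s. indicator {0..t} s * L2norm \<mu> G)"
  proof (rule I.integrable_const_bound[where B = "L2norm \<mu> G"])
    show "AE s in interval_measure T. norm (indicator {0..t} s * L2norm \<mu> G) \<le> L2norm \<mu> G"
      by (intro AE_I2) (auto simp: indicator_def L2norm_def)
  qed (use ind in simp)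
  ultimately show ?thesis by (simp add: L1_L2_def norm)
qed

lemma Linf_L2_square_integrable:
  assumes "prob_space \<mu>" and \<rho>: "\<rho> \<in> Linf_L2 T \<mu>"
  shows "integrable (interval_measure T \<Otimes>\<^sub>M \<mu>) (\<lambda>(s, \<omega>). (\<rho> s \<omega>)\<^sup>2)"
proof -
  interpret prob_space \<mu> by fact
  interpret I: finite_measure "interval_measure T" by (rule finite_interval_measure)
  interpret P: pair_sigma_finite "interval_measure T" \<mu> ..
  obtain C where C: "AE t in interval_measure T. integrable \<mu> (\<lambda>\<omega>. (\<rho> t \<omega>)\<^sup>2) \<and> L2norm \<mu> (\<rho> t) \<le> C"
    and meas: "(\<lambda>(t, \<omega>). \<rho> t \<omega>) \<in> borel_measurable (interval_measure T \<Otimes>\<^sub>M \<mu>)"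
    using \<rho> by (auto simp: Linf_L2_def)
  have m2: "(\<lambda>(s, \<omega>). (\<rho> s \<omega>)\<^sup>2) \<in> borel_measurable (interval_measure T \<Otimes>\<^sub>M \<mu>)"
    using borel_measurable_power[OF meas, of 2] by (simp add: case_prod_beta')
  have "AE s in interval_measure T. (\<integral>\<^sup>+\<omega>. ennreal ((\<rho> s \<omega>)\<^sup>2) \<partial>\<mu>) \<le> ennreal (C\<^sup>2)"
    using C
  proof eventually_elim
    case (elim s)
    have "(\<integral>\<^sup>+\<omega>. ennreal ((\<rho> s \<omega>)\<^sup>2) \<partial>\<mu>) = ennreal (\<integral>\<omega>. (\<rho> s \<omega>)\<^sup>2 \<partial>\<mu>)"
      using elim by (intro nn_integral_eq_integral) auto
    also have "(\<integral>\<omega>. (\<rho> s \<omega>)\<^sup>2 \<partial>\<mu>) = (L2norm \<mu> (\<rho> s))\<^sup>2"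
      by (simp add: L2norm_def)
    also have "\<dots> \<le> C\<^sup>2"
      using elim by (intro power_mono) (auto simp: L2norm_def)
    finally show ?case by (simp add: ennreal_leI)
  qed
  then have "(\<integral>\<^sup>+s. (\<integral>\<^sup>+\<omega>. ennreal ((\<rho> s \<omega>)\<^sup>2) \<partial>\<mu>) \<partial>interval_measure T) \<le> (\<integral>\<^sup>+s. ennreal (C\<^sup>2) \<partial>interval_measure T)"
    by (rule nn_integral_mono_AE)
  also have "\<dots> < \<infinity>"
    using I.emeasure_finite[of "space (interval_measure T)"]
    by (simp add: ennreal_mult_eq_top_iff less_top[symmetric])
  also have "(\<integral>\<^sup>+s. (\<integral>\<^sup>+\<omega>. ennreal ((\<rho> s \<omega>)\<^sup>2) \<partial>\<mu>) \<partial>interval_measure T) =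
      (\<integral>\<^sup>+z. ennreal ((\<lambda>(s, \<omega>). (\<rho> s \<omega>)\<^sup>2) z) \<partial>(interval_measure T \<Otimes>\<^sub>M \<mu>))"
    using nn_integral_fst[of "\<lambda>z. ennreal ((\<lambda>(s, \<omega>). (\<rho> s \<omega>)\<^sup>2) z)" "interval_measure T"] m2 by simp
  finally show ?thesis
    using m2 by (intro integrableI_nonneg) auto
qed

context mode_gaussian
begin

text \<open>The hypotheses concern time integrals, so the argument passes to \<open>h t\<close>, the
  integral of \<open>\<rho>\<close> up to time \<open>t\<close>. This is an element of
  \<open>L^2\<close> orthogonal to all \<open>ou_op\<close>, hence constant, and the constant is
  \<open>t * m\<close>. Differentiating in time recovers \<open>\<rho>\<close>.\<close>

lemma weak_limit_constant:
  assumes T: "T > 0"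
    and sets: "sets M = sigma_sets (space M) {{w \<in> space M. X k w \<in> A} | k A. k \<in> Z20 \<and> A \<in> sets borel}"
    and \<rho>: "\<rho> \<in> Linf_L2 T M"
    and ou: "\<And>t J \<beta> \<theta>. t \<in> {0..T} \<Longrightarrow> finite J \<Longrightarrow> J \<subseteq> Z20 \<Longrightarrow>
      (\<integral>s. indicator {0..t} s * (\<integral>w. \<rho> s w * ou_op J \<beta> \<theta> (\<lambda>k. X k w) \<partial>M) \<partial>interval_measure T) = 0"
    and mean: "\<And>t. t \<in> {0..T} \<Longrightarrow> (\<integral>s. indicator {0..t} s * (\<integral>w. \<rho> s w \<partial>M) \<partial>interval_measure T) = t * m"
  shows "AE s in interval_measure T. AE w in M. \<rho> s w = m"
proof -
  define I where "I = interval_measure T"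
  interpret I: finite_measure I unfolding I_def by (rule finite_interval_measure)
  interpret P: pair_sigma_finite I M ..
  interpret PF: finite_measure "I \<Otimes>\<^sub>M M" by (intro finite_measure_pair_measure) unfold_locales
  have meas: "(\<lambda>(s, w). \<rho> s w) \<in> borel_measurable (I \<Otimes>\<^sub>M M)"
    using \<rho> by (simp add: Linf_L2_def I_def)
  then have meas': "(\<lambda>z. \<rho> (fst z) (snd z)) \<in> borel_measurable (I \<Otimes>\<^sub>M M)"
    by (simp add: case_prod_beta')
  have sq: "integrable (I \<Otimes>\<^sub>M M) (\<lambda>(s, w). (\<rho> s w)\<^sup>2)"
    unfolding I_def by (rule Linf_L2_square_integrable[OF prob_space_axioms \<rho>])
  then have sq': "integrable (I \<Otimes>\<^sub>M M) (\<lambda>z. (\<rho> (fst z) (snd z))\<^sup>2)"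
    by (simp add: case_prod_beta')
  have int1: "integrable (I \<Otimes>\<^sub>M M) (\<lambda>z. \<rho> (fst z) (snd z))"
    by (rule PF.square_integrable_imp_integrable[OF meas' sq'])
  have ind: "(indicator {0..t} :: real \<Rightarrow> real) \<in> borel_measurable I" for t
    unfolding I_def interval_measure_def by (intro measurable_restrict_space1) auto
  have int_ind: "(\<integral>s. indicator {0..t} s \<partial>I) = t" "integrable I (\<lambda>s. indicator {0..t} s :: real)" if t: "t \<in> {0..T}" for t
    using integral_interval_measure[OF t, of "\<lambda>_. 1"] t by (simp_all add: I_def)
  define h where "h t w = (\<integral>s. indicator {0..t} s * \<rho> s w \<partial>I)" for t w
  have h_AE: "AE w in M. h t w = t * m" if t: "t \<in> {0..T}" for t
  proof -
    have intG: "integrable (I \<Otimes>\<^sub>M M) (\<lambda>(s, w). indicator {0..t} s * \<rho> s w * G w)"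
      if G: "G \<in> borel_measurable M" "integrable M (\<lambda>w. (G w)\<^sup>2)" for G
    proof -
      have mg: "(\<lambda>z. indicator {0..t} (fst z) * G (snd z)) \<in> borel_measurable (I \<Otimes>\<^sub>M M)"
        by (intro borel_measurable_times measurable_compose[OF measurable_fst ind] measurable_compose[OF measurable_snd G(1)])
      have "integrable (I \<Otimes>\<^sub>M M) (\<lambda>z. (indicator {0..t} (fst z) * G (snd z))\<^sup>2)"
      proof (rule P.Fubini_integrable)
        show "integrable I (\<lambda>s. \<integral>w. norm ((indicator {0..t} (fst (s, w)) * G (snd (s, w)))\<^sup>2) \<partial>M)"
        proof (rule I.integrable_const_bound[where B = "\<integral>w. (G w)\<^sup>2 \<partial>M"])
          show "AE s in I. norm (\<integral>w. norm ((indicator {0..t} (fst (s, w)) * G (snd (s, w)))\<^sup>2) \<partial>M) \<le> (\<integral>w. (G w)\<^sup>2 \<partial>M)"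
            by (intro AE_I2) (auto simp: indicator_def)
          show "(\<lambda>s. \<integral>w. norm ((indicator {0..t} (fst (s, w)) * G (snd (s, w)))\<^sup>2) \<partial>M) \<in> borel_measurable I"
            using ind[of t] by (simp add: power_mult_distrib)
        qed
        show "AE s in I. integrable M (\<lambda>w. (indicator {0..t} (fst (s, w)) * G (snd (s, w)))\<^sup>2)"
          using G(2) by (simp add: power_mult_distrib)
      qed (use mg in simp)
      from cauchy_schwarz_integral(1)[OF meas' mg sq' this] show ?thesis
        by (simp add: case_prod_beta' mult_ac)
    qed
    have fub: "(\<integral>w. h t w * G w \<partial>M) = (\<integral>s. indicator {0..t} s * (\<integral>w. \<rho> s w * G w \<partial>M) \<partial>I)"
      "integrable M (\<lambda>w. h t w * G w)"
      if G: "G \<in> borel_measurable M" "integrable M (\<lambda>w. (G w)\<^sup>2)" for G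
    proof -
      have "(\<integral>w. h t w * G w \<partial>M) = (\<integral>w. (\<integral>s. indicator {0..t} s * \<rho> s w * G w \<partial>I) \<partial>M)"
        unfolding h_def by simp
      also have "\<dots> = (\<integral>s. (\<integral>w. indicator {0..t} s * \<rho> s w * G w \<partial>M) \<partial>I)"
        by (rule P.Fubini_integral[OF intG[OF G]])
      finally show "(\<integral>w. h t w * G w \<partial>M) = (\<integral>s. indicator {0..t} s * (\<integral>w. \<rho> s w * G w \<partial>M) \<partial>I)"
        by (simp add: mult.assoc)
      show "integrable M (\<lambda>w. h t w * G w)"
        using P.integrable_snd[OF intG[OF G]] unfolding h_def by simp
    qed
    have h_int: "integrable M (h t)" using fub(2)[of "\<lambda>_. 1"] by simp
    \<comment> \<open>Cauchy--Schwarz in time against the indicator of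
      \<open>{0..t}\<close>.\<close>
    have h2: "integrable M (\<lambda>w. (h t w)\<^sup>2)"
    proof (rule Bochner_Integration.integrable_bound)
      show "integrable M (\<lambda>w. T * (\<integral>s. (\<rho> s w)\<^sup>2 \<partial>I))"
        using P.integrable_snd[OF sq] by simp
      show "(\<lambda>w. (h t w)\<^sup>2) \<in> borel_measurable M" using h_int by simp
      show "AE w in M. norm ((h t w)\<^sup>2) \<le> norm (T * (\<integral>s. (\<rho> s w)\<^sup>2 \<partial>I))"
        using P.AE_integrable_snd[OF sq] AE_space
      proof eventually_elim
        case (elim w)
        have mw: "(\<lambda>s. \<rho> s w) \<in> borel_measurable I"
          using measurable_Pair1[OF meas elim(2)] by simp
        have i2: "integrable I (\<lambda>s. (indicator {0..t} s :: real)\<^sup>2)"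
          using int_ind(2)[OF t] by (simp add: power2_eq_square flip: indicator_inter_arith)
        have "\<bar>h t w\<bar> \<le> sqrt (\<integral>s. (indicator {0..t} s)\<^sup>2 \<partial>I) * sqrt (\<integral>s. (\<rho> s w)\<^sup>2 \<partial>I)"
          unfolding h_def by (rule cauchy_schwarz_integral(2)[OF ind mw i2 elim(1)])
        also have "(\<integral>s. (indicator {0..t} s)\<^sup>2 \<partial>I) = t"
          using int_ind(1)[OF t] by (simp add: power2_eq_square flip: indicator_inter_arith)
        finally have "\<bar>h t w\<bar>\<^sup>2 \<le> (sqrt t * sqrt (\<integral>s. (\<rho> s w)\<^sup>2 \<partial>I))\<^sup>2"
          by (rule power_mono) simp
        also have "\<dots> = t * (\<integral>s. (\<rho> s w)\<^sup>2 \<partial>I)"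
          using t by (simp add: power_mult_distrib)
        also have "\<dots> \<le> T * (\<integral>s. (\<rho> s w)\<^sup>2 \<partial>I)"
          using t by (intro mult_right_mono) auto
        finally show ?case by simp
      qed
    qed
    have "AE w in M. h t w = (\<integral>w. h t w \<partial>M)"
    proof (rule constant_of_ou_op_orthogonal[OF _ h2 sets])
      show "(\<integral>w. h t w * ou_op J \<beta> \<theta> (\<lambda>k. X k w) \<partial>M) = 0" if J: "finite J" "J \<subseteq> Z20" for J \<beta> \<theta>
        using fub(1)[OF ou_op_measurable[OF J(2)] integrable_ou_op_square[OF J]] ou[OF t J] by (simp add: I_def)
    qed (use h_int in auto)
    moreover have "(\<integral>w. h t w \<partial>M) = t * m"
      using fub(1)[of "\<lambda>_. 1"] mean[OF t] by (simp add: I_def)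
    ultimately show ?thesis by simp
  qed
  have int_m: "integrable (I \<Otimes>\<^sub>M M) (\<lambda>(s, w). \<rho> s w - m)"
    using int1 by (simp add: case_prod_beta')
  \<comment> \<open>For a fixed event \<open>E\<close> the time function \<open>k\<close> has zero
    primitive. The exceptional null set of times depends on \<open>E\<close>, so the conclusion is
    drawn on rectangles, which generate the product \<open>\<sigma>\<close>-algebra.\<close>
  have rect: "(\<integral>z. (case z of (s, w) \<Rightarrow> \<rho> s w - m) * indicator (B \<times> E) z \<partial>(I \<Otimes>\<^sub>M M)) = 0"
    if B: "B \<in> sets I" and E: "E \<in> sets M" for B E
  proof -
    have intBE: "integrable (I \<Otimes>\<^sub>M M) (\<lambda>(s, w). indicator B s * (indicator E w * (\<rho> s w - m)))" if B: "B \<in> sets I" for B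
      using integrable_mult_indicator[OF pair_measureI[OF B E] int_m]
      by (simp add: case_prod_beta' indicator_times mult_ac)
    define k where "k s = (\<integral>w. indicator E w * (\<rho> s w - m) \<partial>M)" for s
    have SI: "space I \<in> sets I" "{0..t} \<inter> {0..T} \<in> sets I" for t
      by (auto simp: I_def interval_measure_def sets_restrict_space)
    have "AE s in interval_measure T. k s = 0"
    proof (rule AE_eq_0_of_primitive)
      have "integrable (I \<Otimes>\<^sub>M M) (\<lambda>(s, w). indicator E w * (\<rho> s w - m))"
        using intBE[OF SI(1)]
        by (rule Bochner_Integration.integrable_cong[THEN iffD1, rotated 2]) (auto simp: space_pair_measure)
      from P.integrable_fst[OF this] show "integrable (interval_measure T) k"
        unfolding k_def I_def by simp
      fix t assume t: "t \<in> {0..T}"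
      then have S: "{0..t} \<in> sets I" using SI(2)[of t] by (simp add: Int_absorb2)
      have "(\<integral>s. indicator {0..t} s * k s \<partial>I) = (\<integral>s. (\<integral>w. indicator {0..t} s * (indicator E w * (\<rho> s w - m)) \<partial>M) \<partial>I)"
        unfolding k_def by simp
      also have "\<dots> = (\<integral>w. (\<integral>s. indicator {0..t} s * (indicator E w * (\<rho> s w - m)) \<partial>I) \<partial>M)"
        by (rule P.Fubini_integral[OF intBE[OF S], symmetric])
      also have "\<dots> = (\<integral>w. 0 \<partial>M)"
      proof (rule integral_cong_AE)
        show "(\<lambda>w. \<integral>s. indicator {0..t} s * (indicator E w * (\<rho> s w - m)) \<partial>I) \<in> borel_measurable M"
          using P.integrable_snd[OF intBE[OF S]] by simp
        have "AE w in M. integrable I (\<lambda>s. \<rho> s w)"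
          using P.AE_integrable_snd[of "\<lambda>s w. \<rho> s w"] int1 by (simp add: case_prod_beta')
        then show "AE w in M. (\<integral>s. indicator {0..t} s * (indicator E w * (\<rho> s w - m)) \<partial>I) = 0"
          using h_AE[OF t]
        proof eventually_elim
          case (elim w)
          have i: "integrable I (\<lambda>s. indicator {0..t} s * \<rho> s w)"
            using integrable_mult_indicator[OF S elim(1)] by simp
          have "(\<integral>s. indicator {0..t} s * (indicator E w * (\<rho> s w - m)) \<partial>I) =
              (\<integral>s. indicator E w * (indicator {0..t} s * \<rho> s w - m * indicator {0..t} s) \<partial>I)"
            by (intro Bochner_Integration.integral_cong refl) (simp add: algebra_simps)
          also have "\<dots> = indicator E w * (h t w - m * t)"
            using i int_ind[OF t] by (simp add: h_def)
          also have "\<dots> = 0" using elim(2) by (simp add: mult.commute)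
          finally show ?case .
        qed
      qed simp
      finally show "(\<integral>s. indicator {0..t} s * k s \<partial>interval_measure T) = 0" by (simp add: I_def)
    qed
    then have k0: "AE s in I. indicator B s * k s = 0"
      unfolding I_def[symmetric] by eventually_elim simp
    have "(\<integral>z. (case z of (s, w) \<Rightarrow> \<rho> s w - m) * indicator (B \<times> E) z \<partial>(I \<Otimes>\<^sub>M M)) =
        (\<integral>(s, w). indicator B s * (indicator E w * (\<rho> s w - m)) \<partial>(I \<Otimes>\<^sub>M M))"
      by (intro Bochner_Integration.integral_cong refl) (auto simp: indicator_times)
    also have "\<dots> = (\<integral>s. (\<integral>w. indicator B s * (indicator E w * (\<rho> s w - m)) \<partial>M) \<partial>I)"
      by (rule P.integral_fst[OF intBE[OF B], symmetric])
    also have "\<dots> = (\<integral>s. indicator B s * k s \<partial>I)" unfolding k_def by simp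
    also have "\<dots> = 0" by (rule integral_eq_zero_AE[OF k0])
    finally show ?thesis .
  qed
  have "AE z in I \<Otimes>\<^sub>M M. (case z of (s, w) \<Rightarrow> \<rho> s w - m) = 0"
  proof (rule AE_eq_0_of_generator[OF int_m])
    show "sets (I \<Otimes>\<^sub>M M) = sigma_sets (space (I \<Otimes>\<^sub>M M)) {a \<times> b | a b. a \<in> sets I \<and> b \<in> sets M}"
      by (simp add: sets_pair_measure space_pair_measure)
    show "Int_stable {a \<times> b | a b. a \<in> sets I \<and> b \<in> sets M}" by (rule Int_stable_pair_measure_generator)
    show "{a \<times> b | a b. a \<in> sets I \<and> b \<in> sets M} \<subseteq> Pow (space (I \<Otimes>\<^sub>M M))"
      by (auto simp: space_pair_measure dest: sets.sets_into_space)
    have "(\<integral>z. (case z of (s, w) \<Rightarrow> \<rho> s w - m) \<partial>(I \<Otimes>\<^sub>M M)) =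
        (\<integral>z. (case z of (s, w) \<Rightarrow> \<rho> s w - m) * indicator (space I \<times> space M) z \<partial>(I \<Otimes>\<^sub>M M))"
      by (intro Bochner_Integration.integral_cong refl) (auto simp: space_pair_measure indicator_def)
    then show "(\<integral>z. (case z of (s, w) \<Rightarrow> \<rho> s w - m) \<partial>(I \<Otimes>\<^sub>M M)) = 0"
      using rect[of "space I" "space M"] by simp
  qed (use rect in auto)
  from P.AE_pair[OF this] show ?thesis
    unfolding I_def[symmetric] by simp
qed

end

section \<open>Assembly: transfer to coordinates, uniform bounds and passage to the limit\<close>

theorem theorem1p3:
  fixes T :: real
    and \<mu> :: "dist measure"
    and K :: "plane \<Rightarrow> plane"
    and \<rho>0 :: "dist \<Rightarrow> real"
    and \<rho>N0 :: "nat \<Rightarrow> field \<Rightarrow> real"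
    and \<rho>N :: "nat \<Rightarrow> real \<Rightarrow> field \<Rightarrow> real"
    and M :: "'w measure"
    and F :: "real \<Rightarrow> 'w measure"
    and W :: "mode \<Rightarrow> real \<Rightarrow> 'w \<Rightarrow> real"
    and X :: "nat \<Rightarrow> field \<Rightarrow> real \<Rightarrow> 'w \<Rightarrow> field"
    and r :: "nat \<Rightarrow> nat"
    and \<rho> :: "real \<Rightarrow> dist \<Rightarrow> real"
  assumes "T > 0"
    and "white_noise \<mu>"
    and "biot_savart_kernel K"
    and "\<rho>0 \<in> borel_measurable \<mu>" and "integrable \<mu> (\<lambda>\<omega>. (\<rho>0 \<omega>)\<^sup>2)"
    and "\<And>N. \<rho>N0 N \<in> CP_smooth N"
    and "(\<lambda>N. L2norm \<mu> (\<lambda>\<omega>. \<rho>N0 N (proj_dist N \<omega>) - \<rho>0 \<omega>)) \<longlonglongrightarrow> 0"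
    and "\<And>N. galerkin_solution 2 K T N (\<rho>N0 N) (\<rho>N N)"
    and "brownian_family M F W"
    and "\<And>N \<xi>. \<xi> \<in> HN N \<Longrightarrow> sde_solution 2 K T N M F W \<xi> (X N \<xi>)"
    and "\<And>N \<xi> t. \<xi> \<in> HN N \<Longrightarrow> t \<in> {0..T} \<Longrightarrow> \<rho>N N t \<xi> = (\<integral>w. \<rho>N0 N (X N \<xi> t w) \<partial>M)"
    and "strict_mono r"
    and "weak_star_lim T \<mu> (\<lambda>i t \<omega>. \<rho>N (r i) t (proj_dist (r i) \<omega>)) \<rho>"
  shows "\<exists>\<rho>' \<in> Linf_L2 T \<mu>. same_class T \<mu> \<rho>' \<rho> \<and>
           (\<forall>t\<in>{0<..T}. AE \<omega> in \<mu>. \<rho>' t \<omega> = (\<integral>\<omega>'. \<rho>0 \<omega>' \<partial>\<mu>))"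
proof -
  note T = assms(1) and \<mu> = assms(2) and K = assms(3)
  define Y where "Y k \<omega> = \<omega> (basis_fun k)" for k and \<omega> :: dist
  interpret mode_gaussian \<mu> Y
    unfolding Y_def[abs_def] by (rule white_noise_mode_gaussian[OF \<mu>])
  define u where "u N t c = \<rho>N N t (trig_poly N c)" for N t c
  \<comment> \<open>The solutions see the distribution only through its Fourier coefficients, which
    are independent standard normal under white noise.\<close>
  have proj: "trig_poly N (vec (modes N) \<omega>) = proj_dist N \<omega>" for N \<omega>
    unfolding proj_dist_def by (rule trig_poly_cong) (simp add: vec_def Y_def)
  have u_vec: "u N t (vec (modes N) \<omega>) = \<rho>N N t (proj_dist N \<omega>)" for N t \<omega>
    by (simp add: u_def proj)
  have sol: "coordinate_solution T N (u N)" for N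
    unfolding u_def[abs_def] by (rule galerkin_coordinate_solution[OF K T assms(8)])
  have u0: "u N 0 c = \<rho>N0 N (trig_poly N c)" for N c
    using assms(8)[of N] by (simp add: u_def galerkin_solution_def)
  have m0: "(\<lambda>\<omega>. u N 0 (vec (modes N) \<omega>)) \<in> borel_measurable \<mu>" for N
    using u_C2[OF T sol, of 0] T
    by (intro measurable_vec_continuous modes_subset) (auto simp: C2_def intro: C1_continuous)
  have i0: "integrable \<mu> (\<lambda>\<omega>. (u N 0 (vec (modes N) \<omega>))\<^sup>2)" for N
  proof -
    have "CP_order N 0 (\<rho>N0 N)" using assms(6)[of N] unfolding CP_smooth_def by blast
    then obtain C p where C: "\<And>\<xi>. \<xi> \<in> HN N \<Longrightarrow> \<bar>\<rho>N0 N \<xi>\<bar> \<le> C * (1 + L2norm torus \<xi>) ^ p"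
      by (auto simp: poly_growth_def)
    show ?thesis
    proof (rule integrable_square_poly_growth[OF finite_modes modes_subset m0])
      fix \<omega>
      have "(\<Sum>k\<in>modes N. (vec (modes N) \<omega> k)\<^sup>2) = (\<Sum>k\<in>modes N. (Y k \<omega>)\<^sup>2)"
        by (intro sum.cong) (auto simp: vec_def)
      then show "\<bar>u N 0 (vec (modes N) \<omega>)\<bar> \<le> C * (1 + sqrt (\<Sum>k\<in>modes N. (Y k \<omega>)\<^sup>2)) ^ p"
        using C[of "trig_poly N (vec (modes N) \<omega>)"] by (simp add: u0 L2norm_trig_poly)
    qed
  qed
  define dist0 where "dist0 N = L2norm \<mu> (\<lambda>\<omega>. u N 0 (vec (modes N) \<omega>) - \<rho>0 \<omega>)" for N
  have dist0: "dist0 \<longlonglongrightarrow> 0"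
    using assms(7) unfolding dist0_def by (simp add: u0 proj)
  have idiff: "integrable \<mu> (\<lambda>\<omega>. (u N 0 (vec (modes N) \<omega>) - \<rho>0 \<omega>)\<^sup>2)" for N
  proof (rule Bochner_Integration.integrable_bound)
    show "integrable \<mu> (\<lambda>\<omega>. 2 * (u N 0 (vec (modes N) \<omega>))\<^sup>2 + 2 * (\<rho>0 \<omega>)\<^sup>2)"
      using i0 assms(5) by simp
    show "AE \<omega> in \<mu>. norm ((u N 0 (vec (modes N) \<omega>) - \<rho>0 \<omega>)\<^sup>2) \<le> norm (2 * (u N 0 (vec (modes N) \<omega>))\<^sup>2 + 2 * (\<rho>0 \<omega>)\<^sup>2)"
    proof (rule AE_I2)
      fix \<omega>
      have "0 \<le> (u N 0 (vec (modes N) \<omega>) + \<rho>0 \<omega>)\<^sup>2" by simp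
      then have "(u N 0 (vec (modes N) \<omega>) - \<rho>0 \<omega>)\<^sup>2 \<le> 2 * (u N 0 (vec (modes N) \<omega>))\<^sup>2 + 2 * (\<rho>0 \<omega>)\<^sup>2"
        by (simp add: power2_sum power2_diff)
      then show "norm ((u N 0 (vec (modes N) \<omega>) - \<rho>0 \<omega>)\<^sup>2) \<le> norm (2 * (u N 0 (vec (modes N) \<omega>))\<^sup>2 + 2 * (\<rho>0 \<omega>)\<^sup>2)"
        by simp
    qed
  qed (use m0 assms(4) in simp)
  have L2: "sqrt (\<integral>\<omega>. (u N 0 (vec (modes N) \<omega>) - \<rho>0 \<omega>)\<^sup>2 \<partial>\<mu>) = dist0 N" for N
    by (simp add: dist0_def L2norm_def)
  obtain D where D: "\<And>N. dist0 N \<le> D"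
    using Bseq_bdd_above[OF convergent_imp_Bseq[OF convergentI[OF dist0]]] by (auto simp: bdd_above_def)
  \<comment> \<open>An energy bound uniform in \<open>N\<close>, available because the initial data
    converge in \<open>L^2\<close>.\<close>
  define B where "B = 2 * D\<^sup>2 + 2 * (\<integral>\<omega>. (\<rho>0 \<omega>)\<^sup>2 \<partial>\<mu>)"
  have B: "(\<integral>\<omega>. (u N 0 (vec (modes N) \<omega>))\<^sup>2 \<partial>\<mu>) \<le> B" for N
  proof -
    have "(\<integral>\<omega>. (u N 0 (vec (modes N) \<omega>))\<^sup>2 \<partial>\<mu>) \<le>
        (\<integral>\<omega>. 2 * (u N 0 (vec (modes N) \<omega>) - \<rho>0 \<omega>)\<^sup>2 + 2 * (\<rho>0 \<omega>)\<^sup>2 \<partial>\<mu>)"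
    proof (rule integral_mono[OF i0])
      fix \<omega>
      \<comment> \<open>This square is exactly the difference between the two sides of the
        inequality to be shown.\<close>
      have "0 \<le> (u N 0 (vec (modes N) \<omega>) - 2 * \<rho>0 \<omega>)\<^sup>2" by simp
      then show "(u N 0 (vec (modes N) \<omega>))\<^sup>2 \<le> 2 * (u N 0 (vec (modes N) \<omega>) - \<rho>0 \<omega>)\<^sup>2 + 2 * (\<rho>0 \<omega>)\<^sup>2"
        by (simp add: power2_diff power_mult_distrib)
    qed (use idiff assms(5) in simp)
    also have "\<dots> = 2 * (dist0 N)\<^sup>2 + 2 * (\<integral>\<omega>. (\<rho>0 \<omega>)\<^sup>2 \<partial>\<mu>)"
      using idiff[of N] assms(5) by (simp add: L2[symmetric])
    also have "\<dots> \<le> B"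
      unfolding B_def using D[of N]
      by (intro add_right_mono mult_left_mono power_mono) (auto simp: L2[symmetric])
    finally show ?thesis .
  qed
  define m where "m = (\<integral>\<omega>. \<rho>0 \<omega> \<partial>\<mu>)"
  have i\<rho>0: "integrable \<mu> \<rho>0" by (rule square_integrable_imp_integrable[OF assms(4,5)])
  have iu0: "integrable \<mu> (\<lambda>\<omega>. u N 0 (vec (modes N) \<omega>))" for N
    by (rule square_integrable_imp_integrable[OF m0 i0])
  have mean0: "(\<lambda>N. \<integral>\<omega>. u N 0 (vec (modes N) \<omega>) \<partial>\<mu>) \<longlonglongrightarrow> m"
  proof (rule LIM_zero_cancel, rule tendsto_rabs_zero_cancel, rule tendsto_sandwich[OF _ _ tendsto_const dist0])
    show "\<forall>\<^sub>F N in sequentially. \<bar>(\<integral>\<omega>. u N 0 (vec (modes N) \<omega>) \<partial>\<mu>) - m\<bar> \<le> dist0 N"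
    proof (intro always_eventually allI)
      fix N
      have "(\<integral>\<omega>. u N 0 (vec (modes N) \<omega>) \<partial>\<mu>) - m = (\<integral>\<omega>. 1 * (u N 0 (vec (modes N) \<omega>) - \<rho>0 \<omega>) \<partial>\<mu>)"
        using iu0 i\<rho>0 by (simp add: m_def)
      also have "\<bar>\<dots>\<bar> \<le> sqrt (\<integral>\<omega>. 1\<^sup>2 \<partial>\<mu>) * sqrt (\<integral>\<omega>. (u N 0 (vec (modes N) \<omega>) - \<rho>0 \<omega>)\<^sup>2 \<partial>\<mu>)"
        by (rule cauchy_schwarz_integral(2)) (use m0 assms(4) idiff in auto)
      also have "\<dots> = dist0 N" by (simp add: L2 prob_space)
      finally show "\<bar>(\<integral>\<omega>. u N 0 (vec (modes N) \<omega>) \<partial>\<mu>) - m\<bar> \<le> dist0 N" .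
    qed
  qed auto
  have f_Linf: "(\<lambda>t \<omega>. u (r i) t (vec (modes (r i)) \<omega>)) \<in> Linf_L2 T \<mu>" for i
    using assms(13) by (simp add: weak_star_lim_def u_vec)
  have \<rho>_Linf: "\<rho> \<in> Linf_L2 T \<mu>" using assms(13) by (simp add: weak_star_lim_def)
  have lim: "(\<lambda>i. \<integral>t. indicator {0..t0} t * (\<integral>\<omega>. u (r i) t (vec (modes (r i)) \<omega>) * G \<omega> \<partial>\<mu>) \<partial>interval_measure T)
      \<longlonglongrightarrow> (\<integral>t. indicator {0..t0} t * (\<integral>\<omega>. \<rho> t \<omega> * G \<omega> \<partial>\<mu>) \<partial>interval_measure T)"
    if G: "G \<in> borel_measurable \<mu>" "integrable \<mu> (\<lambda>\<omega>. (G \<omega>)\<^sup>2)" for G t0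
  proof -
    have mult: "(\<integral>\<omega>. v \<omega> * (indicator {0..t0} t * G \<omega>) \<partial>\<mu>) = indicator {0..t0} t * (\<integral>\<omega>. v \<omega> * G \<omega> \<partial>\<mu>)" for v t
      by (subst integral_mult_right_zero[symmetric]) (simp add: mult_ac)
    have "(\<lambda>t \<omega>. indicator {0..t0} t * G \<omega>) \<in> L1_L2 T \<mu>"
      by (rule indicator_L1_L2[OF prob_space_axioms G])
    then have "(\<lambda>i. \<integral>t. (\<integral>\<omega>. \<rho>N (r i) t (proj_dist (r i) \<omega>) * (indicator {0..t0} t * G \<omega>) \<partial>\<mu>) \<partial>interval_measure T)
      \<longlonglongrightarrow> (\<integral>t. (\<integral>\<omega>. \<rho> t \<omega> * (indicator {0..t0} t * G \<omega>) \<partial>\<mu>) \<partial>interval_measure T)"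
      by (rule bspec[OF conjunct2[OF conjunct2[OF assms(13)[unfolded weak_star_lim_def]]]])
    then show ?thesis unfolding mult u_vec .
  qed
  have r_top: "filterlim r at_top sequentially" by (rule filterlim_subseq[OF assms(12)])
  have "AE s in interval_measure T. AE \<omega> in \<mu>. \<rho> s \<omega> = m"
  proof (rule weak_limit_constant[OF T _ \<rho>_Linf])
    have sp: "space \<mu> = H1minus" using \<mu> by (simp add: white_noise_def)
    show "sets \<mu> = sigma_sets (space \<mu>) {{w \<in> space \<mu>. Y k w \<in> A} | k A. k \<in> Z20 \<and> A \<in> sets borel}"
      using \<mu> unfolding white_noise_def sp Y_def by blast
  next
    fix t J \<beta> \<theta> assume t: "t \<in> {0..T}" and J: "finite J" "J \<subseteq> Z20"
    let ?G = "\<lambda>\<omega>. ou_op J \<beta> \<theta> (\<lambda>k. Y k \<omega>)"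
    let ?p = "\<lambda>N. \<integral>s. indicator {0..t} s * (\<integral>\<omega>. u N s (vec (modes N) \<omega>) * ?G \<omega> \<partial>\<mu>) \<partial>interval_measure T"
    let ?L = "\<lambda>N w. galerkin_op (- 1) N (plane_wave J \<beta> \<theta>) (vec (modes N) w)"
    obtain N1 \<epsilon> where \<epsilon>: "\<epsilon> \<longlonglongrightarrow> 0" and a: "\<And>N. N1 \<le> N \<Longrightarrow> inv_square_sum N > 0"
      and "\<And>N. N1 \<le> N \<Longrightarrow> J \<subseteq> modes N"
      and int: "\<And>N. N1 \<le> N \<Longrightarrow> integrable \<mu> (\<lambda>w. (?L N w / inv_square_sum N - ?G w)\<^sup>2)"
      and le: "\<And>N. N1 \<le> N \<Longrightarrow> (\<integral>w. (?L N w / inv_square_sum N - ?G w)\<^sup>2 \<partial>\<mu>) \<le> \<epsilon> N"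
      by (rule galerkin_op_plane_wave_limit[OF J, where \<beta> = \<beta> and \<theta> = \<theta>]) (rule that; assumption)
    \<comment> \<open>The bound of \<open>time_integral_ou_op_bound\<close>: the boundary term
      vanishes since \<open>inv_square_sum\<close> diverges, the second term since the operator
      error does.\<close>
    define b where "b N = 2 * sqrt B / inv_square_sum N + T * (sqrt B * sqrt (\<epsilon> N))" for N
    have "(\<lambda>N. inverse (inv_square_sum N)) \<longlonglongrightarrow> 0"
      by (rule tendsto_inverse_0_at_top[OF inv_square_sum_at_top])
    then have "(\<lambda>N. 2 * sqrt B * inverse (inv_square_sum N) + T * (sqrt B * sqrt (\<epsilon> N)))
        \<longlonglongrightarrow> 2 * sqrt B * 0 + T * (sqrt B * sqrt 0)"
      by (intro tendsto_intros \<epsilon>)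
    then have "b \<longlonglongrightarrow> 0" by (simp add: b_def[abs_def] divide_inverse)
    then have b: "(\<lambda>i. b (r i)) \<longlonglongrightarrow> 0" using r_top by (rule filterlim_compose)
    have "\<forall>\<^sub>F i in sequentially. N1 \<le> r i"
      using r_top by (simp add: filterlim_at_top)
    then have "\<forall>\<^sub>F i in sequentially. \<bar>?p (r i)\<bar> \<le> b (r i)"
    proof eventually_elim
      case (elim i)
      show ?case
        unfolding b_def
        by (rule time_integral_ou_op_bound[OF T sol i0 B J a[OF elim] int[OF elim] le[OF elim] _ t])
          (use f_Linf[of i] in \<open>simp add: Linf_L2_def\<close>)
    qed
    then have "(\<lambda>i. \<bar>?p (r i)\<bar>) \<longlonglongrightarrow> 0"
      by (intro tendsto_sandwich[OF _ _ tendsto_const b]) auto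
    then have "(\<lambda>i. ?p (r i)) \<longlonglongrightarrow> 0" by (rule tendsto_rabs_zero_cancel)
    then show "(\<integral>s. indicator {0..t} s * (\<integral>\<omega>. \<rho> s \<omega> * ?G \<omega> \<partial>\<mu>) \<partial>interval_measure T) = 0"
      using LIMSEQ_unique[OF lim[OF ou_op_measurable[OF J(2)] integrable_ou_op_square[OF J]]] by blast
  next
    \<comment> \<open>Conservation reduces the mean at every time to the initial one, and the
      initial means converge to \<open>m\<close>.\<close>
    fix t assume t: "t \<in> {0..T}"
    have "(\<integral>s. indicator {0..t} s * (\<integral>\<omega>. u N s (vec (modes N) \<omega>) * 1 \<partial>\<mu>) \<partial>interval_measure T) =
        t * (\<integral>\<omega>. u N 0 (vec (modes N) \<omega>) \<partial>\<mu>)" for N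
    proof -
      have "(\<integral>s. indicator {0..t} s * (\<integral>\<omega>. u N s (vec (modes N) \<omega>) * 1 \<partial>\<mu>) \<partial>interval_measure T) =
          (\<integral>s. indicator {0..t} s * (\<integral>\<omega>. u N 0 (vec (modes N) \<omega>) \<partial>\<mu>) \<partial>interval_measure T)"
      proof (rule Bochner_Integration.integral_cong[OF refl])
        fix s assume "s \<in> space (interval_measure T)"
        then have "s \<in> {0..T}" by (simp add: space_interval_measure)
        from expectation_conserved[OF T sol[of N] i0[of N] this]
        show "indicator {0..t} s * (\<integral>\<omega>. u N s (vec (modes N) \<omega>) * 1 \<partial>\<mu>) =
            indicator {0..t} s * (\<integral>\<omega>. u N 0 (vec (modes N) \<omega>) \<partial>\<mu>)"
          by simp
      qed
      also have "\<dots> = t * (\<integral>\<omega>. u N 0 (vec (modes N) \<omega>) \<partial>\<mu>)"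
        using integral_interval_measure(2)[OF t, of "\<lambda>_. \<integral>\<omega>. u N 0 (vec (modes N) \<omega>) \<partial>\<mu>"] t by simp
      finally show ?thesis .
    qed
    then have "(\<lambda>i. t * (\<integral>\<omega>. u (r i) 0 (vec (modes (r i)) \<omega>) \<partial>\<mu>)) \<longlonglongrightarrow>
        (\<integral>s. indicator {0..t} s * (\<integral>\<omega>. \<rho> s \<omega> * 1 \<partial>\<mu>) \<partial>interval_measure T)"
      using lim[of "\<lambda>_. 1" t] by simp
    moreover have "(\<lambda>i. t * (\<integral>\<omega>. u (r i) 0 (vec (modes (r i)) \<omega>) \<partial>\<mu>)) \<longlonglongrightarrow> t * m"
      by (intro tendsto_intros filterlim_compose[OF mean0 r_top])
    ultimately show "(\<integral>s. indicator {0..t} s * (\<integral>\<omega>. \<rho> s \<omega> \<partial>\<mu>) \<partial>interval_measure T) = t * m"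
      using LIMSEQ_unique by fastforce
  qed
  \<comment> \<open>The limit is determined only up to null sets of times; its class contains the
    function constantly equal to \<open>m\<close>, for which the claim holds at every
    \<open>t\<close>.\<close>
  then have "same_class T \<mu> (\<lambda>_ _. m) \<rho>"
    unfolding same_class_def by (simp add: eq_commute)
  moreover have "(\<lambda>_ _. m) \<in> Linf_L2 T \<mu>"
    by (auto simp: Linf_L2_def intro!: exI[of _ "L2norm \<mu> (\<lambda>_. m)"])
  ultimately show ?thesis by (intro bexI[of _ "\<lambda>_ _. m"]) (auto simp: m_def)
qed

end
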